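(* Let $H$ be a triangular quasi-Hopf algebra. Let $(A,\mathrm{d})$ be a differential calculus in ${}^{H}\mathscr{M}$ and $V$ any object in ${}^{H}_{A}\mathscr{M}^{\mathrm{sym}}_{A}$. Then the ${}^{H}\mathscr{M}$-morphism $$[\![\cdot,\cdot]\!]:(\mathrm{end}(V)\times I[1])\otimes(\mathrm{end}(V)\times I[1])\longrightarrow\mathrm{end}(V),\qquad (L,c)\otimes(L',c')\longmapsto[L,L'],$$ restricts to an ${}^{H}\mathscr{M}$-morphism $$[\![\cdot,\cdot]\!]:\mathrm{con}(V)\otimes\mathrm{con}(V)\longrightarrow\mathrm{end}_A(V).$$
   Context: BASIC SETTING. $k$ is a commutative associative ring with unit. $H$ is a quasitriangular quasi-Hopf algebra over $k$, placed in degree $0$, with coproduct $\Delta(h)=h_{(1)}\otimes h_{(2)}$, counit $\epsilon$, invertible associator $\phi=\phi^{(1)}\otimes\phi^{(2)}\otimes\phi^{(3)}$ with inverse $\phi^{-1}=\phi^{(-1)}\otimes\phi^{(-2)}\otimes\phi^{(-3)}$, quasi-antipode $(S,\alpha,\beta)$ and universal $R$-matrix $R=R^{(1)}\otimes R^{(2)}$ (summations understood). $H$ is triangular if $R=R_{21}^{-1}$, $R_{21}=R^{(2)}\otimes R^{(1)}$. Conventions: $(\mathrm{id}\otimes\Delta)\Delta(h)=\phi\,(\Delta\otimes\mathrm{id})\Delta(h)\,\phi^{-1}$; $S(h_{(1)})\alpha h_{(2)}=\epsilon(h)\alpha$; $h_{(1)}\beta S(h_{(2)})=\epsilon(h)\beta$;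 $\phi^{(1)}\beta S(\phi^{(2)})\alpha\phi^{(3)}=1=S(\phi^{(-1)})\alpha\phi^{(-2)}\beta S(\phi^{(-3)})$; $\Delta^{\mathrm{op}}(h)=R\,\Delta(h)\,R^{-1}$; the remaining axioms (pentagon, counit normalization, hexagons) are the ones making the following a braided monoidal category. ${}^{H}\mathscr{M}$: objects are bounded $\mathbb{Z}$-graded left $H$-modules $V=\bigoplus_n V_n$ ($V_n=0$ for all but finitely many $n$; action $\triangleright$ degree-preserving); morphisms are degree-preserving $H$-equivariant $k$-linear maps. $V\otimes W$ is the graded tensor product over $k$ with $h\triangleright(v\otimes w)=(h_{(1)}\triangleright v)\otimes(h_{(2)}\triangleright w)$; unit $I=k$ (degree $0$, action by $\epsilon$); associator $\Phi((v\otimes w)\otimes x)=(\phi^{(1)}\triangleright v)\otimes((\phi^{(2)}\triangleright w)\otimes(\phi^{(3)}\triangleright x))$; braiding $\tau(v\otimes w)=(-1)^{|v||w|}(R^{(2)}\triangleright w)\otimes(R^{(1)}\triangleright v)$. Internal hom: $\hom(V,W)=\bigoplus_n\bigoplus_{l-m=n}\mathrm{Hom}_k(V_m,W_l)$ with $h\triangleright L=(h_{(1)}\triangleright\cdot)\circ L\circ(S(h_{(2)})\triangleright\cdot)$. Currying bijection: for $f:V\otimes W\to X$, $\zeta(f)(v)=f((\phi^{(-1)}\triangleright v)\otimes((\phi^{(-2)}\beta S(\phi^{(-3)}))\triangleright(\cdot)))$; inverse: for $g:V\to\hom(W,X)$, $\zeta^{-1}(g)(v\otimes w)=\phi^{(1)}\triangleright(g(v)((S(\phi^{(2)})\alpha\phi^{(3)})\triangleright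 w))$. Evaluation $\mathrm{ev}=\zeta^{-1}(\mathrm{id}):\hom(V,W)\otimes V\to W$; internal composition $\bullet=\zeta(\mathrm{ev}\circ(\mathrm{id}\otimes\mathrm{ev})\circ\Phi):\hom(W,X)\otimes\hom(V,W)\to\hom(V,X)$. $\mathrm{end}(V)=\hom(V,V)$, unit $1=(\beta\triangleright\cdot)$. Commutator on $\mathrm{end}(V)$: $[L,L']=L\bullet L'-(-1)^{|L||L'|}(R^{(2)}\triangleright L')\bullet(R^{(1)}\triangleright L)$. ALGEBRAS AND BIMODULES. An algebra in ${}^{H}\mathscr{M}$ is an object $A$ with ${}^{H}\mathscr{M}$-morphisms product $\mu:A\otimes A\to A$ and unit $I\to A$, with $(aa')a''=(\phi^{(1)}\triangleright a)((\phi^{(2)}\triangleright a')(\phi^{(3)}\triangleright a''))$ and $1a=a=a1$; it is braided commutative (an object of ${}^{H}\mathscr{A}^{\mathrm{com}}$) if $\mu\circ\tau=\mu$. An $A$-bimodule $V$ in ${}^{H}\mathscr{M}$ has ${}^{H}\mathscr{M}$-morphisms $l:A\otimes V\to V$, $r:V\otimes A\to V$ (written by juxtaposition) that are unital and satisfy the module and bimodule axioms with brackets changed by $\Phi$; it is symmetric if $r\circ\tau=l$ and $l\circ\tau=r$. ${}^{H}_{A}\mathscr{M}^{\mathrm{sym}}_{A}$ is the category of symmetric $A$-bimodules. $\hat l=\zeta(l):A\to\mathrm{end}(V)$, and $[L,a]:=[L,\hat l(a)]$ for $L\in\mathrm{end}(V)$, $a\in A$. $\mathrm{end}_A(V)=\mathrm{Ker}(\zeta([\cdot,\cdot]))\subseteq\mathrm{end}(V)$,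 where here $[\cdot,\cdot]:\mathrm{end}(V)\otimes A\to\mathrm{end}(V)$, $L\otimes a\mapsto[L,a]$. DIFFERENTIAL CALCULUS AND CONNECTIONS. $I[1]$ is $k$ placed in degree $1$ with $H$ acting by $\epsilon$. Derivations: $\mathrm{der}(A)=\mathrm{Ker}\,\zeta([\cdot,\cdot]-\hat l\circ\mathrm{ev})\subseteq\mathrm{end}(A)$, where $[\cdot,\cdot]-\hat l\circ\mathrm{ev}:\mathrm{end}(A)\otimes A\to\mathrm{end}(A)$, $L\otimes a\mapsto[L,a]-\hat l(\mathrm{ev}(L\otimes a))$. A differential calculus $(A,\mathrm{d})$ in ${}^{H}\mathscr{M}$ is an object $A$ of ${}^{H}\mathscr{A}^{\mathrm{com}}$ with an ${}^{H}\mathscr{M}$-morphism $\mathrm{d}:I[1]\to\mathrm{der}(A)$ such that $\mathrm{d}(c)\bullet\mathrm{d}(c')=0$ for all $c,c'$. With $\times$ the categorical product in ${}^{H}\mathscr{M}$, $\mathrm{con}(V)=\mathrm{Ker}\,\zeta(f)\subseteq\mathrm{end}(V)\times I[1]$, where $f:(\mathrm{end}(V)\times I[1])\otimes A\to\mathrm{end}(V)$, $f((L,c)\otimes a)=[L,a]-\hat l(\mathrm{ev}(\mathrm{d}(c)\otimes a))$. *)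

theory Defs
  imports "HOL-Algebra.Module" "HOL-Algebra.AbelCoset"
begin

section \<open>Tensor products over a commutative ring\<close>

definition module_span ::
    "('k, 'r) ring_scheme \<Rightarrow> ('k, 'm, 'x) module_scheme \<Rightarrow> 'm set \<Rightarrow> 'm set" where
  "module_span K M X = \<Inter> {N. submodule N K M \<and> X \<subseteq> N}"

definition module_lin ::
    "('k, 'r) ring_scheme \<Rightarrow> ('k, 'm, 'x) module_scheme \<Rightarrow> ('k, 'n, 'y) module_scheme
      \<Rightarrow> ('m \<Rightarrow> 'n) \<Rightarrow> bool" where
  "module_lin K M N f \<longleftrightarrow>
     f \<in> carrier M \<rightarrow> carrier N \<and>
     (\<forall>x\<in>carrier M. \<forall>y\<in>carrier M. f (x \<oplus>\<^bsub>M\<^esub> y) = f x \<oplus>\<^bsub>N\<^esub> f y) \<and>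
     (\<forall>r\<in>carrier K. \<forall>x\<in>carrier M. f (r \<odot>\<^bsub>M\<^esub> x) = r \<odot>\<^bsub>N\<^esub> f x)"

text \<open>
  Only the module part of the records below is meaningful; as usual in HOL-Algebra, the
  ring fields \<open>mult\<close> and \<open>one\<close> of a bare module are irrelevant.
\<close>

definition free_module :: "('k, 'r) ring_scheme \<Rightarrow> 'i set \<Rightarrow> ('k, 'i \<Rightarrow> 'k) module" where
  "free_module K I =
    \<lparr>carrier = {f. (\<forall>i. f i \<in> carrier K) \<and> finite {i. f i \<noteq> \<zero>\<^bsub>K\<^esub>} \<and> {i. f i \<noteq> \<zero>\<^bsub>K\<^esub>} \<subseteq> I},
     mult = undefined, one = undefined,
     zero = (\<lambda>i. \<zero>\<^bsub>K\<^esub>),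
     add = (\<lambda>f g i. f i \<oplus>\<^bsub>K\<^esub> g i),
     smult = (\<lambda>r f i. r \<otimes>\<^bsub>K\<^esub> f i)\<rparr>"

definition free_gen :: "('k, 'r) ring_scheme \<Rightarrow> 'i \<Rightarrow> 'i \<Rightarrow> 'k" where
  "free_gen K i = (\<lambda>j. if j = i then \<one>\<^bsub>K\<^esub> else \<zero>\<^bsub>K\<^esub>)"

definition tensor_relations ::
    "('k, 'r) ring_scheme \<Rightarrow> ('k, 'm, 'x) module_scheme \<Rightarrow> ('k, 'n, 'y) module_scheme
      \<Rightarrow> ('m \<times> 'n \<Rightarrow> 'k) set" where
  "tensor_relations K M N =
    (let F = free_module K (carrier M \<times> carrier N); g = (\<lambda>m n. free_gen K (m, n)) in
      {g (m \<oplus>\<^bsub>M\<^esub> m') n \<ominus>\<^bsub>F\<^esub> (g m n \<oplus>\<^bsub>F\<^esub> g m' n) | m m' n.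
         m \<in> carrier M \<and> m' \<in> carrier M \<and> n \<in> carrier N} \<union>
      {g m (n \<oplus>\<^bsub>N\<^esub> n') \<ominus>\<^bsub>F\<^esub> (g m n \<oplus>\<^bsub>F\<^esub> g m n') | m n n'.
         m \<in> carrier M \<and> n \<in> carrier N \<and> n' \<in> carrier N} \<union>
      {g (r \<odot>\<^bsub>M\<^esub> m) n \<ominus>\<^bsub>F\<^esub> r \<odot>\<^bsub>F\<^esub> g m n | r m n.
         r \<in> carrier K \<and> m \<in> carrier M \<and> n \<in> carrier N} \<union>
      {g m (r \<odot>\<^bsub>N\<^esub> n) \<ominus>\<^bsub>F\<^esub> r \<odot>\<^bsub>F\<^esub> g m n | r m n.
         r \<in> carrier K \<and> m \<in> carrier M \<and> n \<in> carrier N})"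

definition tensor_null ::
    "('k, 'r) ring_scheme \<Rightarrow> ('k, 'm, 'x) module_scheme \<Rightarrow> ('k, 'n, 'y) module_scheme
      \<Rightarrow> ('m \<times> 'n \<Rightarrow> 'k) set" where
  "tensor_null K M N =
     module_span K (free_module K (carrier M \<times> carrier N)) (tensor_relations K M N)"

text \<open>An element of a tensor product is a coset of \<^const>\<open>tensor_null\<close> in the free module.\<close>

type_synonym ('k, 'm, 'n) tensor = "('m \<times> 'n \<Rightarrow> 'k) set"

definition tensor_module ::
    "('k, 'r) ring_scheme \<Rightarrow> ('k, 'm, 'x) module_scheme \<Rightarrow> ('k, 'n, 'y) module_scheme
      \<Rightarrow> ('k, ('k, 'm, 'n) tensor) module" where
  "tensor_module K M N =
    (let F = free_module K (carrier M \<times> carrier N); Z = tensor_null K M N in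
      \<lparr>carrier = a_rcosets\<^bsub>F\<^esub> Z,
       mult = undefined, one = undefined,
       zero = Z,
       add = (\<lambda>s t. s <+>\<^bsub>F\<^esub> t),
       smult = (\<lambda>r t. \<Union>x\<in>t. Z +>\<^bsub>F\<^esub> (r \<odot>\<^bsub>F\<^esub> x))\<rparr>)"

definition tensor_elem ::
    "('k, 'r) ring_scheme \<Rightarrow> ('k, 'm, 'x) module_scheme \<Rightarrow> ('k, 'n, 'y) module_scheme
      \<Rightarrow> 'm \<Rightarrow> 'n \<Rightarrow> ('k, 'm, 'n) tensor" where
  "tensor_elem K M N m n =
     tensor_null K M N +>\<^bsub>free_module K (carrier M \<times> carrier N)\<^esub> free_gen K (m, n)"

text \<open>
  \<open>tensor_lift K M N P b\<close> is the linear map \<open>M \<otimes> N \<rightarrow> P\<close> induced by \<open>b\<close>: it writes its argument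
  as a finite sum of pure tensors \<open>m \<otimes> n\<close> with coefficients and replaces each \<open>m \<otimes> n\<close> by
  \<open>b m n\<close>. The value does not depend on the chosen representative when \<open>b\<close> is \<open>K\<close>-bilinear,
  the only case in which it is used.
\<close>

definition tensor_lift ::
    "('k, 'r) ring_scheme \<Rightarrow> ('k, 'm, 'x) module_scheme \<Rightarrow> ('k, 'n, 'y) module_scheme
      \<Rightarrow> ('k, 'p, 'z) module_scheme \<Rightarrow> ('m \<Rightarrow> 'n \<Rightarrow> 'p) \<Rightarrow> ('k, 'm, 'n) tensor \<Rightarrow> 'p" where
  "tensor_lift K M N P b t =
    (let x = (SOME x. x \<in> t) in
      \<Oplus>\<^bsub>P\<^esub>i\<in>{i. x i \<noteq> \<zero>\<^bsub>K\<^esub>}. x i \<odot>\<^bsub>P\<^esub> b (fst i) (snd i))"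

definition tensor_algebra ::
    "('k, 'r) ring_scheme \<Rightarrow> ('k, 'm, 'x) module_scheme \<Rightarrow> ('k, 'n, 'y) module_scheme
      \<Rightarrow> ('k, ('k, 'm, 'n) tensor) module" where
  "tensor_algebra K M N =
    (let T = tensor_module K M N in
      T\<lparr>mult := (\<lambda>s t. tensor_lift K M N T (\<lambda>a b. tensor_lift K M N T (\<lambda>c d.
            tensor_elem K M N (a \<otimes>\<^bsub>M\<^esub> c) (b \<otimes>\<^bsub>N\<^esub> d)) t) s),
        one := tensor_elem K M N \<one>\<^bsub>M\<^esub> \<one>\<^bsub>N\<^esub>\<rparr>)"


section \<open>Quasitriangular quasi-Hopf algebras\<close>

text \<open>Threefold tensor products are bracketed to the left throughout.\<close>

record ('k, 'h) qhopf =
  qbase  :: "'k ring"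
  qalg   :: "('k, 'h) module"
  qcop   :: "'h \<Rightarrow> ('k, 'h, 'h) tensor"
  qeps   :: "'h \<Rightarrow> 'k"
  qphi   :: "('k, ('k, 'h, 'h) tensor, 'h) tensor"
  qanti  :: "'h \<Rightarrow> 'h"
  qalpha :: 'h
  qbeta  :: 'h
  qR     :: "('k, 'h, 'h) tensor"

definition H2 :: "('k, 'h) qhopf \<Rightarrow> ('k, ('k, 'h, 'h) tensor) module" where
  "H2 Q = tensor_algebra (qbase Q) (qalg Q) (qalg Q)"

definition H3 :: "('k, 'h) qhopf \<Rightarrow> ('k, ('k, ('k, 'h, 'h) tensor, 'h) tensor) module" where
  "H3 Q = tensor_algebra (qbase Q) (H2 Q) (qalg Q)"

definition H4 :: "('k, 'h) qhopf
    \<Rightarrow> ('k, ('k, ('k, ('k, 'h, 'h) tensor, 'h) tensor, 'h) tensor) module" where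
  "H4 Q = tensor_algebra (qbase Q) (H3 Q) (qalg Q)"

definition e2 :: "('k, 'h) qhopf \<Rightarrow> 'h \<Rightarrow> 'h \<Rightarrow> ('k, 'h, 'h) tensor" where
  "e2 Q x y = tensor_elem (qbase Q) (qalg Q) (qalg Q) x y"

definition e3 :: "('k, 'h) qhopf \<Rightarrow> 'h \<Rightarrow> 'h \<Rightarrow> 'h
    \<Rightarrow> ('k, ('k, 'h, 'h) tensor, 'h) tensor" where
  "e3 Q x y z = tensor_elem (qbase Q) (H2 Q) (qalg Q) (e2 Q x y) z"

definition e4 :: "('k, 'h) qhopf \<Rightarrow> 'h \<Rightarrow> 'h \<Rightarrow> 'h \<Rightarrow> 'h
    \<Rightarrow> ('k, ('k, ('k, 'h, 'h) tensor, 'h) tensor, 'h) tensor" where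
  "e4 Q x y z u = tensor_elem (qbase Q) (H3 Q) (qalg Q) (e3 Q x y z) u"

text \<open>
  Sweedler-type summation: for \<open>t = t\<^sup>(\<^sup>1\<^sup>) \<otimes> t\<^sup>(\<^sup>2\<^sup>)\<close> (summation understood), \<open>sum2 Q P t b\<close> is
  \<open>b t\<^sup>(\<^sup>1\<^sup>) t\<^sup>(\<^sup>2\<^sup>)\<close>, computed in the module \<open>P\<close>; similarly \<open>sum3\<close>.
\<close>

definition sum2 :: "('k, 'h) qhopf \<Rightarrow> ('k, 'p, 'z) module_scheme
    \<Rightarrow> ('k, 'h, 'h) tensor \<Rightarrow> ('h \<Rightarrow> 'h \<Rightarrow> 'p) \<Rightarrow> 'p" where
  "sum2 Q P t b = tensor_lift (qbase Q) (qalg Q) (qalg Q) P b t"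

definition sum3 :: "('k, 'h) qhopf \<Rightarrow> ('k, 'p, 'z) module_scheme
    \<Rightarrow> ('k, ('k, 'h, 'h) tensor, 'h) tensor \<Rightarrow> ('h \<Rightarrow> 'h \<Rightarrow> 'h \<Rightarrow> 'p) \<Rightarrow> 'p" where
  "sum3 Q P t b =
     tensor_lift (qbase Q) (H2 Q) (qalg Q) P (\<lambda>s z. sum2 Q P s (\<lambda>x y. b x y z)) t"

definition qphi_inv :: "('k, 'h) qhopf \<Rightarrow> ('k, ('k, 'h, 'h) tensor, 'h) tensor" where
  "qphi_inv Q = inv\<^bsub>H3 Q\<^esub> (qphi Q)"

definition flip2 :: "('k, 'h) qhopf \<Rightarrow> ('k, 'h, 'h) tensor \<Rightarrow> ('k, 'h, 'h) tensor" where
  "flip2 Q t = sum2 Q (H2 Q) t (\<lambda>x y. e2 Q y x)"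

definition quasi_bialgebra :: "('k, 'h) qhopf \<Rightarrow> bool" where
  "quasi_bialgebra Q \<longleftrightarrow>
    (let K = qbase Q; H = qalg Q; D = qcop Q; \<epsilon> = qeps Q; \<phi> = qphi Q in
      module K H \<and> ring H \<and>
      (\<forall>r\<in>carrier K. \<forall>x\<in>carrier H. \<forall>y\<in>carrier H.
         (r \<odot>\<^bsub>H\<^esub> x) \<otimes>\<^bsub>H\<^esub> y = r \<odot>\<^bsub>H\<^esub> (x \<otimes>\<^bsub>H\<^esub> y) \<and>
         x \<otimes>\<^bsub>H\<^esub> (r \<odot>\<^bsub>H\<^esub> y) = r \<odot>\<^bsub>H\<^esub> (x \<otimes>\<^bsub>H\<^esub> y)) \<and>
      D \<in> ring_hom H (H2 Q) \<and>
      (\<forall>r\<in>carrier K. \<forall>x\<in>carrier H. D (r \<odot>\<^bsub>H\<^esub> x) = r \<odot>\<^bsub>H2 Q\<^esub> D x) \<and>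
      \<epsilon> \<in> ring_hom H K \<and>
      (\<forall>r\<in>carrier K. \<forall>x\<in>carrier H. \<epsilon> (r \<odot>\<^bsub>H\<^esub> x) = r \<otimes>\<^bsub>K\<^esub> \<epsilon> x) \<and>
      (\<forall>h\<in>carrier H. sum2 Q H (D h) (\<lambda>x y. \<epsilon> x \<odot>\<^bsub>H\<^esub> y) = h) \<and>
      (\<forall>h\<in>carrier H. sum2 Q H (D h) (\<lambda>x y. \<epsilon> y \<odot>\<^bsub>H\<^esub> x) = h) \<and>
      \<phi> \<in> Units (H3 Q) \<and>
      (\<forall>h\<in>carrier H.
         sum2 Q (H3 Q) (D h) (\<lambda>x y. sum2 Q (H3 Q) (D y) (\<lambda>a b. e3 Q x a b)) =
         \<phi> \<otimes>\<^bsub>H3 Q\<^esub>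
         sum2 Q (H3 Q) (D h) (\<lambda>x y. sum2 Q (H3 Q) (D x) (\<lambda>a b. e3 Q a b y)) \<otimes>\<^bsub>H3 Q\<^esub>
         qphi_inv Q) \<and>
      sum3 Q (H2 Q) \<phi> (\<lambda>x y z. \<epsilon> y \<odot>\<^bsub>H2 Q\<^esub> e2 Q x z) = \<one>\<^bsub>H2 Q\<^esub> \<and>
      sum3 Q (H4 Q) \<phi> (\<lambda>x y z. sum2 Q (H4 Q) (D z) (\<lambda>a b. e4 Q x y a b)) \<otimes>\<^bsub>H4 Q\<^esub>
      sum3 Q (H4 Q) \<phi> (\<lambda>x y z. sum2 Q (H4 Q) (D x) (\<lambda>a b. e4 Q a b y z)) =
      sum3 Q (H4 Q) \<phi> (\<lambda>x y z. e4 Q \<one>\<^bsub>H\<^esub> x y z) \<otimes>\<^bsub>H4 Q\<^esub>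
      sum3 Q (H4 Q) \<phi> (\<lambda>x y z. sum2 Q (H4 Q) (D y) (\<lambda>a b. e4 Q x a b z)) \<otimes>\<^bsub>H4 Q\<^esub>
      sum3 Q (H4 Q) \<phi> (\<lambda>x y z. e4 Q x y z \<one>\<^bsub>H\<^esub>))"

text \<open>The antipode is an algebra anti-homomorphism; its bijectivity is not required.\<close>

definition quasi_antipode :: "('k, 'h) qhopf \<Rightarrow> bool" where
  "quasi_antipode Q \<longleftrightarrow>
    (let K = qbase Q; H = qalg Q; S = qanti Q; \<alpha> = qalpha Q; \<beta> = qbeta Q in
      module_lin K H H S \<and>
      (\<forall>x\<in>carrier H. \<forall>y\<in>carrier H. S (x \<otimes>\<^bsub>H\<^esub> y) = S y \<otimes>\<^bsub>H\<^esub> S x) \<and>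
      S \<one>\<^bsub>H\<^esub> = \<one>\<^bsub>H\<^esub> \<and>
      \<alpha> \<in> carrier H \<and> \<beta> \<in> carrier H \<and>
      (\<forall>h\<in>carrier H.
         sum2 Q H (qcop Q h) (\<lambda>x y. S x \<otimes>\<^bsub>H\<^esub> \<alpha> \<otimes>\<^bsub>H\<^esub> y) = qeps Q h \<odot>\<^bsub>H\<^esub> \<alpha>) \<and>
      (\<forall>h\<in>carrier H.
         sum2 Q H (qcop Q h) (\<lambda>x y. x \<otimes>\<^bsub>H\<^esub> \<beta> \<otimes>\<^bsub>H\<^esub> S y) = qeps Q h \<odot>\<^bsub>H\<^esub> \<beta>) \<and>
      sum3 Q H (qphi Q)
        (\<lambda>x y z. x \<otimes>\<^bsub>H\<^esub> \<beta> \<otimes>\<^bsub>H\<^esub> S y \<otimes>\<^bsub>H\<^esub> \<alpha> \<otimes>\<^bsub>H\<^esub> z) = \<one>\<^bsub>H\<^esub> \<and>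
      sum3 Q H (qphi_inv Q)
        (\<lambda>x y z. S x \<otimes>\<^bsub>H\<^esub> \<alpha> \<otimes>\<^bsub>H\<^esub> y \<otimes>\<^bsub>H\<^esub> \<beta> \<otimes>\<^bsub>H\<^esub> S z) = \<one>\<^bsub>H\<^esub>)"

text \<open>
  The last two equations are the hexagon axioms
  \<open>(id \<otimes> \<Delta>)(R) = \<phi>\<^sub>2\<^sub>3\<^sub>1\<inverse> R\<^sub>1\<^sub>3 \<phi>\<^sub>2\<^sub>1\<^sub>3 R\<^sub>1\<^sub>2 \<phi>\<inverse>\<close> and
  \<open>(\<Delta> \<otimes> id)(R) = \<phi>\<^sub>3\<^sub>1\<^sub>2 R\<^sub>1\<^sub>3 \<phi>\<^sub>1\<^sub>3\<^sub>2\<inverse> R\<^sub>2\<^sub>3 \<phi>\<close>,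
  where \<open>\<phi>\<^sub>i\<^sub>j\<^sub>k\<close> has the first leg of \<open>\<phi>\<close> in position \<open>i\<close>, the second in position \<open>j\<close>
  and the third in position \<open>k\<close>.
\<close>

definition quasitriangular :: "('k, 'h) qhopf \<Rightarrow> bool" where
  "quasitriangular Q \<longleftrightarrow>
    (let H = qalg Q; D = qcop Q; \<phi> = qphi Q; \<psi> = qphi_inv Q; R = qR Q in
      R \<in> Units (H2 Q) \<and>
      (\<forall>h\<in>carrier H. flip2 Q (D h) = R \<otimes>\<^bsub>H2 Q\<^esub> D h \<otimes>\<^bsub>H2 Q\<^esub> inv\<^bsub>H2 Q\<^esub> R) \<and>
      sum2 Q (H3 Q) R (\<lambda>x y. sum2 Q (H3 Q) (D y) (\<lambda>a b. e3 Q x a b)) =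
        sum3 Q (H3 Q) \<psi> (\<lambda>x y z. e3 Q z x y) \<otimes>\<^bsub>H3 Q\<^esub>
        sum2 Q (H3 Q) R (\<lambda>x y. e3 Q x \<one>\<^bsub>H\<^esub> y) \<otimes>\<^bsub>H3 Q\<^esub>
        sum3 Q (H3 Q) \<phi> (\<lambda>x y z. e3 Q y x z) \<otimes>\<^bsub>H3 Q\<^esub>
        sum2 Q (H3 Q) R (\<lambda>x y. e3 Q x y \<one>\<^bsub>H\<^esub>) \<otimes>\<^bsub>H3 Q\<^esub>
        \<psi> \<and>
      sum2 Q (H3 Q) R (\<lambda>x y. sum2 Q (H3 Q) (D x) (\<lambda>a b. e3 Q a b y)) =
        sum3 Q (H3 Q) \<phi> (\<lambda>x y z. e3 Q y z x) \<otimes>\<^bsub>H3 Q\<^esub>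
        sum2 Q (H3 Q) R (\<lambda>x y. e3 Q x \<one>\<^bsub>H\<^esub> y) \<otimes>\<^bsub>H3 Q\<^esub>
        sum3 Q (H3 Q) \<psi> (\<lambda>x y z. e3 Q x z y) \<otimes>\<^bsub>H3 Q\<^esub>
        sum2 Q (H3 Q) R (\<lambda>x y. e3 Q \<one>\<^bsub>H\<^esub> x y) \<otimes>\<^bsub>H3 Q\<^esub>
        \<phi>)"

definition quasitriangular_quasi_hopf :: "('k, 'h) qhopf \<Rightarrow> bool" where
  "quasitriangular_quasi_hopf Q \<longleftrightarrow> quasi_bialgebra Q \<and> quasi_antipode Q \<and> quasitriangular Q"

definition triangular_quasi_hopf :: "('k, 'h) qhopf \<Rightarrow> bool" where
  "triangular_quasi_hopf Q \<longleftrightarrow>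
     quasitriangular_quasi_hopf Q \<and> qR Q = inv\<^bsub>H2 Q\<^esub> (flip2 Q (qR Q))"


section \<open>The braided closed monoidal category of graded modules\<close>

record ('k, 'h, 'v) gmod = "('k, 'v) module" +
  grd :: "int \<Rightarrow> 'v set"
  act :: "'h \<Rightarrow> 'v \<Rightarrow> 'v"

definition homog_decomp :: "('k, 'h, 'v, 'x) gmod_scheme \<Rightarrow> 'v \<Rightarrow> (int \<Rightarrow> 'v) \<Rightarrow> bool" where
  "homog_decomp V v c \<longleftrightarrow>
     (\<forall>n. c n \<in> grd V n) \<and> finite {n. c n \<noteq> \<zero>\<^bsub>V\<^esub>} \<and>
     v = (\<Oplus>\<^bsub>V\<^esub>n\<in>{n. c n \<noteq> \<zero>\<^bsub>V\<^esub>}. c n)"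

definition homog_part :: "('k, 'h, 'v, 'x) gmod_scheme \<Rightarrow> 'v \<Rightarrow> int \<Rightarrow> 'v" where
  "homog_part V v = (THE c. homog_decomp V v c)"

definition hm_obj :: "('k, 'h) qhopf \<Rightarrow> ('k, 'h, 'v) gmod \<Rightarrow> bool" where
  "hm_obj Q V \<longleftrightarrow>
    (let K = qbase Q; H = qalg Q in
      module K V \<and>
      (\<forall>n. submodule (grd V n) K V) \<and>
      (\<forall>v\<in>carrier V. \<exists>!c. homog_decomp V v c) \<and>
      finite {n. grd V n \<noteq> {\<zero>\<^bsub>V\<^esub>}} \<and>
      (\<forall>h\<in>carrier H. module_lin K V V (act V h)) \<and>
      (\<forall>h\<in>carrier H. \<forall>n. \<forall>v\<in>grd V n. act V h v \<in> grd V n) \<and>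
      (\<forall>h\<in>carrier H. \<forall>h'\<in>carrier H. \<forall>v\<in>carrier V.
         act V (h \<oplus>\<^bsub>H\<^esub> h') v = act V h v \<oplus>\<^bsub>V\<^esub> act V h' v \<and>
         act V (h \<otimes>\<^bsub>H\<^esub> h') v = act V h (act V h' v)) \<and>
      (\<forall>r\<in>carrier K. \<forall>h\<in>carrier H. \<forall>v\<in>carrier V.
         act V (r \<odot>\<^bsub>H\<^esub> h) v = r \<odot>\<^bsub>V\<^esub> act V h v) \<and>
      (\<forall>v\<in>carrier V. act V \<one>\<^bsub>H\<^esub> v = v))"

definition hm_mor :: "('k, 'h) qhopf \<Rightarrow> ('k, 'h, 'v) gmod \<Rightarrow> ('k, 'h, 'w) gmod
    \<Rightarrow> ('v \<Rightarrow> 'w) \<Rightarrow> bool" where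
  "hm_mor Q V W f \<longleftrightarrow>
     module_lin (qbase Q) V W f \<and>
     (\<forall>n. \<forall>v\<in>grd V n. f v \<in> grd W n) \<and>
     (\<forall>h\<in>carrier (qalg Q). \<forall>v\<in>carrier V. f (act V h v) = act W h (f v))"

text \<open>The base ring placed in degree \<open>n\<close>: \<open>I\<close> is the case \<open>n = 0\<close> and \<open>I[1]\<close> the case \<open>n = 1\<close>.\<close>

definition gunit :: "('k, 'h) qhopf \<Rightarrow> int \<Rightarrow> ('k, 'h, 'k) gmod" where
  "gunit Q n =
    (let K = qbase Q in
      \<lparr>carrier = carrier K, mult = mult K, one = one K, zero = zero K, add = add K,
       smult = mult K,
       grd = (\<lambda>m. if m = n then carrier K else {\<zero>\<^bsub>K\<^esub>}),
       act = (\<lambda>h r. qeps Q h \<otimes>\<^bsub>K\<^esub> r)\<rparr>)"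

definition gtensor_elem :: "('k, 'h) qhopf \<Rightarrow> ('k, 'h, 'v) gmod \<Rightarrow> ('k, 'h, 'w) gmod
    \<Rightarrow> 'v \<Rightarrow> 'w \<Rightarrow> ('k, 'v, 'w) tensor" where
  "gtensor_elem Q V W v w = tensor_elem (qbase Q) V W v w"

definition gtensor :: "('k, 'h) qhopf \<Rightarrow> ('k, 'h, 'v) gmod \<Rightarrow> ('k, 'h, 'w) gmod
    \<Rightarrow> ('k, 'h, ('k, 'v, 'w) tensor) gmod" where
  "gtensor Q V W =
    (let K = qbase Q; T = tensor_module K V W in
      \<lparr>carrier = carrier T, mult = mult T, one = one T, zero = zero T, add = add T,
       smult = smult T,
       grd = (\<lambda>n. module_span K T
                {gtensor_elem Q V W v w | v w i j. v \<in> grd V i \<and> w \<in> grd W j \<and> i + j = n}),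
       act = (\<lambda>h. tensor_lift K V W T (\<lambda>v w.
                sum2 Q T (qcop Q h) (\<lambda>x y. gtensor_elem Q V W (act V x v) (act W y w))))\<rparr>)"

definition gtensor_map :: "('k, 'h) qhopf \<Rightarrow> ('k, 'h, 'v) gmod \<Rightarrow> ('k, 'h, 'w) gmod
    \<Rightarrow> ('k, 'h, 'v2) gmod \<Rightarrow> ('k, 'h, 'w2) gmod \<Rightarrow> ('v \<Rightarrow> 'v2) \<Rightarrow> ('w \<Rightarrow> 'w2)
    \<Rightarrow> ('k, 'v, 'w) tensor \<Rightarrow> ('k, 'v2, 'w2) tensor" where
  "gtensor_map Q V W V' W' f g =
     tensor_lift (qbase Q) V W (gtensor Q V' W') (\<lambda>v w. gtensor_elem Q V' W' (f v) (g w))"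

definition gassoc :: "('k, 'h) qhopf \<Rightarrow> ('k, 'h, 'v) gmod \<Rightarrow> ('k, 'h, 'w) gmod
    \<Rightarrow> ('k, 'h, 'x) gmod \<Rightarrow> ('k, ('k, 'v, 'w) tensor, 'x) tensor
    \<Rightarrow> ('k, 'v, ('k, 'w, 'x) tensor) tensor" where
  "gassoc Q V W X =
    (let K = qbase Q; WX = gtensor Q W X; T = gtensor Q V WX in
      tensor_lift K (gtensor Q V W) X T (\<lambda>s u. tensor_lift K V W T (\<lambda>v w.
        sum3 Q T (qphi Q) (\<lambda>x y z.
          gtensor_elem Q V WX (act V x v) (gtensor_elem Q W X (act W y w) (act X z u)))) s))"

text \<open>The braiding, with its Koszul sign, evaluated on homogeneous components.\<close>

definition gbraid :: "('k, 'h) qhopf \<Rightarrow> ('k, 'h, 'v) gmod \<Rightarrow> ('k, 'h, 'w) gmod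
    \<Rightarrow> ('k, 'v, 'w) tensor \<Rightarrow> ('k, 'w, 'v) tensor" where
  "gbraid Q V W =
    (let T = gtensor Q W V in
      tensor_lift (qbase Q) V W T (\<lambda>v w.
        \<Oplus>\<^bsub>T\<^esub>i\<in>{m. homog_part V v m \<noteq> \<zero>\<^bsub>V\<^esub>} \<times> {n. homog_part W w n \<noteq> \<zero>\<^bsub>W\<^esub>}.
          (let t = sum2 Q T (qR Q) (\<lambda>x y.
                     gtensor_elem Q W V (act W y (homog_part W w (snd i)))
                                        (act V x (homog_part V v (fst i))))
           in if even (fst i * snd i) then t else \<ominus>\<^bsub>T\<^esub> t)))"

text \<open>
  A linear map of degree \<open>n\<close> sends \<open>V\<^sub>m\<close> to \<open>W\<^sub>m\<^sub>+\<^sub>n\<close>; maps \<open>V\<^sub>m \<rightarrow> W\<^sub>l\<close> are identified with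
  their extensions by zero to the other homogeneous components. As objects are bounded, the direct
  sum of these spaces of maps consists of all linear maps \<open>V \<rightarrow> W\<close>.
\<close>

definition ghom :: "('k, 'h) qhopf \<Rightarrow> ('k, 'h, 'v) gmod \<Rightarrow> ('k, 'h, 'w) gmod
    \<Rightarrow> ('k, 'h, 'v \<Rightarrow> 'w) gmod" where
  "ghom Q V W =
    (let C = {L \<in> extensional (carrier V). module_lin (qbase Q) V W L} in
      \<lparr>carrier = C, mult = undefined, one = undefined,
       zero = (\<lambda>v\<in>carrier V. \<zero>\<^bsub>W\<^esub>),
       add = (\<lambda>L L'. \<lambda>v\<in>carrier V. L v \<oplus>\<^bsub>W\<^esub> L' v),
       smult = (\<lambda>r L. \<lambda>v\<in>carrier V. r \<odot>\<^bsub>W\<^esub> L v),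
       grd = (\<lambda>n. {L \<in> C. \<forall>m. \<forall>v\<in>grd V m. L v \<in> grd W (m + n)}),
       act = (\<lambda>h L. \<lambda>v\<in>carrier V.
                sum2 Q W (qcop Q h) (\<lambda>x y. act W x (L (act V (qanti Q y) v))))\<rparr>)"

abbreviation gend :: "('k, 'h) qhopf \<Rightarrow> ('k, 'h, 'v) gmod \<Rightarrow> ('k, 'h, 'v \<Rightarrow> 'v) gmod" where
  "gend Q V \<equiv> ghom Q V V"

text \<open>The currying bijection \<open>\<zeta>\<close> and its inverse.\<close>

definition gcurry :: "('k, 'h) qhopf \<Rightarrow> ('k, 'h, 'v) gmod \<Rightarrow> ('k, 'h, 'w) gmod
    \<Rightarrow> (('k, 'v, 'w) tensor \<Rightarrow> 'x) \<Rightarrow> 'v \<Rightarrow> 'w \<Rightarrow> 'x" where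
  "gcurry Q V W f =
    (let H = qalg Q in
      (\<lambda>v\<in>carrier V. \<lambda>w\<in>carrier W.
        f (sum3 Q (gtensor Q V W) (qphi_inv Q) (\<lambda>x y z.
             gtensor_elem Q V W (act V x v) (act W (y \<otimes>\<^bsub>H\<^esub> qbeta Q \<otimes>\<^bsub>H\<^esub> qanti Q z) w)))))"

definition guncurry :: "('k, 'h) qhopf \<Rightarrow> ('k, 'h, 'v) gmod \<Rightarrow> ('k, 'h, 'w) gmod
    \<Rightarrow> ('k, 'h, 'x) gmod \<Rightarrow> ('v \<Rightarrow> 'w \<Rightarrow> 'x) \<Rightarrow> ('k, 'v, 'w) tensor \<Rightarrow> 'x" where
  "guncurry Q V W X g =
    (let H = qalg Q in
      tensor_lift (qbase Q) V W X (\<lambda>v w.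
        sum3 Q X (qphi Q) (\<lambda>x y z.
          act X x (g v (act W (qanti Q y \<otimes>\<^bsub>H\<^esub> qalpha Q \<otimes>\<^bsub>H\<^esub> z) w)))))"

definition gev :: "('k, 'h) qhopf \<Rightarrow> ('k, 'h, 'v) gmod \<Rightarrow> ('k, 'h, 'w) gmod
    \<Rightarrow> ('k, 'v \<Rightarrow> 'w, 'v) tensor \<Rightarrow> 'w" where
  "gev Q V W = guncurry Q (ghom Q V W) V W (\<lambda>L. L)"

definition gcomp :: "('k, 'h) qhopf \<Rightarrow> ('k, 'h, 'v) gmod \<Rightarrow> ('k, 'h, 'w) gmod
    \<Rightarrow> ('k, 'h, 'x) gmod \<Rightarrow> ('k, 'w \<Rightarrow> 'x, 'v \<Rightarrow> 'w) tensor \<Rightarrow> 'v \<Rightarrow> 'x" where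
  "gcomp Q V W X =
     gcurry Q (gtensor Q (ghom Q W X) (ghom Q V W)) V
       (gev Q W X
        \<circ> gtensor_map Q (ghom Q W X) (gtensor Q (ghom Q V W) V) (ghom Q W X) W (\<lambda>L. L) (gev Q V W)
        \<circ> gassoc Q (ghom Q W X) (ghom Q V W) V)"

definition gcommutator :: "('k, 'h) qhopf \<Rightarrow> ('k, 'h, 'v) gmod
    \<Rightarrow> ('k, 'v \<Rightarrow> 'v, 'v \<Rightarrow> 'v) tensor \<Rightarrow> 'v \<Rightarrow> 'v" where
  "gcommutator Q V t =
     gcomp Q V V V t \<ominus>\<^bsub>gend Q V\<^esub> gcomp Q V V V (gbraid Q (gend Q V) (gend Q V) t)"

definition gprod :: "('k, 'h, 'v) gmod \<Rightarrow> ('k, 'h, 'w) gmod \<Rightarrow> ('k, 'h, 'v \<times> 'w) gmod" where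
  "gprod V W =
    \<lparr>carrier = carrier V \<times> carrier W, mult = undefined, one = undefined,
     zero = (\<zero>\<^bsub>V\<^esub>, \<zero>\<^bsub>W\<^esub>),
     add = (\<lambda>p q. (fst p \<oplus>\<^bsub>V\<^esub> fst q, snd p \<oplus>\<^bsub>W\<^esub> snd q)),
     smult = (\<lambda>r p. (r \<odot>\<^bsub>V\<^esub> fst p, r \<odot>\<^bsub>W\<^esub> snd p)),
     grd = (\<lambda>n. grd V n \<times> grd W n),
     act = (\<lambda>h p. (act V h (fst p), act W h (snd p)))\<rparr>"

definition gker :: "('k, 'h, 'v) gmod \<Rightarrow> ('k, 'h, 'w) gmod \<Rightarrow> ('v \<Rightarrow> 'w)
    \<Rightarrow> ('k, 'h, 'v) gmod" where
  "gker V W g =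
     V\<lparr>carrier := {v \<in> carrier V. g v = \<zero>\<^bsub>W\<^esub>},
       grd := (\<lambda>n. {v \<in> grd V n. g v = \<zero>\<^bsub>W\<^esub>})\<rparr>"


section \<open>Algebras and bimodules\<close>

text \<open>The unit morphism \<open>\<eta> : I \<rightarrow> A\<close> sends \<open>1 \<in> k\<close> to the unit element of \<open>A\<close>.\<close>

definition hm_algebra :: "('k, 'h) qhopf \<Rightarrow> ('k, 'h, 'a) gmod
    \<Rightarrow> (('k, 'a, 'a) tensor \<Rightarrow> 'a) \<Rightarrow> ('k \<Rightarrow> 'a) \<Rightarrow> bool" where
  "hm_algebra Q A \<mu> \<eta> \<longleftrightarrow>
    (let e = gtensor_elem Q A A; u = \<eta> \<one>\<^bsub>qbase Q\<^esub> in
      hm_obj Q A \<and>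
      hm_mor Q (gtensor Q A A) A \<mu> \<and>
      hm_mor Q (gunit Q 0) A \<eta> \<and>
      (\<forall>a\<in>carrier A. \<forall>b\<in>carrier A. \<forall>c\<in>carrier A.
         \<mu> (e (\<mu> (e a b)) c) =
         sum3 Q A (qphi Q) (\<lambda>x y z. \<mu> (e (act A x a) (\<mu> (e (act A y b) (act A z c)))))) \<and>
      (\<forall>a\<in>carrier A. \<mu> (e u a) = a \<and> \<mu> (e a u) = a))"

definition braided_comm_algebra :: "('k, 'h) qhopf \<Rightarrow> ('k, 'h, 'a) gmod
    \<Rightarrow> (('k, 'a, 'a) tensor \<Rightarrow> 'a) \<Rightarrow> ('k \<Rightarrow> 'a) \<Rightarrow> bool" where
  "braided_comm_algebra Q A \<mu> \<eta> \<longleftrightarrow>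
     hm_algebra Q A \<mu> \<eta> \<and>
     (\<forall>t\<in>carrier (gtensor Q A A). \<mu> (gbraid Q A A t) = \<mu> t)"

definition hm_bimodule :: "('k, 'h) qhopf \<Rightarrow> ('k, 'h, 'a) gmod
    \<Rightarrow> (('k, 'a, 'a) tensor \<Rightarrow> 'a) \<Rightarrow> ('k \<Rightarrow> 'a) \<Rightarrow> ('k, 'h, 'v) gmod
    \<Rightarrow> (('k, 'a, 'v) tensor \<Rightarrow> 'v) \<Rightarrow> (('k, 'v, 'a) tensor \<Rightarrow> 'v) \<Rightarrow> bool" where
  "hm_bimodule Q A \<mu> \<eta> V l r \<longleftrightarrow>
    (let eA = gtensor_elem Q A A; el = gtensor_elem Q A V; er = gtensor_elem Q V A;
         u = \<eta> \<one>\<^bsub>qbase Q\<^esub> in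
      hm_obj Q V \<and>
      hm_mor Q (gtensor Q A V) V l \<and>
      hm_mor Q (gtensor Q V A) V r \<and>
      (\<forall>v\<in>carrier V. l (el u v) = v \<and> r (er v u) = v) \<and>
      (\<forall>a\<in>carrier A. \<forall>b\<in>carrier A. \<forall>v\<in>carrier V.
         l (el (\<mu> (eA a b)) v) =
           sum3 Q V (qphi Q) (\<lambda>x y z. l (el (act A x a) (l (el (act A y b) (act V z v))))) \<and>
         r (er (r (er v a)) b) =
           sum3 Q V (qphi Q) (\<lambda>x y z. r (er (act V x v) (\<mu> (eA (act A y a) (act A z b))))) \<and>
         r (er (l (el a v)) b) =
           sum3 Q V (qphi Q) (\<lambda>x y z. l (el (act A x a) (r (er (act V y v) (act A z b)))))))"

definition symmetric_bimodule :: "('k, 'h) qhopf \<Rightarrow> ('k, 'h, 'a) gmod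
    \<Rightarrow> (('k, 'a, 'a) tensor \<Rightarrow> 'a) \<Rightarrow> ('k \<Rightarrow> 'a) \<Rightarrow> ('k, 'h, 'v) gmod
    \<Rightarrow> (('k, 'a, 'v) tensor \<Rightarrow> 'v) \<Rightarrow> (('k, 'v, 'a) tensor \<Rightarrow> 'v) \<Rightarrow> bool" where
  "symmetric_bimodule Q A \<mu> \<eta> V l r \<longleftrightarrow>
     hm_bimodule Q A \<mu> \<eta> V l r \<and>
     (\<forall>t\<in>carrier (gtensor Q A V). r (gbraid Q A V t) = l t) \<and>
     (\<forall>t\<in>carrier (gtensor Q V A). l (gbraid Q V A t) = r t)"

text \<open>\<open>lhat\<close> is \<open>\<zeta>(l) : A \<rightarrow> end(V)\<close>, and \<open>acommutator\<close> is \<open>end(V) \<otimes> A \<rightarrow> end(V)\<close>, \<open>L \<otimes> a \<mapsto> [L, a]\<close>.\<close>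

definition lhat :: "('k, 'h) qhopf \<Rightarrow> ('k, 'h, 'a) gmod \<Rightarrow> ('k, 'h, 'v) gmod
    \<Rightarrow> (('k, 'a, 'v) tensor \<Rightarrow> 'v) \<Rightarrow> 'a \<Rightarrow> 'v \<Rightarrow> 'v" where
  "lhat Q A V l = gcurry Q A V l"

definition acommutator :: "('k, 'h) qhopf \<Rightarrow> ('k, 'h, 'a) gmod \<Rightarrow> ('k, 'h, 'v) gmod
    \<Rightarrow> (('k, 'a, 'v) tensor \<Rightarrow> 'v) \<Rightarrow> ('k, 'v \<Rightarrow> 'v, 'a) tensor \<Rightarrow> 'v \<Rightarrow> 'v" where
  "acommutator Q A V l =
     gcommutator Q V
       \<circ> gtensor_map Q (gend Q V) A (gend Q V) (gend Q V) (\<lambda>L. L) (lhat Q A V l)"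

definition end_A :: "('k, 'h) qhopf \<Rightarrow> ('k, 'h, 'a) gmod \<Rightarrow> ('k, 'h, 'v) gmod
    \<Rightarrow> (('k, 'a, 'v) tensor \<Rightarrow> 'v) \<Rightarrow> ('k, 'h, 'v \<Rightarrow> 'v) gmod" where
  "end_A Q A V l =
     gker (gend Q V) (ghom Q A (gend Q V)) (gcurry Q (gend Q V) A (acommutator Q A V l))"


section \<open>Differential calculi and connections\<close>

definition der :: "('k, 'h) qhopf \<Rightarrow> ('k, 'h, 'a) gmod \<Rightarrow> (('k, 'a, 'a) tensor \<Rightarrow> 'a)
    \<Rightarrow> ('k, 'h, 'a \<Rightarrow> 'a) gmod" where
  "der Q A \<mu> =
     gker (gend Q A) (ghom Q A (gend Q A))
       (gcurry Q (gend Q A) A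
         (\<lambda>t. acommutator Q A A \<mu> t \<ominus>\<^bsub>gend Q A\<^esub> lhat Q A A \<mu> (gev Q A A t)))"

definition differential_calculus :: "('k, 'h) qhopf \<Rightarrow> ('k, 'h, 'a) gmod
    \<Rightarrow> (('k, 'a, 'a) tensor \<Rightarrow> 'a) \<Rightarrow> ('k \<Rightarrow> 'a) \<Rightarrow> ('k \<Rightarrow> 'a \<Rightarrow> 'a) \<Rightarrow> bool" where
  "differential_calculus Q A \<mu> \<eta> d \<longleftrightarrow>
     braided_comm_algebra Q A \<mu> \<eta> \<and>
     hm_mor Q (gunit Q 1) (der Q A \<mu>) d \<and>
     (\<forall>c\<in>carrier (qbase Q). \<forall>c'\<in>carrier (qbase Q).
        gcomp Q A A A (gtensor_elem Q (gend Q A) (gend Q A) (d c) (d c')) = \<zero>\<^bsub>gend Q A\<^esub>)"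

abbreviation end_shift :: "('k, 'h) qhopf \<Rightarrow> ('k, 'h, 'v) gmod
    \<Rightarrow> ('k, 'h, ('v \<Rightarrow> 'v) \<times> 'k) gmod" where
  "end_shift Q V \<equiv> gprod (gend Q V) (gunit Q 1)"

definition connection_defect :: "('k, 'h) qhopf \<Rightarrow> ('k, 'h, 'a) gmod \<Rightarrow> ('k \<Rightarrow> 'a \<Rightarrow> 'a)
    \<Rightarrow> ('k, 'h, 'v) gmod \<Rightarrow> (('k, 'a, 'v) tensor \<Rightarrow> 'v)
    \<Rightarrow> ('k, ('v \<Rightarrow> 'v) \<times> 'k, 'a) tensor \<Rightarrow> 'v \<Rightarrow> 'v" where
  "connection_defect Q A d V l =
     tensor_lift (qbase Q) (end_shift Q V) A (gend Q V) (\<lambda>p a.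
       acommutator Q A V l (gtensor_elem Q (gend Q V) A (fst p) a)
       \<ominus>\<^bsub>gend Q V\<^esub>
       lhat Q A V l (gev Q A A (gtensor_elem Q (gend Q A) A (d (snd p)) a)))"

definition con :: "('k, 'h) qhopf \<Rightarrow> ('k, 'h, 'a) gmod \<Rightarrow> ('k \<Rightarrow> 'a \<Rightarrow> 'a)
    \<Rightarrow> ('k, 'h, 'v) gmod \<Rightarrow> (('k, 'a, 'v) tensor \<Rightarrow> 'v)
    \<Rightarrow> ('k, 'h, ('v \<Rightarrow> 'v) \<times> 'k) gmod" where
  "con Q A d V l =
     gker (end_shift Q V) (ghom Q A (gend Q V))
       (gcurry Q (end_shift Q V) A (connection_defect Q A d V l))"

definition con_bracket :: "('k, 'h) qhopf \<Rightarrow> ('k, 'h, 'v) gmod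
    \<Rightarrow> ('k, ('v \<Rightarrow> 'v) \<times> 'k, ('v \<Rightarrow> 'v) \<times> 'k) tensor \<Rightarrow> 'v \<Rightarrow> 'v" where
  "con_bracket Q V =
     tensor_lift (qbase Q) (end_shift Q V) (end_shift Q V) (gend Q V) (\<lambda>p q.
       gcommutator Q V (gtensor_elem Q (gend Q V) (gend Q V) (fst p) (fst q)))"

end

theory Submission
 imports Defs
begin

text \<open>
 Evaluation turns internal composition into composition of operators up to the associator, so an
 element \<open>p = (L, c)\<close> lies in \<open>con(V)\<close> iff it satisfies a Leibniz rule
 \<open>p (a v) = (p a) v + (-1)\<^sup>p\<^sup>a a (p v)\<close>, where \<open>p a = ev (d c, a)\<close>, the first term carries \<open>\<phi>\<inverse>\<close> and the
 second one carries \<open>X = \<phi>\<^sub>2\<^sub>1\<^sub>3 R\<^sub>1\<^sub>2 \<phi>\<inverse>\<close>. For homogeneous \<open>p\<close> and \<open>q\<close>, applying both rules to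
 \<open>p (q (a v))\<close> gives four terms. The term \<open>(p (q a)) v\<close> vanishes since \<open>d \<bullet> d = 0\<close>; by the pentagon and
 the hexagons together with \<open>R\<^sub>2\<^sub>1 = R\<inverse>\<close>, the two mixed terms are exchanged, up to the sign in the
 bracket, when \<open>p\<close> and \<open>q\<close> are interchanged, so they cancel in the bracket. What remains is
 \<open>[p, q] (a v) = (-1)\<^sup>(\<^sup>p\<^sup>+\<^sup>q\<^sup>)\<^sup>a a ([p, q] v)\<close> with \<open>X\<close> inserted, which says that \<open>[p, q]\<close> commutes with \<open>A\<close>.
 The general case follows since \<open>con(V)\<close> contains the homogeneous components of its elements.
\<close>

text \<open>The map \<zeta> inserts the inverse associator and \<beta>, so the vanishing of
  \<zeta>(f)(v) is not literally the vanishing of f(v, w). By equivariance and the two zigzag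
  identities of the quasi-antipode it is equivalent to f(h v, w) = 0 for all h and w. Membership in
  \<open>con\<close> or \<open>end_A\<close> is therefore a condition on a whole H-orbit, and the
  Leibniz rule is formulated for an H-stable set of elements of one degree. The four terms carry
  words in \<phi>, its inverse and R, with permuted and comultiplied legs. A leg is encoded as an
  algebra homomorphism from H into a fixed algebra, different legs having commuting images. Each
  axiom then becomes one identity for all choices of legs, and comparing two words is a computation
  in a monoid. The target that finally acts on the arguments p, q, a, v is the fourfold tensor power
  of H. An operator N is treated as the pair (N, 0): its first Leibniz term vanishes, so one and the
  same rule describes \<open>con\<close> and \<open>end_A\<close>.\<close>

abbreviation in_carrier (infix "<:" 50) where "x <: M \<equiv> x \<in> carrier M"

section \<open>Linear and bilinear maps\<close>

lemma module_linI:
 assumes "!!x. x <: M ==> f x <: N"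
  and "!!x y. x <: M ==> y <: M ==> f (x \<oplus>\<^bsub>M\<^esub> y) = f x \<oplus>\<^bsub>N\<^esub> f y"
  and "!!r x. r <: K ==> x <: M ==> f (r \<odot>\<^bsub>M\<^esub> x) = r \<odot>\<^bsub>N\<^esub> f x"
 shows "module_lin K M N f"
 using assms unfolding module_lin_def by auto

lemma module_lin_closed: "module_lin K M N f ==> x <: M ==> f x <: N"
 and module_lin_add: "module_lin K M N f ==> x <: M ==> y <: M ==>
  f (x \<oplus>\<^bsub>M\<^esub> y) = f x \<oplus>\<^bsub>N\<^esub> f y"
 and module_lin_smult: "module_lin K M N f ==> r <: K ==> x <: M ==>
  f (r \<odot>\<^bsub>M\<^esub> x) = r \<odot>\<^bsub>N\<^esub> f x"
 unfolding module_lin_def by auto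

lemma module_abelian_group: "module K M ==> abelian_group M"
 by (simp add: module_def)

lemma module_abelian_monoid: "module K M ==> abelian_monoid M"
 by (simp add: module_abelian_group abelian_group.axioms(1))

lemma module_cring: "module K M ==> cring K"
 by (simp add: module_def)

lemma module_zero_closed: "module K M ==> \<zero>\<^bsub>M\<^esub> <: M"
 by (simp add: abelian_monoid.zero_closed module_abelian_monoid)

lemma module_add_closed:
 "module K M ==> x <: M ==> y <: M ==> x \<oplus>\<^bsub>M\<^esub> y <: M"
 by (simp add: abelian_monoid.a_closed module_abelian_monoid)

lemmas module_smult_closed = module.smult_closed

lemma module_minus_eq_zero_iff:
 assumes "module K M" "x <: M" "y <: M"
 shows "x \<ominus>\<^bsub>M\<^esub> y = \<zero>\<^bsub>M\<^esub> \<longleftrightarrow> x = y"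
proof -
 interpret abelian_group M using assms module_abelian_group by auto
 show ?thesis
 proof
  assume "x \<ominus>\<^bsub>M\<^esub> y = \<zero>\<^bsub>M\<^esub>"
  then have "x = \<ominus>\<^bsub>M\<^esub> (\<ominus>\<^bsub>M\<^esub> y)"
   using assms(2,3) minus_equality[of x "\<ominus>\<^bsub>M\<^esub> y"] by (simp add: a_minus_def)
  then show "x = y" using assms(3) by simp
 qed (use assms(3) in "simp add: a_minus_def r_neg")
qed

lemma module_lin_zero:
 assumes "module K M" "module K N" "module_lin K M N f"
 shows "f \<zero>\<^bsub>M\<^esub> = \<zero>\<^bsub>N\<^esub>"
proof -
 interpret M: module K M by fact
 interpret N: module K N by fact
 have "f (\<zero>\<^bsub>K\<^esub> \<odot>\<^bsub>M\<^esub> \<zero>\<^bsub>M\<^esub>) = \<zero>\<^bsub>K\<^esub> \<odot>\<^bsub>N\<^esub> f \<zero>\<^bsub>M\<^esub>"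
  using assms(3) by (intro module_lin_smult[OF assms(3)]) auto
 moreover have "f \<zero>\<^bsub>M\<^esub> <: N" using assms(3) by (auto simp: module_lin_def)
 ultimately show ?thesis by simp
qed

lemma module_lin_finsum:
 assumes "module K M" "module K N" "module_lin K M N f" "x \<in> I \<rightarrow> carrier M"
 shows "f (\<Oplus>\<^bsub>M\<^esub>i\<in>I. x i) = (\<Oplus>\<^bsub>N\<^esub>i\<in>I. f (x i))"
proof -
 interpret M: module K M by fact
 interpret N: module K N by fact
 have f: "f \<in> carrier M \<rightarrow> carrier N" using assms(3) by (auto simp: module_lin_def)
 show ?thesis
 proof (cases "finite I")
  case True
  then show ?thesis using assms(4)
  proof (induction I)
   case empty
   then show ?case using module_lin_zero[OF assms(1-3)] by simp
  next
   case (insert i I)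
   have "x i <: M" "x \<in> I \<rightarrow> carrier M" using insert by auto
   moreover have "(%i. f (x i)) \<in> I \<rightarrow> carrier N" "f (x i) <: N"
    using insert f by fastforce+
   ultimately show ?case using insert assms(3) by (simp add: module_lin_def)
  qed
 next
  \<comment> \<open>A \<open>finsum\<close> over an infinite set is zero by convention, so only f 0
    = 0 is left.\<close>
  case False
  then show ?thesis using module_lin_zero[OF assms(1-3)] by (simp add: M.add.finprod_infinite N.add.finprod_infinite)
 qed
qed

lemma module_lin_minus:
 assumes "module K M" "module K N" "module_lin K M N f" "x <: M" "y <: M"
 shows "f (x \<ominus>\<^bsub>M\<^esub> y) = f x \<ominus>\<^bsub>N\<^esub> f y"
proof -
 interpret M: module K M by fact
 interpret N: module K N by fact
 have "f (x \<ominus>\<^bsub>M\<^esub> y) \<oplus>\<^bsub>N\<^esub> f y = f (x \<ominus>\<^bsub>M\<^esub> y \<oplus>\<^bsub>M\<^esub> y)"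
  using assms by (simp add: module_lin_add)
 also have "x \<ominus>\<^bsub>M\<^esub> y \<oplus>\<^bsub>M\<^esub> y = x"
  using assms by (simp add: M.add.m_assoc M.l_neg a_minus_def)
 finally have eq: "f (x \<ominus>\<^bsub>M\<^esub> y) \<oplus>\<^bsub>N\<^esub> f y = f x" .
 have "f (x \<ominus>\<^bsub>M\<^esub> y) <: N" "f y <: N"
  using assms by (auto intro: module_lin_closed)
 then show ?thesis unfolding eq[symmetric] a_minus_def
  by (simp add: N.a_assoc N.r_neg)
qed

lemma module_finsum_smult:
 assumes "module K M" "r <: K" "x \<in> I \<rightarrow> carrier M"
 shows "r \<odot>\<^bsub>M\<^esub> (\<Oplus>\<^bsub>M\<^esub>i\<in>I. x i) = (\<Oplus>\<^bsub>M\<^esub>i\<in>I. r \<odot>\<^bsub>M\<^esub> x i)"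
proof -
 interpret M: module K M by fact
 have "module_lin K M M (%x. r \<odot>\<^bsub>M\<^esub> x)"
  using assms by (intro module_linI) (auto simp: M.smult_r_distr M.smult_assoc1[symmetric] M.R.m_comm)
 then show ?thesis using module_lin_finsum[OF assms(1) assms(1) _ assms(3)] by auto
qed

lemma finsum_swap:
 assumes "abelian_monoid P" "finite I" "finite J" "!!i j. i \<in> I ==> j \<in> J ==> f i j <: P"
 shows "(\<Oplus>\<^bsub>P\<^esub>i\<in>I. \<Oplus>\<^bsub>P\<^esub>j\<in>J. f i j) = (\<Oplus>\<^bsub>P\<^esub>j\<in>J. \<Oplus>\<^bsub>P\<^esub>i\<in>I. f i j)"
proof -
 interpret abelian_monoid P by fact
 show ?thesis using assms(2,4)
 proof (induction I)
  case empty
  then show ?case by simp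
 next
  case (insert k I)
  have "(\<Oplus>\<^bsub>P\<^esub>i\<in>insert k I. \<Oplus>\<^bsub>P\<^esub>j\<in>J. f i j) = (\<Oplus>\<^bsub>P\<^esub>j\<in>J. f k j) \<oplus>\<^bsub>P\<^esub> (\<Oplus>\<^bsub>P\<^esub>i\<in>I. \<Oplus>\<^bsub>P\<^esub>j\<in>J. f i j)"
   using insert by (subst finsum_insert) (auto intro!: finsum_closed)
  also have "... = (\<Oplus>\<^bsub>P\<^esub>j\<in>J. f k j) \<oplus>\<^bsub>P\<^esub> (\<Oplus>\<^bsub>P\<^esub>j\<in>J. \<Oplus>\<^bsub>P\<^esub>i\<in>I. f i j)"
   using insert by simp
  also have "... = (\<Oplus>\<^bsub>P\<^esub>j\<in>J. f k j \<oplus>\<^bsub>P\<^esub> (\<Oplus>\<^bsub>P\<^esub>i\<in>I. f i j))"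
   using insert by (subst finsum_addf) (auto intro!: finsum_closed)
  also have "... = (\<Oplus>\<^bsub>P\<^esub>j\<in>J. \<Oplus>\<^bsub>P\<^esub>i\<in>insert k I. f i j)"
   using insert by (intro finsum_cong') (auto intro!: finsum_closed)
  finally show ?case .
 qed
qed

definition bilin :: "('k, 'r) ring_scheme => ('k, 'm, 'x) module_scheme => ('k, 'n, 'y) module_scheme
  => ('k, 'p, 'z) module_scheme => ('m => 'n => 'p) => bool" where
 "bilin K M N P b \<longleftrightarrow>
   (\<forall>n\<in>carrier N. module_lin K M P (%m. b m n)) \<and> (\<forall>m\<in>carrier M. module_lin K N P (%n. b m n))"

lemma bilinI:
 assumes "!!n. n <: N ==> module_lin K M P (%m. b m n)"
  and "!!m. m <: M ==> module_lin K N P (%n. b m n)"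
 shows "bilin K M N P b"
 using assms by (simp add: bilin_def)

lemma bilin_lin1: "bilin K M N P b ==> n <: N ==> module_lin K M P (%m. b m n)"
 and bilin_lin2: "bilin K M N P b ==> m <: M ==> module_lin K N P (%n. b m n)"
 by (auto simp: bilin_def)

lemma bilin_closed: "bilin K M N P b ==> m <: M ==> n <: N ==> b m n <: P"
 using bilin_lin1 module_lin_closed by fastforce

lemma module_lin_id: "module_lin K M M (%x. x)"
 by (auto simp: module_lin_def)

lemma module_lin_comp: "module_lin K N P g ==> module_lin K M N f ==> module_lin K M P (%x. g (f x))"
 by (rule module_linI) (simp_all add: module_lin_closed module_lin_add module_lin_smult)

text \<open>Shaped as an introduction rule: linearity of a long Sweedler expression is later proved
  by descending through it, with one such rule for each operation and slot.\<close>

lemma bilin_comp1: "bilin K M N P b ==> module_lin K L M f ==> n <: N ==> module_lin K L P (%x. b (f x) n)"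
 using module_lin_comp[OF bilin_lin1] .

lemma bilin_comp2: "bilin K M N P b ==> m <: M ==> module_lin K L N f ==> module_lin K L P (%x. b m (f x))"
 using module_lin_comp[OF bilin_lin2] .

lemma module_lin_plus:
 assumes "module K N" "module_lin K M N f" "module_lin K M N g"
 shows "module_lin K M N (%x. f x \<oplus>\<^bsub>N\<^esub> g x)"
proof -
 interpret N: module K N by fact
 show ?thesis
  by (rule module_linI)
   (use assms(2,3) in \<open>auto simp: module_lin_closed module_lin_add module_lin_smult
    N.smult_r_distr N.a_ac\<close>)
qed

lemma module_lin_smult_fun:
 assumes "module K N" "module_lin K M N f" "r <: K"
 shows "module_lin K M N (%x. r \<odot>\<^bsub>N\<^esub> f x)"
proof -
 interpret N: module K N by fact
 show ?thesis
  by (rule module_linI)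
   (use assms(2,3) in \<open>auto simp: module_lin_closed module_lin_add module_lin_smult
    N.smult_r_distr N.smult_assoc1[symmetric] N.R.m_comm\<close>)
qed

lemma module_lin_scalar:
 assumes "module K N" "f \<in> carrier M \<rightarrow> carrier K" "n <: N"
  "!!x y. x <: M ==> y <: M ==> f (x \<oplus>\<^bsub>M\<^esub> y) = f x \<oplus>\<^bsub>K\<^esub> f y"
  "!!r x. r <: K ==> x <: M ==> f (r \<odot>\<^bsub>M\<^esub> x) = r \<otimes>\<^bsub>K\<^esub> f x"
 shows "module_lin K M N (%x. f x \<odot>\<^bsub>N\<^esub> n)"
proof -
 interpret N: module K N by fact
 have f: "!!x. x <: M ==> f x <: K" using assms(2) by auto
 show ?thesis
  by (rule module_linI) (use assms(3-5) f in "auto simp: N.smult_l_distr N.smult_assoc1")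
qed

lemma module_lin_a_inv:
 assumes "module K N" "module_lin K M N f"
 shows "module_lin K M N (%x. \<ominus>\<^bsub>N\<^esub> f x)"
proof -
 interpret N: module K N by fact
 show ?thesis
  by (rule module_linI)
   (use assms(2) in \<open>auto simp: module_lin_closed module_lin_add module_lin_smult
    N.minus_add N.smult_r_minus\<close>)
qed

lemma module_lin_diff:
 assumes "module K N" "module_lin K M N f" "module_lin K M N g"
 shows "module_lin K M N (%x. f x \<ominus>\<^bsub>N\<^esub> g x)"
 unfolding a_minus_def by (intro module_lin_plus module_lin_a_inv assms)

lemma module_lin_zero_fun:
 assumes "module K N"
 shows "module_lin K M N (%x. \<zero>\<^bsub>N\<^esub>)"
proof -
 interpret N: module K N by fact
 show ?thesis by (rule module_linI) auto
qed

lemma submodule_zero: "submodule N K M ==> \<zero>\<^bsub>M\<^esub> \<in> N"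
 using subgroup.one_closed[OF submodule.axioms(1), of N K M] by simp

lemma submodule_kernel:
 assumes "module K M" "module K N" "module_lin K M N f"
 shows "submodule {x \<in> carrier M. f x = \<zero>\<^bsub>N\<^esub>} K M"
proof -
 interpret M: module K M by fact
 interpret N: module K N by fact
 have "f (\<ominus>\<^bsub>M\<^esub> x) = \<zero>\<^bsub>N\<^esub>" if "x <: M" "f x = \<zero>\<^bsub>N\<^esub>" for x
  using module_lin_minus[OF assms, of "\<zero>\<^bsub>M\<^esub>" x] that module_lin_zero[OF assms]
  by (simp add: a_minus_def)
 then show ?thesis
  by (intro M.submoduleI)
   (use module_lin_zero[OF assms] assms(3) in "auto simp: module_lin_add module_lin_smult")
qed

text \<open>Meant for degree arguments: the tensors mapped into a homogeneous component form a
  submodule, so it is enough to look at generators of a graded piece.\<close>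

lemma submodule_vimage:
 assumes "module K M" "module K N" "module_lin K M N f" "submodule U K N"
 shows "submodule {x \<in> carrier M. f x \<in> U} K M"
proof -
 interpret M: module K M by fact
 interpret N: module K N by fact
 note E = N.submoduleE[OF assms(4)]
 have z: "\<zero>\<^bsub>N\<^esub> \<in> U"
  by (rule submodule_zero[OF assms(4)])
 have "f (\<ominus>\<^bsub>M\<^esub> x) \<in> U" if "x <: M" "f x \<in> U" for x
 proof -
  have "f x <: N" using that assms(3) by (auto simp: module_lin_closed)
  then have "f (\<ominus>\<^bsub>M\<^esub> x) = \<ominus>\<^bsub>N\<^esub> f x"
   using module_lin_minus[OF assms(1-3), of "\<zero>\<^bsub>M\<^esub>" x] that module_lin_zero[OF assms(1-3)]
   by (simp add: a_minus_def)
  then show ?thesis using E(3) that by auto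
 qed
 then show ?thesis
  by (intro M.submoduleI)
   (use z E module_lin_zero[OF assms(1-3)] assms(3) in "auto simp: module_lin_add module_lin_smult")
qed

lemma submodule_Inter:
 assumes "module K M" "!!N. N \<in> \<N> ==> submodule N K M" "\<N> \<noteq> {}"
 shows "submodule (\<Inter> \<N>) K M"
proof -
 interpret M: module K M by fact
 obtain N0 where N0: "N0 \<in> \<N>" using assms(3) by auto
 note E = M.submoduleE[OF assms(2)]
 show ?thesis
 proof (rule M.submoduleI)
  show "\<Inter> \<N> \<subseteq> carrier M" using E(1)[OF N0] N0 by auto
  show "\<zero>\<^bsub>M\<^esub> \<in> \<Inter> \<N>" using submodule_zero[OF assms(2)] by auto
 qed (use E(3-5) in auto)
qed

lemma module_span_submodule:
 assumes "module K M" "X \<subseteq> carrier M"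
 shows "submodule (module_span K M X) K M"
 unfolding module_span_def
 by (rule submodule_Inter) (use assms module.carrier_is_submodule in auto)

lemma module_span_mono: "X \<subseteq> module_span K M X"
 by (auto simp: module_span_def)

lemma module_span_least: "submodule N K M ==> X \<subseteq> N ==> module_span K M X \<subseteq> N"
 by (auto simp: module_span_def)

section \<open>Free modules and tensor products\<close>

lemma free_module_simps:
 "carrier (free_module K I) = {f. (\<forall>i. f i <: K) \<and> finite {i. f i \<noteq> \<zero>\<^bsub>K\<^esub>} \<and> {i. f i \<noteq> \<zero>\<^bsub>K\<^esub>} \<subseteq> I}"
 "\<zero>\<^bsub>free_module K I\<^esub> = (%i. \<zero>\<^bsub>K\<^esub>)"
 "f \<oplus>\<^bsub>free_module K I\<^esub> g = (%i. f i \<oplus>\<^bsub>K\<^esub> g i)"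
 "r \<odot>\<^bsub>free_module K I\<^esub> f = (%i. r \<otimes>\<^bsub>K\<^esub> f i)"
 by (simp_all add: free_module_def)

lemma module_free_module:
 assumes "cring K"
 shows "module K (free_module K I)"
proof -
 interpret K: cring K by fact
 have fin: "finite {i. f i \<oplus>\<^bsub>K\<^esub> g i \<noteq> \<zero>\<^bsub>K\<^esub>}" "{i. f i \<oplus>\<^bsub>K\<^esub> g i \<noteq> \<zero>\<^bsub>K\<^esub>} \<subseteq> I"
  if "finite {i. f i \<noteq> \<zero>\<^bsub>K\<^esub>}" "finite {i. g i \<noteq> \<zero>\<^bsub>K\<^esub>}"
   "{i. f i \<noteq> \<zero>\<^bsub>K\<^esub>} \<subseteq> I" "{i. g i \<noteq> \<zero>\<^bsub>K\<^esub>} \<subseteq> I" for f g :: "_ => _"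
 proof -
  have "{i. f i \<oplus>\<^bsub>K\<^esub> g i \<noteq> \<zero>\<^bsub>K\<^esub>} \<subseteq> {i. f i \<noteq> \<zero>\<^bsub>K\<^esub>} \<union> {i. g i \<noteq> \<zero>\<^bsub>K\<^esub>}"
   by auto
  then show "finite {i. f i \<oplus>\<^bsub>K\<^esub> g i \<noteq> \<zero>\<^bsub>K\<^esub>}" "{i. f i \<oplus>\<^bsub>K\<^esub> g i \<noteq> \<zero>\<^bsub>K\<^esub>} \<subseteq> I"
   using that by (auto intro: finite_subset)
 qed
 have fin': "finite {i. r \<otimes>\<^bsub>K\<^esub> g i \<noteq> \<zero>\<^bsub>K\<^esub>}" "{i. r \<otimes>\<^bsub>K\<^esub> g i \<noteq> \<zero>\<^bsub>K\<^esub>} \<subseteq> I"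
  if "r <: K" "finite {i. g i \<noteq> \<zero>\<^bsub>K\<^esub>}" "{i. g i \<noteq> \<zero>\<^bsub>K\<^esub>} \<subseteq> I" for r and g :: "_ => _"
 proof -
  have "{i. r \<otimes>\<^bsub>K\<^esub> g i \<noteq> \<zero>\<^bsub>K\<^esub>} \<subseteq> {i. g i \<noteq> \<zero>\<^bsub>K\<^esub>}"
   using that(1) by auto
  then show "finite {i. r \<otimes>\<^bsub>K\<^esub> g i \<noteq> \<zero>\<^bsub>K\<^esub>}" "{i. r \<otimes>\<^bsub>K\<^esub> g i \<noteq> \<zero>\<^bsub>K\<^esub>} \<subseteq> I"
   using that by (auto intro: finite_subset)
 qed
 show ?thesis
 proof (intro moduleI abelian_groupI)
  fix x assume x: "x <: (free_module K I)"
  have "{i. \<ominus>\<^bsub>K\<^esub> x i \<noteq> \<zero>\<^bsub>K\<^esub>} \<subseteq> {i. x i \<noteq> \<zero>\<^bsub>K\<^esub>}" by auto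
  then have "(%i. \<ominus>\<^bsub>K\<^esub> x i) <: (free_module K I)"
   using x by (auto simp: free_module_simps intro: finite_subset)
  moreover have "(%i. \<ominus>\<^bsub>K\<^esub> x i) \<oplus>\<^bsub>free_module K I\<^esub> x = \<zero>\<^bsub>free_module K I\<^esub>"
   using x by (auto simp: free_module_simps K.l_neg)
  ultimately show "\<exists>y\<in>carrier (free_module K I). y \<oplus>\<^bsub>free_module K I\<^esub> x = \<zero>\<^bsub>free_module K I\<^esub>"
   by blast
 qed (use fin fin' in "auto simp: free_module_simps K.a_ac K.m_ac K.l_distr K.r_distr assms")
qed

lemma free_gen_closed: "cring K ==> i \<in> I ==> free_gen K i <: (free_module K I)"
 using cring.cring_simprules(2,6) by (auto simp: free_module_simps free_gen_def)

text \<open>The sum occurring in \<open>tensor_lift\<close>, taken before passing to cosets. On the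
  free module it is linear for every choice of values on the generators.\<close>

definition free_ext :: "('k, 'r) ring_scheme => ('k, 'p, 'z) module_scheme => ('i => 'p) => ('i => 'k) => 'p" where
 "free_ext K P b x = (\<Oplus>\<^bsub>P\<^esub>i\<in>{i. x i \<noteq> \<zero>\<^bsub>K\<^esub>}. x i \<odot>\<^bsub>P\<^esub> b i)"

text \<open>Two elements have different supports; their sums can be added only after both are
  written over a common finite set, where the additional coefficients are zero.\<close>

lemma free_ext_superset:
 assumes "module K P" "finite S" "{i. x i \<noteq> \<zero>\<^bsub>K\<^esub>} \<subseteq> S" "!!i. x i <: K" "!!i. i \<in> S ==> b i <: P"
 shows "free_ext K P b x = (\<Oplus>\<^bsub>P\<^esub>i\<in>S. x i \<odot>\<^bsub>P\<^esub> b i)"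
proof -
 interpret P: module K P by fact
 show ?thesis unfolding free_ext_def
  by (rule P.add.finprod_mono_neutral_cong_left) (use assms in auto)
qed

lemma free_ext_linear:
 assumes "module K P" "!!i. i \<in> I ==> b i <: P"
 shows "module_lin K (free_module K I) P (free_ext K P b)"
proof -
 interpret P: module K P by fact
 show ?thesis
 proof (rule module_linI)
  fix x assume x: "x <: (free_module K I)"
  then show "free_ext K P b x <: P"
   using assms(2) by (auto simp: free_ext_def free_module_simps intro!: P.finsum_closed)
  fix y assume y: "y <: (free_module K I)"
  define S where "S = {i. x i \<noteq> \<zero>\<^bsub>K\<^esub>} \<union> {i. y i \<noteq> \<zero>\<^bsub>K\<^esub>}"
  have S: "finite S" "!!i. i \<in> S ==> b i <: P" "{i. x i \<oplus>\<^bsub>K\<^esub> y i \<noteq> \<zero>\<^bsub>K\<^esub>} \<subseteq> S"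
   "{i. x i \<noteq> \<zero>\<^bsub>K\<^esub>} \<subseteq> S" "{i. y i \<noteq> \<zero>\<^bsub>K\<^esub>} \<subseteq> S"
   using x y assms(2) by (auto simp: S_def free_module_simps)
  have xy: "!!i. x i <: K" "!!i. y i <: K"
   using x y by (auto simp: free_module_simps)
  have "free_ext K P b (x \<oplus>\<^bsub>free_module K I\<^esub> y) = (\<Oplus>\<^bsub>P\<^esub>i\<in>S. (x i \<oplus>\<^bsub>K\<^esub> y i) \<odot>\<^bsub>P\<^esub> b i)"
   unfolding free_module_simps by (rule free_ext_superset) (use S xy assms(1) in auto)
  also have "... = (\<Oplus>\<^bsub>P\<^esub>i\<in>S. x i \<odot>\<^bsub>P\<^esub> b i \<oplus>\<^bsub>P\<^esub> y i \<odot>\<^bsub>P\<^esub> b i)"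
   by (rule P.finsum_cong') (use S xy in "auto simp: P.smult_l_distr")
  also have "... = (\<Oplus>\<^bsub>P\<^esub>i\<in>S. x i \<odot>\<^bsub>P\<^esub> b i) \<oplus>\<^bsub>P\<^esub> (\<Oplus>\<^bsub>P\<^esub>i\<in>S. y i \<odot>\<^bsub>P\<^esub> b i)"
   by (rule P.finsum_addf) (use S xy in auto)
  also have "... = free_ext K P b x \<oplus>\<^bsub>P\<^esub> free_ext K P b y"
   using free_ext_superset[OF assms(1) S(1,4) xy(1) S(2)] free_ext_superset[OF assms(1) S(1,5) xy(2) S(2)]
   by simp
  finally show "free_ext K P b (x \<oplus>\<^bsub>free_module K I\<^esub> y) = free_ext K P b x \<oplus>\<^bsub>P\<^esub> free_ext K P b y" .
 next
  fix r x assume r: "r <: K" and x: "x <: (free_module K I)"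
  define S where "S = {i. x i \<noteq> \<zero>\<^bsub>K\<^esub>}"
  have xK: "!!i. x i <: K" using x by (auto simp: free_module_simps)
  have S: "finite S" "!!i. i \<in> S ==> b i <: P" "{i. r \<otimes>\<^bsub>K\<^esub> x i \<noteq> \<zero>\<^bsub>K\<^esub>} \<subseteq> S"
   using x assms(2) r by (auto simp: S_def free_module_simps)
  have "free_ext K P b (r \<odot>\<^bsub>free_module K I\<^esub> x) = (\<Oplus>\<^bsub>P\<^esub>i\<in>S. (r \<otimes>\<^bsub>K\<^esub> x i) \<odot>\<^bsub>P\<^esub> b i)"
   unfolding free_module_simps by (rule free_ext_superset) (use S xK r assms(1) in auto)
  also have "... = (\<Oplus>\<^bsub>P\<^esub>i\<in>S. r \<odot>\<^bsub>P\<^esub> (x i \<odot>\<^bsub>P\<^esub> b i))"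
   by (rule P.finsum_cong') (use S xK r in "auto simp: P.smult_assoc1")
  also have "... = r \<odot>\<^bsub>P\<^esub> free_ext K P b x"
   unfolding free_ext_def S_def[symmetric]
   by (rule module_finsum_smult[symmetric]) (use S xK r assms(1) in auto)
  finally show "free_ext K P b (r \<odot>\<^bsub>free_module K I\<^esub> x) = r \<odot>\<^bsub>P\<^esub> free_ext K P b x" .
 qed
qed

lemma free_ext_gen:
 assumes "module K P" "b i <: P"
 shows "free_ext K P b (free_gen K i) = b i"
proof -
 interpret P: module K P by fact
 have "free_ext K P b (free_gen K i) = (\<Oplus>\<^bsub>P\<^esub>j\<in>{i}. free_gen K i j \<odot>\<^bsub>P\<^esub> b j)"
  by (rule free_ext_superset) (use assms in "auto simp: free_gen_def")
 also have "... = b i" using assms by (simp add: free_gen_def)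
 finally show ?thesis .
qed

text \<open>Induction on the finite support, removing one coefficient at a time. Multiples of
  generators serve as base cases, so closure under scalars need not be an induction step.\<close>

lemma free_module_induct:
 assumes "cring K" "x <: (free_module K I)"
  and zero: "Q \<zero>\<^bsub>free_module K I\<^esub>"
  and gen: "!!r i. r <: K ==> i \<in> I ==> Q (r \<odot>\<^bsub>free_module K I\<^esub> free_gen K i)"
  and add: "!!x y. x <: (free_module K I) ==> y <: (free_module K I) ==> Q x ==> Q y
   ==> Q (x \<oplus>\<^bsub>free_module K I\<^esub> y)"
 shows "Q x"
proof -
 interpret K: cring K by fact
 interpret F: module K "free_module K I" using module_free_module[OF assms(1)] .
 define S where "S = {i. x i \<noteq> \<zero>\<^bsub>K\<^esub>}"
 have "finite S" using assms(2) by (auto simp: S_def free_module_simps)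
 then show ?thesis using assms(2) S_def
 proof (induction S arbitrary: x)
  case empty
  then have "x = \<zero>\<^bsub>free_module K I\<^esub>" by (auto simp: free_module_simps)
  then show ?case using zero by simp
 next
  case (insert k S)
  define y where "y = x(k := \<zero>\<^bsub>K\<^esub>)"
  have S: "S = {i. y i \<noteq> \<zero>\<^bsub>K\<^esub>}" using insert by (auto simp: y_def)
  have yc: "y <: (free_module K I)"
   using insert S by (auto simp: free_module_simps y_def)
  have k: "k \<in> I" "x k <: K" using insert by (auto simp: free_module_simps)
  have "x = y \<oplus>\<^bsub>free_module K I\<^esub> x k \<odot>\<^bsub>free_module K I\<^esub> free_gen K k"
   using insert(4) by (auto simp: free_module_simps y_def free_gen_def fun_eq_iff)
  moreover have "Q y" using insert.IH yc S by blast
  ultimately show ?case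
   using add[OF yc F.smult_closed[OF k(2) free_gen_closed[OF assms(1) k(1)]] \<open>Q y\<close> gen[OF k(2,1)]]
   by simp
 qed
qed

section \<open>The tensor product as a quotient of the free module\<close>

locale tensor_pair =
 fixes K :: "('k, 'r) ring_scheme" and M :: "('k, 'm, 'x) module_scheme"
  and N :: "('k, 'n, 'y) module_scheme"
 assumes module_M: "module K M" and module_N: "module K N"
begin

interpretation M: module K M by (rule module_M)
interpretation N: module K N by (rule module_N)

abbreviation "FF \<equiv> free_module K (carrier M \<times> carrier N)"
abbreviation "ZZ \<equiv> tensor_null K M N"
abbreviation "TT \<equiv> tensor_module K M N"

lemma FF_module: "module K FF"
 using module_free_module M.R.is_cring by blast

interpretation FF: module K FF by (rule FF_module)

lemma gen_closed: "m <: M ==> n <: N ==> free_gen K (m, n) <: FF"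
 by (rule free_gen_closed[OF M.R.is_cring]) simp

lemma relations_closed: "tensor_relations K M N \<subseteq> carrier FF"
 unfolding tensor_relations_def Let_def using gen_closed by auto

lemma null_submodule: "submodule ZZ K FF"
 unfolding tensor_null_def by (rule module_span_submodule[OF FF_module relations_closed])

lemma null_subset: "ZZ \<subseteq> carrier FF"
 using FF.submoduleE(1)[OF null_submodule] .

interpretation ZZ: abelian_subgroup ZZ FF
 by (rule abelian_subgroupI3)
  (use null_submodule FF.abelian_group_axioms in "auto simp: additive_subgroup_def submodule_def")

lemma null_smult: "r <: K ==> x \<in> ZZ ==> r \<odot>\<^bsub>FF\<^esub> x \<in> ZZ"
 using FF.submoduleE(4)[OF null_submodule] .

lemma coset_eq_iff:
 assumes "x <: FF" "y <: FF"
 shows "ZZ +>\<^bsub>FF\<^esub> x = ZZ +>\<^bsub>FF\<^esub> y \<longleftrightarrow> x \<ominus>\<^bsub>FF\<^esub> y \<in> ZZ"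
proof
 assume "ZZ +>\<^bsub>FF\<^esub> x = ZZ +>\<^bsub>FF\<^esub> y"
 then have "x \<in> ZZ +>\<^bsub>FF\<^esub> y" using ZZ.a_rcos_self[OF assms(1)] by simp
 then show "x \<ominus>\<^bsub>FF\<^esub> y \<in> ZZ"
  using ZZ.a_rcos_module_imp[OF assms(2)] by (simp add: a_minus_def)
next
 assume "x \<ominus>\<^bsub>FF\<^esub> y \<in> ZZ"
 then have "x \<in> ZZ +>\<^bsub>FF\<^esub> y"
  using ZZ.a_rcos_module_rev[OF assms(2,1)] by (simp add: a_minus_def)
 then show "ZZ +>\<^bsub>FF\<^esub> x = ZZ +>\<^bsub>FF\<^esub> y"
  using ZZ.a_repr_independence'[OF _ assms(2)] by simp
qed

lemma TT_simps:
 "carrier TT = a_rcosets\<^bsub>FF\<^esub> ZZ" "\<zero>\<^bsub>TT\<^esub> = ZZ" "s \<oplus>\<^bsub>TT\<^esub> t = s <+>\<^bsub>FF\<^esub> t"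
 "r \<odot>\<^bsub>TT\<^esub> t = (\<Union>x\<in>t. ZZ +>\<^bsub>FF\<^esub> (r \<odot>\<^bsub>FF\<^esub> x))"
 by (simp_all add: tensor_module_def Let_def)

lemma TT_carrierE:
 assumes "t <: TT"
 obtains x where "x <: FF" "t = ZZ +>\<^bsub>FF\<^esub> x"
 using assms unfolding TT_simps A_RCOSETS_def' by auto

lemma coset_closed: "x <: FF ==> ZZ +>\<^bsub>FF\<^esub> x <: TT"
 unfolding TT_simps A_RCOSETS_def' by auto

lemma coset_add:
 "x <: FF ==> y <: FF ==> (ZZ +>\<^bsub>FF\<^esub> x) \<oplus>\<^bsub>TT\<^esub> (ZZ +>\<^bsub>FF\<^esub> y) = ZZ +>\<^bsub>FF\<^esub> (x \<oplus>\<^bsub>FF\<^esub> y)"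
 unfolding TT_simps by (rule ZZ.a_rcos_sum)

text \<open>The scalar multiple of a coset is a union over all its representatives. Two
  representatives differ by an element of the null submodule, which is closed under scalars, so all
  cosets in that union coincide.\<close>

lemma coset_smult:
 assumes "x <: FF" "r <: K"
 shows "r \<odot>\<^bsub>TT\<^esub> (ZZ +>\<^bsub>FF\<^esub> x) = ZZ +>\<^bsub>FF\<^esub> (r \<odot>\<^bsub>FF\<^esub> x)"
proof -
 have "ZZ +>\<^bsub>FF\<^esub> (r \<odot>\<^bsub>FF\<^esub> y) = ZZ +>\<^bsub>FF\<^esub> (r \<odot>\<^bsub>FF\<^esub> x)" if "y \<in> ZZ +>\<^bsub>FF\<^esub> x" for y
 proof -
  have y: "y <: FF" using that assms(1) ZZ.a_elemrcos_carrier by blast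
  have "y \<ominus>\<^bsub>FF\<^esub> x \<in> ZZ" using ZZ.a_rcos_module_imp[OF assms(1) that] by (simp add: a_minus_def)
  then have "r \<odot>\<^bsub>FF\<^esub> (y \<ominus>\<^bsub>FF\<^esub> x) \<in> ZZ" using null_smult assms(2) by blast
  also have "r \<odot>\<^bsub>FF\<^esub> (y \<ominus>\<^bsub>FF\<^esub> x) = r \<odot>\<^bsub>FF\<^esub> y \<ominus>\<^bsub>FF\<^esub> r \<odot>\<^bsub>FF\<^esub> x"
   using assms y by (simp add: a_minus_def FF.smult_r_distr FF.smult_r_minus)
  finally show ?thesis using coset_eq_iff[of "r \<odot>\<^bsub>FF\<^esub> y" "r \<odot>\<^bsub>FF\<^esub> x"] y assms by simp
 qed
 moreover have "x \<in> ZZ +>\<^bsub>FF\<^esub> x" using ZZ.a_rcos_self[OF assms(1)] .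
 ultimately show ?thesis unfolding TT_simps by blast
qed

lemma module_tensor: "module K TT"
proof -
 have z: "\<zero>\<^bsub>TT\<^esub> = ZZ +>\<^bsub>FF\<^esub> \<zero>\<^bsub>FF\<^esub>"
  using FF.a_coset_add_zero[OF null_subset] by (simp add: TT_simps)
 have inv: "\<exists>y\<in>carrier TT. y \<oplus>\<^bsub>TT\<^esub> x = \<zero>\<^bsub>TT\<^esub>" if x: "x <: TT" for x
 proof -
  obtain u where u: "u <: FF" "x = ZZ +>\<^bsub>FF\<^esub> u" using x TT_carrierE by blast
  then have "(ZZ +>\<^bsub>FF\<^esub> (\<ominus>\<^bsub>FF\<^esub> u)) \<oplus>\<^bsub>TT\<^esub> x = \<zero>\<^bsub>TT\<^esub>" by (simp add: z coset_add FF.l_neg)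
  then show ?thesis using u coset_closed by blast
 qed
 have "abelian_group TT"
 proof (rule abelian_groupI)
  show "\<zero>\<^bsub>TT\<^esub> <: TT" unfolding z by (rule coset_closed) simp
 qed (auto elim!: TT_carrierE simp: z coset_closed coset_add FF.a_ac intro!: inv[unfolded z])
 then show ?thesis
  by (intro moduleI)
   (auto elim!: TT_carrierE simp: M.R.is_cring coset_closed coset_add coset_smult FF.smult_l_distr FF.smult_r_distr
    FF.smult_assoc1)
qed

interpretation TT: module K TT by (rule module_tensor)

lemma elem_closed: "m <: M ==> n <: N ==> tensor_elem K M N m n <: TT"
 unfolding tensor_elem_def by (rule coset_closed[OF gen_closed])

lemma relation_null: "x \<in> tensor_relations K M N ==> x \<in> ZZ"
 unfolding tensor_null_def by (rule subsetD[OF module_span_mono])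

lemma elem_bilin: "bilin K M N TT (tensor_elem K M N)"
proof (intro bilinI module_linI)
 fix m m' n assume A: "m <: M" "m' <: M" "n <: N"
 have "free_gen K (m \<oplus>\<^bsub>M\<^esub> m', n) \<ominus>\<^bsub>FF\<^esub> (free_gen K (m, n) \<oplus>\<^bsub>FF\<^esub> free_gen K (m', n)) \<in> ZZ"
  by (rule relation_null) (use A in "auto simp: tensor_relations_def Let_def")
 then show "tensor_elem K M N (m \<oplus>\<^bsub>M\<^esub> m') n = tensor_elem K M N m n \<oplus>\<^bsub>TT\<^esub> tensor_elem K M N m' n"
  using A coset_eq_iff by (simp add: tensor_elem_def coset_add gen_closed)
next
 fix m n n' assume A: "m <: M" "n' <: N" "n <: N"
 have "free_gen K (m, n \<oplus>\<^bsub>N\<^esub> n') \<ominus>\<^bsub>FF\<^esub> (free_gen K (m, n) \<oplus>\<^bsub>FF\<^esub> free_gen K (m, n')) \<in> ZZ"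
  by (rule relation_null) (use A in "auto simp: tensor_relations_def Let_def")
 then show "tensor_elem K M N m (n \<oplus>\<^bsub>N\<^esub> n') = tensor_elem K M N m n \<oplus>\<^bsub>TT\<^esub> tensor_elem K M N m n'"
  using A coset_eq_iff by (simp add: tensor_elem_def coset_add gen_closed)
next
 fix r m n assume A: "r <: K" "m <: M" "n <: N"
 have "free_gen K (r \<odot>\<^bsub>M\<^esub> m, n) \<ominus>\<^bsub>FF\<^esub> r \<odot>\<^bsub>FF\<^esub> free_gen K (m, n) \<in> ZZ"
  by (rule relation_null) (use A in "auto simp: tensor_relations_def Let_def")
 then show "tensor_elem K M N (r \<odot>\<^bsub>M\<^esub> m) n = r \<odot>\<^bsub>TT\<^esub> tensor_elem K M N m n"
  using A coset_eq_iff by (simp add: tensor_elem_def coset_smult gen_closed)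
 have "free_gen K (m, r \<odot>\<^bsub>N\<^esub> n) \<ominus>\<^bsub>FF\<^esub> r \<odot>\<^bsub>FF\<^esub> free_gen K (m, n) \<in> ZZ"
  by (rule relation_null) (use A in "auto simp: tensor_relations_def Let_def")
 then show "tensor_elem K M N m (r \<odot>\<^bsub>N\<^esub> n) = r \<odot>\<^bsub>TT\<^esub> tensor_elem K M N m n"
  using A coset_eq_iff by (simp add: tensor_elem_def coset_smult gen_closed)
qed (auto simp: elem_closed)

text \<open>Neither scalars nor zero require a case: r (m \<otimes> n) is the pure tensor (r m)
  \<otimes> n, and 0 is 0 \<otimes> 0.\<close>

lemma induct [consumes 1, case_names elem add]:
 assumes "t <: TT"
  and elem: "!!m n. m <: M ==> n <: N ==> Q (tensor_elem K M N m n)"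
  and add: "!!s t. s <: TT ==> t <: TT ==> Q s ==> Q t ==> Q (s \<oplus>\<^bsub>TT\<^esub> t)"
 shows "Q t"
proof -
 obtain x where x: "x <: FF" "t = ZZ +>\<^bsub>FF\<^esub> x" using TT_carrierE[OF assms(1)] by blast
 note E = module_lin_smult[OF bilin_lin1[OF elem_bilin]]
 have gen: "Q (ZZ +>\<^bsub>FF\<^esub> r \<odot>\<^bsub>FF\<^esub> free_gen K (m, n))"
  if "r <: K" "m <: M" "n <: N" for r m n
 proof -
  have "ZZ +>\<^bsub>FF\<^esub> r \<odot>\<^bsub>FF\<^esub> free_gen K (m, n) = r \<odot>\<^bsub>TT\<^esub> tensor_elem K M N m n"
   using coset_smult[OF gen_closed[OF that(2,3)] that(1)] by (simp add: tensor_elem_def)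
  also have "... = tensor_elem K M N (r \<odot>\<^bsub>M\<^esub> m) n" using E that by simp
  finally show ?thesis using elem that by simp
 qed
 have "Q (ZZ +>\<^bsub>FF\<^esub> x)"
 proof (rule free_module_induct[where Q = "%x. Q (ZZ +>\<^bsub>FF\<^esub> x)", OF M.R.is_cring x(1)])
  have "\<zero>\<^bsub>FF\<^esub> = \<zero>\<^bsub>K\<^esub> \<odot>\<^bsub>FF\<^esub> free_gen K (\<zero>\<^bsub>M\<^esub>, \<zero>\<^bsub>N\<^esub>)" by (simp add: gen_closed)
  then show "Q (ZZ +>\<^bsub>FF\<^esub> \<zero>\<^bsub>FF\<^esub>)" using gen[of "\<zero>\<^bsub>K\<^esub>" "\<zero>\<^bsub>M\<^esub>" "\<zero>\<^bsub>N\<^esub>"] by simp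
 next
  fix r i assume "r <: K" "i \<in> carrier M \<times> carrier N"
  then show "Q (ZZ +>\<^bsub>FF\<^esub> r \<odot>\<^bsub>FF\<^esub> free_gen K i)" using gen by (cases i) simp
 next
  fix x y assume "x <: FF" "y <: FF" "Q (ZZ +>\<^bsub>FF\<^esub> x)" "Q (ZZ +>\<^bsub>FF\<^esub> y)"
  then show "Q (ZZ +>\<^bsub>FF\<^esub> (x \<oplus>\<^bsub>FF\<^esub> y))"
   using add[OF coset_closed[of x] coset_closed[of y]] by (simp only: coset_add)
 qed
 then show ?thesis using x by simp
qed

text \<open>The chosen representative depends on t alone and not on the form b. All lifts over the
  same t are thus sums over one finite support, which gives congruence, additivity and exchange of
  lifts for arbitrary b with values in P.\<close>

lemma rep:
 assumes "t <: TT"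
 defines "x \<equiv> SOME x. x \<in> t"
 shows "x <: FF" "ZZ +>\<^bsub>FF\<^esub> x = t"
  "tensor_lift K M N P b t = free_ext K P (%i. b (fst i) (snd i)) x"
  "finite {i. x i \<noteq> \<zero>\<^bsub>K\<^esub>}" "{i. x i \<noteq> \<zero>\<^bsub>K\<^esub>} \<subseteq> carrier M \<times> carrier N" "!!i. x i <: K"
proof -
 obtain y where y: "y <: FF" "t = ZZ +>\<^bsub>FF\<^esub> y" using TT_carrierE[OF assms(1)] by blast
 have "y \<in> t" using y ZZ.a_rcos_self by simp
 then have "x \<in> t" unfolding x_def by (rule someI[of "%x. x \<in> t"])
 then show "ZZ +>\<^bsub>FF\<^esub> x = t" using ZZ.a_repr_independence'[of x y] y by simp
 show *: "x <: FF" using \<open>x \<in> t\<close> y ZZ.a_elemrcos_carrier by blast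
 show "tensor_lift K M N P b t = free_ext K P (%i. b (fst i) (snd i)) x"
  by (simp add: tensor_lift_def Let_def free_ext_def x_def)
 show "finite {i. x i \<noteq> \<zero>\<^bsub>K\<^esub>}" "{i. x i \<noteq> \<zero>\<^bsub>K\<^esub>} \<subseteq> carrier M \<times> carrier N" "!!i. x i <: K"
  using * by (auto simp: free_module_simps)
qed

lemma lift_closed:
 assumes "module K P" "!!m n. m <: M ==> n <: N ==> b m n <: P" "t <: TT"
 shows "tensor_lift K M N P b t <: P"
 unfolding rep(3)[OF assms(3)]
 by (rule module_lin_closed[OF free_ext_linear[OF assms(1)] rep(1)[OF assms(3)]]) (use assms(2) in auto)

lemma lift_cong:
 assumes "module K P" "!!m n. m <: M ==> n <: N ==> b m n = b' m n"
  "!!m n. m <: M ==> n <: N ==> b' m n <: P" "t <: TT"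
 shows "tensor_lift K M N P b t = tensor_lift K M N P b' t"
proof -
 interpret P: module K P by fact
 define x where "x = (SOME x. x \<in> t)"
 note r = rep[OF assms(4), folded x_def]
 have mem: "fst i <: M" "snd i <: N" if "i \<in> {i. x i \<noteq> \<zero>\<^bsub>K\<^esub>}" for i
  using subsetD[OF r(5) that] by (auto simp: mem_Times_iff)
 show ?thesis
  unfolding r(3) free_ext_def
  by (rule P.finsum_cong') (use mem r(6) assms(2,3) in auto)
qed

lemma lift_comp:
 assumes "module K P" "module K P'" "module_lin K P P' g"
  "!!m n. m <: M ==> n <: N ==> b m n <: P" "t <: TT"
 shows "g (tensor_lift K M N P b t) = tensor_lift K M N P' (%m n. g (b m n)) t"
proof -
 interpret P: module K P by fact
 interpret P': module K P' by fact
 define x where "x = (SOME x. x \<in> t)"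
 note r = rep[OF assms(5), folded x_def]
 have b: "b (fst i) (snd i) <: P" if "i \<in> {i. x i \<noteq> \<zero>\<^bsub>K\<^esub>}" for i
  using subsetD[OF r(5) that] by (auto simp: mem_Times_iff intro: assms(4))
 have "g (tensor_lift K M N P b t) = (\<Oplus>\<^bsub>P'\<^esub>i\<in>{i. x i \<noteq> \<zero>\<^bsub>K\<^esub>}. g (x i \<odot>\<^bsub>P\<^esub> b (fst i) (snd i)))"
  unfolding r(3) free_ext_def
  by (rule module_lin_finsum[OF assms(1-3)]) (use b r(6) in auto)
 also have "... = tensor_lift K M N P' (%m n. g (b m n)) t"
  unfolding r(3) free_ext_def
  by (rule P'.finsum_cong')
   (use b r(6) assms(3) in "auto simp: module_lin_closed module_lin_smult")
 finally show ?thesis .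
qed

lemma lift_add:
 assumes "module K P"
  "!!m n. m <: M ==> n <: N ==> b m n <: P"
  "!!m n. m <: M ==> n <: N ==> b' m n <: P" "t <: TT"
 shows "tensor_lift K M N P (%m n. b m n \<oplus>\<^bsub>P\<^esub> b' m n) t
  = tensor_lift K M N P b t \<oplus>\<^bsub>P\<^esub> tensor_lift K M N P b' t"
proof -
 interpret P: module K P by fact
 define x where "x = (SOME x. x \<in> t)"
 note r = rep[OF assms(4), folded x_def]
 have b: "b (fst i) (snd i) <: P" "b' (fst i) (snd i) <: P"
  if "i \<in> {i. x i \<noteq> \<zero>\<^bsub>K\<^esub>}" for i
  using subsetD[OF r(5) that] by (auto simp: mem_Times_iff intro: assms(2,3))
 have "(\<Oplus>\<^bsub>P\<^esub>i\<in>{i. x i \<noteq> \<zero>\<^bsub>K\<^esub>}. x i \<odot>\<^bsub>P\<^esub> (b (fst i) (snd i) \<oplus>\<^bsub>P\<^esub> b' (fst i) (snd i)))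
  = (\<Oplus>\<^bsub>P\<^esub>i\<in>{i. x i \<noteq> \<zero>\<^bsub>K\<^esub>}. x i \<odot>\<^bsub>P\<^esub> b (fst i) (snd i) \<oplus>\<^bsub>P\<^esub> x i \<odot>\<^bsub>P\<^esub> b' (fst i) (snd i))"
  by (rule P.finsum_cong') (use b r(6) in "auto simp: P.smult_r_distr")
 also have "... = (\<Oplus>\<^bsub>P\<^esub>i\<in>{i. x i \<noteq> \<zero>\<^bsub>K\<^esub>}. x i \<odot>\<^bsub>P\<^esub> b (fst i) (snd i))
   \<oplus>\<^bsub>P\<^esub> (\<Oplus>\<^bsub>P\<^esub>i\<in>{i. x i \<noteq> \<zero>\<^bsub>K\<^esub>}. x i \<odot>\<^bsub>P\<^esub> b' (fst i) (snd i))"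
  by (rule P.finsum_addf) (use b r(6) in auto)
 finally show ?thesis unfolding r(3) free_ext_def .
qed

lemma lift_smult:
 assumes "module K P" "r <: K"
  "!!m n. m <: M ==> n <: N ==> b m n <: P" "t <: TT"
 shows "tensor_lift K M N P (%m n. r \<odot>\<^bsub>P\<^esub> b m n) t = r \<odot>\<^bsub>P\<^esub> tensor_lift K M N P b t"
proof -
 interpret P: module K P by fact
 have "module_lin K P P (%x. r \<odot>\<^bsub>P\<^esub> x)"
  by (rule module_lin_smult_fun[OF assms(1) module_lin_id assms(2)])
 from lift_comp[OF assms(1,1) this assms(3,4)] show ?thesis by simp
qed

text \<open>Bilinearity puts every defining relation, hence the whole null submodule, into the
  kernel of the free extension. Only then is the value independent of the representative, and the
  universal property follows.\<close>

lemma
 assumes "module K P" "bilin K M N P b"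
 shows lift_bilin_lin: "module_lin K TT P (tensor_lift K M N P b)"
  and lift_elem: "m <: M ==> n <: N ==> tensor_lift K M N P b (tensor_elem K M N m n) = b m n"
proof -
 interpret P: module K P by fact
 let ?b = "%i. b (fst i) (snd i)"
 let ?e = "free_ext K P ?b"
 have b: "b m n <: P" if "m <: M" "n <: N" for m n
  using bilin_closed[OF assms(2)] that .
 have lin: "module_lin K FF P ?e"
  by (rule free_ext_linear[OF assms(1)]) (use b in auto)
 have gen: "?e (free_gen K (m, n)) = b m n" if "m <: M" "n <: N" for m n
  using free_ext_gen[OF assms(1), of ?b "(m, n)"] b[OF that] by simp
 note L = module_lin_minus[OF FF_module assms(1) lin] module_lin_add[OF lin] module_lin_smult[OF lin]
 note B1 = module_lin_add[OF bilin_lin1[OF assms(2)]] module_lin_smult[OF bilin_lin1[OF assms(2)]]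
 note B2 = module_lin_add[OF bilin_lin2[OF assms(2)]] module_lin_smult[OF bilin_lin2[OF assms(2)]]
 have "tensor_relations K M N \<subseteq> {x \<in> carrier FF. ?e x = \<zero>\<^bsub>P\<^esub>}"
  unfolding tensor_relations_def Let_def
  by (auto simp: L gen gen_closed B1 B2 module_minus_eq_zero_iff[OF assms(1)] b)
 then have ker: "ZZ \<subseteq> {x \<in> carrier FF. ?e x = \<zero>\<^bsub>P\<^esub>}"
  unfolding tensor_null_def
  by (intro module_span_least submodule_kernel[OF FF_module assms(1) lin])
 have coset: "tensor_lift K M N P b (ZZ +>\<^bsub>FF\<^esub> x) = ?e x" if x: "x <: FF" for x
 proof -
  define y where "y = (SOME y. y \<in> ZZ +>\<^bsub>FF\<^esub> x)"
  note r = rep[OF coset_closed[OF x], folded y_def]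
  have "y \<ominus>\<^bsub>FF\<^esub> x \<in> ZZ" using coset_eq_iff[OF r(1) x] r(2) by simp
  then have "?e (y \<ominus>\<^bsub>FF\<^esub> x) = \<zero>\<^bsub>P\<^esub>" using ker by auto
  then have "?e y = ?e x"
   using L(1)[OF r(1) x] module_minus_eq_zero_iff[OF assms(1)] module_lin_closed[OF lin] r(1) x by simp
  then show ?thesis using r(3)[of P b] by (simp only:)
 qed
 show "module_lin K TT P (tensor_lift K M N P b)"
  by (rule module_linI)
   (auto elim!: TT_carrierE simp: coset coset_add coset_smult L module_lin_closed[OF lin])
 show "tensor_lift K M N P b (tensor_elem K M N m n) = b m n" if "m <: M" "n <: N"
  using coset[OF gen_closed[OF that]] gen[OF that] by (simp add: tensor_elem_def)
qed

text \<open>For fixed t the support is the same for all values of the parameter x, so linearity in x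
  is inherited term by term.\<close>

lemma lift_fun_lin:
 assumes "module K P" "!!m n. m <: M ==> n <: N ==> module_lin K L P (%x. b x m n)"
  "t <: TT"
 shows "module_lin K L P (%x. tensor_lift K M N P (b x) t)"
proof (rule module_linI)
 note c = module_lin_closed[OF assms(2)] and a = module_lin_add[OF assms(2)] and s = module_lin_smult[OF assms(2)]
 fix x assume x: "x <: L"
 then show "tensor_lift K M N P (b x) t <: P"
  by (intro lift_closed assms c)
 fix y assume y: "y <: L"
 have "tensor_lift K M N P (b (x \<oplus>\<^bsub>L\<^esub> y)) t = tensor_lift K M N P (%m n. b x m n \<oplus>\<^bsub>P\<^esub> b y m n) t"
  by (rule lift_cong) (use assms x y c a module_add_closed[OF assms(1)] in auto)
 also have "... = tensor_lift K M N P (b x) t \<oplus>\<^bsub>P\<^esub> tensor_lift K M N P (b y) t"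
  by (rule lift_add) (use assms x y c in auto)
 finally show "tensor_lift K M N P (b (x \<oplus>\<^bsub>L\<^esub> y)) t = tensor_lift K M N P (b x) t \<oplus>\<^bsub>P\<^esub> tensor_lift K M N P (b y) t" .
next
 note c = module_lin_closed[OF assms(2)] and a = module_lin_add[OF assms(2)] and s = module_lin_smult[OF assms(2)]
 fix r x assume r: "r <: K" and x: "x <: L"
 have "tensor_lift K M N P (b (r \<odot>\<^bsub>L\<^esub> x)) t = tensor_lift K M N P (%m n. r \<odot>\<^bsub>P\<^esub> b x m n) t"
  by (rule lift_cong) (use assms x r c s module_smult_closed[OF assms(1)] in auto)
 also have "... = r \<odot>\<^bsub>P\<^esub> tensor_lift K M N P (b x) t"
  by (rule lift_smult) (use assms x r c in auto)
 finally show "tensor_lift K M N P (b (r \<odot>\<^bsub>L\<^esub> x)) t = r \<odot>\<^bsub>P\<^esub> tensor_lift K M N P (b x) t" .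
qed

lemma ext:
 assumes "module K P" "module_lin K TT P f" "module_lin K TT P g"
  "!!m n. m <: M ==> n <: N ==> f (tensor_elem K M N m n) = g (tensor_elem K M N m n)"
  "t <: TT"
 shows "f t = g t"
 using assms(5)
 by (induction rule: induct) (use assms(2-4) in "auto simp: module_lin_add")

end

text \<open>Once the representatives of s and t are fixed, this is the exchange of two finite sums.
  It justifies every reordering of independent Sweedler sums below.\<close>

lemma tensor_lift_swap:
 assumes "tensor_pair K M N" "tensor_pair K M' N'" "module K P"
  and s: "s <: (tensor_module K M N)" and t: "t <: (tensor_module K M' N')"
  and b: "!!m n m' n'. m <: M ==> n <: N ==> m' <: M' ==> n' <: N' ==>
   b m n m' n' <: P"
 shows "tensor_lift K M N P (%m n. tensor_lift K M' N' P (b m n) t) s =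
  tensor_lift K M' N' P (%m' n'. tensor_lift K M N P (%m n. b m n m' n') s) t"
proof -
 interpret A: tensor_pair K M N by fact
 interpret B: tensor_pair K M' N' by fact
 interpret P: module K P by fact
 define x where "x = (SOME x. x \<in> s)"
 define y where "y = (SOME x. x \<in> t)"
 note x = A.rep[OF s, folded x_def]
 note y = B.rep[OF t, folded y_def]
 let ?I = "{i. x i \<noteq> \<zero>\<^bsub>K\<^esub>}" and ?J = "{i. y i \<noteq> \<zero>\<^bsub>K\<^esub>}"
 let ?b = "%i j. b (fst i) (snd i) (fst j) (snd j)"
 have c: "?b i j <: P" if "i \<in> ?I" "j \<in> ?J" for i j
  using subsetD[OF x(5) that(1)] subsetD[OF y(5) that(2)] by (auto intro!: b simp: mem_Times_iff)
 have "tensor_lift K M N P (%m n. tensor_lift K M' N' P (b m n) t) s =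
   (\<Oplus>\<^bsub>P\<^esub>i\<in>?I. x i \<odot>\<^bsub>P\<^esub> (\<Oplus>\<^bsub>P\<^esub>j\<in>?J. y j \<odot>\<^bsub>P\<^esub> ?b i j))"
  unfolding x(3) y(3) free_ext_def ..
 also have "... = (\<Oplus>\<^bsub>P\<^esub>i\<in>?I. \<Oplus>\<^bsub>P\<^esub>j\<in>?J. x i \<odot>\<^bsub>P\<^esub> (y j \<odot>\<^bsub>P\<^esub> ?b i j))"
  by (rule P.finsum_cong') (use c x(6) y(6) in "auto intro!: module_finsum_smult assms(3) P.finsum_closed")
 also have "... = (\<Oplus>\<^bsub>P\<^esub>j\<in>?J. \<Oplus>\<^bsub>P\<^esub>i\<in>?I. x i \<odot>\<^bsub>P\<^esub> (y j \<odot>\<^bsub>P\<^esub> ?b i j))"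
  by (rule finsum_swap) (use c x(4,6) y(4,6) P.abelian_monoid_axioms in auto)
 also have "... = (\<Oplus>\<^bsub>P\<^esub>j\<in>?J. \<Oplus>\<^bsub>P\<^esub>i\<in>?I. y j \<odot>\<^bsub>P\<^esub> (x i \<odot>\<^bsub>P\<^esub> ?b i j))"
  by (intro P.finsum_cong')
   (use c x(6) y(6) in "auto intro!: P.finsum_closed simp: P.smult_assoc1[symmetric] P.R.m_comm")
 also have "... = (\<Oplus>\<^bsub>P\<^esub>j\<in>?J. y j \<odot>\<^bsub>P\<^esub> (\<Oplus>\<^bsub>P\<^esub>i\<in>?I. x i \<odot>\<^bsub>P\<^esub> ?b i j))"
  by (rule P.finsum_cong') (use c x(6) y(6) in "auto intro!: module_finsum_smult[symmetric] assms(3) P.finsum_closed")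
 also have "... = tensor_lift K M' N' P (%m' n'. tensor_lift K M N P (%m n. b m n m' n') s) t"
  unfolding x(3) y(3) free_ext_def ..
 finally show ?thesis .
qed

section \<open>Tensor products of algebras\<close>

text \<open>\<open>tensor_algebra\<close> and \<open>gtensor\<close> take over the module fields of
  \<open>tensor_module\<close> and differ in \<open>mult\<close>, \<open>one\<close>,
  \<open>grd\<close> and \<open>act\<close>. Agreement on the four module fields carries all linear
  statements from one record to the other.\<close>

definition same_module :: "('k, 'm, 'x) module_scheme => ('k, 'm, 'y) module_scheme => bool" where
 "same_module T T' \<longleftrightarrow> carrier T' = carrier T \<and> zero T' = zero T \<and> add T' = add T \<and> smult T' = smult T"

lemma same_moduleD:
 assumes "same_module T T'"
 shows "carrier T' = carrier T" "zero T' = zero T" "add T' = add T" "smult T' = smult T"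
 using assms by (simp_all add: same_module_def)

lemma same_module_module:
 assumes "same_module T T'" "module K T"
 shows "module K T'"
proof -
 interpret T: module K T by fact
 have inv: "\<exists>y\<in>carrier T. y \<oplus>\<^bsub>T\<^esub> x = \<zero>\<^bsub>T\<^esub>" if "x <: T" for x
  using that by (intro bexI[of _ "\<ominus>\<^bsub>T\<^esub> x"]) (auto simp: T.l_neg)
 show ?thesis
  by (intro moduleI abelian_groupI)
   (auto simp: same_moduleD[OF assms(1)] T.R.is_cring T.smult_l_distr T.smult_r_distr
    T.smult_assoc1 T.a_ac inv)
qed

lemma same_module_lin1: "same_module T T' ==> module_lin K T' P f = module_lin K T P f"
 and same_module_lin2: "same_module T T' ==> module_lin K P T' g = module_lin K P T g"
 by (simp_all add: same_module_def module_lin_def)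

lemma same_module_bilin: "same_module T T' ==> bilin K M N T' b = bilin K M N T b"
 by (simp add: bilin_def same_module_lin2)

lemma same_module_tensor_algebra: "same_module (tensor_module K M N) (tensor_algebra K M N)"
 by (simp add: same_module_def tensor_algebra_def Let_def)

lemma same_module_gtensor: "same_module (tensor_module (qbase Q) V W) (gtensor Q V W)"
 by (simp add: same_module_def gtensor_def Let_def)

text \<open>An associative unital algebra: distributivity and compatibility with scalars are both
  contained in the bilinearity of the product, and the rest is a monoid.\<close>

definition kalg :: "('k, 'r) ring_scheme => ('k, 'm, 'x) module_scheme => bool" where
 "kalg K A \<longleftrightarrow> module K A \<and> bilin K A A A (mult A) \<and> monoid A"

lemma kalgD:
 assumes "kalg K A"
 shows "module K A" "bilin K A A A (mult A)" "monoid A"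
 using assms by (auto simp: kalg_def)

lemma kalgI_ring:
 assumes "module K A" "ring A"
  "!!r x y. r <: K ==> x <: A ==> y <: A ==>
   (r \<odot>\<^bsub>A\<^esub> x) \<otimes>\<^bsub>A\<^esub> y = r \<odot>\<^bsub>A\<^esub> (x \<otimes>\<^bsub>A\<^esub> y)"
  "!!r x y. r <: K ==> x <: A ==> y <: A ==>
   x \<otimes>\<^bsub>A\<^esub> (r \<odot>\<^bsub>A\<^esub> y) = r \<odot>\<^bsub>A\<^esub> (x \<otimes>\<^bsub>A\<^esub> y)"
 shows "kalg K A"
proof -
 interpret A: ring A by fact
 have "bilin K A A A (mult A)"
  by (intro bilinI module_linI) (use assms(3,4) in "auto simp: A.l_distr A.r_distr")
 then show ?thesis using assms(1) A.monoid_axioms by (simp add: kalg_def)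
qed

definition alghom :: "('k, 'r) ring_scheme => ('k, 'm, 'x) module_scheme => ('k, 'n, 'y) module_scheme
  => ('m => 'n) => bool" where
 "alghom K A B f \<longleftrightarrow> module_lin K A B f \<and> f \<one>\<^bsub>A\<^esub> = \<one>\<^bsub>B\<^esub> \<and>
   (\<forall>x\<in>carrier A. \<forall>y\<in>carrier A. f (x \<otimes>\<^bsub>A\<^esub> y) = f x \<otimes>\<^bsub>B\<^esub> f y)"

lemma alghomD:
 assumes "alghom K A B f"
 shows "module_lin K A B f" "f \<one>\<^bsub>A\<^esub> = \<one>\<^bsub>B\<^esub>"
  "!!x y. x <: A ==> y <: A ==> f (x \<otimes>\<^bsub>A\<^esub> y) = f x \<otimes>\<^bsub>B\<^esub> f y"
  "!!x. x <: A ==> f x <: B"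
 using assms by (auto simp: alghom_def module_lin_closed)

locale tensor_alg =
 fixes K :: "('k, 'r) ring_scheme" and M :: "('k, 'm, 'x) module_scheme"
  and N :: "('k, 'n, 'y) module_scheme"
 assumes alg_M: "kalg K M" and alg_N: "kalg K N"
begin

abbreviation "TA \<equiv> tensor_algebra K M N"
abbreviation "e \<equiv> tensor_elem K M N"

lemma tp: "tensor_pair K M N"
 by (rule tensor_pair.intro[OF kalgD(1)[OF alg_M] kalgD(1)[OF alg_N]])

lemmas same = same_module_tensor_algebra[of K M N]

lemma module_TA: "module K TA"
 by (rule same_module_module[OF same tensor_pair.module_tensor[OF tp]])

lemma e_bilin: "bilin K M N TA e"
 using tensor_pair.elem_bilin[OF tp] by (simp add: same_module_bilin[OF same])

lemma e_closed: "m <: M ==> n <: N ==> e m n <: TA"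
 using bilin_closed[OF e_bilin] .

lemma lift_lin: "module K P ==> bilin K M N P b ==> module_lin K TA P (tensor_lift K M N P b)"
 using tensor_pair.lift_bilin_lin[OF tp] by (simp add: same_module_lin1[OF same])

lemma ext:
 assumes "module_lin K TA P f" "module_lin K TA P g" "module K P"
  "!!m n. m <: M ==> n <: N ==> f (e m n) = g (e m n)" "t <: TA"
 shows "f t = g t"
 using tensor_pair.ext[OF tp assms(3)] assms(1,2,4,5)
 by (simp add: same_module_lin1[OF same] same_moduleD[OF same])

lemma mult_def': "s \<otimes>\<^bsub>TA\<^esub> t = tensor_lift K M N (tensor_module K M N) (%a b.
  tensor_lift K M N (tensor_module K M N) (%c d. e (a \<otimes>\<^bsub>M\<^esub> c) (b \<otimes>\<^bsub>N\<^esub> d)) t) s"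
 by (simp add: tensor_algebra_def Let_def)

lemma b1:
 assumes "a <: M" "b <: N"
 shows "bilin K M N (tensor_module K M N) (%c d. e (a \<otimes>\<^bsub>M\<^esub> c) (b \<otimes>\<^bsub>N\<^esub> d))"
 by (intro bilinI bilin_comp1[OF tensor_pair.elem_bilin[OF tp]] bilin_comp2[OF tensor_pair.elem_bilin[OF tp]]
   bilin_lin2[OF kalgD(2)[OF alg_M]] bilin_lin2[OF kalgD(2)[OF alg_N]]
   bilin_closed[OF kalgD(2)[OF alg_M]] bilin_closed[OF kalgD(2)[OF alg_N]] assms)

lemma b2:
 assumes "c <: M" "d <: N"
 shows "bilin K M N (tensor_module K M N) (%a b. e (a \<otimes>\<^bsub>M\<^esub> c) (b \<otimes>\<^bsub>N\<^esub> d))"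
 by (intro bilinI bilin_comp1[OF tensor_pair.elem_bilin[OF tp]] bilin_comp2[OF tensor_pair.elem_bilin[OF tp]]
   bilin_lin1[OF kalgD(2)[OF alg_M]] bilin_lin1[OF kalgD(2)[OF alg_N]]
   bilin_closed[OF kalgD(2)[OF alg_M]] bilin_closed[OF kalgD(2)[OF alg_N]] assms)

lemma b3:
 assumes "t <: TA"
 shows "bilin K M N (tensor_module K M N) (%a b. tensor_lift K M N (tensor_module K M N)
  (%c d. e (a \<otimes>\<^bsub>M\<^esub> c) (b \<otimes>\<^bsub>N\<^esub> d)) t)"
 using assms
 by (intro bilinI tensor_pair.lift_fun_lin[OF tp tensor_pair.module_tensor[OF tp]] bilin_lin1[OF b2] bilin_lin2[OF b2])
  (simp_all add: same_moduleD[OF same])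

lemma mult_elem:
 assumes "a <: M" "b <: N" "c <: M" "d <: N"
 shows "e a b \<otimes>\<^bsub>TA\<^esub> e c d = e (a \<otimes>\<^bsub>M\<^esub> c) (b \<otimes>\<^bsub>N\<^esub> d)"
 using assms tensor_pair.lift_elem[OF tp tensor_pair.module_tensor[OF tp] b3[OF e_closed]]
  tensor_pair.lift_elem[OF tp tensor_pair.module_tensor[OF tp] b1]
 by (simp add: mult_def')

lemma mult_bilin: "bilin K TA TA TA (mult TA)"
proof (rule bilinI)
 fix t assume t: "t <: TA"
 show "module_lin K TA TA (%s. s \<otimes>\<^bsub>TA\<^esub> t)"
  unfolding mult_def' same_module_lin1[OF same] same_module_lin2[OF same]
  by (rule tensor_pair.lift_bilin_lin[OF tp tensor_pair.module_tensor[OF tp] b3[OF t]])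
next
 fix s assume s: "s <: TA"
 show "module_lin K TA TA (%t. s \<otimes>\<^bsub>TA\<^esub> t)"
  unfolding mult_def' same_module_lin1[OF same] same_module_lin2[OF same]
  by (rule tensor_pair.lift_fun_lin[OF tp tensor_pair.module_tensor[OF tp]
    tensor_pair.lift_bilin_lin[OF tp tensor_pair.module_tensor[OF tp] b1]])
   (use s in "simp_all add: same_moduleD[OF same]")
qed

lemma mult_closed: "s <: TA ==> t <: TA ==> s \<otimes>\<^bsub>TA\<^esub> t <: TA"
 using bilin_closed[OF mult_bilin] .

lemmas alg_closed = bilin_closed[OF kalgD(2)[OF alg_M]] bilin_closed[OF kalgD(2)[OF alg_N]]
 monoid.one_closed[OF kalgD(3)[OF alg_M]] monoid.one_closed[OF kalgD(3)[OF alg_N]]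

lemma one_TA: "\<one>\<^bsub>TA\<^esub> = e \<one>\<^bsub>M\<^esub> \<one>\<^bsub>N\<^esub>"
 by (simp add: tensor_algebra_def Let_def)

text \<open>Both sides are linear in each factor, so pure tensors decide. The factors are released
  one at a time: u first, then t, then s.\<close>

lemma mult_assoc:
 assumes s: "s <: TA" and t: "t <: TA" and u: "u <: TA"
 shows "(s \<otimes>\<^bsub>TA\<^esub> t) \<otimes>\<^bsub>TA\<^esub> u = s \<otimes>\<^bsub>TA\<^esub> (t \<otimes>\<^bsub>TA\<^esub> u)"
proof -
 note L = bilin_comp1[OF mult_bilin] bilin_comp2[OF mult_bilin] module_lin_id
 note [intro] = mult_closed e_closed alg_closed
 have 1: "(e a b \<otimes>\<^bsub>TA\<^esub> e c d) \<otimes>\<^bsub>TA\<^esub> u = e a b \<otimes>\<^bsub>TA\<^esub> (e c d \<otimes>\<^bsub>TA\<^esub> u)"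
  if "a <: M" "b <: N" "c <: M" "d <: N" for a b c d
  by (rule ext[OF _ _ module_TA _ u])
   (use that in \<open>auto intro!: L simp: mult_elem alg_closed
    monoid.m_assoc[OF kalgD(3)[OF alg_M]] monoid.m_assoc[OF kalgD(3)[OF alg_N]]\<close>)
 have 2: "(e a b \<otimes>\<^bsub>TA\<^esub> t) \<otimes>\<^bsub>TA\<^esub> u = e a b \<otimes>\<^bsub>TA\<^esub> (t \<otimes>\<^bsub>TA\<^esub> u)"
  if "a <: M" "b <: N" for a b
  by (rule ext[OF _ _ module_TA _ t]) (use that 1 u in "auto intro!: L")
 show ?thesis
  by (rule ext[OF _ _ module_TA _ s]) (use t u 2 in "auto intro!: L")
qed

lemma kalg_TA: "kalg K TA"
proof -
 note L = bilin_comp1[OF mult_bilin] bilin_comp2[OF mult_bilin] module_lin_id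
 note [intro] = mult_closed e_closed alg_closed
 have 1: "\<one>\<^bsub>TA\<^esub> <: TA" unfolding one_TA by (intro e_closed alg_closed)
 have "\<one>\<^bsub>TA\<^esub> \<otimes>\<^bsub>TA\<^esub> s = s" if "s <: TA" for s
  by (rule ext[OF _ _ module_TA _ that])
   (use 1 in "auto intro!: L simp: one_TA mult_elem alg_closed monoid.l_one[OF kalgD(3)[OF alg_M]] monoid.l_one[OF kalgD(3)[OF alg_N]]")
 moreover have "s \<otimes>\<^bsub>TA\<^esub> \<one>\<^bsub>TA\<^esub> = s" if "s <: TA" for s
  by (rule ext[OF _ _ module_TA _ that])
   (use 1 in "auto intro!: L simp: one_TA mult_elem alg_closed monoid.r_one[OF kalgD(3)[OF alg_M]] monoid.r_one[OF kalgD(3)[OF alg_N]]")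
 ultimately have "monoid TA"
  using 1 by (intro monoidI mult_closed mult_assoc) auto
 then show ?thesis by (simp add: kalg_def module_TA mult_bilin)
qed

text \<open>The universal property of a tensor product of algebras. Commuting images allow f(c) and
  g(b) to be exchanged in f(a) f(c) g(b) g(d), which is multiplicativity on pure tensors. Iterating
  it produces the leg calculus.\<close>

lemma lift_alghom:
 assumes B: "kalg K B" and f: "alghom K M B f" and g: "alghom K N B g"
  and comm: "!!m n. m <: M ==> n <: N ==> f m \<otimes>\<^bsub>B\<^esub> g n = g n \<otimes>\<^bsub>B\<^esub> f m"
 shows "alghom K TA B (tensor_lift K M N B (%m n. f m \<otimes>\<^bsub>B\<^esub> g n))"
  and "m <: M ==> n <: N ==> tensor_lift K M N B (%m n. f m \<otimes>\<^bsub>B\<^esub> g n) (e m n) = f m \<otimes>\<^bsub>B\<^esub> g n"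
proof -
 interpret B: monoid B using kalgD(3)[OF B] .
 have b: "bilin K M N B (%m n. f m \<otimes>\<^bsub>B\<^esub> g n)"
  by (intro bilinI bilin_comp1[OF kalgD(2)[OF B]] bilin_comp2[OF kalgD(2)[OF B]] alghomD(1)[OF f] alghomD(1)[OF g]
    alghomD(4)[OF f] alghomD(4)[OF g])
 let ?F = "tensor_lift K M N B (%m n. f m \<otimes>\<^bsub>B\<^esub> g n)"
 have lin: "module_lin K TA B ?F" by (rule lift_lin[OF kalgD(1)[OF B] b])
 have el: "?F (e m n) = f m \<otimes>\<^bsub>B\<^esub> g n" if "m <: M" "n <: N" for m n
  by (rule tensor_pair.lift_elem[OF tp kalgD(1)[OF B] b that])
 have 1: "?F (e a b \<otimes>\<^bsub>TA\<^esub> e c d) = ?F (e a b) \<otimes>\<^bsub>B\<^esub> ?F (e c d)"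
  if abcd: "a <: M" "b <: N" "c <: M" "d <: N" for a b c d
 proof -
  have cl: "f a <: B" "g b <: B" "f c <: B" "g d <: B"
   using abcd alghomD(4)[OF f] alghomD(4)[OF g] by auto
  have "?F (e a b \<otimes>\<^bsub>TA\<^esub> e c d) = (f a \<otimes>\<^bsub>B\<^esub> f c) \<otimes>\<^bsub>B\<^esub> (g b \<otimes>\<^bsub>B\<^esub> g d)"
   using abcd by (simp add: mult_elem el alg_closed alghomD(3)[OF f] alghomD(3)[OF g])
  also have "... = f a \<otimes>\<^bsub>B\<^esub> ((f c \<otimes>\<^bsub>B\<^esub> g b) \<otimes>\<^bsub>B\<^esub> g d)" using cl by (simp add: B.m_assoc)
  also have "... = f a \<otimes>\<^bsub>B\<^esub> ((g b \<otimes>\<^bsub>B\<^esub> f c) \<otimes>\<^bsub>B\<^esub> g d)" using comm abcd by simp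
  also have "... = ?F (e a b) \<otimes>\<^bsub>B\<^esub> ?F (e c d)" using cl abcd by (simp add: B.m_assoc el)
  finally show ?thesis .
 qed
 have 2: "?F (e a b \<otimes>\<^bsub>TA\<^esub> t) = ?F (e a b) \<otimes>\<^bsub>B\<^esub> ?F t"
  if "a <: M" "b <: N" and t: "t <: TA" for a b t
 proof -
  have "?F (e a b) <: B" using module_lin_closed[OF lin] e_closed that by blast
  then show ?thesis
   by (intro ext[OF module_lin_comp[OF lin bilin_comp2[OF mult_bilin _ module_lin_id]]
      bilin_comp2[OF kalgD(2)[OF B] _ lin] kalgD(1)[OF B] _ t] e_closed 1 that)
 qed
 have 3: "?F (s \<otimes>\<^bsub>TA\<^esub> t) = ?F s \<otimes>\<^bsub>B\<^esub> ?F t" if s: "s <: TA" and t: "t <: TA" for s t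
 proof -
  have "?F t <: B" using module_lin_closed[OF lin] t by blast
  then show ?thesis
   by (intro ext[OF module_lin_comp[OF lin bilin_comp1[OF mult_bilin module_lin_id]]
      bilin_comp1[OF kalgD(2)[OF B] lin] kalgD(1)[OF B] _ s] 2 t)
 qed
 have "?F \<one>\<^bsub>TA\<^esub> = \<one>\<^bsub>B\<^esub>"
  unfolding one_TA using el[of "\<one>\<^bsub>M\<^esub>" "\<one>\<^bsub>N\<^esub>"] alg_closed(3,4) alghomD(2)[OF f] alghomD(2)[OF g] by simp
 then show "alghom K TA B ?F" using lin 3 by (simp add: alghom_def)
 show "m <: M ==> n <: N ==> ?F (e m n) = f m \<otimes>\<^bsub>B\<^esub> g n" by (rule el)
qed

end

lemma alghom_Units:
 assumes f: "alghom K A B f" and A: "kalg K A" and x: "x \<in> Units A"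
 shows "f x \<otimes>\<^bsub>B\<^esub> f (inv\<^bsub>A\<^esub> x) = \<one>\<^bsub>B\<^esub>" "f (inv\<^bsub>A\<^esub> x) \<otimes>\<^bsub>B\<^esub> f x = \<one>\<^bsub>B\<^esub>"
proof -
 interpret A: monoid A using kalgD(3)[OF A] .
 show "f x \<otimes>\<^bsub>B\<^esub> f (inv\<^bsub>A\<^esub> x) = \<one>\<^bsub>B\<^esub>" "f (inv\<^bsub>A\<^esub> x) \<otimes>\<^bsub>B\<^esub> f x = \<one>\<^bsub>B\<^esub>"
  using x alghomD(2,3)[OF f] by (metis A.Units_closed A.Units_inv_closed A.Units_r_inv A.Units_l_inv)+
qed

lemma alghom_comp: "alghom K B C g ==> alghom K A B f ==> alghom K A C (%x. g (f x))"
 by (auto simp: alghom_def module_lin_comp module_lin_closed)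

section \<open>Sweedler sums in a triangular quasi-Hopf algebra\<close>

definition sum4 :: "('k, 'h) qhopf => ('k, 'p, 'z) module_scheme
  => ('k, ('k, ('k, 'h, 'h) tensor, 'h) tensor, 'h) tensor => ('h => 'h => 'h => 'h => 'p) => 'p" where
 "sum4 Q P t b =
   tensor_lift (qbase Q) (H3 Q) (qalg Q) P (%s w. sum3 Q P s (%x y z. b x y z w)) t"

locale qhopf =
 fixes Q :: "('k, 'h) qhopf"
 assumes triangular: "triangular_quasi_hopf Q"
begin

abbreviation "K \<equiv> qbase Q"
abbreviation "H \<equiv> qalg Q"
abbreviation "HH2 \<equiv> H2 Q"
abbreviation "HH3 \<equiv> H3 Q"
abbreviation "HH4 \<equiv> H4 Q"
abbreviation mult_H (infixl "**" 70) where "x ** y \<equiv> x \<otimes>\<^bsub>H\<^esub> y"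
abbreviation mult_HH2 (infixl "*\<^sub>2" 70) where "x *\<^sub>2 y \<equiv> x \<otimes>\<^bsub>HH2\<^esub> y"
abbreviation mult_HH3 (infixl "*\<^sub>3" 70) where "x *\<^sub>3 y \<equiv> x \<otimes>\<^bsub>HH3\<^esub> y"
abbreviation mult_HH4 (infixl "*\<^sub>4" 70) where "x *\<^sub>4 y \<equiv> x \<otimes>\<^bsub>HH4\<^esub> y"
abbreviation "D \<equiv> qcop Q"
abbreviation "ep \<equiv> qeps Q"
abbreviation "phi \<equiv> qphi Q"
abbreviation "psi \<equiv> qphi_inv Q"
abbreviation "S \<equiv> qanti Q"
abbreviation "al \<equiv> qalpha Q"
abbreviation "be \<equiv> qbeta Q"
abbreviation "R \<equiv> qR Q"

lemma ax_bialgebra: "quasi_bialgebra Q" and ax_antipode: "quasi_antipode Q" and ax_qtri: "quasitriangular Q"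
 and ax_tri: "R = inv\<^bsub>HH2\<^esub> (flip2 Q R)"
 using triangular by (auto simp: triangular_quasi_hopf_def quasitriangular_quasi_hopf_def)

lemma modH: "module K H" and ringH: "ring H"
 using ax_bialgebra by (auto simp: quasi_bialgebra_def Let_def)

lemma kalgH: "kalg K H"
 using ax_bialgebra by (intro kalgI_ring) (auto simp: quasi_bialgebra_def Let_def)

lemma cringK: "cring K" using modH by (rule module_cring)

lemma ta2: "tensor_alg K H H" by (intro tensor_alg.intro kalgH)
lemma kalgH2: "kalg K HH2" unfolding H2_def by (rule tensor_alg.kalg_TA[OF ta2])
lemma ta3: "tensor_alg K HH2 H" by (intro tensor_alg.intro kalgH kalgH2)
lemma kalgH3: "kalg K HH3" unfolding H3_def by (rule tensor_alg.kalg_TA[OF ta3])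
lemma ta4: "tensor_alg K HH3 H" by (intro tensor_alg.intro kalgH kalgH3)
lemma kalgH4: "kalg K HH4" unfolding H4_def by (rule tensor_alg.kalg_TA[OF ta4])

lemmas modH2 = kalgD(1)[OF kalgH2]
lemmas modH3 = kalgD(1)[OF kalgH3]
lemmas modH4 = kalgD(1)[OF kalgH4]

lemma Hmult_closed [simp]: "x <: H ==> y <: H ==> x ** y <: H"
 using bilin_closed[OF kalgD(2)[OF kalgH]] .
lemma H2mult_closed [simp]: "x <: HH2 ==> y <: HH2 ==> x *\<^sub>2 y <: HH2"
 using bilin_closed[OF kalgD(2)[OF kalgH2]] .
lemma H3mult_closed [simp]: "x <: HH3 ==> y <: HH3 ==> x *\<^sub>3 y <: HH3"
 using bilin_closed[OF kalgD(2)[OF kalgH3]] .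
lemma H4mult_closed [simp]: "x <: HH4 ==> y <: HH4 ==> x *\<^sub>4 y <: HH4"
 using bilin_closed[OF kalgD(2)[OF kalgH4]] .

lemma Hone_closed [simp]: "\<one>\<^bsub>H\<^esub> <: H" "\<one>\<^bsub>HH2\<^esub> <: HH2" "\<one>\<^bsub>HH3\<^esub> <: HH3" "\<one>\<^bsub>HH4\<^esub> <: HH4"
 using kalgD(3)[OF kalgH] kalgD(3)[OF kalgH2] kalgD(3)[OF kalgH3] kalgD(3)[OF kalgH4]
 by (auto intro: monoid.one_closed)

lemma e2_closed [simp]: "x <: H ==> y <: H ==> e2 Q x y <: HH2"
 unfolding e2_def H2_def by (rule tensor_alg.e_closed[OF ta2])
lemma e3_closed [simp]: "x <: H ==> y <: H ==> z <: H ==> e3 Q x y z <: HH3"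
 unfolding e3_def H3_def by (rule tensor_alg.e_closed[OF ta3]) simp_all
lemma e4_closed [simp]: "x <: H ==> y <: H ==> z <: H ==> u <: H ==>
  e4 Q x y z u <: HH4"
 unfolding e4_def H4_def by (rule tensor_alg.e_closed[OF ta4]) simp_all

lemma e2_bilin: "bilin K H H HH2 (e2 Q)"
 using tensor_alg.e_bilin[OF ta2] by (simp add: e2_def[abs_def] H2_def)
lemma e32_bilin: "bilin K HH2 H HH3 (tensor_elem K HH2 H)"
 using tensor_alg.e_bilin[OF ta3] by (simp add: H3_def)
lemma e43_bilin: "bilin K HH3 H HH4 (tensor_elem K HH3 H)"
 using tensor_alg.e_bilin[OF ta4] by (simp add: H4_def)

lemma e2_mult: "x <: H ==> y <: H ==> x' <: H ==> y' <: H ==>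
  e2 Q x y *\<^sub>2 e2 Q x' y' = e2 Q (x ** x') (y ** y')"
 using tensor_alg.mult_elem[OF ta2] by (simp add: H2_def e2_def)
lemma e3_mult: "x <: H ==> y <: H ==> z <: H ==>
  x' <: H ==> y' <: H ==> z' <: H ==>
  e3 Q x y z *\<^sub>3 e3 Q x' y' z' = e3 Q (x ** x') (y ** y') (z ** z')"
 using tensor_alg.mult_elem[OF ta3] by (simp add: H3_def e3_def e2_mult)
lemma e4_mult: "x <: H ==> y <: H ==> z <: H ==> u <: H ==>
  x' <: H ==> y' <: H ==> z' <: H ==> u' <: H ==>
  e4 Q x y z u *\<^sub>4 e4 Q x' y' z' u' =
  e4 Q (x ** x') (y ** y') (z ** z') (u ** u')"
 using tensor_alg.mult_elem[OF ta4] by (simp add: H4_def e4_def e3_mult)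

lemma one_H2: "\<one>\<^bsub>HH2\<^esub> = e2 Q \<one>\<^bsub>H\<^esub> \<one>\<^bsub>H\<^esub>"
 unfolding H2_def e2_def by (rule tensor_alg.one_TA[OF ta2])
lemma one_H3: "\<one>\<^bsub>HH3\<^esub> = e3 Q \<one>\<^bsub>H\<^esub> \<one>\<^bsub>H\<^esub> \<one>\<^bsub>H\<^esub>"
 unfolding H3_def e3_def one_H2[symmetric] by (rule tensor_alg.one_TA[OF ta3])
lemma one_H4: "\<one>\<^bsub>HH4\<^esub> = e4 Q \<one>\<^bsub>H\<^esub> \<one>\<^bsub>H\<^esub> \<one>\<^bsub>H\<^esub> \<one>\<^bsub>H\<^esub>"
 unfolding H4_def e4_def one_H3[symmetric] by (rule tensor_alg.one_TA[OF ta4])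

lemma D_alghom: "alghom K H HH2 D"
 using ax_bialgebra
 by (auto simp: quasi_bialgebra_def Let_def alghom_def ring_hom_def module_lin_def Pi_def)

lemma D_closed [simp]: "h <: H ==> D h <: HH2"
 using alghomD(4)[OF D_alghom] .

lemma ep_hom: "ep \<in> ring_hom H K"
 using ax_bialgebra by (simp add: quasi_bialgebra_def Let_def)

lemma ep_simps [simp]:
 "h <: H ==> ep h <: K"
 "h <: H ==> h' <: H ==> ep (h ** h') = ep h \<otimes>\<^bsub>K\<^esub> ep h'"
 "h <: H ==> h' <: H ==> ep (h \<oplus>\<^bsub>H\<^esub> h') = ep h \<oplus>\<^bsub>K\<^esub> ep h'"
 "ep \<one>\<^bsub>H\<^esub> = \<one>\<^bsub>K\<^esub>"
 "r <: K ==> h <: H ==> ep (r \<odot>\<^bsub>H\<^esub> h) = r \<otimes>\<^bsub>K\<^esub> ep h"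
 using ep_hom ax_bialgebra by (auto simp: ring_hom_def quasi_bialgebra_def Let_def)

lemma S_lin: "module_lin K H H S"
 and S_mult: "x <: H ==> y <: H ==> S (x ** y) = S y ** S x"
 and S_one [simp]: "S \<one>\<^bsub>H\<^esub> = \<one>\<^bsub>H\<^esub>"
 and al_closed [simp]: "al <: H" and be_closed [simp]: "be <: H"
 using ax_antipode by (auto simp: quasi_antipode_def Let_def)

lemma S_closed [simp]: "x <: H ==> S x <: H"
 using module_lin_closed[OF S_lin] .

lemma phi_Units: "phi \<in> Units HH3"
 using ax_bialgebra by (simp add: quasi_bialgebra_def Let_def)

lemma R_Units: "R \<in> Units HH2"
 using ax_qtri by (simp add: quasitriangular_def Let_def)

lemma phi_closed [simp]: "phi <: HH3" and psi_closed [simp]: "psi <: HH3"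
 and phi_psi: "phi *\<^sub>3 psi = \<one>\<^bsub>HH3\<^esub>" and psi_phi: "psi *\<^sub>3 phi = \<one>\<^bsub>HH3\<^esub>"
 and R_closed [simp]: "R <: HH2"
 using phi_Units R_Units kalgD(3)[OF kalgH3] kalgD(3)[OF kalgH2]
 by (auto simp: qphi_inv_def monoid.Units_closed monoid.Units_inv_closed monoid.Units_r_inv monoid.Units_l_inv)

section \<open>Multilinear test functions and the exchange of Sweedler sums\<close>

definition trilin :: "('k, 'p, 'z) module_scheme => ('h => 'h => 'h => 'p) => bool" where
 "trilin P b \<longleftrightarrow>
  (\<forall>y\<in>carrier H. \<forall>z\<in>carrier H. module_lin K H P (%x. b x y z)) \<and>
  (\<forall>x\<in>carrier H. \<forall>z\<in>carrier H. module_lin K H P (%y. b x y z)) \<and>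
  (\<forall>x\<in>carrier H. \<forall>y\<in>carrier H. module_lin K H P (%z. b x y z))"

definition quadlin :: "('k, 'p, 'z) module_scheme => ('h => 'h => 'h => 'h => 'p) => bool" where
 "quadlin P b \<longleftrightarrow>
  (\<forall>y\<in>carrier H. \<forall>z\<in>carrier H. \<forall>u\<in>carrier H. module_lin K H P (%x. b x y z u)) \<and>
  (\<forall>x\<in>carrier H. \<forall>z\<in>carrier H. \<forall>u\<in>carrier H. module_lin K H P (%y. b x y z u)) \<and>
  (\<forall>x\<in>carrier H. \<forall>y\<in>carrier H. \<forall>u\<in>carrier H. module_lin K H P (%z. b x y z u)) \<and>
  (\<forall>x\<in>carrier H. \<forall>y\<in>carrier H. \<forall>z\<in>carrier H. module_lin K H P (%u. b x y z u))"

lemma trilinI: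
 assumes "!!y z. y <: H ==> z <: H ==> module_lin K H P (%x. b x y z)"
  "!!x z. x <: H ==> z <: H ==> module_lin K H P (%y. b x y z)"
  "!!x y. x <: H ==> y <: H ==> module_lin K H P (%z. b x y z)"
 shows "trilin P b"
 using assms by (simp add: trilin_def)

lemma quadlinI:
 assumes "!!y z u. y <: H ==> z <: H ==> u <: H ==> module_lin K H P (%x. b x y z u)"
  "!!x z u. x <: H ==> z <: H ==> u <: H ==> module_lin K H P (%y. b x y z u)"
  "!!x y u. x <: H ==> y <: H ==> u <: H ==> module_lin K H P (%z. b x y z u)"
  "!!x y z. x <: H ==> y <: H ==> z <: H ==> module_lin K H P (%u. b x y z u)"
 shows "quadlin P b"
 using assms by (simp add: quadlin_def)

lemmas tp2 = tensor_alg.tp[OF ta2]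
lemmas tp3 = tensor_alg.tp[OF ta3]
lemmas tp4 = tensor_alg.tp[OF ta4]

lemma carrier_H2: "carrier (tensor_module K H H) = carrier HH2"
 and carrier_H3: "carrier (tensor_module K HH2 H) = carrier HH3"
 and carrier_H4: "carrier (tensor_module K HH3 H) = carrier HH4"
 by (simp_all add: H2_def H3_def H4_def same_moduleD[OF same_module_tensor_algebra])

lemma sum2_closed:
 "module K P ==> (!!x y. x <: H ==> y <: H ==> b x y <: P) ==> t <: HH2 ==>
  sum2 Q P t b <: P"
 unfolding sum2_def by (rule tensor_pair.lift_closed[OF tp2]) (simp_all add: carrier_H2)

lemma sum3_closed:
 "module K P ==> (!!x y z. x <: H ==> y <: H ==> z <: H ==> b x y z <: P) ==>
  t <: HH3 ==> sum3 Q P t b <: P"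
 unfolding sum3_def by (rule tensor_pair.lift_closed[OF tp3]) (simp_all add: carrier_H3 sum2_closed)

lemma sum4_closed:
 "module K P ==> (!!x y z u. x <: H ==> y <: H ==> z <: H ==> u <: H ==>
   b x y z u <: P) ==> t <: HH4 ==> sum4 Q P t b <: P"
 unfolding sum4_def by (rule tensor_pair.lift_closed[OF tp4]) (simp_all add: carrier_H4 sum3_closed)

lemma sum2_cong:
 assumes "module K P" "t <: HH2"
  "!!x y. x <: H ==> y <: H ==> b x y = b' x y"
  "!!x y. x <: H ==> y <: H ==> b' x y <: P"
 shows "sum2 Q P t b = sum2 Q P t b'"
 unfolding sum2_def by (rule tensor_pair.lift_cong[OF tp2]) (use assms in "simp_all add: carrier_H2")

lemma sum3_cong:
 assumes "module K P" "t <: HH3"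
  "!!x y z. x <: H ==> y <: H ==> z <: H ==> b x y z = b' x y z"
  "!!x y z. x <: H ==> y <: H ==> z <: H ==> b' x y z <: P"
 shows "sum3 Q P t b = sum3 Q P t b'"
 unfolding sum3_def
 by (rule tensor_pair.lift_cong[OF tp3])
  (use assms in "simp_all add: carrier_H3 sum2_closed cong: sum2_cong")

lemma sum4_cong:
 assumes "module K P" "t <: HH4"
  "!!x y z u. x <: H ==> y <: H ==> z <: H ==> u <: H ==> b x y z u = b' x y z u"
  "!!x y z u. x <: H ==> y <: H ==> z <: H ==> u <: H ==> b' x y z u <: P"
 shows "sum4 Q P t b = sum4 Q P t b'"
 unfolding sum4_def
 by (rule tensor_pair.lift_cong[OF tp4])
  (use assms in "simp_all add: carrier_H4 sum3_closed cong: sum3_cong")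

lemma sum2_comp:
 assumes "module K P" "module K P'" "module_lin K P P' g" "t <: HH2"
  "!!x y. x <: H ==> y <: H ==> b x y <: P"
 shows "g (sum2 Q P t b) = sum2 Q P' t (%x y. g (b x y))"
 unfolding sum2_def by (rule tensor_pair.lift_comp[OF tp2]) (use assms in "simp_all add: carrier_H2")

lemma sum3_comp:
 assumes "module K P" "module K P'" "module_lin K P P' g" "t <: HH3"
  "!!x y z. x <: H ==> y <: H ==> z <: H ==> b x y z <: P"
 shows "g (sum3 Q P t b) = sum3 Q P' t (%x y z. g (b x y z))"
proof -
 have "g (sum3 Q P t b) = tensor_lift K HH2 H P' (%s z. g (sum2 Q P s (%x y. b x y z))) t"
  unfolding sum3_def
  by (rule tensor_pair.lift_comp[OF tp3 assms(1-3)]) (use assms in "simp_all add: carrier_H3 sum2_closed")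
 also have "... = sum3 Q P' t (%x y z. g (b x y z))"
  unfolding sum3_def
  by (rule tensor_pair.lift_cong[OF tp3 assms(2)])
   (use assms in "simp_all add: carrier_H3 sum2_closed sum2_comp[OF assms(1-3)] module_lin_closed")
 finally show ?thesis .
qed

lemma sum2_fun_lin:
 assumes "module K P" "t <: HH2"
  "!!x y. x <: H ==> y <: H ==> module_lin K L P (%u. b u x y)"
 shows "module_lin K L P (%u. sum2 Q P t (b u))"
 unfolding sum2_def by (rule tensor_pair.lift_fun_lin[OF tp2]) (use assms in "simp_all add: carrier_H2")

lemma sum3_fun_lin:
 assumes "module K P" "t <: HH3"
  "!!x y z. x <: H ==> y <: H ==> z <: H ==> module_lin K L P (%u. b u x y z)"
 shows "module_lin K L P (%u. sum3 Q P t (b u))"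
 unfolding sum3_def by (rule tensor_pair.lift_fun_lin[OF tp3 assms(1)])
  (use assms in "simp_all add: carrier_H3 sum2_fun_lin")

lemma sum4_fun_lin:
 assumes "module K P" "t <: HH4"
  "!!x y z w. x <: H ==> y <: H ==> z <: H ==> w <: H ==>
   module_lin K L P (%u. b u x y z w)"
 shows "module_lin K L P (%u. sum4 Q P t (b u))"
 unfolding sum4_def by (rule tensor_pair.lift_fun_lin[OF tp4 assms(1)])
  (use assms in "simp_all add: carrier_H4 sum3_fun_lin")

lemma sum2_lin:
 assumes "module K P" "bilin K H H P b"
 shows "module_lin K HH2 P (%t. sum2 Q P t b)"
 unfolding sum2_def H2_def by (rule tensor_alg.lift_lin[OF ta2 assms])

lemma sum2_e2:
 assumes "module K P" "bilin K H H P b" "x <: H" "y <: H"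
 shows "sum2 Q P (e2 Q x y) b = b x y"
 unfolding sum2_def e2_def by (rule tensor_pair.lift_elem[OF tp2 assms])

lemma sum3_bilin:
 assumes "module K P" "trilin P b"
 shows "bilin K HH2 H P (%s z. sum2 Q P s (%x y. b x y z))"
 by (intro bilinI sum2_lin sum2_fun_lin assms) (use assms(2) in "auto simp: trilin_def")

lemma sum3_lin:
 assumes "module K P" "trilin P b"
 shows "module_lin K HH3 P (%t. sum3 Q P t b)"
 unfolding sum3_def H3_def
 using tensor_alg.lift_lin[OF ta3 assms(1) sum3_bilin[OF assms]] .

lemma sum3_e3:
 assumes "module K P" "trilin P b" "x <: H" "y <: H" "z <: H"
 shows "sum3 Q P (e3 Q x y z) b = b x y z"
proof -
 have "sum3 Q P (e3 Q x y z) b = sum2 Q P (e2 Q x y) (%x y. b x y z)"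
  unfolding sum3_def e3_def by (rule tensor_pair.lift_elem[OF tp3 assms(1) sum3_bilin]) (use assms in simp_all)
 also have "... = b x y z"
  by (rule sum2_e2) (use assms in "auto simp: trilin_def intro!: bilinI")
 finally show ?thesis .
qed

lemma sum4_bilin:
 assumes "module K P" "quadlin P b"
 shows "bilin K HH3 H P (%s u. sum3 Q P s (%x y z. b x y z u))"
 by (intro bilinI sum3_lin sum3_fun_lin trilinI assms) (use assms(2) in "auto simp: quadlin_def")

lemma sum4_lin:
 assumes "module K P" "quadlin P b"
 shows "module_lin K HH4 P (%t. sum4 Q P t b)"
 unfolding sum4_def H4_def
 using tensor_alg.lift_lin[OF ta4 assms(1) sum4_bilin[OF assms]] .

lemma sum4_e4:
 assumes "module K P" "quadlin P b" "x <: H" "y <: H" "z <: H" "u <: H"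
 shows "sum4 Q P (e4 Q x y z u) b = b x y z u"
proof -
 have "sum4 Q P (e4 Q x y z u) b = sum3 Q P (e3 Q x y z) (%x y z. b x y z u)"
  unfolding sum4_def e4_def by (rule tensor_pair.lift_elem[OF tp4 assms(1) sum4_bilin]) (use assms in simp_all)
 also have "... = b x y z u"
  by (rule sum3_e3) (use assms in "auto simp: quadlin_def intro!: trilinI")
 finally show ?thesis .
qed

lemma H2_ext:
 assumes "module K P" "module_lin K HH2 P f" "module_lin K HH2 P g"
  "!!x y. x <: H ==> y <: H ==> f (e2 Q x y) = g (e2 Q x y)" "t <: HH2"
 shows "f t = g t"
 using tensor_alg.ext[OF ta2, of P f g t] assms by (simp add: H2_def e2_def)

text \<open>Threefold tensors are bracketed to the left, so agreement spreads from pure tensors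
  first through the inner factor in \<open>HH2\<close> and then through the outer one.\<close>

lemma H3_ext:
 assumes "module K P" "module_lin K HH3 P f" "module_lin K HH3 P g"
  "!!x y z. x <: H ==> y <: H ==> z <: H ==> f (e3 Q x y z) = g (e3 Q x y z)"
  "t <: HH3"
 shows "f t = g t"
proof (rule tensor_alg.ext[OF ta3, of P f g t])
 fix s z assume s: "s <: HH2" and z: "z <: H"
 have l: "module_lin K HH2 HH3 (%s. tensor_elem K HH2 H s z)" by (rule bilin_lin1[OF e32_bilin z])
 show "f (tensor_elem K HH2 H s z) = g (tensor_elem K HH2 H s z)"
  by (rule H2_ext[OF assms(1) module_lin_comp[OF assms(2) l] module_lin_comp[OF assms(3) l] _ s])
   (use assms(4) z in "simp add: e3_def")
qed (use assms in "simp_all add: H3_def")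

lemma H4_ext:
 assumes "module K P" "module_lin K HH4 P f" "module_lin K HH4 P g"
  "!!x y z u. x <: H ==> y <: H ==> z <: H ==> u <: H ==>
   f (e4 Q x y z u) = g (e4 Q x y z u)"
  "t <: HH4"
 shows "f t = g t"
proof (rule tensor_alg.ext[OF ta4, of P f g t])
 fix s z assume s: "s <: HH3" and z: "z <: H"
 have l: "module_lin K HH3 HH4 (%s. tensor_elem K HH3 H s z)" by (rule bilin_lin1[OF e43_bilin z])
 show "f (tensor_elem K HH3 H s z) = g (tensor_elem K HH3 H s z)"
  by (rule H3_ext[OF assms(1) module_lin_comp[OF assms(2) l] module_lin_comp[OF assms(3) l] _ s])
   (use assms(4) z in "simp add: e4_def")
qed (use assms in "simp_all add: H4_def")

lemma sum2_swap:
 assumes "module K P" "s <: HH2" "t <: HH2"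
  "!!x y x' y'. x <: H ==> y <: H ==> x' <: H ==> y' <: H ==> b x y x' y' <: P"
 shows "sum2 Q P s (%x y. sum2 Q P t (b x y)) = sum2 Q P t (%x' y'. sum2 Q P s (%x y. b x y x' y'))"
 unfolding sum2_def by (rule tensor_lift_swap[OF tp2 tp2]) (use assms in "simp_all add: carrier_H2")

lemma sum23_swap:
 assumes "module K P" "s <: HH2" "t <: HH3"
  "!!x y x' y' z'. x <: H ==> y <: H ==> x' <: H ==> y' <: H ==> z' <: H ==>
   b x y x' y' z' <: P"
 shows "sum2 Q P s (%x y. sum3 Q P t (b x y)) = sum3 Q P t (%x' y' z'. sum2 Q P s (%x y. b x y x' y' z'))"
proof -
 have "sum2 Q P s (%x y. sum3 Q P t (b x y)) =
  tensor_lift K HH2 H P (%u z'. sum2 Q P s (%x y. sum2 Q P u (%x' y'. b x y x' y' z'))) t"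
  unfolding sum3_def sum2_def[of _ _ s]
  by (rule tensor_lift_swap[OF tp2 tp3]) (use assms in "simp_all add: carrier_H2 carrier_H3 sum2_closed")
 also have "... = sum3 Q P t (%x' y' z'. sum2 Q P s (%x y. b x y x' y' z'))"
  unfolding sum3_def
 proof (rule tensor_pair.lift_cong[OF tp3 assms(1)])
  fix u z' assume "u <: HH2" "z' <: H"
  then show "sum2 Q P s (%x y. sum2 Q P u (%x' y'. b x y x' y' z')) =
    sum2 Q P u (%x' y'. sum2 Q P s (%x y. b x y x' y' z'))"
   by (intro sum2_swap) (use assms in simp_all)
 qed (use assms in "simp_all add: carrier_H3 sum2_closed")
 finally show ?thesis .
qed

text \<open>A threefold sum is a lift over \<open>HH2\<close> and H of a twofold sum. The exchange
  is done level by level: the inner sum of s passes t, then the outer lifts are exchanged, then the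
  inner sum of t passes s.\<close>

lemma sum3_swap:
 assumes "module K P" "s <: HH3" "t <: HH3"
  "!!x y z x' y' z'. x <: H ==> y <: H ==> z <: H ==> x' <: H ==> y' <: H
   ==> z' <: H ==> b x y z x' y' z' <: P"
 shows "sum3 Q P s (%x y z. sum3 Q P t (b x y z)) = sum3 Q P t (%x' y' z'. sum3 Q P s (%x y z. b x y z x' y' z'))"
proof -
 have "sum3 Q P s (%x y z. sum3 Q P t (b x y z)) =
  tensor_lift K HH2 H P (%u z. sum3 Q P t (%x' y' z'. sum2 Q P u (%x y. b x y z x' y' z'))) s"
  unfolding sum3_def[of Q P s]
  by (rule tensor_pair.lift_cong[OF tp3 assms(1)])
   (use assms in "simp_all add: carrier_H3 sum2_closed sum3_closed sum23_swap")
 also have "... = tensor_lift K HH2 H P (%u' z'. tensor_lift K HH2 H P (%u z.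
    sum2 Q P u' (%x' y'. sum2 Q P u (%x y. b x y z x' y' z'))) s) t"
  unfolding sum3_def
  by (rule tensor_lift_swap[OF tp3 tp3]) (use assms in "simp_all add: carrier_H2 carrier_H3 sum2_closed")
 also have "... = sum3 Q P t (%x' y' z'. sum3 Q P s (%x y z. b x y z x' y' z'))"
  unfolding sum3_def[of Q P t]
 proof (rule tensor_pair.lift_cong[OF tp3 assms(1)])
  fix u' z' assume u': "u' <: HH2" and z': "z' <: H"
  have "tensor_lift K HH2 H P (%u z. sum2 Q P u' (%x' y'. sum2 Q P u (%x y. b x y z x' y' z'))) s =
   tensor_lift K HH2 H P (%u z. sum2 Q P u (%x y. sum2 Q P u' (%x' y'. b x y z x' y' z'))) s"
  proof (rule tensor_pair.lift_cong[OF tp3 assms(1)])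
   fix u z assume "u <: HH2" "z <: H"
   then show "sum2 Q P u' (%x' y'. sum2 Q P u (%x y. b x y z x' y' z')) =
     sum2 Q P u (%x y. sum2 Q P u' (%x' y'. b x y z x' y' z'))"
    by (intro sum2_swap) (use assms u' z' in simp_all)
  qed (use assms u' z' in "simp_all add: carrier_H3 sum2_closed")
  also have "... = sum3 Q P s (%x y z. sum2 Q P u' (%x' y'. b x y z x' y' z'))"
   unfolding sum3_def ..
  also have "... = sum2 Q P u' (%x' y'. sum3 Q P s (%x y z. b x y z x' y' z'))"
   by (rule sum23_swap[symmetric]) (use assms u' z' in simp_all)
  finally show "tensor_lift K HH2 H P (%u z. sum2 Q P u' (%x' y'. sum2 Q P u (%x y. b x y z x' y' z'))) s =
    sum2 Q P u' (%x' y'. sum3 Q P s (%x y z. b x y z x' y' z'))" .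
 qed (use assms in "simp_all add: carrier_H3 sum2_closed sum3_closed")
 finally show ?thesis .
qed

text \<open>In the rules for a product the constant factor is matched first; with the other order a
 constant left factor would be taken for a linear expression.\<close>

lemma lin_e3:
 "y <: H ==> z <: H ==> module_lin K L H f ==> module_lin K L HH3 (%u. e3 Q (f u) y z)"
 "x <: H ==> z <: H ==> module_lin K L H f ==> module_lin K L HH3 (%u. e3 Q x (f u) z)"
 "x <: H ==> y <: H ==> module_lin K L H f ==> module_lin K L HH3 (%u. e3 Q x y (f u))"
 unfolding e3_def
 by (intro bilin_comp1[OF e32_bilin] bilin_comp2[OF e32_bilin] bilin_comp1[OF e2_bilin] bilin_comp2[OF e2_bilin]; simp)+

lemma lin_e4:
 "y <: H ==> z <: H ==> w <: H ==> module_lin K L H f ==> module_lin K L HH4 (%u. e4 Q (f u) y z w)"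
 "x <: H ==> z <: H ==> w <: H ==> module_lin K L H f ==> module_lin K L HH4 (%u. e4 Q x (f u) z w)"
 "x <: H ==> y <: H ==> w <: H ==> module_lin K L H f ==> module_lin K L HH4 (%u. e4 Q x y (f u) w)"
 "x <: H ==> y <: H ==> z <: H ==> module_lin K L H f ==> module_lin K L HH4 (%u. e4 Q x y z (f u))"
 unfolding e4_def
 by (intro bilin_comp1[OF e43_bilin] bilin_comp2[OF e43_bilin] lin_e3; simp)+

lemma lin_ep: "module K N ==> n <: N ==> module_lin K L H f ==> module_lin K L N (%u. ep (f u) \<odot>\<^bsub>N\<^esub> n)"
 by (rule module_lin_scalar) (auto simp: module_lin_closed module_lin_add module_lin_smult)

lemma lin_sum2: "module K P ==> module_lin K L HH2 f ==> bilin K H H P b ==> module_lin K L P (%u. sum2 Q P (f u) b)"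
 using module_lin_comp[OF sum2_lin] .

lemma lin_sum3: "module K P ==> module_lin K L HH3 f ==> trilin P b ==> module_lin K L P (%u. sum3 Q P (f u) b)"
 using module_lin_comp[OF sum3_lin] .

lemma lin_sum4: "module K P ==> module_lin K L HH4 f ==> quadlin P b ==> module_lin K L P (%u. sum4 Q P (f u) b)"
 using module_lin_comp[OF sum4_lin] .

lemmas lins = module_lin_id bilinI trilinI quadlinI
 bilin_comp2[OF kalgD(2)[OF kalgH]] bilin_comp1[OF kalgD(2)[OF kalgH]]
 bilin_comp2[OF kalgD(2)[OF kalgH2]] bilin_comp1[OF kalgD(2)[OF kalgH2]]
 bilin_comp2[OF kalgD(2)[OF kalgH3]] bilin_comp1[OF kalgD(2)[OF kalgH3]]
 bilin_comp2[OF kalgD(2)[OF kalgH4]] bilin_comp1[OF kalgD(2)[OF kalgH4]]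
 bilin_comp2[OF e2_bilin] bilin_comp1[OF e2_bilin]
 lin_e3(3,2,1) lin_e4(4,3,2,1)
 module_lin_comp[OF S_lin] module_lin_comp[OF alghomD(1)[OF D_alghom]]
 lin_ep sum2_fun_lin sum3_fun_lin sum4_fun_lin lin_sum2 lin_sum3 lin_sum4 module_lin_smult_fun

lemmas cl = sum2_closed sum3_closed sum4_closed modH modH2 modH3 modH4 module_smult_closed[of K]

end

section \<open>Coherence in an algebra with commuting images of H\<close>

lemma module_lin_cong:
 assumes "module K A" "!!t. t <: A ==> f t = f' t"
 shows "module_lin K A B f = module_lin K A B f'"
 using assms(2) module_add_closed[OF assms(1)] module_smult_closed[OF assms(1)]
 by (auto simp: module_lin_def Pi_def)

lemma alghom_cong:
 assumes "kalg K A" "alghom K A B f'" "!!t. t <: A ==> f t = f' t"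
 shows "alghom K A B f"
proof -
 interpret A: monoid A by (rule kalgD(3)[OF assms(1)])
 show ?thesis
  using assms(2,3) module_lin_cong[where f = f and f' = f', OF kalgD(1)[OF assms(1)] assms(3)]
  by (auto simp: alghom_def)
qed

text \<open>The target B stays arbitrary so that the same results serve \<open>HH2\<close>, where
  flip and counit are studied, and \<open>HH4\<close>, where the four arguments of the Leibniz
  computation live.\<close>

locale qhopf_alg = qhopf Q for Q :: "('k, 'h) qhopf" +
 fixes B :: "('k, 'b, 'z) module_scheme"
 assumes kalgB: "kalg K B"
begin

abbreviation mB (infixl "\<cdot>" 70) where "x \<cdot> y \<equiv> x \<otimes>\<^bsub>B\<^esub> y"

definition commute :: "('h => 'b) => ('h => 'b) => bool" where
 "commute f g \<longleftrightarrow> (\<forall>x\<in>carrier H. \<forall>y\<in>carrier H. f x \<cdot> g y = g y \<cdot> f x)"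

text \<open>For commuting f and g this is the algebra map from H \<otimes> H to B with legs f and g;
  \<open>L2 f g R\<close> is the R-matrix placed in these two positions and moves f past g.\<close>

definition L2 :: "('h => 'b) => ('h => 'b) => ('k, 'h, 'h) tensor => 'b" where
 "L2 f g t = sum2 Q B t (%x y. f x \<cdot> g y)"

text \<open>\<open>L3 f g h phi\<close> stands for the rebracketing from (f g) h to f (g h), and
  \<open>L3 f g h psi\<close> for its inverse. A product of such factors is a route between
  bracketings, read from right to left.\<close>

definition L3 :: "('h => 'b) => ('h => 'b) => ('h => 'b) => ('k, ('k, 'h, 'h) tensor, 'h) tensor => 'b" where
 "L3 f g h t = sum3 Q B t (%x y z. f x \<cdot> g y \<cdot> h z)"

definition L4 :: "('h => 'b) => ('h => 'b) => ('h => 'b) => ('h => 'b) =>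
  ('k, ('k, ('k, 'h, 'h) tensor, 'h) tensor, 'h) tensor => 'b" where
 "L4 f g h k t = sum4 Q B t (%x y z w. f x \<cdot> g y \<cdot> h z \<cdot> k w)"

text \<open>The leg of a pair: H acts on the tensor product of the positions f and g through the
  coproduct.\<close>

definition L2D :: "('h => 'b) => ('h => 'b) => 'h => 'b" where
 "L2D f g h = L2 f g (D h)"

abbreviation "Hhom f \<equiv> alghom K H B f"

lemma modB: "module K B" and monB: "monoid B" and bilB: "bilin K B B B (mult B)"
 using kalgB by (auto simp: kalg_def)

interpretation B: monoid B by (rule monB)

lemma commuteD: "commute f g ==> x <: H ==> y <: H ==> f x \<cdot> g y = g y \<cdot> f x"
 by (simp add: commute_def)

lemma commute_sym: "commute f g ==> commute g f"
 by (simp add: commute_def)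

lemma hom_closed: "Hhom f ==> x <: H ==> f x <: B"
 by (rule alghomD(4))

lemma L2_alghom:
 assumes "Hhom f" "Hhom g" "commute f g"
 shows "alghom K HH2 B (L2 f g)"
 using tensor_alg.lift_alghom(1)[OF ta2 kalgB assms(1,2) commuteD[OF assms(3)]]
 by (simp add: L2_def[abs_def] H2_def sum2_def)

lemma L2_e2:
 assumes "Hhom f" "Hhom g" "commute f g" "x <: H" "y <: H"
 shows "L2 f g (e2 Q x y) = f x \<cdot> g y"
 using tensor_alg.lift_alghom(2)[OF ta2 kalgB assms(1,2) commuteD[OF assms(3)] assms(4,5)]
 by (simp add: L2_def[abs_def] e2_def sum2_def)

lemma L2_closed: "Hhom f ==> Hhom g ==> t <: HH2 ==> L2 f g t <: B"
 unfolding L2_def by (intro sum2_closed modB) (simp_all add: hom_closed)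

lemma L3_closed: "Hhom f ==> Hhom g ==> Hhom h ==> t <: HH3 ==> L3 f g h t <: B"
 unfolding L3_def by (intro sum3_closed modB) (simp_all add: hom_closed)

lemma L2_commute:
 assumes "Hhom f" "Hhom g" "commute f g" "c <: B"
  "!!x. x <: H ==> f x \<cdot> c = c \<cdot> f x" "!!x. x <: H ==> g x \<cdot> c = c \<cdot> g x" "t <: HH2"
 shows "L2 f g t \<cdot> c = c \<cdot> L2 f g t"
proof (rule H2_ext[where f = "%t. L2 f g t \<cdot> c" and g = "%t. c \<cdot> L2 f g t", OF modB _ _ _ assms(7)])
 show "module_lin K HH2 B (%t. L2 f g t \<cdot> c)"
  by (intro bilin_comp1[OF bilB] alghomD(1)[OF L2_alghom] assms)
 show "module_lin K HH2 B (%t. c \<cdot> L2 f g t)"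
  by (intro bilin_comp2[OF bilB] alghomD(1)[OF L2_alghom] assms)
 fix x y assume xy: "x <: H" "y <: H"
 have cl: "f x <: B" "g y <: B" using xy assms hom_closed by auto
 have "f x \<cdot> g y \<cdot> c = f x \<cdot> (c \<cdot> g y)" using cl assms xy by (simp add: B.m_assoc)
 also have "... = c \<cdot> (f x \<cdot> g y)" using cl assms(4,5) xy by (simp add: B.m_assoc[symmetric])
 finally show "L2 f g (e2 Q x y) \<cdot> c = c \<cdot> L2 f g (e2 Q x y)" using L2_e2 assms xy by simp
qed

lemma L2_commute': "Hhom f ==> Hhom g ==> Hhom h ==> commute f g ==> commute f h ==> commute g h ==>
  t <: HH2 ==> z <: H ==> L2 f g t \<cdot> h z = h z \<cdot> L2 f g t"
 by (rule L2_commute) (auto simp: hom_closed intro: commuteD)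

lemma L2D_hom: "Hhom f ==> Hhom g ==> commute f g ==> Hhom (L2D f g)"
 unfolding L2D_def[abs_def] by (rule alghom_comp[OF L2_alghom D_alghom])

lemma L2D_commute: "Hhom f ==> Hhom g ==> Hhom h ==> commute f g ==> commute f h ==> commute g h ==>
  commute (L2D f g) h"
 unfolding commute_def[of "L2D f g"] L2D_def by (auto intro!: L2_commute')

lemma L2D_commute2: "Hhom f ==> Hhom g ==> Hhom h ==> commute f g ==> commute f h ==> commute g h ==>
  commute h (L2D f g)"
 by (rule commute_sym[OF L2D_commute])

lemma L3_alghom:
 assumes "Hhom f" "Hhom g" "Hhom h" "commute f g" "commute f h" "commute g h"
 shows "alghom K HH3 B (L3 f g h)"
  and "x <: H ==> y <: H ==> z <: H ==> L3 f g h (e3 Q x y z) = f x \<cdot> g y \<cdot> h z"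
proof -
 have c: "!!m n. m <: HH2 ==> n <: H ==> L2 f g m \<cdot> h n = h n \<cdot> L2 f g m"
  using L2_commute' assms by blast
 note ll = tensor_alg.lift_alghom[OF ta3 kalgB L2_alghom[OF assms(1,2,4)] assms(3) c]
 \<comment> \<open>The definition multiplies three legs inside nested sums, while
   \<open>lift_alghom\<close> treats f and g together as one leg. Pulling \<open>h z\<close> out of
   the inner sum identifies the two.\<close>
 have eq: "L3 f g h t = tensor_lift K HH2 H B (%m n. L2 f g m \<cdot> h n) t" if "t <: HH3" for t
  unfolding L3_def sum3_def L2_def
 proof (rule tensor_pair.lift_cong[OF tp3 modB])
  fix s z assume s: "s <: HH2" and z: "z <: H"
  show "sum2 Q B s (%x y. f x \<cdot> g y \<cdot> h z) = sum2 Q B s (%x y. f x \<cdot> g y) \<cdot> h z"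
   by (rule sum2_comp[symmetric, where g = "%u. u \<cdot> h z", OF modB modB bilin_comp1[OF bilB module_lin_id] s])
    (use assms z in "auto simp: hom_closed")
  show "sum2 Q B s (%x y. f x \<cdot> g y) \<cdot> h z <: B"
   using s z assms by (intro B.m_closed sum2_closed modB) (auto simp: hom_closed)
 qed (use that in "simp add: carrier_H3")
 show "alghom K HH3 B (L3 f g h)"
  by (rule alghom_cong[OF kalgH3 _ eq]) (use ll(1) in "simp_all add: H3_def")
 assume xyz: "x <: H" "y <: H" "z <: H"
 show "L3 f g h (e3 Q x y z) = f x \<cdot> g y \<cdot> h z"
  using ll(2)[OF _ _ e2_closed[OF xyz(1,2)] xyz(3)] eq[OF e3_closed[OF xyz]] L2_e2[OF assms(1,2,4) xyz(1,2)]
  by (simp add: e3_def)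
qed

lemma L3_commute':
 assumes "Hhom f" "Hhom g" "Hhom h" "Hhom k" "commute f g" "commute f h" "commute g h" "commute f k" "commute g k" "commute h k"
  "t <: HH3" "w <: H"
 shows "L3 f g h t \<cdot> k w = k w \<cdot> L3 f g h t"
proof (rule H3_ext[where f = "%t. L3 f g h t \<cdot> k w" and g = "%t. k w \<cdot> L3 f g h t", OF modB _ _ _ assms(11)])
 have kw: "k w <: B" using assms hom_closed by auto
 note a = L3_alghom[OF assms(1-3,5-7)]
 show "module_lin K HH3 B (%t. L3 f g h t \<cdot> k w)"
  by (intro bilin_comp1[OF bilB] alghomD(1)[OF a(1)] kw)
 show "module_lin K HH3 B (%t. k w \<cdot> L3 f g h t)"
  by (intro bilin_comp2[OF bilB] alghomD(1)[OF a(1)] kw)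
 fix x y z assume xy: "x <: H" "y <: H" "z <: H"
 have cl: "f x <: B" "g y <: B" "h z <: B" using xy assms hom_closed by auto
 have "f x \<cdot> g y \<cdot> h z \<cdot> k w = f x \<cdot> g y \<cdot> (k w \<cdot> h z)"
  using cl kw commuteD[OF assms(10) xy(3) assms(12)] by (simp add: B.m_assoc)
 also have "... = f x \<cdot> (g y \<cdot> k w) \<cdot> h z" using cl kw by (simp add: B.m_assoc)
 also have "... = f x \<cdot> k w \<cdot> g y \<cdot> h z"
  unfolding commuteD[OF assms(9) xy(2) assms(12)] using cl kw by (simp add: B.m_assoc)
 also have "... = k w \<cdot> (f x \<cdot> g y \<cdot> h z)"
  unfolding commuteD[OF assms(8) xy(1) assms(12)] using cl kw by (simp add: B.m_assoc)
 finally show "L3 f g h (e3 Q x y z) \<cdot> k w = k w \<cdot> L3 f g h (e3 Q x y z)" using a(2)[OF xy] by simp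
qed

lemma L4_alghom:
 assumes "Hhom f" "Hhom g" "Hhom h" "Hhom k" "commute f g" "commute f h" "commute g h" "commute f k" "commute g k" "commute h k"
 shows "alghom K HH4 B (L4 f g h k)"
  and "x <: H ==> y <: H ==> z <: H ==> w <: H ==>
   L4 f g h k (e4 Q x y z w) = f x \<cdot> g y \<cdot> h z \<cdot> k w"
proof -
 have c: "!!m n. m <: HH3 ==> n <: H ==> L3 f g h m \<cdot> k n = k n \<cdot> L3 f g h m"
  using L3_commute' assms by blast
 note a3 = L3_alghom[OF assms(1-3,5-7)]
 note ll = tensor_alg.lift_alghom[OF ta4 kalgB a3(1) assms(4) c]
 have eq: "L4 f g h k t = tensor_lift K HH3 H B (%m n. L3 f g h m \<cdot> k n) t" if "t <: HH4" for t
  unfolding L4_def sum4_def L3_def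
 proof (rule tensor_pair.lift_cong[OF tp4 modB])
  fix s w assume s: "s <: HH3" and w: "w <: H"
  show "sum3 Q B s (%x y z. f x \<cdot> g y \<cdot> h z \<cdot> k w) = sum3 Q B s (%x y z. f x \<cdot> g y \<cdot> h z) \<cdot> k w"
   by (rule sum3_comp[symmetric, where g = "%u. u \<cdot> k w", OF modB modB bilin_comp1[OF bilB module_lin_id] s])
    (use assms w in "auto simp: hom_closed")
  show "sum3 Q B s (%x y z. f x \<cdot> g y \<cdot> h z) \<cdot> k w <: B"
   using s w assms by (intro B.m_closed sum3_closed modB) (auto simp: hom_closed)
 qed (use that in "simp add: carrier_H4")
 show "alghom K HH4 B (L4 f g h k)"
  by (rule alghom_cong[OF kalgH4 _ eq]) (use ll(1) in "simp_all add: H4_def")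
 assume xyz: "x <: H" "y <: H" "z <: H" "w <: H"
 show "L4 f g h k (e4 Q x y z w) = f x \<cdot> g y \<cdot> h z \<cdot> k w"
  using ll(2)[OF _ _ e3_closed[OF xyz(1-3)] xyz(4)] eq[OF e4_closed[OF xyz]] a3(2)[OF xyz(1-3)]
  by (simp add: e4_def)
qed

definition indep4 :: "('h => 'b) => ('h => 'b) => ('h => 'b) => ('h => 'b) => bool" where
 "indep4 f g h k \<longleftrightarrow> Hhom f \<and> Hhom g \<and> Hhom h \<and> Hhom k \<and> commute f g \<and> commute f h \<and> commute g h \<and>
   commute f k \<and> commute g k \<and> commute h k"

lemma indep4D:
 assumes "indep4 f g h k"
 shows "Hhom f" "Hhom g" "Hhom h" "Hhom k" "commute f g" "commute f h" "commute g h"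
  "commute f k" "commute g k" "commute h k"
  "commute g f" "commute h f" "commute h g" "commute k f" "commute k g" "commute k h"
 using assms by (auto simp: indep4_def intro: commute_sym)

lemma indep4_perm:
 assumes "indep4 f g h k"
 shows "indep4 g f h k" "indep4 f h g k" "indep4 f g k h"
 using indep4D[OF assms] by (auto simp: indep4_def)

lemma mult_comp:
 assumes "c <: B"
 shows "module_lin K B B (%x. x \<cdot> c)" "module_lin K B B (%x. c \<cdot> x)"
 using bilin_comp1[OF bilB module_lin_id assms] bilin_comp2[OF bilB assms module_lin_id] by auto

text \<open>Translates the five factors of the pentagon axiom into words. A position filled with the
  unit of H disappears because homomorphisms are unital, and an expanded coproduct becomes an
  \<open>L2D\<close> leg.\<close>

lemma L4_outer:
 assumes i: "indep4 f g h k"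
 shows "L4 f g h k (sum3 Q HH4 phi (%x y z. sum2 Q HH4 (D z) (%a b. e4 Q x y a b))) = L3 f g (L2D h k) phi"
  "L4 f g h k (sum3 Q HH4 phi (%x y z. sum2 Q HH4 (D x) (%a b. e4 Q a b y z))) = L3 (L2D f g) h k phi"
  "L4 f g h k (sum3 Q HH4 phi (%x y z. e4 Q \<one>\<^bsub>H\<^esub> x y z)) = L3 g h k phi"
  "L4 f g h k (sum3 Q HH4 phi (%x y z. sum2 Q HH4 (D y) (%a b. e4 Q x a b z))) = L3 f (L2D g h) k phi"
  "L4 f g h k (sum3 Q HH4 phi (%x y z. e4 Q x y z \<one>\<^bsub>H\<^esub>)) = L3 f g h phi"
proof -
 note d = indep4D[OF i]
 note a = L4_alghom[OF d(1-10)]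
 note lin = alghomD(1)[OF a(1)]
 note hc = hom_closed[OF d(1)] hom_closed[OF d(2)] hom_closed[OF d(3)] hom_closed[OF d(4)]
 note c3 = sum3_comp[where P = HH4 and P' = B, OF modH4 modB lin phi_closed]
 note c2 = sum2_comp[where P = HH4 and P' = B, OF modH4 modB lin]
 have "L4 f g h k (sum3 Q HH4 phi (%x y z. sum2 Q HH4 (D z) (%a b. e4 Q x y a b))) =
  sum3 Q B phi (%x y z. L4 f g h k (sum2 Q HH4 (D z) (%a b. e4 Q x y a b)))"
  by (rule c3) (simp add: sum2_closed modH4)
 also have "... = L3 f g (L2D h k) phi"
  unfolding L3_def
 proof (rule sum3_cong[OF modB phi_closed])
  fix x y z assume xyz: "x <: H" "y <: H" "z <: H"
  have "L4 f g h k (sum2 Q HH4 (D z) (%a b. e4 Q x y a b)) = sum2 Q B (D z) (%a b. L4 f g h k (e4 Q x y a b))"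
   by (rule c2) (use xyz in simp_all)
  also have "... = sum2 Q B (D z) (%a b. f x \<cdot> g y \<cdot> (h a \<cdot> k b))"
   by (rule sum2_cong[OF modB]) (use xyz hc a(2) in "simp_all add: B.m_assoc")
  also have "... = f x \<cdot> g y \<cdot> L2D h k z"
   unfolding L2D_def L2_def
   by (rule sum2_comp[symmetric, OF modB modB mult_comp(2)]) (use xyz hc in simp_all)
  finally show "L4 f g h k (sum2 Q HH4 (D z) (%a b. e4 Q x y a b)) = f x \<cdot> g y \<cdot> L2D h k z" .
  show "f x \<cdot> g y \<cdot> L2D h k z <: B" unfolding L2D_def using xyz hc d L2_closed by simp
 qed
 finally show "L4 f g h k (sum3 Q HH4 phi (%x y z. sum2 Q HH4 (D z) (%a b. e4 Q x y a b))) = L3 f g (L2D h k) phi" .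
 have "L4 f g h k (sum3 Q HH4 phi (%x y z. sum2 Q HH4 (D x) (%a b. e4 Q a b y z))) =
  sum3 Q B phi (%x y z. L4 f g h k (sum2 Q HH4 (D x) (%a b. e4 Q a b y z)))"
  by (rule c3) (simp add: sum2_closed modH4)
 also have "... = L3 (L2D f g) h k phi"
  unfolding L3_def
 proof (rule sum3_cong[OF modB phi_closed])
  fix x y z assume xyz: "x <: H" "y <: H" "z <: H"
  have "L4 f g h k (sum2 Q HH4 (D x) (%a b. e4 Q a b y z)) = sum2 Q B (D x) (%a b. L4 f g h k (e4 Q a b y z))"
   by (rule c2) (use xyz in simp_all)
  also have "... = sum2 Q B (D x) (%a b. f a \<cdot> g b \<cdot> (h y \<cdot> k z))"
   by (rule sum2_cong[OF modB]) (use xyz hc a(2) in "simp_all add: B.m_assoc")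
  also have "... = L2D f g x \<cdot> (h y \<cdot> k z)"
   unfolding L2D_def L2_def
   by (rule sum2_comp[symmetric, OF modB modB mult_comp(1)]) (use xyz hc in simp_all)
  also have "... = L2D f g x \<cdot> h y \<cdot> k z"
   unfolding L2D_def using xyz hc d L2_closed by (simp add: B.m_assoc)
  finally show "L4 f g h k (sum2 Q HH4 (D x) (%a b. e4 Q a b y z)) = L2D f g x \<cdot> h y \<cdot> k z" .
  show "L2D f g x \<cdot> h y \<cdot> k z <: B" unfolding L2D_def using xyz hc d L2_closed by simp
 qed
 finally show "L4 f g h k (sum3 Q HH4 phi (%x y z. sum2 Q HH4 (D x) (%a b. e4 Q a b y z))) = L3 (L2D f g) h k phi" .
 have "L4 f g h k (sum3 Q HH4 phi (%x y z. sum2 Q HH4 (D y) (%a b. e4 Q x a b z))) =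
  sum3 Q B phi (%x y z. L4 f g h k (sum2 Q HH4 (D y) (%a b. e4 Q x a b z)))"
  by (rule c3) (simp add: sum2_closed modH4)
 also have "... = L3 f (L2D g h) k phi"
  unfolding L3_def
 proof (rule sum3_cong[OF modB phi_closed])
  fix x y z assume xyz: "x <: H" "y <: H" "z <: H"
  have l: "module_lin K B B (%u. f x \<cdot> u \<cdot> k z)"
   by (intro bilin_comp1[OF bilB] bilin_comp2[OF bilB] module_lin_id hc xyz)
  have "L4 f g h k (sum2 Q HH4 (D y) (%a b. e4 Q x a b z)) = sum2 Q B (D y) (%a b. L4 f g h k (e4 Q x a b z))"
   by (rule c2) (use xyz in simp_all)
  also have "... = sum2 Q B (D y) (%a b. f x \<cdot> (g a \<cdot> h b) \<cdot> k z)"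
   by (rule sum2_cong[OF modB]) (use xyz hc a(2) in "simp_all add: B.m_assoc")
  also have "... = f x \<cdot> L2D g h y \<cdot> k z"
   unfolding L2D_def L2_def
   by (rule sum2_comp[symmetric, OF modB modB l]) (use xyz hc in simp_all)
  finally show "L4 f g h k (sum2 Q HH4 (D y) (%a b. e4 Q x a b z)) = f x \<cdot> L2D g h y \<cdot> k z" .
  show "f x \<cdot> L2D g h y \<cdot> k z <: B" unfolding L2D_def using xyz hc d L2_closed by simp
 qed
 finally show "L4 f g h k (sum3 Q HH4 phi (%x y z. sum2 Q HH4 (D y) (%a b. e4 Q x a b z))) = L3 f (L2D g h) k phi" .
 have ones: "f \<one>\<^bsub>H\<^esub> = \<one>\<^bsub>B\<^esub>" "k \<one>\<^bsub>H\<^esub> = \<one>\<^bsub>B\<^esub>"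
  using alghomD(2)[OF d(1)] alghomD(2)[OF d(4)] by auto
 have "L4 f g h k (sum3 Q HH4 phi (%x y z. e4 Q \<one>\<^bsub>H\<^esub> x y z)) = sum3 Q B phi (%x y z. L4 f g h k (e4 Q \<one>\<^bsub>H\<^esub> x y z))"
  by (rule c3) simp
 also have "... = L3 g h k phi" unfolding L3_def
  by (rule sum3_cong[OF modB phi_closed]) (use hc a(2) in "simp_all add: ones")
 finally show "L4 f g h k (sum3 Q HH4 phi (%x y z. e4 Q \<one>\<^bsub>H\<^esub> x y z)) = L3 g h k phi" .
 have "L4 f g h k (sum3 Q HH4 phi (%x y z. e4 Q x y z \<one>\<^bsub>H\<^esub>)) = sum3 Q B phi (%x y z. L4 f g h k (e4 Q x y z \<one>\<^bsub>H\<^esub>))"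
  by (rule c3) simp
 also have "... = L3 f g h phi" unfolding L3_def
  by (rule sum3_cong[OF modB phi_closed]) (use hc a(2) in "simp_all add: ones")
 finally show "L4 f g h k (sum3 Q HH4 phi (%x y z. e4 Q x y z \<one>\<^bsub>H\<^esub>)) = L3 f g h phi" .
qed

text \<open>The image of the axiom under the algebra homomorphism \<open>L4 f g h k\<close>. As the
  legs are arbitrary, all permuted versions and those with trivial legs are included.\<close>

lemma pentagon:
 assumes i: "indep4 f g h k"
 shows "L3 f g (L2D h k) phi \<cdot> L3 (L2D f g) h k phi = L3 g h k phi \<cdot> L3 f (L2D g h) k phi \<cdot> L3 f g h phi"
proof -
 have ax: "sum3 Q HH4 phi (%x y z. sum2 Q HH4 (D z) (%a b. e4 Q x y a b)) *\<^sub>4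
   sum3 Q HH4 phi (%x y z. sum2 Q HH4 (D x) (%a b. e4 Q a b y z)) =
   sum3 Q HH4 phi (%x y z. e4 Q \<one>\<^bsub>H\<^esub> x y z) *\<^sub>4
   sum3 Q HH4 phi (%x y z. sum2 Q HH4 (D y) (%a b. e4 Q x a b z)) *\<^sub>4
   sum3 Q HH4 phi (%x y z. e4 Q x y z \<one>\<^bsub>H\<^esub>)"
  using ax_bialgebra by (simp add: quasi_bialgebra_def Let_def)
 note a = L4_alghom(1)[OF indep4D(1-10)[OF i]]
 have c: "sum3 Q HH4 phi (%x y z. sum2 Q HH4 (D z) (%a b. e4 Q x y a b)) <: HH4"
  "sum3 Q HH4 phi (%x y z. sum2 Q HH4 (D x) (%a b. e4 Q a b y z)) <: HH4"
  "sum3 Q HH4 phi (%x y z. e4 Q \<one>\<^bsub>H\<^esub> x y z) <: HH4"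
  "sum3 Q HH4 phi (%x y z. sum2 Q HH4 (D y) (%a b. e4 Q x a b z)) <: HH4"
  "sum3 Q HH4 phi (%x y z. e4 Q x y z \<one>\<^bsub>H\<^esub>) <: HH4"
  by (intro sum3_closed sum2_closed modH4; simp add: sum2_closed modH4)+
 show ?thesis
  using arg_cong[OF ax, of "L4 f g h k"] by (simp add: alghomD(3)[OF a] c L4_outer[OF i])
qed

end

text \<open>The three monoid lemmas isolate the diagram chases: \<open>F\<^sub>i\<close> are legs of the associator with
 inverses \<open>F\<^sub>i'\<close>, and \<open>r\<close>, \<open>r\<^sub>1\<close> are legs of the R-matrix.\<close>

lemma (in monoid) chase_core:
 assumes cl: "T1 <: G" "F1 <: G" "F2 <: G" "F3 <: G" "F4 <: G" "F5 <: G"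
   "F6 <: G" "F7 <: G" "F8 <: G" "F9 <: G" "r <: G"
   "F1' <: G" "F4' <: G" "F7' <: G" "F8' <: G"
  and p1: "F1 \<otimes> T1 = F2 \<otimes> F3 \<otimes> F4" and i1: "F1' \<otimes> F1 = \<one>" and i4: "F4 \<otimes> F4' = \<one>"
  and n: "F3 \<otimes> r = r \<otimes> F5"
  and p2: "F6 \<otimes> F7 = F8 \<otimes> F5 \<otimes> F9" and i8: "F8' \<otimes> F8 = \<one>" and i7: "F7 \<otimes> F7' = \<one>"
 shows "T1 \<otimes> F4' \<otimes> r \<otimes> F9 \<otimes> F7' = F1' \<otimes> F2 \<otimes> r \<otimes> F8' \<otimes> F6"
proof -
 have a: "T1 \<otimes> F4' = F1' \<otimes> F2 \<otimes> F3"
 proof -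
  have "T1 \<otimes> F4' = F1' \<otimes> F1 \<otimes> T1 \<otimes> F4'" using i1 cl by simp
  also have "... = F1' \<otimes> (F1 \<otimes> T1) \<otimes> F4'" using cl by (simp add: m_assoc)
  also have "... = F1' \<otimes> F2 \<otimes> F3 \<otimes> (F4 \<otimes> F4')" using cl by (simp add: p1 m_assoc)
  finally show ?thesis using cl i4 by simp
 qed
 have b: "F5 \<otimes> F9 \<otimes> F7' = F8' \<otimes> F6"
 proof -
  have "F5 \<otimes> F9 \<otimes> F7' = F8' \<otimes> F8 \<otimes> F5 \<otimes> F9 \<otimes> F7'" using i8 cl by simp
  also have "... = F8' \<otimes> (F8 \<otimes> F5 \<otimes> F9) \<otimes> F7'" using cl by (simp add: m_assoc)
  also have "... = F8' \<otimes> F6 \<otimes> (F7 \<otimes> F7')" using cl by (simp add: p2[symmetric] m_assoc)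
  finally show ?thesis using cl i7 by simp
 qed
 \<comment> \<open>Each pentagon is now solved for the part facing r. Naturality \<open>n\<close>
   pulls r through the associator whose middle leg it braids, and this joins the two solved
   forms.\<close>
 have "T1 \<otimes> F4' \<otimes> r \<otimes> F9 \<otimes> F7' = F1' \<otimes> F2 \<otimes> (F3 \<otimes> r) \<otimes> F9 \<otimes> F7'"
  using cl by (simp add: a m_assoc)
 also have "... = F1' \<otimes> F2 \<otimes> r \<otimes> (F5 \<otimes> F9 \<otimes> F7')" using cl by (simp add: n m_assoc)
 also have "... = F1' \<otimes> F2 \<otimes> r \<otimes> F8' \<otimes> F6" using cl by (simp add: b m_assoc)
 finally show ?thesis .
qed

lemma (in monoid) chase_two_past_one:
 assumes cl: "T1 <: G" "F1 <: G" "F2 <: G" "F4' <: G" "F6 <: G" "F7' <: G"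
   "F8' <: G" "F9 <: G" "F1' <: G" "r <: G" "r1 <: G"
   "E1 <: G" "E2 <: G" "E3 <: G" "E4 <: G" "E5 <: G" "Rpq <: G"
  and core: "T1 \<otimes> F4' \<otimes> r \<otimes> F9 \<otimes> F7' = F1' \<otimes> F2 \<otimes> r \<otimes> F8' \<otimes> F6"
  and hex: "Rpq = E3 \<otimes> r1 \<otimes> F4' \<otimes> r \<otimes> F9"
  and pent: "E4 \<otimes> E5 = E1 \<otimes> E2 \<otimes> E3"
  and nat: "E5 \<otimes> r1 = r1 \<otimes> T1"
 shows "(E4 \<otimes> r1 \<otimes> F1') \<otimes> (F2 \<otimes> r \<otimes> F8') \<otimes> F6 = E1 \<otimes> (E2 \<otimes> Rpq \<otimes> F7')"
proof -
 have "E1 \<otimes> (E2 \<otimes> Rpq \<otimes> F7') = (E1 \<otimes> E2 \<otimes> E3) \<otimes> r1 \<otimes> F4' \<otimes> r \<otimes> F9 \<otimes> F7'"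
  using cl by (simp add: hex m_assoc)
 also have "... = E4 \<otimes> (E5 \<otimes> r1) \<otimes> F4' \<otimes> r \<otimes> F9 \<otimes> F7'" using cl by (simp add: pent[symmetric] m_assoc)
 also have "... = E4 \<otimes> r1 \<otimes> (T1 \<otimes> F4' \<otimes> r \<otimes> F9 \<otimes> F7')" using cl by (simp add: nat m_assoc)
 also have "... = (E4 \<otimes> r1 \<otimes> F1') \<otimes> (F2 \<otimes> r \<otimes> F8') \<otimes> F6" unfolding core using cl by (simp add: m_assoc)
 finally show ?thesis by simp
qed

lemma (in monoid) chase_one_past_two:
 assumes cl: "T1 <: G" "F2 <: G" "F4' <: G" "F6 <: G" "F7' <: G"
   "F8' <: G" "F9 <: G" "F1' <: G" "r <: G" "rqp <: G" "rpq <: G"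
   "E1 <: G" "E2 <: G" "E3 <: G" "E4 <: G" "E5 <: G"
   "E1' <: G" "E2' <: G" "E3' <: G" "E5' <: G" "Rq <: G"
  and core: "T1 \<otimes> F4' \<otimes> r \<otimes> F9 \<otimes> F7' = F1' \<otimes> F2 \<otimes> r \<otimes> F8' \<otimes> F6"
  and hex: "Rq = F4' \<otimes> r \<otimes> F9 \<otimes> rqp \<otimes> E3'"
  and pent: "E4 \<otimes> E5 = E1 \<otimes> E2 \<otimes> E3" and i1: "E1' \<otimes> E1 = \<one>" and i2: "E2' \<otimes> E2 = \<one>" and i3: "E3' \<otimes> E3 = \<one>"
   and i5: "E5 \<otimes> E5' = \<one>"
  and nat: "rqp \<otimes> E5' = F7' \<otimes> rqp" and tri: "rqp \<otimes> rpq = \<one>"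
 shows "F1' \<otimes> (F2 \<otimes> r \<otimes> F8') \<otimes> F6 = (T1 \<otimes> Rq \<otimes> E2') \<otimes> E1' \<otimes> E4 \<otimes> rpq"
proof -
 \<comment> \<open>The surplus associators form the inverse of E5 by the pentagon. Naturality then
   carries \<open>rqp\<close> past it until it meets \<open>rpq\<close>, and triangularity cancels
   the two crossings.\<close>
 have a: "E3' \<otimes> E2' \<otimes> E1' \<otimes> E4 = E5'"
 proof -
  have "E3' \<otimes> E2' \<otimes> E1' \<otimes> E4 = E3' \<otimes> E2' \<otimes> E1' \<otimes> (E4 \<otimes> (E5 \<otimes> E5'))" using cl i5 by simp
  also have "... = E3' \<otimes> E2' \<otimes> E1' \<otimes> (E4 \<otimes> E5) \<otimes> E5'" using cl by (simp add: m_assoc)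
  also have "... = E3' \<otimes> E2' \<otimes> (E1' \<otimes> E1) \<otimes> E2 \<otimes> E3 \<otimes> E5'" using cl by (simp add: pent m_assoc)
  also have "... = E3' \<otimes> (E2' \<otimes> E2) \<otimes> E3 \<otimes> E5'" using cl by (simp add: i1 m_assoc)
  also have "... = E5'" using cl by (simp add: i2 i3)
  finally show ?thesis .
 qed
 have "(T1 \<otimes> Rq \<otimes> E2') \<otimes> E1' \<otimes> E4 \<otimes> rpq = T1 \<otimes> F4' \<otimes> r \<otimes> F9 \<otimes> rqp \<otimes> (E3' \<otimes> E2' \<otimes> E1' \<otimes> E4) \<otimes> rpq"
  using cl by (simp add: hex m_assoc)
 also have "... = T1 \<otimes> F4' \<otimes> r \<otimes> F9 \<otimes> (rqp \<otimes> E5') \<otimes> rpq" unfolding a using cl by (simp add: m_assoc)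
 also have "... = (T1 \<otimes> F4' \<otimes> r \<otimes> F9 \<otimes> F7') \<otimes> (rqp \<otimes> rpq)" unfolding nat using cl by (simp add: m_assoc)
 also have "... = F1' \<otimes> (F2 \<otimes> r \<otimes> F8') \<otimes> F6" unfolding core tri using cl by (simp add: m_assoc)
 finally show ?thesis by simp
qed

text \<open>\<open>braidX\<close> is the element moving the first of two arguments past the second inside a
 right-nested bracket \<open>(u, (v, w)) \<mapsto> (v, (u, w))\<close>.\<close>

definition braidX :: "('k, 'h) qhopf => ('k, ('k, 'h, 'h) tensor, 'h) tensor" where
 "braidX Q = sum3 Q (H3 Q) (qphi Q) (%x y z. e3 Q y x z) \<otimes>\<^bsub>H3 Q\<^esub>
   sum2 Q (H3 Q) (qR Q) (%x y. e3 Q x y \<one>\<^bsub>qalg Q\<^esub>) \<otimes>\<^bsub>H3 Q\<^esub> qphi_inv Q"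

section \<open>The R-matrix with arbitrary legs\<close>

context qhopf_alg
begin

interpretation B: monoid B by (rule monB)

lemma flip2_image:
 assumes "Hhom f" "Hhom g" "commute f g" "t <: HH2"
 shows "L2 f g (flip2 Q t) = L2 g f t"
proof -
 have "L2 f g (flip2 Q t) = sum2 Q B t (%x y. L2 f g (e2 Q y x))"
  unfolding flip2_def
  by (rule sum2_comp[OF modH2 modB alghomD(1)[OF L2_alghom[OF assms(1-3)]] assms(4)]) simp
 also have "... = L2 g f t" unfolding L2_def[of g f]
  by (rule sum2_cong[OF modB assms(4)])
   (use assms(1,2) in "simp_all add: L2_e2[OF assms(1-3)] commuteD[OF assms(3)] hom_closed")
 finally show ?thesis .
qed

lemma L3_psi:
 assumes "Hhom f" "Hhom g" "Hhom h" "commute f g" "commute f h" "commute g h"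
 shows "L3 f g h phi \<cdot> L3 f g h psi = \<one>\<^bsub>B\<^esub>" "L3 f g h psi \<cdot> L3 f g h phi = \<one>\<^bsub>B\<^esub>"
 using alghomD(2,3)[OF L3_alghom(1)[OF assms]] phi_closed psi_closed phi_psi psi_phi by metis+

end

text \<open>\<open>inv\<close> has its meaning only on units, so the triangularity axiom says
  nothing before the flipped R-matrix is known to be invertible. The flip is the algebra map given
  by the two exchanged embeddings of H, and algebra maps preserve units.\<close>

lemma (in qhopf) flip2_R_Units: "flip2 Q R \<in> Units HH2"
proof -
 interpret E: qhopf_alg Q HH2 by unfold_locales (rule kalgH2)
 interpret M: monoid HH2 by (rule kalgD(3)[OF kalgH2])
 let ?f = "%x. e2 Q \<one>\<^bsub>H\<^esub> x" and ?g = "%y. e2 Q y \<one>\<^bsub>H\<^esub>"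
 note H1 = monoid.l_one[OF kalgD(3)[OF kalgH]] monoid.r_one[OF kalgD(3)[OF kalgH]]
 have f: "alghom K H HH2 ?f" "alghom K H HH2 ?g"
  unfolding alghom_def by (auto simp: one_H2 e2_mult H1 intro: bilin_lin1[OF e2_bilin] bilin_lin2[OF e2_bilin])
 have c: "E.commute ?f ?g" by (simp add: E.commute_def e2_mult H1)
 have eq: "flip2 Q t = E.L2 ?f ?g t" if "t <: HH2" for t
  unfolding flip2_def E.L2_def
  by (rule sum2_cong[OF modH2 that]) (simp_all add: e2_mult H1)
 have "E.L2 ?f ?g R *\<^sub>2 E.L2 ?f ?g (inv\<^bsub>HH2\<^esub> R) = \<one>\<^bsub>HH2\<^esub>"
  "E.L2 ?f ?g (inv\<^bsub>HH2\<^esub> R) *\<^sub>2 E.L2 ?f ?g R = \<one>\<^bsub>HH2\<^esub>"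
  using alghom_Units[OF E.L2_alghom[OF f c] kalgH2 R_Units] by auto
 moreover have "E.L2 ?f ?g R <: HH2" "E.L2 ?f ?g (inv\<^bsub>HH2\<^esub> R) <: HH2"
  using alghomD(4)[OF E.L2_alghom[OF f c]] M.Units_inv_closed[OF R_Units] by auto
 ultimately show ?thesis unfolding eq[OF R_closed] Units_def by blast
qed

lemma (in qhopf) R_flip2: "R *\<^sub>2 flip2 Q R = \<one>\<^bsub>HH2\<^esub>"
proof -
 interpret M: monoid HH2 by (rule kalgD(3)[OF kalgH2])
 have "inv\<^bsub>HH2\<^esub> (flip2 Q R) *\<^sub>2 flip2 Q R = \<one>\<^bsub>HH2\<^esub>" by (rule M.Units_l_inv[OF flip2_R_Units])
 then show ?thesis using ax_tri by simp
qed

lemma (in qhopf) flip2_D: "h <: H ==> flip2 Q (D h) *\<^sub>2 R = R *\<^sub>2 D h"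
proof -
 interpret M: monoid HH2 by (rule kalgD(3)[OF kalgH2])
 assume h: "h <: H"
 have "flip2 Q (D h) = R *\<^sub>2 D h *\<^sub>2 inv\<^bsub>HH2\<^esub> R"
  using ax_qtri h by (simp add: quasitriangular_def Let_def)
 then show ?thesis
  using h M.Units_l_inv[OF R_Units] M.Units_inv_closed[OF R_Units] by (simp add: M.m_assoc)
qed

lemma (in qhopf) flip2_closed: "t <: HH2 ==> flip2 Q t <: HH2"
 unfolding flip2_def by (rule sum2_closed[OF modH2]) auto

context qhopf_alg
begin

interpretation B: monoid B by (rule monB)

text \<open>Triangularity pushed forward to B: crossing two legs and crossing back is
  trivial.\<close>

lemma R_inverse:
 assumes "Hhom f" "Hhom g" "commute f g"
 shows "L2 f g R \<cdot> L2 g f R = \<one>\<^bsub>B\<^esub>"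
 using alghomD(2,3)[OF L2_alghom[OF assms]] flip2_image[OF assms R_closed] R_flip2
  flip2_R_Units flip2_closed R_closed by metis

lemma R_L2D:
 assumes "Hhom f" "Hhom g" "commute f g" "x <: H"
 shows "L2D g f x \<cdot> L2 f g R = L2 f g R \<cdot> L2D f g x"
 using arg_cong[OF flip2_D[OF assms(4)], of "L2 f g"] alghomD(3)[OF L2_alghom[OF assms(1-3)]]
  flip2_image[OF assms(1-3) D_closed[OF assms(4)]] flip2_closed assms(4)
 by (simp add: L2D_def)

text \<open>R exchanges the coproduct in the composite leg with the opposite one and commutes with
  the other two legs. This is naturality of the associator with respect to a braiding inside its
  first argument; \<open>R_natural2\<close> treats the middle argument.\<close>

lemma R_natural1:
 assumes i: "indep4 f g h k" and t: "t <: HH3"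
 shows "L3 (L2D g f) h k t \<cdot> L2 f g R = L2 f g R \<cdot> L3 (L2D f g) h k t"
proof (rule H3_ext[where f = "%t. L3 (L2D g f) h k t \<cdot> L2 f g R" and g = "%t. L2 f g R \<cdot> L3 (L2D f g) h k t",
   OF modB _ _ _ t])
 note d = indep4D[OF i]
 have r: "L2 f g R <: B" by (rule L2_closed) (use d in simp_all)
 note a1 = L3_alghom[OF L2D_hom[OF d(2,1,11)] d(3,4) L2D_commute L2D_commute d(10), OF d(2,1,3,11,7,6) d(2,1,4,11,9,8)]
 note a2 = L3_alghom[OF L2D_hom[OF d(1,2,5)] d(3,4) L2D_commute L2D_commute d(10), OF d(1,2,3,5,6,7) d(1,2,4,5,8,9)]
 show "module_lin K HH3 B (%t. L3 (L2D g f) h k t \<cdot> L2 f g R)"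
  by (rule bilin_comp1[OF bilB alghomD(1)[OF a1(1)] r])
 show "module_lin K HH3 B (%t. L2 f g R \<cdot> L3 (L2D f g) h k t)"
  by (rule bilin_comp2[OF bilB r alghomD(1)[OF a2(1)]])
 fix x y z assume xyz: "x <: H" "y <: H" "z <: H"
 have cl: "L2D f g x <: B" "L2D g f x <: B" "h y <: B" "k z <: B"
  using xyz d by (auto simp: hom_closed L2D_def intro: L2_closed)
 have c: "L2 f g R \<cdot> h y = h y \<cdot> L2 f g R" "L2 f g R \<cdot> k z = k z \<cdot> L2 f g R"
  using L2_commute'[OF d(1,2,3,5,6,7) R_closed xyz(2)] L2_commute'[OF d(1,2,4,5,8,9) R_closed xyz(3)] by auto
 have "L2D g f x \<cdot> h y \<cdot> k z \<cdot> L2 f g R = L2D g f x \<cdot> h y \<cdot> (L2 f g R \<cdot> k z)"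
  using cl r c(2) by (simp add: B.m_assoc)
 also have "... = L2D g f x \<cdot> (h y \<cdot> L2 f g R) \<cdot> k z" using cl r by (simp add: B.m_assoc)
 also have "... = L2D g f x \<cdot> L2 f g R \<cdot> h y \<cdot> k z" unfolding c(1)[symmetric] using cl r by (simp add: B.m_assoc)
 also have "... = L2 f g R \<cdot> (L2D f g x \<cdot> h y \<cdot> k z)"
  using cl r R_L2D[OF d(1,2,5) xyz(1)] by (simp add: B.m_assoc)
 finally show "L3 (L2D g f) h k (e3 Q x y z) \<cdot> L2 f g R = L2 f g R \<cdot> L3 (L2D f g) h k (e3 Q x y z)"
  using a1(2)[OF xyz] a2(2)[OF xyz] by simp
qed

lemma R_natural2:
 assumes i: "indep4 f g h k" and t: "t <: HH3"
 shows "L3 h (L2D g f) k t \<cdot> L2 f g R = L2 f g R \<cdot> L3 h (L2D f g) k t"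
proof (rule H3_ext[where f = "%t. L3 h (L2D g f) k t \<cdot> L2 f g R" and g = "%t. L2 f g R \<cdot> L3 h (L2D f g) k t",
   OF modB _ _ _ t])
 note d = indep4D[OF i]
 have r: "L2 f g R <: B" by (rule L2_closed) (use d in simp_all)
 note a1 = L3_alghom[OF d(3) L2D_hom[OF d(2,1,11)] d(4) L2D_commute2 d(10) L2D_commute, OF d(2,1,3,11,7,6) d(2,1,4,11,9,8)]
 note a2 = L3_alghom[OF d(3) L2D_hom[OF d(1,2,5)] d(4) L2D_commute2 d(10) L2D_commute, OF d(1,2,3,5,6,7) d(1,2,4,5,8,9)]
 show "module_lin K HH3 B (%t. L3 h (L2D g f) k t \<cdot> L2 f g R)"
  by (rule bilin_comp1[OF bilB alghomD(1)[OF a1(1)] r])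
 show "module_lin K HH3 B (%t. L2 f g R \<cdot> L3 h (L2D f g) k t)"
  by (rule bilin_comp2[OF bilB r alghomD(1)[OF a2(1)]])
 fix y x z assume xyz: "y <: H" "x <: H" "z <: H"
 have cl: "L2D f g x <: B" "L2D g f x <: B" "h y <: B" "k z <: B"
  using xyz d by (auto simp: hom_closed L2D_def intro: L2_closed)
 have c: "L2 f g R \<cdot> h y = h y \<cdot> L2 f g R" "L2 f g R \<cdot> k z = k z \<cdot> L2 f g R"
  using L2_commute'[OF d(1,2,3,5,6,7) R_closed xyz(1)] L2_commute'[OF d(1,2,4,5,8,9) R_closed xyz(3)] by auto
 have "h y \<cdot> L2D g f x \<cdot> k z \<cdot> L2 f g R = h y \<cdot> (L2D g f x \<cdot> L2 f g R) \<cdot> k z"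
  using cl r c(2) by (simp add: B.m_assoc)
 also have "... = (h y \<cdot> L2 f g R) \<cdot> L2D f g x \<cdot> k z"
  unfolding R_L2D[OF d(1,2,5) xyz(2)] using cl r by (simp add: B.m_assoc)
 also have "... = L2 f g R \<cdot> (h y \<cdot> L2D f g x \<cdot> k z)"
  unfolding c(1)[symmetric] using cl r by (simp add: B.m_assoc)
 finally show "L3 h (L2D g f) k (e3 Q y x z) \<cdot> L2 f g R = L2 f g R \<cdot> L3 h (L2D f g) k (e3 Q y x z)"
  using a1(2)[OF xyz] a2(2)[OF xyz] by simp
qed

definition indep3 :: "('h => 'b) => ('h => 'b) => ('h => 'b) => bool" where
 "indep3 f g h \<longleftrightarrow> Hhom f \<and> Hhom g \<and> Hhom h \<and> commute f g \<and> commute f h \<and> commute g h"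

lemma indep3D:
 assumes "indep3 f g h"
 shows "Hhom f" "Hhom g" "Hhom h" "commute f g" "commute f h" "commute g h"
  "commute g f" "commute h f" "commute h g"
 using assms by (auto simp: indep3_def intro: commute_sym)

text \<open>Because the images commute, a permutation of tensor factors can be traded for a
  permutation of the homomorphisms. In this way the permuted associators of the hexagon axioms
  become words.\<close>

lemma L3_perm:
 assumes i: "indep3 f g h" and t: "t <: HH3"
 shows "L3 f g h (sum3 Q HH3 t (%x y z. e3 Q z x y)) = L3 g h f t"
  "L3 f g h (sum3 Q HH3 t (%x y z. e3 Q y x z)) = L3 g f h t"
  "L3 f g h (sum3 Q HH3 t (%x y z. e3 Q y z x)) = L3 h f g t"
  "L3 f g h (sum3 Q HH3 t (%x y z. e3 Q x z y)) = L3 f h g t"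
proof -
 note d = indep3D[OF i]
 note a = L3_alghom[OF d(1-6)]
 note hc = hom_closed[OF d(1)] hom_closed[OF d(2)] hom_closed[OF d(3)]
 note c = sum3_comp[where g = "L3 f g h", OF modH3 modB alghomD(1)[OF a(1)] t]
 have 1: "f z \<cdot> g x \<cdot> h y = g x \<cdot> h y \<cdot> f z" if "x <: H" "y <: H" "z <: H" for x y z
 proof -
  have "f z \<cdot> g x \<cdot> h y = g x \<cdot> (f z \<cdot> h y)"
   using that commuteD[OF d(4) that(3,1)] hc by (simp add: B.m_assoc[symmetric])
  then show ?thesis using that commuteD[OF d(5) that(3,2)] hc by (simp add: B.m_assoc[symmetric])
 qed
 have 3: "f y \<cdot> g z \<cdot> h x = h x \<cdot> f y \<cdot> g z" if "x <: H" "y <: H" "z <: H" for x y z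
 proof -
  have "f y \<cdot> g z \<cdot> h x = f y \<cdot> h x \<cdot> g z"
   using that commuteD[OF d(6) that(3,1)] hc by (simp add: B.m_assoc)
  then show ?thesis using that commuteD[OF d(5) that(2,1)] hc by simp
 qed
 have 4: "f x \<cdot> g z \<cdot> h y = f x \<cdot> h y \<cdot> g z" if "x <: H" "y <: H" "z <: H" for x y z
  using that commuteD[OF d(6) that(3,2)] hc by (simp add: B.m_assoc)
 show "L3 f g h (sum3 Q HH3 t (%x y z. e3 Q z x y)) = L3 g h f t"
  unfolding L3_def[of g] by (subst c, simp, rule sum3_cong[OF modB t]) (simp_all add: a(2) hc 1)
 show "L3 f g h (sum3 Q HH3 t (%x y z. e3 Q y x z)) = L3 g f h t"
  unfolding L3_def[of g] by (subst c, simp, rule sum3_cong[OF modB t]) (simp_all add: a(2) hc commuteD[OF d(4)])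
 show "L3 f g h (sum3 Q HH3 t (%x y z. e3 Q y z x)) = L3 h f g t"
  unfolding L3_def[of h] by (subst c, simp, rule sum3_cong[OF modB t]) (simp_all add: a(2) hc 3)
 show "L3 f g h (sum3 Q HH3 t (%x y z. e3 Q x z y)) = L3 f h g t"
  unfolding L3_def[of f h] by (subst c, simp, rule sum3_cong[OF modB t]) (simp_all add: a(2) hc 4)
qed

lemma L3_R:
 assumes i: "indep3 f g h"
 shows "L3 f g h (sum2 Q HH3 R (%x y. e3 Q x \<one>\<^bsub>H\<^esub> y)) = L2 f h R"
  "L3 f g h (sum2 Q HH3 R (%x y. e3 Q x y \<one>\<^bsub>H\<^esub>)) = L2 f g R"
  "L3 f g h (sum2 Q HH3 R (%x y. e3 Q \<one>\<^bsub>H\<^esub> x y)) = L2 g h R"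
  "L3 f g h (sum2 Q HH3 R (%x y. sum2 Q HH3 (D y) (%a b. e3 Q x a b))) = L2 f (L2D g h) R"
  "L3 f g h (sum2 Q HH3 R (%x y. sum2 Q HH3 (D x) (%a b. e3 Q a b y))) = L2 (L2D f g) h R"
proof -
 note d = indep3D[OF i]
 note a = L3_alghom[OF d(1-6)]
 note hc = hom_closed[OF d(1)] hom_closed[OF d(2)] hom_closed[OF d(3)]
 note ones = alghomD(2)[OF d(1)] alghomD(2)[OF d(2)] alghomD(2)[OF d(3)]
 note c = sum2_comp[where g = "L3 f g h", OF modH3 modB alghomD(1)[OF a(1)]]
 show "L3 f g h (sum2 Q HH3 R (%x y. e3 Q x \<one>\<^bsub>H\<^esub> y)) = L2 f h R"
  unfolding L2_def by (subst c[OF R_closed], simp, rule sum2_cong[OF modB R_closed]) (simp_all add: a(2) hc ones)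
 show "L3 f g h (sum2 Q HH3 R (%x y. e3 Q x y \<one>\<^bsub>H\<^esub>)) = L2 f g R"
  unfolding L2_def by (subst c[OF R_closed], simp, rule sum2_cong[OF modB R_closed]) (simp_all add: a(2) hc ones)
 show "L3 f g h (sum2 Q HH3 R (%x y. e3 Q \<one>\<^bsub>H\<^esub> x y)) = L2 g h R"
  unfolding L2_def by (subst c[OF R_closed], simp, rule sum2_cong[OF modB R_closed]) (simp_all add: a(2) hc ones)
 have 1: "L3 f g h (sum2 Q HH3 (D y) (%a b. e3 Q x a b)) = f x \<cdot> L2D g h y" if "x <: H" "y <: H" for x y
 proof -
  have "L3 f g h (sum2 Q HH3 (D y) (%a b. e3 Q x a b)) = sum2 Q B (D y) (%a b. f x \<cdot> (g a \<cdot> h b))"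
   by (subst c, simp add: that, simp add: that, rule sum2_cong[OF modB])
    (use that in "simp_all add: a(2) hc B.m_assoc")
  also have "... = f x \<cdot> L2D g h y"
   unfolding L2D_def L2_def
   by (rule sum2_comp[symmetric, OF modB modB mult_comp(2)]) (use that hc in simp_all)
  finally show ?thesis .
 qed
 have 2: "L3 f g h (sum2 Q HH3 (D x) (%a b. e3 Q a b y)) = L2D f g x \<cdot> h y" if "x <: H" "y <: H" for x y
 proof -
  have "L3 f g h (sum2 Q HH3 (D x) (%a b. e3 Q a b y)) = sum2 Q B (D x) (%a b. f a \<cdot> g b \<cdot> h y)"
   by (subst c, simp add: that, simp add: that, rule sum2_cong[OF modB])
    (use that in "simp_all add: a(2) hc B.m_assoc")
  also have "... = L2D f g x \<cdot> h y"
   unfolding L2D_def L2_def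
   by (rule sum2_comp[symmetric, OF modB modB mult_comp(1)]) (use that hc in simp_all)
  finally show ?thesis .
 qed
 have cD: "L2D g h y <: B" "L2D f g y <: B" if "y <: H" for y
  unfolding L2D_def using that d L2_closed by auto
 show "L3 f g h (sum2 Q HH3 R (%x y. sum2 Q HH3 (D y) (%a b. e3 Q x a b))) = L2 f (L2D g h) R"
  unfolding L2_def[of f]
  by (subst c[OF R_closed], simp add: sum2_closed modH3, rule sum2_cong[OF modB R_closed])
   (simp_all add: 1 hc cD)
 show "L3 f g h (sum2 Q HH3 R (%x y. sum2 Q HH3 (D x) (%a b. e3 Q a b y))) = L2 (L2D f g) h R"
  unfolding L2_def[of _ h]
  by (subst c[OF R_closed], simp add: sum2_closed modH3, rule sum2_cong[OF modB R_closed])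
   (simp_all add: 2 hc cD)
qed

lemma H3_closures:
 "t <: HH3 ==> sum3 Q HH3 t (%x y z. e3 Q z x y) <: HH3"
 "t <: HH3 ==> sum3 Q HH3 t (%x y z. e3 Q y x z) <: HH3"
 "t <: HH3 ==> sum3 Q HH3 t (%x y z. e3 Q y z x) <: HH3"
 "t <: HH3 ==> sum3 Q HH3 t (%x y z. e3 Q x z y) <: HH3"
 "sum2 Q HH3 R (%x y. e3 Q x \<one>\<^bsub>H\<^esub> y) <: HH3"
 "sum2 Q HH3 R (%x y. e3 Q x y \<one>\<^bsub>H\<^esub>) <: HH3"
 "sum2 Q HH3 R (%x y. e3 Q \<one>\<^bsub>H\<^esub> x y) <: HH3"
 by (intro sum3_closed sum2_closed modH3; simp)+

text \<open>The route of a leg past a pair: f crosses g first and then h, with the brackets adjusted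
  before, between and after the crossings.\<close>

lemma hexagon1:
 assumes i: "indep3 f g h"
 shows "L2 f (L2D g h) R = L3 g h f psi \<cdot> L2 f h R \<cdot> L3 g f h phi \<cdot> L2 f g R \<cdot> L3 f g h psi"
proof -
 have ax: "sum2 Q HH3 R (%x y. sum2 Q HH3 (D y) (%a b. e3 Q x a b)) =
    sum3 Q HH3 psi (%x y z. e3 Q z x y) *\<^sub>3
    sum2 Q HH3 R (%x y. e3 Q x \<one>\<^bsub>H\<^esub> y) *\<^sub>3
    sum3 Q HH3 phi (%x y z. e3 Q y x z) *\<^sub>3
    sum2 Q HH3 R (%x y. e3 Q x y \<one>\<^bsub>H\<^esub>) *\<^sub>3 psi"
  using ax_qtri by (simp add: quasitriangular_def Let_def)
 note a = L3_alghom(1)[OF indep3D(1-6)[OF i]]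
 show ?thesis
  using arg_cong[OF ax, of "L3 f g h"]
  by (simp add: alghomD(3)[OF a] H3_closures L3_R[OF i] L3_perm[OF i])
qed

text \<open>The route of a pair past a leg: g crosses h first, and f follows.\<close>

lemma hexagon2:
 assumes i: "indep3 f g h"
 shows "L2 (L2D f g) h R = L3 h f g phi \<cdot> L2 f h R \<cdot> L3 f h g psi \<cdot> L2 g h R \<cdot> L3 f g h phi"
proof -
 have ax: "sum2 Q HH3 R (%x y. sum2 Q HH3 (D x) (%a b. e3 Q a b y)) =
    sum3 Q HH3 phi (%x y z. e3 Q y z x) *\<^sub>3
    sum2 Q HH3 R (%x y. e3 Q x \<one>\<^bsub>H\<^esub> y) *\<^sub>3
    sum3 Q HH3 psi (%x y z. e3 Q x z y) *\<^sub>3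
    sum2 Q HH3 R (%x y. e3 Q \<one>\<^bsub>H\<^esub> x y) *\<^sub>3 phi"
  using ax_qtri by (simp add: quasitriangular_def Let_def)
 note a = L3_alghom(1)[OF indep3D(1-6)[OF i]]
 show ?thesis
  using arg_cong[OF ax, of "L3 f g h"]
  by (simp add: alghomD(3)[OF a] H3_closures L3_R[OF i] L3_perm[OF i])
qed

lemma braidX_closed: "braidX Q <: HH3"
 unfolding braidX_def by (simp add: H3_closures)

lemma L3_braidX:
 assumes i: "indep3 f g h"
 shows "L3 f g h (braidX Q) = L3 g f h phi \<cdot> L2 f g R \<cdot> L3 f g h psi"
 unfolding braidX_def
 using alghomD(3)[OF L3_alghom(1)[OF indep3D(1-6)[OF i]]]
 by (simp add: H3_closures L3_R[OF i] L3_perm[OF i])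

lemma indep4_3:
 assumes i: "indep4 f g h k"
 shows "indep3 f g h" "indep3 f g k" "indep3 f h k" "indep3 g h k"
  "indep3 (L2D f g) h k" "indep3 f (L2D g h) k" "indep3 f g (L2D h k)"
 using indep4D[OF i] by (auto simp: indep3_def L2D_hom L2D_commute L2D_commute2)

lemma indep3_perm:
 assumes i: "indep3 f g h"
 shows "indep3 g f h" "indep3 f h g"
 using indep3D[OF i] by (simp_all add: indep3_def)

lemma L3_cl: "indep3 f g h ==> t <: HH3 ==> L3 f g h t <: B"
 by (rule L3_closed) (auto simp: indep3_def)

lemma L3_inv:
 assumes i: "indep3 f g h"
 shows "L3 f g h phi \<cdot> L3 f g h psi = \<one>\<^bsub>B\<^esub>" "L3 f g h psi \<cdot> L3 f g h phi = \<one>\<^bsub>B\<^esub>"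
 using L3_psi[OF indep3D(1-6)[OF i]] by simp_all

text \<open>Two routes from (p q)(a v) to (p a)(q v) that exchange q and a. The left one works
  inside ((p q) a) v, the right one inside p (q (a v)). Each pair of neighbouring bracketings is
  compared by one pentagon, and \<open>R_natural2\<close> relates the two crossings.\<close>

lemma coherence_core:
 assumes i: "indep4 p q a v"
 shows "L3 (L2D p a) q v phi \<cdot> L3 p a q psi \<cdot> L2 q a R \<cdot> L3 p q a phi \<cdot> L3 (L2D p q) a v psi =
  L3 p a (L2D q v) psi \<cdot> L3 a q v phi \<cdot> L2 q a R \<cdot> L3 q a v psi \<cdot> L3 p q (L2D a v) phi"
proof -
 note j = indep4_perm(2)[OF i]
 note d = indep4D[OF i]
 note i3 = indep4_3[OF i]
 note j3 = indep4_3[OF j]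
 have k: "indep4 q a p v" using d by (auto simp: indep4_def)
 show ?thesis
  by (rule B.chase_core[where ?F3.0 = "L3 p (L2D a q) v phi" and ?F5.0 = "L3 p (L2D q a) v phi"
     and ?F4.0 = "L3 p a q phi" and ?F7.0 = "L3 (L2D p q) a v phi" and ?F8.0 = "L3 q a v phi" and ?F1.0 = "L3 p a (L2D q v) phi"])
   (use L3_cl[OF i3(1)] L3_cl[OF i3(2)] L3_cl[OF i3(3)] L3_cl[OF i3(4)] L3_cl[OF i3(5)] L3_cl[OF i3(6)] L3_cl[OF i3(7)]
    L3_cl[OF j3(1)] L3_cl[OF j3(2)] L3_cl[OF j3(3)] L3_cl[OF j3(4)] L3_cl[OF j3(5)] L3_cl[OF j3(6)] L3_cl[OF j3(7)]
    L2_closed[OF d(2,3)] pentagon[OF i] pentagon[OF j] R_natural2[OF k]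
    L3_inv(2)[OF j3(7)] L3_inv(1)[OF j3(1)] L3_inv(2)[OF i3(4)] L3_inv(1)[OF i3(5)] in simp_all)
qed

text \<open>Two routes from (p q)(a v) to a (p (q v)): q and then p move past a, or the pair p q
  moves past a as a whole. The hexagon for a pair splits the second crossing, and the core identity
  aligns the brackets.\<close>

lemma two_past_one:
 assumes i: "indep4 p q a v"
 shows "L3 p a (L2D q v) (braidX Q) \<cdot> L3 q a v (braidX Q) \<cdot> L3 p q (L2D a v) phi =
  L3 p q v phi \<cdot> L3 (L2D p q) a v (braidX Q)"
proof -
 note j = indep4_perm(2)[OF i]
 note l = indep4_perm(1)[OF j]
 note d = indep4D[OF i]
 note i3 = indep4_3[OF i]
 note j3 = indep4_3[OF j]
 note l3 = indep4_3[OF l]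
 have m: "indep4 p a q v" "indep3 a q v" by (rule j, rule j3(4))
 show ?thesis
  unfolding L3_braidX[OF j3(7)] L3_braidX[OF i3(4)] L3_braidX[OF i3(5)]
  by (rule B.chase_two_past_one[OF _ _ _ _ _ _ _ _ _ _ _ _ _ _ _ _ _ coherence_core[OF i],
     where ?F1.0 = "L3 p a (L2D q v) phi" and ?E3.0 = "L3 a p q phi" and ?E5.0 = "L3 (L2D a p) q v phi"])
   (use L3_cl[OF i3(1)] L3_cl[OF i3(2)] L3_cl[OF i3(3)] L3_cl[OF i3(4)] L3_cl[OF i3(5)] L3_cl[OF i3(6)] L3_cl[OF i3(7)]
    L3_cl[OF j3(1)] L3_cl[OF j3(2)] L3_cl[OF j3(3)] L3_cl[OF j3(4)] L3_cl[OF j3(5)] L3_cl[OF j3(6)] L3_cl[OF j3(7)]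
    L3_cl[OF l3(1)] L3_cl[OF l3(2)] L3_cl[OF l3(3)] L3_cl[OF l3(4)] L3_cl[OF l3(5)] L3_cl[OF l3(6)] L3_cl[OF l3(7)]
    L2_closed[OF d(2,3)] L2_closed[OF d(1,3)] L2_closed[OF L2D_hom[OF d(1,2,5)] d(3)]
    hexagon2[OF i3(1)] pentagon[OF l] R_natural1[OF j] in simp_all)
qed

text \<open>Two routes from (p q)(a v) to (p a)(q v): directly, or by first exchanging p and q and
  then moving q past the pair p a. The hexagon splits the last crossing into q past p and q past a;
  the former undoes the initial exchange because R is triangular.\<close>

lemma one_past_two:
 assumes i: "indep4 p q a v"
 shows "L3 p a (L2D q v) psi \<cdot> L3 q a v (braidX Q) \<cdot> L3 p q (L2D a v) phi =
  L3 q (L2D p a) v (braidX Q) \<cdot> L3 p a v psi \<cdot> L3 q p (L2D a v) phi \<cdot> L2 p q R"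
proof -
 note j = indep4_perm(2)[OF i]
 note l = indep4_perm(1)[OF i]
 note d = indep4D[OF i]
 note i3 = indep4_3[OF i]
 note j3 = indep4_3[OF j]
 note l3 = indep4_3[OF l]
 have k: "indep4 q p a v" using d by (auto simp: indep4_def)
 have nat: "L2 q p R \<cdot> L3 (L2D q p) a v psi = L3 (L2D p q) a v psi \<cdot> L2 q p R"
  by (rule R_natural1[OF k psi_closed, symmetric])
 show ?thesis
  unfolding L3_braidX[OF i3(4)] L3_braidX[OF l3(6)]
  by (rule B.chase_one_past_two[OF _ _ _ _ _ _ _ _ _ _ _ _ _ _ _ _ _ _ _ _ _ coherence_core[OF i],
     where rqp = "L2 q p R" and ?E1.0 = "L3 p a v phi" and ?E2.0 = "L3 q (L2D p a) v phi" and ?E3.0 = "L3 q p a phi"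
      and ?E3' = "L3 q p a psi" and ?E5.0 = "L3 (L2D q p) a v phi" and ?E5' = "L3 (L2D q p) a v psi"])
   (use L3_cl[OF i3(1)] L3_cl[OF i3(2)] L3_cl[OF i3(3)] L3_cl[OF i3(4)] L3_cl[OF i3(5)] L3_cl[OF i3(6)] L3_cl[OF i3(7)]
    L3_cl[OF j3(1)] L3_cl[OF j3(2)] L3_cl[OF j3(3)] L3_cl[OF j3(4)] L3_cl[OF j3(5)] L3_cl[OF j3(6)] L3_cl[OF j3(7)]
    L3_cl[OF l3(1)] L3_cl[OF l3(2)] L3_cl[OF l3(3)] L3_cl[OF l3(4)] L3_cl[OF l3(5)] L3_cl[OF l3(6)] L3_cl[OF l3(7)]
    L2_closed[OF d(2,3)] L2_closed[OF d(1,2)] L2_closed[OF d(2,1)] L2_closed[OF d(2) L2D_hom[OF d(1,3,6)]]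
    hexagon1[OF l3(1)] pentagon[OF l] nat R_inverse[OF d(2,1,11)]
    L3_inv(2)[OF l3(1)] L3_inv(2)[OF l3(4)] L3_inv(2)[OF l3(6)] L3_inv(1)[OF l3(5)] in simp_all)
qed

end

section \<open>Counit normalizations and antipode identities\<close>

context qhopf
begin

lemma H_ring: "monoid H" using kalgD(3)[OF kalgH] .

lemmas H_assoc = monoid.m_assoc[OF H_ring]
lemmas H_one [simp] = monoid.l_one[OF H_ring] monoid.r_one[OF H_ring]

lemma counit1: "h <: H ==> sum2 Q H (D h) (%x y. ep x \<odot>\<^bsub>H\<^esub> y) = h"
 and counit2: "h <: H ==> sum2 Q H (D h) (%x y. ep y \<odot>\<^bsub>H\<^esub> x) = h"
 and phi_counit: "sum3 Q HH2 phi (%x y z. ep y \<odot>\<^bsub>HH2\<^esub> e2 Q x z) = \<one>\<^bsub>HH2\<^esub>"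
 using ax_bialgebra by (auto simp: quasi_bialgebra_def Let_def)

lemma antipode1: "h <: H ==>
   sum2 Q H (D h) (%x y. S x ** al ** y) = ep h \<odot>\<^bsub>H\<^esub> al"
 and antipode2: "h <: H ==>
   sum2 Q H (D h) (%x y. x ** be ** S y) = ep h \<odot>\<^bsub>H\<^esub> be"
 and antipode3: "sum3 Q H phi (%x y z. x ** be ** S y ** al ** z) = \<one>\<^bsub>H\<^esub>"
 and antipode4: "sum3 Q H psi (%x y z. S x ** al ** y ** be ** S z) = \<one>\<^bsub>H\<^esub>"
 using ax_antipode by (auto simp: quasi_antipode_def Let_def)

lemma bilin_lins:
 assumes "bilin K H H P b"
 shows "y <: H ==> module_lin K L H f ==> module_lin K L P (%u. b (f u) y)"
  "x <: H ==> module_lin K L H f ==> module_lin K L P (%u. b x (f u))"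
 using bilin_comp1[OF assms] bilin_comp2[OF assms] by auto

lemma trilinD:
 assumes "trilin P b"
 shows "y <: H ==> z <: H ==> module_lin K H P (%x. b x y z)"
  "x <: H ==> z <: H ==> module_lin K H P (%y. b x y z)"
  "x <: H ==> y <: H ==> module_lin K H P (%z. b x y z)"
 using assms unfolding trilin_def by blast+

lemma trilin_lins:
 assumes "trilin P b"
 shows "y <: H ==> z <: H ==> module_lin K L H f ==> module_lin K L P (%u. b (f u) y z)"
  "x <: H ==> z <: H ==> module_lin K L H f ==> module_lin K L P (%u. b x (f u) z)"
  "x <: H ==> y <: H ==> module_lin K L H f ==> module_lin K L P (%u. b x y (f u))"
  "x <: H ==> y <: H ==> z <: H ==> b x y z <: P"
 using module_lin_comp[OF trilinD(1)[OF assms]] module_lin_comp[OF trilinD(2)[OF assms]]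
  module_lin_comp[OF trilinD(3)[OF assms]] module_lin_closed[OF trilinD(3)[OF assms]] by blast+

lemma quadlinD:
 assumes "quadlin P b"
 shows "y <: H ==> z <: H ==> w <: H ==> module_lin K H P (%x. b x y z w)"
  "x <: H ==> z <: H ==> w <: H ==> module_lin K H P (%y. b x y z w)"
  "x <: H ==> y <: H ==> w <: H ==> module_lin K H P (%z. b x y z w)"
  "x <: H ==> y <: H ==> z <: H ==> module_lin K H P (%w. b x y z w)"
 using assms unfolding quadlin_def by blast+

lemma sum2_mult:
 assumes P: "module K P" and b: "bilin K H H P b" and s: "s <: HH2" and t: "t <: HH2"
 shows "sum2 Q P (s *\<^sub>2 t) b = sum2 Q P s (%x y. sum2 Q P t (%x' y'. b (x ** x') (y ** y')))"
proof -
 note l = lins bilin_lins[OF b]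
 have 1: "sum2 Q P (e2 Q x y *\<^sub>2 t) b = sum2 Q P t (%x' y'. b (x ** x') (y ** y'))"
  if xy: "x <: H" "y <: H" for x y
 proof (rule H2_ext[where f = "%t. sum2 Q P (e2 Q x y *\<^sub>2 t) b" and
    g = "%t. sum2 Q P t (%x' y'. b (x ** x') (y ** y'))", OF P _ _ _ t])
  have b': "bilin K H H P (%x' y'. b (x ** x') (y ** y'))"
   by (rule l | simp add: xy P)+
  show "module_lin K HH2 P (%t. sum2 Q P t (%x' y'. b (x ** x') (y ** y')))"
   by (rule sum2_lin[OF P b'])
  show "module_lin K HH2 P (%t. sum2 Q P (e2 Q x y *\<^sub>2 t) b)"
   by (rule lin_sum2[OF P _ b] | rule l | simp add: xy P)+
  fix x' y' assume "x' <: H" "y' <: H"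
  then show "sum2 Q P (e2 Q x y *\<^sub>2 e2 Q x' y') b = sum2 Q P (e2 Q x' y') (%x' y'. b (x ** x') (y ** y'))"
   using xy by (simp add: e2_mult sum2_e2[OF P b] sum2_e2[OF P b'])
 qed
 have b': "bilin K H H P (%x y. sum2 Q P t (%x' y'. b (x ** x') (y ** y')))"
  by (rule l | simp add: t P)+
 show ?thesis
 proof (rule H2_ext[where f = "%s. sum2 Q P (s *\<^sub>2 t) b" and
    g = "%s. sum2 Q P s (%x y. sum2 Q P t (%x' y'. b (x ** x') (y ** y')))", OF P _ sum2_lin[OF P b'] _ s])
  show "module_lin K HH2 P (%s. sum2 Q P (s *\<^sub>2 t) b)"
   by (rule lin_sum2[OF P _ b] | rule l | simp add: t P)+
 qed (simp add: 1 sum2_e2[OF P b'])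
qed

lemma sum3_mult:
 assumes P: "module K P" and b: "trilin P b" and s: "s <: HH3" and t: "t <: HH3"
 shows "sum3 Q P (s *\<^sub>3 t) b =
  sum3 Q P s (%x y z. sum3 Q P t (%x' y' z'. b (x ** x') (y ** y') (z ** z')))"
proof -
 note l = lins trilin_lins(1-3)[OF b]
 have 1: "sum3 Q P (e3 Q x y z *\<^sub>3 t) b = sum3 Q P t (%x' y' z'. b (x ** x') (y ** y') (z ** z'))"
  if xy: "x <: H" "y <: H" "z <: H" for x y z
 proof (rule H3_ext[where f = "%t. sum3 Q P (e3 Q x y z *\<^sub>3 t) b" and
    g = "%t. sum3 Q P t (%x' y' z'. b (x ** x') (y ** y') (z ** z'))", OF P _ _ _ t])
  have b': "trilin P (%x' y' z'. b (x ** x') (y ** y') (z ** z'))"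
   by (rule l | simp add: xy P)+
  show "module_lin K HH3 P (%t. sum3 Q P t (%x' y' z'. b (x ** x') (y ** y') (z ** z')))"
   by (rule sum3_lin[OF P b'])
  show "module_lin K HH3 P (%t. sum3 Q P (e3 Q x y z *\<^sub>3 t) b)"
   by (rule lin_sum3[OF P _ b] | rule l | simp add: xy P)+
  fix x' y' z' assume "x' <: H" "y' <: H" "z' <: H"
  then show "sum3 Q P (e3 Q x y z *\<^sub>3 e3 Q x' y' z') b =
    sum3 Q P (e3 Q x' y' z') (%x' y' z'. b (x ** x') (y ** y') (z ** z'))"
   using xy by (simp add: e3_mult sum3_e3[OF P b] sum3_e3[OF P b'])
 qed
 have b': "trilin P (%x y z. sum3 Q P t (%x' y' z'. b (x ** x') (y ** y') (z ** z')))"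
  by (rule l | simp add: t P)+
 show ?thesis
 proof (rule H3_ext[where f = "%s. sum3 Q P (s *\<^sub>3 t) b" and
    g = "%s. sum3 Q P s (%x y z. sum3 Q P t (%x' y' z'. b (x ** x') (y ** y') (z ** z')))",
    OF P _ sum3_lin[OF P b'] _ s])
  show "module_lin K HH3 P (%s. sum3 Q P (s *\<^sub>3 t) b)"
   by (rule lin_sum3[OF P _ b] | rule l | simp add: t P)+
 qed (simp add: 1 sum3_e3[OF P b'])
qed

text \<open>The universal choice of four commuting legs: an identity between words in these
  embeddings is an identity in the fourfold tensor power itself. Positions 1 to 4 will belong to the
  arguments p, q, a, v.\<close>

abbreviation "i1 \<equiv> (%x. e4 Q x \<one>\<^bsub>H\<^esub> \<one>\<^bsub>H\<^esub> \<one>\<^bsub>H\<^esub>)"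
abbreviation "i2 \<equiv> (%x. e4 Q \<one>\<^bsub>H\<^esub> x \<one>\<^bsub>H\<^esub> \<one>\<^bsub>H\<^esub>)"
abbreviation "i3 \<equiv> (%x. e4 Q \<one>\<^bsub>H\<^esub> \<one>\<^bsub>H\<^esub> x \<one>\<^bsub>H\<^esub>)"
abbreviation "i4 \<equiv> (%x. e4 Q \<one>\<^bsub>H\<^esub> \<one>\<^bsub>H\<^esub> \<one>\<^bsub>H\<^esub> x)"

lemma qalg4: "qhopf_alg Q HH4"
 by unfold_locales (rule kalgH4)

lemma indep_i: "qhopf_alg.indep4 Q HH4 i1 i2 i3 i4"
 unfolding qhopf_alg.indep4_def[OF qalg4] alghom_def qhopf_alg.commute_def[OF qalg4]
 by (auto simp: e4_mult one_H4 intro!: lin_e4 module_lin_id)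

end

context qhopf_alg
begin

interpretation B: monoid B by (rule monB)

text \<open>The leg of the unit object, on which H acts through the counit.\<close>

definition triv :: "'h => 'b" where "triv h = ep h \<odot>\<^bsub>B\<^esub> \<one>\<^bsub>B\<^esub>"

lemma B_smult:
 assumes "r <: K" "x <: B" "y <: B"
 shows "(r \<odot>\<^bsub>B\<^esub> x) \<cdot> y = r \<odot>\<^bsub>B\<^esub> (x \<cdot> y)" "x \<cdot> (r \<odot>\<^bsub>B\<^esub> y) = r \<odot>\<^bsub>B\<^esub> (x \<cdot> y)"
 using module_lin_smult[OF bilin_lin1[OF bilB assms(3)] assms(1,2)]
  module_lin_smult[OF bilin_lin2[OF bilB assms(2)] assms(1,3)] by auto

lemma triv_hom: "Hhom triv"
proof -
 interpret M: module K B by (rule modB)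
 have "module_lin K H B triv" unfolding triv_def[abs_def]
  by (rule lin_ep[OF modB B.one_closed module_lin_id])
 then show ?thesis
  unfolding alghom_def by (auto simp: triv_def B_smult M.smult_assoc1[symmetric] M.R.m_comm)
qed

lemma triv_commute: "Hhom f ==> commute f triv" "Hhom f ==> commute triv f"
 using hom_closed by (auto simp: commute_def triv_def B_smult)

text \<open>The two counit axioms, read as: tensoring a leg with the unit object does not change
  it.\<close>

lemma L2D_triv:
 assumes "Hhom f" "x <: H"
 shows "L2D triv f x = f x" "L2D f triv x = f x"
proof -
 have lin: "module_lin K H B f" by (rule alghomD(1)[OF assms(1)])
 have "L2D triv f x = sum2 Q B (D x) (%a c. f (ep a \<odot>\<^bsub>H\<^esub> c))"
  unfolding L2D_def L2_def
  by (rule sum2_cong[OF modB])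
   (use assms in "simp_all add: triv_def B_smult hom_closed module_lin_smult[OF lin] module_smult_closed[OF modH] module_smult_closed[OF modB]")
 also have "... = f (sum2 Q H (D x) (%a c. ep a \<odot>\<^bsub>H\<^esub> c))"
  by (rule sum2_comp[symmetric, OF modH modB lin]) (use assms in "simp_all add: module_smult_closed[OF modH]")
 finally show "L2D triv f x = f x" using counit1 assms by simp
 have "L2D f triv x = sum2 Q B (D x) (%a c. f (ep c \<odot>\<^bsub>H\<^esub> a))"
  unfolding L2D_def L2_def
  by (rule sum2_cong[OF modB])
   (use assms in "simp_all add: triv_def B_smult hom_closed module_lin_smult[OF lin] module_smult_closed[OF modH] module_smult_closed[OF modB]")
 also have "... = f (sum2 Q H (D x) (%a c. ep c \<odot>\<^bsub>H\<^esub> a))"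
  by (rule sum2_comp[symmetric, OF modH modB lin]) (use assms in "simp_all add: module_smult_closed[OF modH]")
 finally show "L2D f triv x = f x" using counit2 assms by simp
qed

lemma L3_cong:
 assumes "!!x. x <: H ==> f x = f' x" "!!x. x <: H ==> g x = g' x" "!!x. x <: H ==> h x = h' x"
  "Hhom f'" "Hhom g'" "Hhom h'" "t <: HH3"
 shows "L3 f g h t = L3 f' g' h' t"
 unfolding L3_def by (rule sum3_cong[OF modB assms(7)]) (use assms(1-6) in "simp_all add: hom_closed")

lemma L3_middle_counit:
 assumes "Hhom f" "Hhom g" "commute f g"
 shows "L3 f triv g phi = \<one>\<^bsub>B\<^esub>"
proof -
 note a = L2_alghom[OF assms]
 note lin = alghomD(1)[OF a]
 have "L3 f triv g phi = sum3 Q B phi (%x y z. L2 f g (ep y \<odot>\<^bsub>HH2\<^esub> e2 Q x z))"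
  unfolding L3_def
  by (rule sum3_cong[OF modB phi_closed])
   (use assms in \<open>simp_all add: triv_def B_smult hom_closed module_lin_smult[OF lin] L2_e2
    module_smult_closed[OF modH2] module_smult_closed[OF modB]\<close>)
 also have "... = L2 f g (sum3 Q HH2 phi (%x y z. ep y \<odot>\<^bsub>HH2\<^esub> e2 Q x z))"
  by (rule sum3_comp[symmetric, OF modH2 modB lin phi_closed]) (simp add: module_smult_closed[OF modH2])
 finally show ?thesis unfolding phi_counit using alghomD(2)[OF a] by simp
qed

lemma indep4_triv:
 assumes "indep3 f g k"
 shows "indep4 f g triv k"
 using indep3D[OF assms] triv_hom triv_commute by (simp add: indep4_def)

text \<open>Let x be the associator with trivial last leg. In the pentagon with two trivial legs the
  factors with trivial middle leg equal 1 by axiom, and what remains is x = x x. Since x is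
  invertible, x = 1.\<close>

lemma L3_right_counit:
 assumes "Hhom f" "Hhom g" "commute f g"
 shows "L3 f g triv phi = \<one>\<^bsub>B\<^esub>" "L3 f g triv psi = \<one>\<^bsub>B\<^esub>"
proof -
 have i3: "indep3 f g triv" using assms triv_hom triv_commute by (simp add: indep3_def)
 have i: "indep4 f g triv triv" by (rule indep4_triv[OF i3])
 have c: "L3 f g triv phi <: B" "L3 f g triv psi <: B"
  by (auto intro: L3_cl[OF i3])
 have "L3 f g (L2D triv triv) phi = L3 f g triv phi"
  by (rule L3_cong) (use assms triv_hom in "simp_all add: L2D_triv")
 moreover have "L3 (L2D f g) triv triv phi = \<one>\<^bsub>B\<^esub>" "L3 g triv triv phi = \<one>\<^bsub>B\<^esub>"
  using assms triv_hom triv_commute L2D_hom by (simp_all add: L3_middle_counit)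
 moreover have "L3 f (L2D g triv) triv phi = L3 f g triv phi"
  by (rule L3_cong) (use assms triv_hom in "simp_all add: L2D_triv")
 ultimately have "L3 f g triv phi = L3 f g triv phi \<cdot> L3 f g triv phi"
  using pentagon[OF i] c by simp
 then have "L3 f g triv phi \<cdot> L3 f g triv psi = L3 f g triv phi \<cdot> (L3 f g triv phi \<cdot> L3 f g triv psi)"
  using c by (metis B.m_assoc)
 then show 1: "L3 f g triv phi = \<one>\<^bsub>B\<^esub>" using L3_inv(1)[OF i3] c by simp
 show "L3 f g triv psi = \<one>\<^bsub>B\<^esub>" using L3_inv(1)[OF i3] c 1 by simp
qed

lemma L3_middle_counit_inverse:
 assumes "Hhom f" "Hhom g" "commute f g"
 shows "L3 f triv g psi = \<one>\<^bsub>B\<^esub>"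
proof -
 have i3: "indep3 f triv g" using assms triv_hom triv_commute by (simp add: indep3_def)
 show ?thesis using L3_inv(1)[OF i3] L3_middle_counit[OF assms] L3_cl[OF i3 psi_closed] by simp
qed

end

section \<open>From words in legs back to Sweedler sums; two solved forms of the pentagon\<close>

context qhopf_alg
begin

interpretation B: monoid B by (rule monB)

lemma eval_L2:
 assumes P: "module K P" and l: "module_lin K B P \<Theta>" and h: "Hhom f" "Hhom g" and t: "t <: HH2"
 shows "\<Theta> (L2 f g t) = sum2 Q P t (%x y. \<Theta> (f x \<cdot> g y))"
 unfolding L2_def by (rule sum2_comp[OF modB P l t]) (use h in "simp add: hom_closed")

lemma eval_L3:
 assumes P: "module K P" and l: "module_lin K B P \<Theta>" and h: "Hhom f" "Hhom g" "Hhom h" and t: "t <: HH3"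
 shows "\<Theta> (L3 f g h t) = sum3 Q P t (%x y z. \<Theta> (f x \<cdot> g y \<cdot> h z))"
 unfolding L3_def by (rule sum3_comp[OF modB P l t]) (use h in "simp add: hom_closed")

lemma eval_L3D1:
 assumes P: "module K P" and l: "module_lin K B P \<Theta>" and i: "indep4 f f' g h" and t: "t <: HH3"
 shows "\<Theta> (L3 (L2D f f') g h t) = sum3 Q P t (%x y z. sum2 Q P (D x) (%a c. \<Theta> (f a \<cdot> f' c \<cdot> g y \<cdot> h z)))"
proof -
 note d = indep4D[OF i]
 note hc = hom_closed[OF d(1)] hom_closed[OF d(2)] hom_closed[OF d(3)] hom_closed[OF d(4)]
 have 1: "\<Theta> (L2D f f' x \<cdot> g y \<cdot> h z) = sum2 Q P (D x) (%a c. \<Theta> (f a \<cdot> f' c \<cdot> g y \<cdot> h z))"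
  if "x <: H" "y <: H" "z <: H" for x y z
  unfolding L2D_def
  by (rule eval_L2[OF P _ d(1,2), where \<Theta> = "%u. \<Theta> (u \<cdot> g y \<cdot> h z)"])
   (use that in "auto intro!: module_lin_comp[OF l] bilin_comp1[OF bilB] module_lin_id hc")
 show ?thesis
  by (subst eval_L3[OF P l L2D_hom[OF d(1,2,5)] d(3,4) t], rule sum3_cong[OF P t])
   (simp_all add: 1 sum2_closed P module_lin_closed[OF l] hc)
qed

lemma eval_L3D2:
 assumes P: "module K P" and l: "module_lin K B P \<Theta>" and i: "indep4 f g g' h" and t: "t <: HH3"
 shows "\<Theta> (L3 f (L2D g g') h t) = sum3 Q P t (%x y z. sum2 Q P (D y) (%a c. \<Theta> (f x \<cdot> (g a \<cdot> g' c) \<cdot> h z)))"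
proof -
 note d = indep4D[OF i]
 note hc = hom_closed[OF d(1)] hom_closed[OF d(2)] hom_closed[OF d(3)] hom_closed[OF d(4)]
 have 1: "\<Theta> (f x \<cdot> L2D g g' y \<cdot> h z) = sum2 Q P (D y) (%a c. \<Theta> (f x \<cdot> (g a \<cdot> g' c) \<cdot> h z))"
  if "x <: H" "y <: H" "z <: H" for x y z
  unfolding L2D_def
  by (rule eval_L2[OF P _ d(2,3), where \<Theta> = "%u. \<Theta> (f x \<cdot> u \<cdot> h z)"])
   (use that in "auto intro!: module_lin_comp[OF l] bilin_comp1[OF bilB] bilin_comp2[OF bilB] module_lin_id hc")
 show ?thesis
  by (subst eval_L3[OF P l d(1) L2D_hom[OF d(2,3,7)] d(4) t], rule sum3_cong[OF P t])
   (simp_all add: 1 sum2_closed P module_lin_closed[OF l] hc)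
qed

lemma eval_L3D3:
 assumes P: "module K P" and l: "module_lin K B P \<Theta>" and i: "indep4 f g h h'" and t: "t <: HH3"
 shows "\<Theta> (L3 f g (L2D h h') t) = sum3 Q P t (%x y z. sum2 Q P (D z) (%a c. \<Theta> (f x \<cdot> g y \<cdot> (h a \<cdot> h' c))))"
proof -
 note d = indep4D[OF i]
 note hc = hom_closed[OF d(1)] hom_closed[OF d(2)] hom_closed[OF d(3)] hom_closed[OF d(4)]
 have 1: "\<Theta> (f x \<cdot> g y \<cdot> L2D h h' z) = sum2 Q P (D z) (%a c. \<Theta> (f x \<cdot> g y \<cdot> (h a \<cdot> h' c)))"
  if "x <: H" "y <: H" "z <: H" for x y z
  unfolding L2D_def
  by (rule eval_L2[OF P _ d(3,4), where \<Theta> = "%u. \<Theta> (f x \<cdot> g y \<cdot> u)"])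
   (use that in "auto intro!: module_lin_comp[OF l] bilin_comp1[OF bilB] bilin_comp2[OF bilB] module_lin_id hc")
 show ?thesis
  by (subst eval_L3[OF P l d(1,2) L2D_hom[OF d(3,4,10)] t], rule sum3_cong[OF P t])
   (simp_all add: 1 sum2_closed P module_lin_closed[OF l] hc)
qed

text \<open>Solved so that the factor with a coproduct in its last leg stands on the far left, where
  the contraction used in \<open>zigzag1\<close> can absorb it.\<close>

lemma pentagon_left:
 assumes i: "indep4 f g h k"
 shows "L3 (L2D f g) h k phi \<cdot> L3 f g h psi = L3 f g (L2D h k) psi \<cdot> (L3 g h k phi \<cdot> L3 f (L2D g h) k phi)"
proof -
 note i3 = indep4_3[OF i]
 note c = L3_cl[OF i3(1)] L3_cl[OF i3(4)] L3_cl[OF i3(5)] L3_cl[OF i3(6)] L3_cl[OF i3(7)]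
 have "L3 (L2D f g) h k phi \<cdot> L3 f g h psi = L3 f g (L2D h k) psi \<cdot> L3 f g (L2D h k) phi \<cdot> L3 (L2D f g) h k phi \<cdot> L3 f g h psi"
  using c by (simp add: L3_inv(2)[OF i3(7)])
 also have "... = L3 f g (L2D h k) psi \<cdot> (L3 f g (L2D h k) phi \<cdot> L3 (L2D f g) h k phi) \<cdot> L3 f g h psi"
  using c by (simp add: B.m_assoc)
 also have "... = L3 f g (L2D h k) psi \<cdot> (L3 g h k phi \<cdot> L3 f (L2D g h) k phi) \<cdot> (L3 f g h phi \<cdot> L3 f g h psi)"
  unfolding pentagon[OF i] using c by (simp add: B.m_assoc)
 finally show ?thesis using c by (simp add: L3_inv(1)[OF i3(1)])
qed

text \<open>Solved so that the factor with a coproduct in its last leg stands on the far right, as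
  the contraction in \<open>zigzag2\<close> requires.\<close>

lemma pentagon_right:
 assumes i: "indep4 f g h k"
 shows "L3 f g h phi \<cdot> L3 (L2D f g) h k psi = L3 f (L2D g h) k psi \<cdot> L3 g h k psi \<cdot> L3 f g (L2D h k) phi"
proof -
 note i3 = indep4_3[OF i]
 note c = L3_cl[OF i3(1)] L3_cl[OF i3(4)] L3_cl[OF i3(5)] L3_cl[OF i3(6)] L3_cl[OF i3(7)]
 have "L3 f (L2D g h) k psi \<cdot> L3 g h k psi \<cdot> L3 f g (L2D h k) phi =
   L3 f (L2D g h) k psi \<cdot> L3 g h k psi \<cdot> (L3 f g (L2D h k) phi \<cdot> (L3 (L2D f g) h k phi \<cdot> L3 (L2D f g) h k psi))"
  using c by (simp add: L3_inv(1)[OF i3(5)])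
 also have "... = L3 f (L2D g h) k psi \<cdot> L3 g h k psi \<cdot> (L3 f g (L2D h k) phi \<cdot> L3 (L2D f g) h k phi) \<cdot> L3 (L2D f g) h k psi"
  using c by (simp add: B.m_assoc)
 also have "... = L3 f (L2D g h) k psi \<cdot> (L3 g h k psi \<cdot> L3 g h k phi) \<cdot> L3 f (L2D g h) k phi \<cdot> L3 f g h phi \<cdot> L3 (L2D f g) h k psi"
  unfolding pentagon[OF i] using c by (simp add: B.m_assoc)
 also have "... = L3 f (L2D g h) k psi \<cdot> L3 f (L2D g h) k phi \<cdot> L3 f g h phi \<cdot> L3 (L2D f g) h k psi"
  using c by (simp add: L3_inv(2)[OF i3(4)])
 finally show ?thesis using c by (simp add: L3_inv(2)[OF i3(6)])
qed

end

context qhopf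
begin

interpretation E: qhopf_alg Q HH4 by (rule qalg4)

lemmas i_indep = E.indep4D[OF indep_i]

lemma antipode_absorb1:
 assumes "z <: H" "u <: H" "w <: H" and P: "module K P" and g: "module_lin K H P g"
 shows "sum2 Q P (D z) (%a c. g (u ** (S a ** al ** c) ** w)) = ep z \<odot>\<^bsub>P\<^esub> g (u ** al ** w)"
proof -
 have l: "module_lin K H P (%t. g (u ** t ** w))"
  by (rule module_lin_comp[OF g] lins | simp add: assms)+
 have "sum2 Q P (D z) (%a c. g (u ** (S a ** al ** c) ** w)) = g (u ** (ep z \<odot>\<^bsub>H\<^esub> al) ** w)"
  unfolding antipode1[OF assms(1), symmetric]
  by (rule sum2_comp[OF modH P l, symmetric]) (use assms in simp_all)
 then show ?thesis using module_lin_smult[OF l ep_simps(1) al_closed] assms(1) by simp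
qed

lemma antipode_absorb2:
 assumes "z <: H" "u <: H" "w <: H" and P: "module K P" and g: "module_lin K H P g"
 shows "sum2 Q P (D z) (%a c. g (u ** (a ** be ** S c) ** w)) = ep z \<odot>\<^bsub>P\<^esub> g (u ** be ** w)"
proof -
 have l: "module_lin K H P (%t. g (u ** t ** w))"
  by (rule module_lin_comp[OF g] lins | simp add: assms)+
 have "sum2 Q P (D z) (%a c. g (u ** (a ** be ** S c) ** w)) = g (u ** (ep z \<odot>\<^bsub>H\<^esub> be) ** w)"
  unfolding antipode2[OF assms(1), symmetric]
  by (rule sum2_comp[OF modH P l, symmetric]) (use assms in simp_all)
 then show ?thesis using module_lin_smult[OF l ep_simps(1) be_closed] assms(1) by simp
qed

text \<open>The counit in the middle leg turns the associator into 1 \<otimes> 1, and the same holds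
  for its inverse; b is then evaluated there as a linear map on \<open>HH2\<close>.\<close>

lemma sum3_eps2:
 assumes P: "module K P" and b: "bilin K H H P b" and t: "t \<in> {phi, psi}"
 shows "sum3 Q P t (%x y z. ep y \<odot>\<^bsub>P\<^esub> b x z) = b \<one>\<^bsub>H\<^esub> \<one>\<^bsub>H\<^esub>"
proof -
 interpret P: module K P by (rule P)
 interpret E2: qhopf_alg Q HH2 by unfold_locales (rule kalgH2)
 let ?f = "%x. e2 Q x \<one>\<^bsub>H\<^esub>" and ?g = "%y. e2 Q \<one>\<^bsub>H\<^esub> y"
 have f: "alghom K H HH2 ?f" "alghom K H HH2 ?g"
  unfolding alghom_def by (auto simp: one_H2 e2_mult intro: bilin_lin1[OF e2_bilin] bilin_lin2[OF e2_bilin])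
 have c: "E2.commute ?f ?g" by (simp add: E2.commute_def e2_mult)
 have l: "module_lin K HH2 P (%t. sum2 Q P t b)" by (rule sum2_lin[OF P b])
 have t': "t <: HH3" using t by auto
 have 1: "E2.L3 ?f E2.triv ?g t = \<one>\<^bsub>HH2\<^esub>"
  using t E2.L3_middle_counit[OF f c] E2.L3_middle_counit_inverse[OF f c] by auto
 have "b \<one>\<^bsub>H\<^esub> \<one>\<^bsub>H\<^esub> = sum2 Q P (E2.L3 ?f E2.triv ?g t) b"
  unfolding 1 by (simp add: one_H2 sum2_e2[OF P b])
 also have "... = sum3 Q P t (%x y z. sum2 Q P (?f x *\<^sub>2 E2.triv y *\<^sub>2 ?g z) b)"
  by (rule E2.eval_L3[OF P l f(1) E2.triv_hom f(2) t'])
 also have "... = sum3 Q P t (%x y z. ep y \<odot>\<^bsub>P\<^esub> b x z)"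
  by (rule sum3_cong[OF P t'])
   (simp_all add: E2.triv_def E2.B_smult one_H2 e2_mult module_lin_smult[OF l] sum2_e2[OF P b] bilin_closed[OF b]
    module_smult_closed[OF modH2])
 finally show ?thesis by simp
qed

text \<open>A rigidity identity in H \<otimes> H, tested against a bilinear b. The contraction
  \<theta> sends x \<otimes> y \<otimes> z \<otimes> w to b x (y \<beta> S(z) \<alpha> w): a
  coproduct entering legs 3 and 4 from the left dies at \<alpha>, one entering legs 2 and 3 from the
  right dies at \<beta>. Applying \<theta> to both sides of \<open>pentagon_left\<close> gives the
  claim.\<close>

lemma zigzag1:
 assumes P: "module K P" and b: "bilin K H H P b"
 shows "sum3 Q P phi (%x y z. sum2 Q P (D x) (%a c. sum3 Q P psi (%u v w.
   b (a ** u) (c ** v ** be ** S (y ** w) ** al ** z)))) = b \<one>\<^bsub>H\<^esub> \<one>\<^bsub>H\<^esub>"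
proof -
 interpret P: module K P by (rule P)
 let ?b = "%x y z w. b x (y ** be ** S z ** al ** w)"
 define \<theta> where "\<theta> T = sum4 Q P T ?b" for T
 note l = lins bilin_lins[OF b]
 have q: "quadlin P ?b" by (rule l | simp)+
 have \<theta>: "module_lin K HH4 P \<theta>" unfolding \<theta>_def by (rule sum4_lin[OF P q])
 have \<theta>e: "\<theta> (e4 Q x y z w) = ?b x y z w" if "x <: H" "y <: H" "z <: H" "w <: H" for x y z w
  unfolding \<theta>_def by (rule sum4_e4[OF P q that])
 note bc = bilin_closed[OF b]
 note \<theta>c = module_lin_closed[OF \<theta>]
 have \<theta>1: "module_lin K HH4 P (%T. \<theta> (T *\<^sub>4 U))" "module_lin K HH4 P (%T. \<theta> (U *\<^sub>4 T))"
  if "U <: HH4" for U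
  by (rule module_lin_comp[OF \<theta>] lins | simp add: that)+
 note t3 = E.triv_hom E.triv_commute
 have i3t: "E.indep3 i1 i2 E.triv" using i_indep t3 by (simp add: E.indep3_def)
 \<comment> \<open>As S reverses products, the two parts of the coproduct meet \<alpha> as S(a)
   \<alpha> c and leave only a counit. The whole factor thereby acts like an inverse associator with
   trivial last leg, which is 1.\<close>
 have tot: "\<theta> (E.L3 i1 i2 (E.L2D i3 i4) psi *\<^sub>4 U) = \<theta> U" if U: "U <: HH4" for U
 proof -
  have "\<theta> (e4 Q x y \<one>\<^bsub>H\<^esub> \<one>\<^bsub>H\<^esub> *\<^sub>4 E.L2D i3 i4 z *\<^sub>4 U) = \<theta> (e4 Q x y \<one>\<^bsub>H\<^esub> \<one>\<^bsub>H\<^esub> *\<^sub>4 E.triv z *\<^sub>4 U)"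
   if xyz: "x <: H" "y <: H" "z <: H" for x y z
  proof -
   have tz: "E.triv z <: HH4" "E.L2D i3 i4 z <: HH4"
    using E.hom_closed[OF E.triv_hom] E.hom_closed[OF E.L2D_hom[OF i_indep(3,4,10)]] xyz by auto
   show ?thesis
   proof (rule H4_ext[where f = "%U. \<theta> (e4 Q x y \<one>\<^bsub>H\<^esub> \<one>\<^bsub>H\<^esub> *\<^sub>4 E.L2D i3 i4 z *\<^sub>4 U)" and
      g = "%U. \<theta> (e4 Q x y \<one>\<^bsub>H\<^esub> \<one>\<^bsub>H\<^esub> *\<^sub>4 E.triv z *\<^sub>4 U)", OF P _ _ _ U])
    fix x' y' z' w' assume xyz': "x' <: H" "y' <: H" "z' <: H" "w' <: H"
    have l1: "module_lin K HH4 P (%T. \<theta> (e4 Q x y \<one>\<^bsub>H\<^esub> \<one>\<^bsub>H\<^esub> *\<^sub>4 T *\<^sub>4 e4 Q x' y' z' w'))"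
     by (rule module_lin_comp[OF \<theta>] lins | simp add: xyz xyz')+
    have "\<theta> (e4 Q x y \<one>\<^bsub>H\<^esub> \<one>\<^bsub>H\<^esub> *\<^sub>4 E.L2D i3 i4 z *\<^sub>4 e4 Q x' y' z' w') =
     sum2 Q P (D z) (%a c. \<theta> (e4 Q x y \<one>\<^bsub>H\<^esub> \<one>\<^bsub>H\<^esub> *\<^sub>4 (i3 a *\<^sub>4 i4 c) *\<^sub>4 e4 Q x' y' z' w'))"
     unfolding E.L2D_def by (rule E.eval_L2[OF P l1 i_indep(3,4)]) (use xyz in simp)
    also have "... = sum2 Q P (D z) (%a c. b (x ** x') (y ** y' ** be ** S z' ** (S a ** al ** c) ** w'))"
     by (rule sum2_cong[OF P]) (use xyz xyz' in "simp_all add: e4_mult \<theta>e bc S_mult H_assoc")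
    also have "... = ep z \<odot>\<^bsub>P\<^esub> b (x ** x') (y ** y' ** be ** S z' ** al ** w')"
     by (rule antipode_absorb1[OF _ _ _ P bilin_lin2[OF b]]) (use xyz xyz' in simp_all)
    also have "... = \<theta> (e4 Q x y \<one>\<^bsub>H\<^esub> \<one>\<^bsub>H\<^esub> *\<^sub>4 E.triv z *\<^sub>4 e4 Q x' y' z' w')"
     using xyz xyz'
     by (simp add: E.triv_def E.B_smult one_H4 e4_mult \<theta>e module_lin_smult[OF \<theta>] module_smult_closed[OF modH4])
    finally show "\<theta> (e4 Q x y \<one>\<^bsub>H\<^esub> \<one>\<^bsub>H\<^esub> *\<^sub>4 E.L2D i3 i4 z *\<^sub>4 e4 Q x' y' z' w') =
     \<theta> (e4 Q x y \<one>\<^bsub>H\<^esub> \<one>\<^bsub>H\<^esub> *\<^sub>4 E.triv z *\<^sub>4 e4 Q x' y' z' w')" .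
   qed (rule \<theta>1 | simp add: xyz tz)+
  qed
  then have "\<theta> (i1 x *\<^sub>4 i2 y *\<^sub>4 E.L2D i3 i4 z *\<^sub>4 U) = \<theta> (i1 x *\<^sub>4 i2 y *\<^sub>4 E.triv z *\<^sub>4 U)"
   if "x <: H" "y <: H" "z <: H" for x y z
   using that by (simp add: e4_mult)
  then have "\<theta> (E.L3 i1 i2 (E.L2D i3 i4) psi *\<^sub>4 U) = \<theta> (E.L3 i1 i2 E.triv psi *\<^sub>4 U)"
   using U E.hom_closed[OF E.triv_hom]
   by (subst (1 2) E.eval_L3[OF P \<theta>1(1)[OF U] i_indep(1,2) _ psi_closed])
    (auto intro!: sum3_cong P E.L2D_hom i_indep E.triv_hom \<theta>c)
  then show ?thesis
   using E.L3_right_counit(2)[OF i_indep(1,2,5)] U kalgD(3)[OF kalgH4] by (simp add: monoid.l_one)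
 qed
 \<comment> \<open>Here the coproduct in legs 2 and 3 meets \<beta> as a \<beta> S(c). The remaining
   associator contracts to 1 by \<open>antipode3\<close>, and the counit left in the middle leg of
   the other one is removed by \<open>sum3_eps2\<close>.\<close>
 have 2: "\<theta> (E.L3 i2 i3 i4 phi *\<^sub>4 E.L3 i1 (E.L2D i2 i3) i4 phi) = b \<one>\<^bsub>H\<^esub> \<one>\<^bsub>H\<^esub>"
 proof -
  have u: "E.L3 i2 i3 i4 phi <: HH4" by (rule E.L3_cl[OF E.indep4_3(4)[OF indep_i]]) simp
  have "\<theta> (E.L3 i2 i3 i4 phi *\<^sub>4 E.L3 i1 (E.L2D i2 i3) i4 phi) =
   sum3 Q P phi (%x y z. sum2 Q P (D y) (%a c. \<theta> (E.L3 i2 i3 i4 phi *\<^sub>4 (i1 x *\<^sub>4 (i2 a *\<^sub>4 i3 c) *\<^sub>4 i4 z))))"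
   by (rule E.eval_L3D2[OF P \<theta>1(2)[OF u] indep_i phi_closed])
  also have "... = sum3 Q P phi (%x y z. ep y \<odot>\<^bsub>P\<^esub> b x z)"
  proof (rule sum3_cong[OF P phi_closed])
   fix x y z assume xyz: "x <: H" "y <: H" "z <: H"
   have A: "\<theta> (E.L3 i2 i3 i4 phi *\<^sub>4 e4 Q x a c z) =
    sum3 Q P phi (%x' y' z'. b x (x' ** (a ** be ** S c) ** (S y' ** al ** z' ** z)))"
    if ac: "a <: H" "c <: H" for a c
    by (subst E.eval_L3[OF P \<theta>1(1) i_indep(2,3,4) phi_closed], use xyz ac in simp, rule sum3_cong[OF P phi_closed])
     (use xyz ac in "simp_all add: e4_mult \<theta>e bc S_mult H_assoc")
   have "sum2 Q P (D y) (%a c. \<theta> (E.L3 i2 i3 i4 phi *\<^sub>4 (i1 x *\<^sub>4 (i2 a *\<^sub>4 i3 c) *\<^sub>4 i4 z))) =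
    sum2 Q P (D y) (%a c. sum3 Q P phi (%x' y' z'. b x (x' ** (a ** be ** S c) ** (S y' ** al ** z' ** z))))"
    by (rule sum2_cong[OF P]) (use xyz in "simp_all add: e4_mult A sum3_closed P bc")
   also have "... = sum3 Q P phi (%x' y' z'. sum2 Q P (D y) (%a c. b x (x' ** (a ** be ** S c) ** (S y' ** al ** z' ** z))))"
    by (rule sum23_swap[OF P]) (use xyz in "simp_all add: bc")
   also have "... = sum3 Q P phi (%x' y' z'. ep y \<odot>\<^bsub>P\<^esub> b x (x' ** be ** S y' ** al ** z' ** z))"
   proof (rule sum3_cong[OF P phi_closed])
    fix x' y' z' assume xyz': "x' <: H" "y' <: H" "z' <: H"
    show "sum2 Q P (D y) (%a c. b x (x' ** (a ** be ** S c) ** (S y' ** al ** z' ** z))) =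
     ep y \<odot>\<^bsub>P\<^esub> b x (x' ** be ** S y' ** al ** z' ** z)"
     by (subst antipode_absorb2[OF _ _ _ P bilin_lin2[OF b]]) (use xyz xyz' in "simp_all add: H_assoc")
   qed (use xyz in "simp add: bc")
   also have "... = ep y \<odot>\<^bsub>P\<^esub> b x (sum3 Q H phi (%x' y' z'. x' ** be ** S y' ** al ** z') ** z)"
    by (rule sum3_comp[symmetric, where g = "%t. ep y \<odot>\<^bsub>P\<^esub> b x (t ** z)", OF modH P _ phi_closed])
     ((rule l | simp add: xyz P)+)
   finally show "sum2 Q P (D y) (%a c. \<theta> (E.L3 i2 i3 i4 phi *\<^sub>4 (i1 x *\<^sub>4 (i2 a *\<^sub>4 i3 c) *\<^sub>4 i4 z))) = ep y \<odot>\<^bsub>P\<^esub> b x z"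
    unfolding antipode3 using xyz by simp
  qed (simp add: bc)
  also have "... = b \<one>\<^bsub>H\<^esub> \<one>\<^bsub>H\<^esub>" by (rule sum3_eps2[OF P b]) simp
  finally show ?thesis .
 qed
 have "b \<one>\<^bsub>H\<^esub> \<one>\<^bsub>H\<^esub> = \<theta> (E.L3 (E.L2D i1 i2) i3 i4 phi *\<^sub>4 E.L3 i1 i2 i3 psi)"
  unfolding E.pentagon_left[OF indep_i] 2[symmetric]
  by (rule tot[symmetric]) (simp add: E.L3_cl[OF E.indep4_3(4)[OF indep_i]] E.L3_cl[OF E.indep4_3(6)[OF indep_i]])
 also have "... = sum3 Q P phi (%x y z. sum2 Q P (D x) (%a c. \<theta> (i1 a *\<^sub>4 i2 c *\<^sub>4 i3 y *\<^sub>4 i4 z *\<^sub>4 E.L3 i1 i2 i3 psi)))"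
  by (rule E.eval_L3D1[OF P \<theta>1(1) indep_i phi_closed]) (simp add: E.L3_cl[OF E.indep4_3(1)[OF indep_i]])
 also have "... = sum3 Q P phi (%x y z. sum2 Q P (D x) (%a c. sum3 Q P psi (%u v w.
   b (a ** u) (c ** v ** be ** S (y ** w) ** al ** z))))"
 proof (intro sum3_cong[OF P phi_closed] sum2_cong[OF P])
  fix x y z a c assume xyz: "x <: H" "y <: H" "z <: H" "a <: H" "c <: H"
  show "\<theta> (i1 a *\<^sub>4 i2 c *\<^sub>4 i3 y *\<^sub>4 i4 z *\<^sub>4 E.L3 i1 i2 i3 psi) = sum3 Q P psi (%u v w.
   b (a ** u) (c ** v ** be ** S (y ** w) ** al ** z))"
   by (subst E.eval_L3[OF P \<theta>1(2) i_indep(1-3) psi_closed], use xyz in simp, rule sum3_cong[OF P psi_closed])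
    (use xyz in "simp_all add: e4_mult \<theta>e bc")
 qed (simp_all add: sum3_closed sum2_closed P bc)
 finally show ?thesis by simp
qed

text \<open>The mirror image of \<open>zigzag1\<close>, with contraction b x (S(y) \<alpha> z
  \<beta> S(w)). Coproducts in legs 3 and 4 are now absorbed at \<beta> from the right, those in
  legs 2 and 3 at \<alpha> from the left, and \<open>antipode4\<close> finishes.\<close>

lemma zigzag2:
 assumes P: "module K P" and b: "bilin K H H P b"
 shows "sum3 Q P phi (%u v w. sum3 Q P psi (%x y z. sum2 Q P (D x) (%a c.
   b (u ** a) (S (v ** c) ** al ** (w ** y) ** be ** S z)))) = b \<one>\<^bsub>H\<^esub> \<one>\<^bsub>H\<^esub>"
proof -
 interpret P: module K P by (rule P)
 let ?b = "%x y z w. b x (S y ** al ** z ** be ** S w)"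
 define \<theta> where "\<theta> T = sum4 Q P T ?b" for T
 note l = lins bilin_lins[OF b]
 have q: "quadlin P ?b" by (rule l | simp)+
 have \<theta>: "module_lin K HH4 P \<theta>" unfolding \<theta>_def by (rule sum4_lin[OF P q])
 have \<theta>e: "\<theta> (e4 Q x y z w) = ?b x y z w" if "x <: H" "y <: H" "z <: H" "w <: H" for x y z w
  unfolding \<theta>_def by (rule sum4_e4[OF P q that])
 note bc = bilin_closed[OF b]
 note \<theta>c = module_lin_closed[OF \<theta>]
 have \<theta>1: "module_lin K HH4 P (%T. \<theta> (T *\<^sub>4 U))" "module_lin K HH4 P (%T. \<theta> (U *\<^sub>4 T))"
  if "U <: HH4" for U
  by (rule module_lin_comp[OF \<theta>] lins | simp add: that)+
 have tot: "\<theta> (U *\<^sub>4 E.L3 i1 i2 (E.L2D i3 i4) phi) = \<theta> U" if U: "U <: HH4" for U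
 proof -
  have "\<theta> (U *\<^sub>4 (e4 Q x y \<one>\<^bsub>H\<^esub> \<one>\<^bsub>H\<^esub> *\<^sub>4 E.L2D i3 i4 z)) = \<theta> (U *\<^sub>4 (e4 Q x y \<one>\<^bsub>H\<^esub> \<one>\<^bsub>H\<^esub> *\<^sub>4 E.triv z))"
   if xyz: "x <: H" "y <: H" "z <: H" for x y z
  proof -
   have tz: "E.triv z <: HH4" "E.L2D i3 i4 z <: HH4"
    using E.hom_closed[OF E.triv_hom] E.hom_closed[OF E.L2D_hom[OF i_indep(3,4,10)]] xyz by auto
   show ?thesis
   proof (rule H4_ext[where f = "%U. \<theta> (U *\<^sub>4 (e4 Q x y \<one>\<^bsub>H\<^esub> \<one>\<^bsub>H\<^esub> *\<^sub>4 E.L2D i3 i4 z))" and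
      g = "%U. \<theta> (U *\<^sub>4 (e4 Q x y \<one>\<^bsub>H\<^esub> \<one>\<^bsub>H\<^esub> *\<^sub>4 E.triv z))", OF P _ _ _ U])
    fix x' y' z' w' assume xyz': "x' <: H" "y' <: H" "z' <: H" "w' <: H"
    have l1: "module_lin K HH4 P (%T. \<theta> (e4 Q x' y' z' w' *\<^sub>4 (e4 Q x y \<one>\<^bsub>H\<^esub> \<one>\<^bsub>H\<^esub> *\<^sub>4 T)))"
     by (rule module_lin_comp[OF \<theta>] lins | simp add: xyz xyz')+
    have "\<theta> (e4 Q x' y' z' w' *\<^sub>4 (e4 Q x y \<one>\<^bsub>H\<^esub> \<one>\<^bsub>H\<^esub> *\<^sub>4 E.L2D i3 i4 z)) =
     sum2 Q P (D z) (%a c. \<theta> (e4 Q x' y' z' w' *\<^sub>4 (e4 Q x y \<one>\<^bsub>H\<^esub> \<one>\<^bsub>H\<^esub> *\<^sub>4 (i3 a *\<^sub>4 i4 c))))"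
     unfolding E.L2D_def by (rule E.eval_L2[OF P l1 i_indep(3,4)]) (use xyz in simp)
    also have "... = sum2 Q P (D z) (%a c. b (x' ** x) (S (y' ** y) ** al ** z' ** (a ** be ** S c) ** S w'))"
     by (rule sum2_cong[OF P]) (use xyz xyz' in "simp_all add: e4_mult \<theta>e bc S_mult H_assoc")
    also have "... = ep z \<odot>\<^bsub>P\<^esub> b (x' ** x) (S (y' ** y) ** al ** z' ** be ** S w')"
     by (rule antipode_absorb2[OF _ _ _ P bilin_lin2[OF b]]) (use xyz xyz' in simp_all)
    also have "... = \<theta> (e4 Q x' y' z' w' *\<^sub>4 (e4 Q x y \<one>\<^bsub>H\<^esub> \<one>\<^bsub>H\<^esub> *\<^sub>4 E.triv z))"
     using xyz xyz'
     by (simp add: E.triv_def E.B_smult one_H4 e4_mult \<theta>e module_lin_smult[OF \<theta>] module_smult_closed[OF modH4])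
    finally show "\<theta> (e4 Q x' y' z' w' *\<^sub>4 (e4 Q x y \<one>\<^bsub>H\<^esub> \<one>\<^bsub>H\<^esub> *\<^sub>4 E.L2D i3 i4 z)) =
     \<theta> (e4 Q x' y' z' w' *\<^sub>4 (e4 Q x y \<one>\<^bsub>H\<^esub> \<one>\<^bsub>H\<^esub> *\<^sub>4 E.triv z))" .
   qed (rule \<theta>1 | simp add: xyz tz)+
  qed
  then have "\<theta> (U *\<^sub>4 (i1 x *\<^sub>4 i2 y *\<^sub>4 E.L2D i3 i4 z)) = \<theta> (U *\<^sub>4 (i1 x *\<^sub>4 i2 y *\<^sub>4 E.triv z))"
   if "x <: H" "y <: H" "z <: H" for x y z
   using that by (simp add: e4_mult)
  then have "\<theta> (U *\<^sub>4 E.L3 i1 i2 (E.L2D i3 i4) phi) = \<theta> (U *\<^sub>4 E.L3 i1 i2 E.triv phi)"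
   using U E.hom_closed[OF E.triv_hom]
   by (subst (1 2) E.eval_L3[OF P \<theta>1(2)[OF U] i_indep(1,2) _ phi_closed])
    (auto intro!: sum3_cong P E.L2D_hom i_indep E.triv_hom \<theta>c)
  then show ?thesis
   using E.L3_right_counit(1)[OF i_indep(1,2,5)] U kalgD(3)[OF kalgH4] by (simp add: monoid.r_one)
 qed
 have bS: "bilin K H H P (%x z. b x (S z))" by (rule l | simp)+
 have 2: "\<theta> (E.L3 i1 (E.L2D i2 i3) i4 psi *\<^sub>4 E.L3 i2 i3 i4 psi) = b \<one>\<^bsub>H\<^esub> \<one>\<^bsub>H\<^esub>"
 proof -
  have u: "E.L3 i2 i3 i4 psi <: HH4" by (rule E.L3_cl[OF E.indep4_3(4)[OF indep_i]]) simp
  have "\<theta> (E.L3 i1 (E.L2D i2 i3) i4 psi *\<^sub>4 E.L3 i2 i3 i4 psi) =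
   sum3 Q P psi (%x y z. sum2 Q P (D y) (%a c. \<theta> (i1 x *\<^sub>4 (i2 a *\<^sub>4 i3 c) *\<^sub>4 i4 z *\<^sub>4 E.L3 i2 i3 i4 psi)))"
   by (rule E.eval_L3D2[OF P \<theta>1(1)[OF u] indep_i psi_closed])
  also have "... = sum3 Q P psi (%x y z. ep y \<odot>\<^bsub>P\<^esub> b x (S z))"
  proof (rule sum3_cong[OF P psi_closed])
   fix x y z assume xyz: "x <: H" "y <: H" "z <: H"
   have A: "\<theta> (e4 Q x a c z *\<^sub>4 E.L3 i2 i3 i4 psi) =
    sum3 Q P psi (%x' y' z'. b x (S x' ** (S a ** al ** c) ** (y' ** be ** S z' ** S z)))"
    if ac: "a <: H" "c <: H" for a c
    by (subst E.eval_L3[OF P \<theta>1(2) i_indep(2,3,4) psi_closed], use xyz ac in simp, rule sum3_cong[OF P psi_closed])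
     (use xyz ac in "simp_all add: e4_mult \<theta>e bc S_mult H_assoc")
   have "sum2 Q P (D y) (%a c. \<theta> (i1 x *\<^sub>4 (i2 a *\<^sub>4 i3 c) *\<^sub>4 i4 z *\<^sub>4 E.L3 i2 i3 i4 psi)) =
    sum2 Q P (D y) (%a c. sum3 Q P psi (%x' y' z'. b x (S x' ** (S a ** al ** c) ** (y' ** be ** S z' ** S z))))"
    by (rule sum2_cong[OF P]) (use xyz in "simp_all add: e4_mult A sum3_closed P bc")
   also have "... = sum3 Q P psi (%x' y' z'. sum2 Q P (D y) (%a c. b x (S x' ** (S a ** al ** c) ** (y' ** be ** S z' ** S z))))"
    by (rule sum23_swap[OF P]) (use xyz in "simp_all add: bc")
   also have "... = sum3 Q P psi (%x' y' z'. ep y \<odot>\<^bsub>P\<^esub> b x (S x' ** al ** y' ** be ** S z' ** S z))"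
   proof (rule sum3_cong[OF P psi_closed])
    fix x' y' z' assume xyz': "x' <: H" "y' <: H" "z' <: H"
    show "sum2 Q P (D y) (%a c. b x (S x' ** (S a ** al ** c) ** (y' ** be ** S z' ** S z))) =
     ep y \<odot>\<^bsub>P\<^esub> b x (S x' ** al ** y' ** be ** S z' ** S z)"
     by (subst antipode_absorb1[OF _ _ _ P bilin_lin2[OF b]]) (use xyz xyz' in "simp_all add: H_assoc")
   qed (use xyz in "simp add: bc")
   also have "... = ep y \<odot>\<^bsub>P\<^esub> b x (sum3 Q H psi (%x' y' z'. S x' ** al ** y' ** be ** S z') ** S z)"
    by (rule sum3_comp[symmetric, where g = "%t. ep y \<odot>\<^bsub>P\<^esub> b x (t ** S z)", OF modH P _ psi_closed])
     ((rule l | simp add: xyz P)+)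
   finally show "sum2 Q P (D y) (%a c. \<theta> (i1 x *\<^sub>4 (i2 a *\<^sub>4 i3 c) *\<^sub>4 i4 z *\<^sub>4 E.L3 i2 i3 i4 psi)) = ep y \<odot>\<^bsub>P\<^esub> b x (S z)"
    unfolding antipode4 using xyz by simp
  qed (simp add: bc)
  also have "... = b \<one>\<^bsub>H\<^esub> \<one>\<^bsub>H\<^esub>" by (subst sum3_eps2[OF P bS]) simp_all
  finally show ?thesis .
 qed
 have "b \<one>\<^bsub>H\<^esub> \<one>\<^bsub>H\<^esub> = \<theta> (E.L3 i1 i2 i3 phi *\<^sub>4 E.L3 (E.L2D i1 i2) i3 i4 psi)"
  unfolding E.pentagon_right[OF indep_i] 2[symmetric]
  by (rule tot[symmetric]) (simp add: E.L3_cl[OF E.indep4_3(4)[OF indep_i]] E.L3_cl[OF E.indep4_3(6)[OF indep_i]])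
 also have "... = sum3 Q P phi (%u v w. \<theta> (i1 u *\<^sub>4 i2 v *\<^sub>4 i3 w *\<^sub>4 E.L3 (E.L2D i1 i2) i3 i4 psi))"
  by (rule E.eval_L3[OF P \<theta>1(1) i_indep(1-3) phi_closed]) (simp add: E.L3_cl[OF E.indep4_3(5)[OF indep_i]])
 also have "... = sum3 Q P phi (%u v w. sum3 Q P psi (%x y z. sum2 Q P (D x) (%a c.
   b (u ** a) (S (v ** c) ** al ** (w ** y) ** be ** S z))))"
 proof (rule sum3_cong[OF P phi_closed])
  fix u v w assume uvw: "u <: H" "v <: H" "w <: H"
  have "\<theta> (i1 u *\<^sub>4 i2 v *\<^sub>4 i3 w *\<^sub>4 E.L3 (E.L2D i1 i2) i3 i4 psi) = sum3 Q P psi (%x y z. sum2 Q P (D x) (%a c.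
   \<theta> (i1 u *\<^sub>4 i2 v *\<^sub>4 i3 w *\<^sub>4 (i1 a *\<^sub>4 i2 c *\<^sub>4 i3 y *\<^sub>4 i4 z))))"
   by (rule E.eval_L3D1[OF P \<theta>1(2) indep_i psi_closed]) (use uvw in simp)
  also have "... = sum3 Q P psi (%x y z. sum2 Q P (D x) (%a c.
   b (u ** a) (S (v ** c) ** al ** (w ** y) ** be ** S z)))"
   by (intro sum3_cong[OF P psi_closed] sum2_cong[OF P]) (use uvw in "simp_all add: e4_mult \<theta>e bc sum2_closed P")
  finally show "\<theta> (i1 u *\<^sub>4 i2 v *\<^sub>4 i3 w *\<^sub>4 E.L3 (E.L2D i1 i2) i3 i4 psi) = sum3 Q P psi (%x y z. sum2 Q P (D x) (%a c.
   b (u ** a) (S (v ** c) ** al ** (w ** y) ** be ** S z)))" .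
 qed (simp add: sum3_closed sum2_closed P bc)
 finally show ?thesis by simp
qed

end

section \<open>Modules over H, internal homs and currying\<close>

context qhopf
begin

lemma quasi_coassoc:
 assumes "h <: H"
 defines "T1 \<equiv> sum2 Q HH3 (D h) (%x y. sum2 Q HH3 (D y) (%a b. e3 Q x a b))"
  and "T2 \<equiv> sum2 Q HH3 (D h) (%x y. sum2 Q HH3 (D x) (%a b. e3 Q a b y))"
 shows "T1 *\<^sub>3 phi = phi *\<^sub>3 T2" "T2 *\<^sub>3 psi = psi *\<^sub>3 T1"
  and "T1 <: HH3" "T2 <: HH3"
proof -
 interpret M: monoid HH3 by (rule kalgD(3)[OF kalgH3])
 have eq: "T1 = phi *\<^sub>3 T2 *\<^sub>3 psi"
  using ax_bialgebra assms(1) unfolding T1_def T2_def by (simp add: quasi_bialgebra_def Let_def)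
 show c: "T1 <: HH3" "T2 <: HH3"
  unfolding T1_def T2_def by (intro sum2_closed modH3; simp add: assms(1) sum2_closed modH3)+
 have "T1 *\<^sub>3 phi = phi *\<^sub>3 T2 *\<^sub>3 (psi *\<^sub>3 phi)" unfolding eq using c by (simp add: M.m_assoc)
 then show "T1 *\<^sub>3 phi = phi *\<^sub>3 T2" using c by (simp add: psi_phi)
 have "psi *\<^sub>3 T1 = (psi *\<^sub>3 phi) *\<^sub>3 T2 *\<^sub>3 psi" unfolding eq using c by (simp add: M.m_assoc)
 then show "T2 *\<^sub>3 psi = psi *\<^sub>3 T1" using c by (simp add: psi_phi)
qed

lemma sum3_coproduct:
 assumes P: "module K P" and b: "trilin P b" and h: "h <: H"
 shows "sum3 Q P (sum2 Q HH3 (D h) (%x y. sum2 Q HH3 (D y) (%a c. e3 Q x a c))) b =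
   sum2 Q P (D h) (%x y. sum2 Q P (D y) (%a c. b x a c))"
  "sum3 Q P (sum2 Q HH3 (D h) (%x y. sum2 Q HH3 (D x) (%a c. e3 Q a c y))) b =
   sum2 Q P (D h) (%x y. sum2 Q P (D x) (%a c. b a c y))"
proof -
 note l = sum3_lin[OF P b]
 note bc = trilin_lins(4)[OF b]
 note c = sum2_comp[where g = "%t. sum3 Q P t b", OF modH3 P l]
 show "sum3 Q P (sum2 Q HH3 (D h) (%x y. sum2 Q HH3 (D y) (%a c. e3 Q x a c))) b =
   sum2 Q P (D h) (%x y. sum2 Q P (D y) (%a c. b x a c))"
  apply (subst c, simp add: h, simp add: sum2_closed modH3)
  apply (rule sum2_cong[OF P], simp add: h)
   apply (subst c, simp, simp, rule sum2_cong[OF P])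
    apply (simp_all add: sum3_e3[OF P b] bc sum2_closed P)
  done
 show "sum3 Q P (sum2 Q HH3 (D h) (%x y. sum2 Q HH3 (D x) (%a c. e3 Q a c y))) b =
   sum2 Q P (D h) (%x y. sum2 Q P (D x) (%a c. b a c y))"
  apply (subst c, simp add: h, simp add: sum2_closed modH3)
  apply (rule sum2_cong[OF P], simp add: h)
   apply (subst c, simp, simp, rule sum2_cong[OF P])
    apply (simp_all add: sum3_e3[OF P b] bc sum2_closed P)
  done
qed

text \<open>Quasi-coassociativity as it is used in practice: a translate by h in front of the
  associator is moved behind it inside a trilinear expression with explicit Sweedler sums.\<close>

lemma coassoc_phi:
 assumes P: "module K P" and b: "trilin P b" and h: "h <: H"
 shows "sum2 Q P (D h) (%x y. sum2 Q P (D y) (%a c. sum3 Q P phi (%u v w. b (x ** u) (a ** v) (c ** w)))) =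
  sum3 Q P phi (%u v w. sum2 Q P (D h) (%x y. sum2 Q P (D x) (%a c. b (u ** a) (v ** c) (w ** y))))"
proof -
 note q = quasi_coassoc[OF h]
 note l = lins trilin_lins(1-3)[OF b]
 have b1: "trilin P (%x a c. sum3 Q P phi (%u v w. b (x ** u) (a ** v) (c ** w)))"
  by (rule l | simp add: P)+
 have b2: "trilin P (%a c y. b (u ** a) (v ** c) (w ** y))"
  if "u <: H" "v <: H" "w <: H" for u v w
  by (rule l | simp add: P that)+
 have "sum2 Q P (D h) (%x y. sum2 Q P (D y) (%a c. sum3 Q P phi (%u v w. b (x ** u) (a ** v) (c ** w)))) =
  sum3 Q P (sum2 Q HH3 (D h) (%x y. sum2 Q HH3 (D y) (%a c. e3 Q x a c)) *\<^sub>3 phi) b"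
  by (subst sum3_mult[OF P b q(3) phi_closed]) (rule sum3_coproduct(1)[OF P b1 h, symmetric])
 also have "... = sum3 Q P phi (%u v w. sum3 Q P (sum2 Q HH3 (D h) (%x y. sum2 Q HH3 (D x) (%a c. e3 Q a c y)))
   (%a c y. b (u ** a) (v ** c) (w ** y)))"
  unfolding q(1) by (rule sum3_mult[OF P b phi_closed q(4)])
 also have "... = sum3 Q P phi (%u v w. sum2 Q P (D h) (%x y. sum2 Q P (D x) (%a c. b (u ** a) (v ** c) (w ** y))))"
  by (rule sum3_cong[OF P phi_closed])
   (simp_all add: sum3_coproduct(2)[OF P b2 h] sum2_closed P trilin_lins(4)[OF b] h)
 finally show ?thesis .
qed

lemma coassoc_psi:
 assumes P: "module K P" and b: "trilin P b" and h: "h <: H"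
 shows "sum2 Q P (D h) (%x y. sum2 Q P (D x) (%a c. sum3 Q P psi (%u v w. b (a ** u) (c ** v) (y ** w)))) =
  sum3 Q P psi (%u v w. sum2 Q P (D h) (%x y. sum2 Q P (D y) (%a c. b (u ** x) (v ** a) (w ** c))))"
proof -
 note q = quasi_coassoc[OF h]
 note l = lins trilin_lins(1-3)[OF b]
 have b1: "trilin P (%a c y. sum3 Q P psi (%u v w. b (a ** u) (c ** v) (y ** w)))"
  by (rule l | simp add: P)+
 have b2: "trilin P (%x a c. b (u ** x) (v ** a) (w ** c))"
  if "u <: H" "v <: H" "w <: H" for u v w
  by (rule l | simp add: P that)+
 have "sum2 Q P (D h) (%x y. sum2 Q P (D x) (%a c. sum3 Q P psi (%u v w. b (a ** u) (c ** v) (y ** w)))) =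
  sum3 Q P (sum2 Q HH3 (D h) (%x y. sum2 Q HH3 (D x) (%a c. e3 Q a c y)) *\<^sub>3 psi) b"
  by (subst sum3_mult[OF P b q(4) psi_closed]) (rule sum3_coproduct(2)[OF P b1 h, symmetric])
 also have "... = sum3 Q P psi (%u v w. sum3 Q P (sum2 Q HH3 (D h) (%x y. sum2 Q HH3 (D y) (%a c. e3 Q x a c)))
   (%x a c. b (u ** x) (v ** a) (w ** c)))"
  unfolding q(2) by (rule sum3_mult[OF P b psi_closed q(3)])
 also have "... = sum3 Q P psi (%u v w. sum2 Q P (D h) (%x y. sum2 Q P (D y) (%a c. b (u ** x) (v ** a) (w ** c))))"
  by (rule sum3_cong[OF P psi_closed])
   (simp_all add: sum3_coproduct(1)[OF P b2 h] sum2_closed P trilin_lins(4)[OF b] h)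
 finally show ?thesis .
qed

lemma sum2_counit2:
 assumes P: "module K P" and g: "module_lin K H P g" and h: "h <: H"
 shows "sum2 Q P (D h) (%x y. ep y \<odot>\<^bsub>P\<^esub> g x) = g h"
proof -
 have "sum2 Q P (D h) (%x y. ep y \<odot>\<^bsub>P\<^esub> g x) = sum2 Q P (D h) (%x y. g (ep y \<odot>\<^bsub>H\<^esub> x))"
  by (rule sum2_cong[OF P])
   (simp_all add: h module_lin_smult[OF g] module_lin_closed[OF g] module_smult_closed[OF modH] module_smult_closed[OF P])
 also have "... = g (sum2 Q H (D h) (%x y. ep y \<odot>\<^bsub>H\<^esub> x))"
  by (rule sum2_comp[symmetric, OF modH P g]) (simp_all add: h module_smult_closed[OF modH])
 finally show ?thesis using counit2 h by simp
qed

text \<open>An object stripped of its grading. Evaluation, currying and composition involve no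
  signs, so they are developed for bare H-modules, and degrees are added afterwards.\<close>

definition hmod :: "('k, 'h, 'v) gmod => bool" where
 "hmod V \<longleftrightarrow> module K V \<and> bilin K H V V (act V) \<and>
   (\<forall>h\<in>carrier H. \<forall>h'\<in>carrier H. \<forall>v\<in>carrier V. act V (h ** h') v = act V h (act V h' v)) \<and>
   (\<forall>v\<in>carrier V. act V \<one>\<^bsub>H\<^esub> v = v)"

lemma hmodD:
 assumes "hmod V"
 shows "module K V" "bilin K H V V (act V)"
  "!!h h' v. h <: H ==> h' <: H ==> v <: V ==> act V (h ** h') v = act V h (act V h' v)"
  "!!v. v <: V ==> act V \<one>\<^bsub>H\<^esub> v = v"
  "!!h v. h <: H ==> v <: V ==> act V h v <: V"
proof -
 show b: "bilin K H V V (act V)" using assms by (simp add: hmod_def)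
 show "h <: H ==> v <: V ==> act V h v <: V" for h v
  by (rule bilin_closed[OF b])
qed (use assms in "simp_all add: hmod_def")

lemma hmod_obj:
 assumes V: "hm_obj Q V"
 shows "hmod V"
proof -
 have l: "module_lin K V V (act V h)" if "h <: H" for h
  using V that by (simp add: hm_obj_def Let_def)
 have "bilin K H V V (act V)"
 proof (rule bilinI)
  show "module_lin K H V (%h. act V h v)" if "v <: V" for v
   using V that by (intro module_linI module_lin_closed[OF l]) (simp_all add: hm_obj_def Let_def)
 qed (rule l)
 then show ?thesis using V by (simp add: hm_obj_def Let_def hmod_def)
qed

section \<open>Linear maps as an H-module\<close>

lemma ghom_carrier: "carrier (ghom Q V W) = {L \<in> extensional (carrier V). module_lin K V W L}"
 and ghom_zero: "\<zero>\<^bsub>ghom Q V W\<^esub> = (\<lambda>v\<in>carrier V. \<zero>\<^bsub>W\<^esub>)"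
 and ghom_add: "L \<oplus>\<^bsub>ghom Q V W\<^esub> L' = (\<lambda>v\<in>carrier V. L v \<oplus>\<^bsub>W\<^esub> L' v)"
 and ghom_smult: "r \<odot>\<^bsub>ghom Q V W\<^esub> L = (\<lambda>v\<in>carrier V. r \<odot>\<^bsub>W\<^esub> L v)"
 and ghom_act: "act (ghom Q V W) h L = (\<lambda>v\<in>carrier V. sum2 Q W (D h) (%x y. act W x (L (act V (S y) v))))"
 by (simp_all add: ghom_def Let_def)

lemma ghom_linD: "L <: (ghom Q V W) ==> module_lin K V W L"
 by (simp add: ghom_carrier)

lemma ghom_app_closed: "L <: (ghom Q V W) ==> v <: V ==> L v <: W"
 using module_lin_closed[OF ghom_linD] .

lemma ghom_eqI: "L <: (ghom Q V W) ==> L' <: (ghom Q V W) ==>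
  (!!v. v <: V ==> L v = L' v) ==> L = L'"
 by (auto simp: ghom_carrier intro: extensionalityI)

lemma ghomI:
 assumes "module K V" "module_lin K V W f"
 shows "restrict f (carrier V) <: (ghom Q V W)"
proof -
 have "module_lin K V W (restrict f (carrier V)) = module_lin K V W f"
  by (rule module_lin_cong[OF assms(1)]) simp
 then show ?thesis using assms(2) by (simp add: ghom_carrier)
qed

lemma module_ghom:
 assumes V: "module K V" and W: "module K W"
 shows "module K (ghom Q V W)"
proof -
 interpret V: module K V by (rule V)
 interpret W: module K W by (rule W)
 have ad: "L \<oplus>\<^bsub>ghom Q V W\<^esub> L' <: (ghom Q V W)"
  if "L <: (ghom Q V W)" "L' <: (ghom Q V W)" for L L'
  unfolding ghom_add by (intro ghomI V module_lin_plus W ghom_linD that)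
 have sm: "r \<odot>\<^bsub>ghom Q V W\<^esub> L <: (ghom Q V W)"
  if "L <: (ghom Q V W)" "r <: K" for r L
  unfolding ghom_smult by (intro ghomI V module_lin_smult_fun W ghom_linD that)
 have ze: "\<zero>\<^bsub>ghom Q V W\<^esub> <: (ghom Q V W)"
  unfolding ghom_zero by (intro ghomI V module_lin_zero_fun W)
 have inv: "\<exists>L'\<in>carrier (ghom Q V W). L' \<oplus>\<^bsub>ghom Q V W\<^esub> L = \<zero>\<^bsub>ghom Q V W\<^esub>"
  if L: "L <: (ghom Q V W)" for L
 proof
  show "(\<lambda>v\<in>carrier V. \<ominus>\<^bsub>W\<^esub> L v) <: (ghom Q V W)"
   by (intro ghomI V module_lin_a_inv W ghom_linD L)
  show "(\<lambda>v\<in>carrier V. \<ominus>\<^bsub>W\<^esub> L v) \<oplus>\<^bsub>ghom Q V W\<^esub> L = \<zero>\<^bsub>ghom Q V W\<^esub>"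
   using ghom_app_closed[OF L] by (auto simp: ghom_add ghom_zero W.l_neg intro!: restrict_ext)
 qed
 show ?thesis
 proof (intro moduleI abelian_groupI)
  fix L assume L: "L <: (ghom Q V W)"
  show "\<exists>L'\<in>carrier (ghom Q V W). L' \<oplus>\<^bsub>ghom Q V W\<^esub> L = \<zero>\<^bsub>ghom Q V W\<^esub>" by (rule inv[OF L])
  show "\<zero>\<^bsub>ghom Q V W\<^esub> \<oplus>\<^bsub>ghom Q V W\<^esub> L = L"
   by (rule ghom_eqI[OF ad[OF ze L] L]) (use ghom_app_closed[OF L] in "simp add: ghom_add ghom_zero")
  show "\<one>\<^bsub>K\<^esub> \<odot>\<^bsub>ghom Q V W\<^esub> L = L"
   by (rule ghom_eqI[OF sm[OF L] L]) (use ghom_app_closed[OF L] in "simp_all add: ghom_smult")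
  fix L' assume L': "L' <: (ghom Q V W)"
  note c = ghom_app_closed[OF L] ghom_app_closed[OF L']
  show "L \<oplus>\<^bsub>ghom Q V W\<^esub> L' = L' \<oplus>\<^bsub>ghom Q V W\<^esub> L"
   using c by (auto simp: ghom_add W.a_comm intro!: restrict_ext)
  fix L'' assume L'': "L'' <: (ghom Q V W)"
  show "L \<oplus>\<^bsub>ghom Q V W\<^esub> L' \<oplus>\<^bsub>ghom Q V W\<^esub> L'' = L \<oplus>\<^bsub>ghom Q V W\<^esub> (L' \<oplus>\<^bsub>ghom Q V W\<^esub> L'')"
   using c ghom_app_closed[OF L''] by (auto simp: ghom_add W.a_assoc intro!: restrict_ext)
 next
  fix r L assume r: "r <: K" and L: "L <: (ghom Q V W)"
  note c = ghom_app_closed[OF L]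
  fix L' assume L': "L' <: (ghom Q V W)"
  show "r \<odot>\<^bsub>ghom Q V W\<^esub> (L \<oplus>\<^bsub>ghom Q V W\<^esub> L') = r \<odot>\<^bsub>ghom Q V W\<^esub> L \<oplus>\<^bsub>ghom Q V W\<^esub> r \<odot>\<^bsub>ghom Q V W\<^esub> L'"
   using r c ghom_app_closed[OF L'] by (auto simp: ghom_add ghom_smult W.smult_r_distr intro!: restrict_ext)
 next
  fix r s L assume r: "r <: K" and s: "s <: K" and L: "L <: (ghom Q V W)"
  note c = ghom_app_closed[OF L]
  show "(r \<oplus>\<^bsub>K\<^esub> s) \<odot>\<^bsub>ghom Q V W\<^esub> L = r \<odot>\<^bsub>ghom Q V W\<^esub> L \<oplus>\<^bsub>ghom Q V W\<^esub> s \<odot>\<^bsub>ghom Q V W\<^esub> L"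
   using r s c by (auto simp: ghom_add ghom_smult W.smult_l_distr intro!: restrict_ext)
  show "(r \<otimes>\<^bsub>K\<^esub> s) \<odot>\<^bsub>ghom Q V W\<^esub> L = r \<odot>\<^bsub>ghom Q V W\<^esub> (s \<odot>\<^bsub>ghom Q V W\<^esub> L)"
   using r s c by (auto simp: ghom_smult W.smult_assoc1 intro!: restrict_ext)
 qed (use ad sm ze cringK in auto)
qed

lemma ghom_app_lin: "v <: V ==> module_lin K (ghom Q V W) W (%L. L v)"
 by (rule module_linI) (simp_all add: ghom_app_closed ghom_add ghom_smult)

lemma ghom_linI:
 assumes "module K V" "module K W" "module K X"
  and "!!x. x <: X ==> F x <: (ghom Q V W)"
  and "!!v. v <: V ==> module_lin K X W (%x. F x v)"
 shows "module_lin K X (ghom Q V W) F"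
proof (rule module_linI)
 interpret G: module K "ghom Q V W" by (rule module_ghom[OF assms(1,2)])
 interpret X: module K X by (rule assms(3))
 show "F x <: (ghom Q V W)" if "x <: X" for x by (rule assms(4)[OF that])
 show "F (x \<oplus>\<^bsub>X\<^esub> y) = F x \<oplus>\<^bsub>ghom Q V W\<^esub> F y" if xy: "x <: X" "y <: X" for x y
 proof (rule ghom_eqI[where V = V and W = W])
  show "F (x \<oplus>\<^bsub>X\<^esub> y) v = (F x \<oplus>\<^bsub>ghom Q V W\<^esub> F y) v" if "v <: V" for v
   using module_lin_add[OF assms(5)[OF that] xy] that by (simp add: ghom_add[where L = "F x"])
 qed (use xy assms(4) in simp_all)
 show "F (r \<odot>\<^bsub>X\<^esub> x) = r \<odot>\<^bsub>ghom Q V W\<^esub> F x" if rx: "r <: K" "x <: X" for r x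
 proof (rule ghom_eqI[where V = V and W = W])
  show "F (r \<odot>\<^bsub>X\<^esub> x) v = (r \<odot>\<^bsub>ghom Q V W\<^esub> F x) v" if "v <: V" for v
   using module_lin_smult[OF assms(5)[OF that] rx] that by (simp add: ghom_smult[where L = "F x"])
 qed (use rx assms(4) in simp_all)
qed

lemma act_lins:
 assumes "hmod V"
 shows "h <: H ==> module_lin K L V f ==> module_lin K L V (%u. act V h (f u))"
  "v <: V ==> module_lin K L H g ==> module_lin K L V (%u. act V (g u) v)"
 using bilin_comp2[OF hmodD(2)[OF assms]] bilin_comp1[OF hmodD(2)[OF assms]] by auto

text \<open>The coproduct is multiplicative and S reverses products: for h h' the argument is hit by
  the antipode part of h first and that of h' second, which is the order in which the iterated
  action of h after h' unfolds.\<close>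

lemma hmod_ghom:
 assumes V: "hmod V" and W: "hmod W"
 shows "hmod (ghom Q V W)"
proof -
 note mV = hmodD(1)[OF V] and mW = hmodD(1)[OF W]
 note cV = hmodD(5)[OF V] and cW = hmodD(5)[OF W]
 note mG = module_ghom[OF mV mW]
 have l1: "bilin K H H W (%x y. act W x (L (act V (S y) v)))" if "L <: (ghom Q V W)" "v <: V" for L v
  by (rule lins act_lins[OF W] act_lins[OF V] module_lin_comp[OF ghom_linD[OF that(1)]]
    | simp add: that cV cW ghom_app_closed[OF that(1)])+
 have a: "act (ghom Q V W) h L <: (ghom Q V W)" if h: "h <: H" and L: "L <: (ghom Q V W)" for h L
  unfolding ghom_act
  by (rule ghomI[OF mV])
   (rule lins act_lins[OF W] act_lins[OF V] module_lin_comp[OF ghom_linD[OF L]]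
    | simp add: h L cV cW mW ghom_app_closed[OF L])+
 have b: "bilin K H (ghom Q V W) (ghom Q V W) (act (ghom Q V W))"
 proof (rule bilinI)
  fix L assume L: "L <: (ghom Q V W)"
  show "module_lin K H (ghom Q V W) (%h. act (ghom Q V W) h L)"
  proof (rule ghom_linI[OF mV mW modH])
   fix v assume v: "v <: V"
   show "module_lin K H W (%h. act (ghom Q V W) h L v)"
    unfolding ghom_act using v
    by simp (rule lins l1[OF L v] | simp add: mW)+
  qed (rule a[OF _ L])
 next
  fix h assume h: "h <: H"
  show "module_lin K (ghom Q V W) (ghom Q V W) (%L. act (ghom Q V W) h L)"
  proof (rule ghom_linI[OF mV mW mG])
   fix v assume v: "v <: V"
   show "module_lin K (ghom Q V W) W (%L. act (ghom Q V W) h L v)"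
    unfolding ghom_act using v
    by simp (rule lins act_lins[OF W] ghom_app_lin | simp add: mW h cV)+
  qed (rule a[OF h])
 qed
 have m: "act (ghom Q V W) (h ** h') L = act (ghom Q V W) h (act (ghom Q V W) h' L)"
  if h: "h <: H" and h': "h' <: H" and L: "L <: (ghom Q V W)" for h h' L
 proof (rule ghom_eqI[where V = V and W = W])
  fix v assume v: "v <: V"
  note c = cV cW ghom_app_closed[OF L] ghom_app_closed[OF a[OF h' L]]
  have "act (ghom Q V W) (h ** h') L v = sum2 Q W (D h *\<^sub>2 D h') (%x y. act W x (L (act V (S y) v)))"
   unfolding ghom_act using v h h' by (simp add: alghomD(3)[OF D_alghom])
  also have "... = sum2 Q W (D h) (%x y. sum2 Q W (D h') (%x' y'. act W (x ** x') (L (act V (S (y ** y')) v))))"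
   by (rule sum2_mult[OF mW l1[OF L v]]) (use h h' in simp_all)
  also have "... = sum2 Q W (D h) (%x y. act W x (act (ghom Q V W) h' L (act V (S y) v)))"
  proof (rule sum2_cong[OF mW])
   fix x y assume xy: "x <: H" "y <: H"
   have "sum2 Q W (D h') (%x' y'. act W (x ** x') (L (act V (S (y ** y')) v))) =
    sum2 Q W (D h') (%x' y'. act W x (act W x' (L (act V (S y') (act V (S y) v)))))"
    by (rule sum2_cong[OF mW]) (use h' xy v in "simp_all add: c S_mult hmodD(3)[OF V] hmodD(3)[OF W]")
   also have "... = act W x (sum2 Q W (D h') (%x' y'. act W x' (L (act V (S y') (act V (S y) v)))))"
    by (rule sum2_comp[symmetric, OF mW mW bilin_lin2[OF hmodD(2)[OF W]]]) (use h' xy v in "simp_all add: c")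
   finally show "sum2 Q W (D h') (%x' y'. act W (x ** x') (L (act V (S (y ** y')) v))) =
     act W x (act (ghom Q V W) h' L (act V (S y) v))"
    unfolding ghom_act using v xy cV by simp
  qed (use h v in "simp_all add: c")
  also have "... = act (ghom Q V W) h (act (ghom Q V W) h' L) v"
   unfolding ghom_act[of V W h] using v by simp
  finally show "act (ghom Q V W) (h ** h') L v = act (ghom Q V W) h (act (ghom Q V W) h' L) v" .
 qed (use h h' L a in simp_all)
 have o: "act (ghom Q V W) \<one>\<^bsub>H\<^esub> L = L" if L: "L <: (ghom Q V W)" for L
 proof (rule ghom_eqI[OF a[OF _ L] L])
  fix v assume v: "v <: V"
  have "act (ghom Q V W) \<one>\<^bsub>H\<^esub> L v = sum2 Q W (e2 Q \<one>\<^bsub>H\<^esub> \<one>\<^bsub>H\<^esub>) (%x y. act W x (L (act V (S y) v)))"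
   unfolding ghom_act using v alghomD(2)[OF D_alghom] by (simp add: one_H2)
  also have "... = L v"
   by (subst sum2_e2[OF mW l1[OF L v]])
    (use v in "simp_all add: hmodD(4)[OF V] hmodD(4)[OF W] ghom_app_closed[OF L]")
  finally show "act (ghom Q V W) \<one>\<^bsub>H\<^esub> L v = L v" .
 qed simp
 show ?thesis unfolding hmod_def using mG b m o by auto
qed

text \<open>Evaluation of the pure tensor L \<otimes> v, written without tensors. It is the plain
  value L v corrected by \<phi> and \<alpha>.\<close>

definition app :: "('k, 'h, 'v) gmod => ('k, 'h, 'w) gmod => ('v => 'w) => 'v => 'w" where
 "app V W L v = sum3 Q W phi (%x y z. act W x (L (act V (S y ** al ** z) v)))"

text \<open>The bilinear form of an H-linear map out of a tensor product, with the grading left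
  aside.\<close>

definition hbilin :: "('k, 'h, 'v) gmod => ('k, 'h, 'w) gmod => ('k, 'h, 'x) gmod => ('v => 'w => 'x) => bool" where
 "hbilin V W X f \<longleftrightarrow> bilin K V W X f \<and> (\<forall>h\<in>carrier H. \<forall>v\<in>carrier V. \<forall>w\<in>carrier W.
   sum2 Q X (D h) (%x y. f (act V x v) (act W y w)) = act X h (f v w))"

lemma hbilinD:
 assumes "hbilin V W X f"
 shows "bilin K V W X f"
  "!!h v w. h <: H ==> v <: V ==> w <: W ==>
   sum2 Q X (D h) (%x y. f (act V x v) (act W y w)) = act X h (f v w)"
  "!!v w. v <: V ==> w <: W ==> f v w <: X"
proof -
 show b: "bilin K V W X f" using assms by (simp add: hbilin_def)
 show "v <: V ==> w <: W ==> f v w <: X" for v w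
  by (rule bilin_closed[OF b])
qed (use assms in "simp_all add: hbilin_def")

definition cur :: "('k, 'h, 'v) gmod => ('k, 'h, 'w) gmod => ('k, 'h, 'x) gmod => ('v => 'w => 'x) => 'v => 'w => 'x" where
 "cur V W X f = (\<lambda>v\<in>carrier V. \<lambda>w\<in>carrier W.
   sum3 Q X psi (%x y z. f (act V x v) (act W (y ** be ** S z) w)))"

lemma app_trilin:
 assumes V: "hmod V" and W: "hmod W" and L: "L <: (ghom Q V W)" and v: "v <: V"
 shows "trilin W (%x y z. act W x (L (act V (S y ** al ** z) v)))"
 by (rule lins act_lins[OF W] act_lins[OF V] module_lin_comp[OF ghom_linD[OF L]]
   | simp add: v hmodD(5)[OF V] ghom_app_closed[OF L])+

lemma app_bilin:
 assumes V: "hmod V" and W: "hmod W"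
 shows "bilin K (ghom Q V W) V W (app V W)"
proof (rule bilinI)
 fix v assume v: "v <: V"
 show "module_lin K (ghom Q V W) W (%L. app V W L v)" unfolding app_def
  by (rule lins act_lins[OF W] ghom_app_lin | simp add: v hmodD(5)[OF V] hmodD(1)[OF W])+
next
 fix L assume L: "L <: (ghom Q V W)"
 show "module_lin K V W (%v. app V W L v)" unfolding app_def
  by (rule lins act_lins[OF W] act_lins[OF V] module_lin_comp[OF ghom_linD[OF L]] | simp add: hmodD(1)[OF W])+
qed

text \<open>Moving h through the associator places the two parts of one coproduct on both sides of
  \<alpha>, where the antipode axiom reduces them to a counit. The remaining part of h acts from
  outside.\<close>

lemma app_hbilin:
 assumes V: "hmod V" and W: "hmod W"
 shows "hbilin (ghom Q V W) V W (app V W)"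
 unfolding hbilin_def
proof (intro conjI ballI app_bilin V W)
 fix h L v assume h: "h <: H" and L: "L <: (ghom Q V W)" and v: "v <: V"
 note mW = hmodD(1)[OF W]
 note G = hmod_ghom[OF V W]
 note c = hmodD(5)[OF V] hmodD(5)[OF W] hmodD(5)[OF G] ghom_app_closed[OF L]
 let ?b = "%x y z. act W x (L (act V (S y ** al ** z) v))"
 note tri = app_trilin[OF V W L v]
 have inner: "app V W (act (ghom Q V W) x L) (act V y v) = sum3 Q W phi (%u a c. sum2 Q W (D x) (%p q.
   ?b (u ** p) (a ** q) (c ** y)))" if xy: "x <: H" "y <: H" for x y
  unfolding app_def
 proof (rule sum3_cong[OF mW phi_closed])
  fix u a d assume uac: "u <: H" "a <: H" "d <: H"
  have "act W u (act (ghom Q V W) x L (act V (S a ** al ** d) (act V y v))) =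
   sum2 Q W (D x) (%p q. act W u (act W p (L (act V (S q) (act V (S a ** al ** d) (act V y v))))))"
   unfolding ghom_act using uac xy v
   by (simp add: c, intro sum2_comp[OF mW mW bilin_lin2[OF hmodD(2)[OF W]]]) (simp_all add: c)
  also have "... = sum2 Q W (D x) (%p q. ?b (u ** p) (a ** q) (d ** y))"
   by (rule sum2_cong[OF mW]) (use uac xy v in "simp_all add: c hmodD(3)[OF W] hmodD(3)[OF V, symmetric] S_mult H_assoc")
  finally show "act W u (act (ghom Q V W) x L (act V (S a ** al ** d) (act V y v))) =
   sum2 Q W (D x) (%p q. ?b (u ** p) (a ** q) (d ** y))" .
 qed (use xy v in "simp add: c sum2_closed mW")
 have "sum2 Q W (D h) (%x y. app V W (act (ghom Q V W) x L) (act V y v)) =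
  sum2 Q W (D h) (%x y. sum3 Q W phi (%u a c. sum2 Q W (D x) (%p q. ?b (u ** p) (a ** q) (c ** y))))"
  by (rule sum2_cong[OF mW]) (use h v in "simp_all add: inner sum3_closed sum2_closed mW c")
 also have "... = sum3 Q W phi (%u a c. sum2 Q W (D h) (%x y. sum2 Q W (D x) (%p q. ?b (u ** p) (a ** q) (c ** y))))"
  by (rule sum23_swap[OF mW]) (use h v in "simp_all add: sum2_closed mW c")
 also have "... = sum2 Q W (D h) (%x y. sum2 Q W (D y) (%p q. sum3 Q W phi (%u a c. ?b (x ** u) (p ** a) (q ** c))))"
  by (rule coassoc_phi[OF mW tri h, symmetric])
 also have "... = sum2 Q W (D h) (%x y. ep y \<odot>\<^bsub>W\<^esub> act W x (app V W L v))"
 proof (rule sum2_cong[OF mW])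
  fix x y assume xy: "x <: H" "y <: H"
  have "sum2 Q W (D y) (%p q. sum3 Q W phi (%u a c. ?b (x ** u) (p ** a) (q ** c))) =
   sum3 Q W phi (%u a c. sum2 Q W (D y) (%p q. ?b (x ** u) (p ** a) (q ** c)))"
   by (rule sum23_swap[OF mW]) (use xy v in "simp_all add: sum2_closed mW c")
  also have "... = sum3 Q W phi (%u a c. ep y \<odot>\<^bsub>W\<^esub> act W x (act W u (L (act V (S a ** al ** c) v))))"
  proof (rule sum3_cong[OF mW phi_closed])
   fix u a d assume uac: "u <: H" "a <: H" "d <: H"
   have l: "module_lin K H W (%t. act W (x ** u) (L (act V t v)))"
    by (rule lins act_lins[OF W] act_lins[OF V] module_lin_comp[OF ghom_linD[OF L]] | simp add: v xy uac)+
   have "sum2 Q W (D y) (%p q. ?b (x ** u) (p ** a) (q ** d)) =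
    sum2 Q W (D y) (%p q. act W (x ** u) (L (act V (S a ** (S p ** al ** q) ** d) v)))"
    by (rule sum2_cong[OF mW]) (use uac xy v in "simp_all add: c S_mult H_assoc")
   also have "... = ep y \<odot>\<^bsub>W\<^esub> act W (x ** u) (L (act V (S a ** al ** d) v))"
    by (rule antipode_absorb1[OF _ _ _ mW l]) (use uac xy in simp_all)
   finally show "sum2 Q W (D y) (%p q. ?b (x ** u) (p ** a) (q ** d)) =
    ep y \<odot>\<^bsub>W\<^esub> act W x (act W u (L (act V (S a ** al ** d) v)))"
    using uac xy v by (simp add: c hmodD(3)[OF W])
  qed (use xy v in "simp add: c module_smult_closed[OF mW]")
  also have "... = ep y \<odot>\<^bsub>W\<^esub> act W x (app V W L v)"
   unfolding app_def
   by (rule sum3_comp[symmetric, where g = "%t. ep y \<odot>\<^bsub>W\<^esub> act W x t", OF mW mW _ phi_closed])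
    ((rule module_lin_smult_fun act_lins[OF W] module_lin_id | simp add: xy v mW c)+)
  finally show "sum2 Q W (D y) (%p q. sum3 Q W phi (%u a c. ?b (x ** u) (p ** a) (q ** c))) =
    ep y \<odot>\<^bsub>W\<^esub> act W x (app V W L v)" .
 qed (use h v in "simp_all add: c module_smult_closed[OF mW] bilin_closed[OF app_bilin[OF V W]] L")
 also have "... = act W h (app V W L v)"
  by (rule sum2_counit2[OF mW bilin_lin1[OF hmodD(2)[OF W]] h]) (simp add: bilin_closed[OF app_bilin[OF V W]] L v)
 finally show "sum2 Q W (D h) (%x y. app V W (act (ghom Q V W) x L) (act V y v)) = act W h (app V W L v)" .
qed

lemma cur_closed:
 assumes V: "hmod V" and W: "hmod W" and X: "hmod X" and f: "bilin K V W X f"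
 shows "v <: V ==> cur V W X f v <: (ghom Q W X)"
  and "module_lin K V (ghom Q W X) (cur V W X f)"
proof -
 show 1: "cur V W X f v <: (ghom Q W X)" if v: "v <: V" for v
  unfolding cur_def using v
  by simp (rule ghomI[OF hmodD(1)[OF W]],
   (rule lins bilin_comp2[OF f] act_lins[OF V] act_lins[OF W] | simp add: hmodD(1)[OF X] hmodD(5)[OF V])+)
 show "module_lin K V (ghom Q W X) (cur V W X f)"
 proof (rule ghom_linI[OF hmodD(1)[OF W] hmodD(1)[OF X] hmodD(1)[OF V] 1])
  fix w assume w: "w <: W"
  have "module_lin K V X (%v. sum3 Q X psi (%x y z. f (act V x v) (act W (y ** be ** S z) w)))"
   by (rule lins bilin_comp1[OF f] act_lins[OF V] act_lins[OF W] | simp add: hmodD(1)[OF X] hmodD(5)[OF W] w)+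
  then show "module_lin K V X (%v. cur V W X f v w)"
   by (subst module_lin_cong[OF hmodD(1)[OF V], where f' = "%v. sum3 Q X psi (%x y z. f (act V x v) (act W (y ** be ** S z) w))"])
    (simp_all add: cur_def w)
 qed
qed

text \<open>The half of the currying bijection saying that uncurrying undoes currying. Equivariance
  of f moves the outer leg of the associator inside f, and the resulting expression is the one of
  \<open>zigzag1\<close>.\<close>

lemma app_cur:
 assumes V: "hmod V" and W: "hmod W" and X: "hmod X" and f: "hbilin V W X f"
  and v: "v <: V" and w: "w <: W"
 shows "app W X (cur V W X f v) w = f v w"
proof -
 note mX = hmodD(1)[OF X]
 note c = hmodD(5)[OF V] hmodD(5)[OF W] hmodD(5)[OF X] hbilinD(3)[OF f]
 let ?b = "%p q. f (act V p v) (act W q w)"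
 have b: "bilin K H H X ?b"
  by (rule lins bilin_comp2[OF hbilinD(1)[OF f]] act_lins[OF V] act_lins[OF W] bilin_comp1[OF hbilinD(1)[OF f]] | simp add: c v w)+
 have "app W X (cur V W X f v) w = sum3 Q X phi (%x y z. sum2 Q X (D x) (%a d. sum3 Q X psi (%u s t.
   ?b (a ** u) (d ** s ** be ** S (y ** t) ** al ** z))))"
  unfolding app_def
 proof (rule sum3_cong[OF mX phi_closed])
  fix x y z assume xyz: "x <: H" "y <: H" "z <: H"
  have "act X x (cur V W X f v (act W (S y ** al ** z) w)) =
   act X x (sum3 Q X psi (%u s t. f (act V u v) (act W (s ** be ** S t) (act W (S y ** al ** z) w))))"
   using xyz v w by (simp add: cur_def c)
  also have "... = sum3 Q X psi (%u s t. act X x (f (act V u v) (act W (s ** be ** S t) (act W (S y ** al ** z) w))))"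
   by (rule sum3_comp[OF mX mX bilin_lin2[OF hmodD(2)[OF X]] psi_closed]) (use xyz v w in "simp_all add: c")
  also have "... = sum3 Q X psi (%u s t. sum2 Q X (D x) (%a d.
   ?b (a ** u) (d ** s ** be ** S (y ** t) ** al ** z)))"
  proof (rule sum3_cong[OF mX psi_closed])
   fix u s t assume ust: "u <: H" "s <: H" "t <: H"
   show "act X x (f (act V u v) (act W (s ** be ** S t) (act W (S y ** al ** z) w))) = sum2 Q X (D x) (%a d.
    ?b (a ** u) (d ** s ** be ** S (y ** t) ** al ** z))"
    by (subst hbilinD(2)[OF f, symmetric], use xyz ust v w in "simp_all add: c", rule sum2_cong[OF mX])
     (use xyz ust v w in "simp_all add: c hmodD(3)[OF V, symmetric] hmodD(3)[OF W, symmetric] S_mult H_assoc")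
  qed (use xyz v w in "simp add: sum2_closed mX c")
  also have "... = sum2 Q X (D x) (%a d. sum3 Q X psi (%u s t.
   ?b (a ** u) (d ** s ** be ** S (y ** t) ** al ** z)))"
   by (rule sum23_swap[OF mX, symmetric]) (use xyz v w in "simp_all add: c")
  finally show "act X x (cur V W X f v (act W (S y ** al ** z) w)) = ..." .
 qed (use v w in "simp add: c sum2_closed sum3_closed mX")
 also have "... = ?b \<one>\<^bsub>H\<^esub> \<one>\<^bsub>H\<^esub>" by (rule zigzag1[OF mX b])
 finally show ?thesis using v w by (simp add: hmodD(4)[OF V] hmodD(4)[OF W])
qed

text \<open>The counterpart of \<open>app_hbilin\<close> for the inverse associator: after
  quasi-coassociativity the parts of one coproduct enclose \<beta> and reduce to a counit.\<close>

lemma cur_equivariant: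
 assumes V: "hmod V" and W: "hmod W" and X: "hmod X" and f: "hbilin V W X f"
  and v: "v <: V" and h: "h <: H"
 shows "cur V W X f (act V h v) = act (ghom Q W X) h (cur V W X f v)"
proof (rule ghom_eqI[where V = W and W = X])
 note mX = hmodD(1)[OF X]
 note c = hmodD(5)[OF V] hmodD(5)[OF W] hmodD(5)[OF X] hbilinD(3)[OF f]
 note cc = cur_closed(1)[OF V W X hbilinD(1)[OF f]]
 show "cur V W X f (act V h v) <: (ghom Q W X)" by (rule cc) (simp add: c h v)
 show "act (ghom Q W X) h (cur V W X f v) <: (ghom Q W X)"
  by (intro hmodD(5)[OF hmod_ghom[OF W X]] cc h v)
 fix w assume w: "w <: W"
 let ?b = "%r s t. f (act V r v) (act W (s ** be ** S t) w)"
 have b: "trilin X ?b"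
  by (rule lins bilin_comp2[OF hbilinD(1)[OF f]] act_lins[OF V] act_lins[OF W] bilin_comp1[OF hbilinD(1)[OF f]] | simp add: c v w)+
 have "act (ghom Q W X) h (cur V W X f v) w = sum2 Q X (D h) (%x y. act X x (cur V W X f v (act W (S y) w)))"
  unfolding ghom_act using w by simp
 also have "... = sum2 Q X (D h) (%x y. sum2 Q X (D x) (%p q. sum3 Q X psi (%u a d. ?b (p ** u) (q ** a) (y ** d))))"
 proof (rule sum2_cong[OF mX])
  fix x y assume xy: "x <: H" "y <: H"
  have "act X x (cur V W X f v (act W (S y) w)) =
   act X x (sum3 Q X psi (%u a d. f (act V u v) (act W (a ** be ** S d) (act W (S y) w))))"
   using xy v w by (simp add: cur_def c)
  also have "... = sum3 Q X psi (%u a d. act X x (f (act V u v) (act W (a ** be ** S d) (act W (S y) w))))"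
   by (rule sum3_comp[OF mX mX bilin_lin2[OF hmodD(2)[OF X]] psi_closed]) (use xy v w in "simp_all add: c")
  also have "... = sum3 Q X psi (%u a d. sum2 Q X (D x) (%p q. ?b (p ** u) (q ** a) (y ** d)))"
  proof (rule sum3_cong[OF mX psi_closed])
   fix u s t assume ust: "u <: H" "s <: H" "t <: H"
   show "act X x (f (act V u v) (act W (s ** be ** S t) (act W (S y) w))) = sum2 Q X (D x) (%p q. ?b (p ** u) (q ** s) (y ** t))"
    by (subst hbilinD(2)[OF f, symmetric], use xy ust v w in "simp_all add: c", rule sum2_cong[OF mX])
     (use xy ust v w in "simp_all add: c hmodD(3)[OF V, symmetric] hmodD(3)[OF W, symmetric] S_mult H_assoc")
  qed (use xy v w in "simp add: sum2_closed mX c")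
  also have "... = sum2 Q X (D x) (%p q. sum3 Q X psi (%u a d. ?b (p ** u) (q ** a) (y ** d)))"
   by (rule sum23_swap[OF mX, symmetric]) (use xy v w in "simp_all add: c")
  finally show "act X x (cur V W X f v (act W (S y) w)) = ..." .
 qed (use h v w in "simp_all add: sum2_closed sum3_closed mX c")
 also have "... = sum3 Q X psi (%u a d. sum2 Q X (D h) (%x y. sum2 Q X (D y) (%p q. ?b (u ** x) (a ** p) (d ** q))))"
  by (rule coassoc_psi[OF mX b h])
 also have "... = sum3 Q X psi (%u a d. f (act V u (act V h v)) (act W (a ** be ** S d) w))"
 proof (rule sum3_cong[OF mX psi_closed])
  fix u a d assume uad: "u <: H" "a <: H" "d <: H"
  have "sum2 Q X (D h) (%x y. sum2 Q X (D y) (%p q. ?b (u ** x) (a ** p) (d ** q))) =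
   sum2 Q X (D h) (%x y. ep y \<odot>\<^bsub>X\<^esub> ?b (u ** x) a d)"
  proof (rule sum2_cong[OF mX])
   fix x y assume xy: "x <: H" "y <: H"
   have l: "module_lin K H X (%t. f (act V (u ** x) v) (act W t w))"
    by (rule bilin_comp2[OF hbilinD(1)[OF f]] act_lins[OF W] module_lin_id | simp add: c uad xy v w)+
   have "sum2 Q X (D y) (%p q. ?b (u ** x) (a ** p) (d ** q)) =
     sum2 Q X (D y) (%p q. f (act V (u ** x) v) (act W (a ** (p ** be ** S q) ** S d) w))"
    by (rule sum2_cong[OF mX]) (use uad xy v w in "simp_all add: c S_mult H_assoc")
   also have "... = ep y \<odot>\<^bsub>X\<^esub> ?b (u ** x) a d"
    by (rule antipode_absorb2[OF _ _ _ mX l]) (use uad xy in simp_all)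
   finally show "sum2 Q X (D y) (%p q. ?b (u ** x) (a ** p) (d ** q)) = ep y \<odot>\<^bsub>X\<^esub> ?b (u ** x) a d" .
  qed (use h v w uad in "simp_all add: c module_smult_closed[OF mX]")
  also have "... = ?b (u ** h) a d"
   by (rule sum2_counit2[OF mX _ h])
    (rule lins bilin_comp1[OF hbilinD(1)[OF f]] act_lins[OF V] | simp add: c v w uad)+
  finally show "sum2 Q X (D h) (%x y. sum2 Q X (D y) (%p q. ?b (u ** x) (a ** p) (d ** q))) =
   f (act V u (act V h v)) (act W (a ** be ** S d) w)"
   using uad h v by (simp add: hmodD(3)[OF V])
 qed (use h v w in "simp add: c")
 also have "... = cur V W X f (act V h v) w" using h v w by (simp add: cur_def c)
 finally show "cur V W X f (act V h v) w = act (ghom Q W X) h (cur V W X f v) w" by simp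
qed

text \<open>By \<open>zigzag2\<close> the plain value N v is a Sweedler sum of evaluations of
  translates of N. This is the step from evaluations, which can be computed, back to linear
  maps.\<close>

lemma ghom_eq_zeroI:
 assumes V: "hmod V" and W: "hmod W" and N: "N <: (ghom Q V W)"
  and z: "!!h v. h <: H ==> v <: V ==> app V W (act (ghom Q V W) h N) v = \<zero>\<^bsub>W\<^esub>"
 shows "N = \<zero>\<^bsub>ghom Q V W\<^esub>"
proof (rule ghom_eqI[OF N])
 note mW = hmodD(1)[OF W]
 note G = hmod_ghom[OF V W]
 note c = hmodD(5)[OF V] hmodD(5)[OF W] hmodD(5)[OF G] ghom_app_closed[OF N]
 show "\<zero>\<^bsub>ghom Q V W\<^esub> <: (ghom Q V W)" by (rule module_zero_closed[OF hmodD(1)[OF G]])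
 fix v assume v: "v <: V"
 let ?b = "%p q. act W p (N (act V q v))"
 have b: "bilin K H H W ?b"
  by (rule lins act_lins[OF W] act_lins[OF V] module_lin_comp[OF ghom_linD[OF N]] | simp add: c v)+
 have "N v = ?b \<one>\<^bsub>H\<^esub> \<one>\<^bsub>H\<^esub>" using v by (simp add: hmodD(4)[OF V] hmodD(4)[OF W] c)
 also have "... = sum3 Q W phi (%u s t. sum3 Q W psi (%x y z. sum2 Q W (D x) (%a d.
   ?b (u ** a) (S (s ** d) ** al ** (t ** y) ** be ** S z))))"
  by (rule zigzag2[OF mW b, symmetric])
 \<comment> \<open>With the inverse associator outermost, the inner sum over \<open>phi\<close> is
   recognizable as the evaluation of one translate of N.\<close>
 also have "... = sum3 Q W psi (%x y z. sum3 Q W phi (%u s t. sum2 Q W (D x) (%a d.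
   ?b (u ** a) (S (s ** d) ** al ** (t ** y) ** be ** S z))))"
  by (rule sum3_swap[OF mW phi_closed psi_closed]) (use v in "simp add: sum2_closed mW c")
 also have "... = sum3 Q W psi (%x y z. \<zero>\<^bsub>W\<^esub>)"
 proof (rule sum3_cong[OF mW psi_closed])
  fix x y z assume xyz: "x <: H" "y <: H" "z <: H"
  have "app V W (act (ghom Q V W) x N) (act V (y ** be ** S z) v) =
   sum3 Q W phi (%u s t. sum2 Q W (D x) (%a d.
   ?b (u ** a) (S (s ** d) ** al ** (t ** y) ** be ** S z)))"
   unfolding app_def
  proof (rule sum3_cong[OF mW phi_closed])
   fix u s t assume ust: "u <: H" "s <: H" "t <: H"
   have "act W u (act (ghom Q V W) x N (act V (S s ** al ** t) (act V (y ** be ** S z) v))) =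
    sum2 Q W (D x) (%a d. act W u (act W a (N (act V (S d) (act V (S s ** al ** t) (act V (y ** be ** S z) v))))))"
    unfolding ghom_act using ust xyz v
    by (simp add: c, intro sum2_comp[OF mW mW bilin_lin2[OF hmodD(2)[OF W]]]) (simp_all add: c)
   also have "... = sum2 Q W (D x) (%a d. ?b (u ** a) (S (s ** d) ** al ** (t ** y) ** be ** S z))"
    by (rule sum2_cong[OF mW]) (use ust xyz v in "simp_all add: c hmodD(3)[OF W] hmodD(3)[OF V, symmetric] S_mult H_assoc")
   finally show "act W u (act (ghom Q V W) x N (act V (S s ** al ** t) (act V (y ** be ** S z) v))) = ..." .
  qed (use xyz v in "simp add: c sum2_closed mW")
  then show "sum3 Q W phi (%u s t. sum2 Q W (D x) (%a d.
   ?b (u ** a) (S (s ** d) ** al ** (t ** y) ** be ** S z))) = \<zero>\<^bsub>W\<^esub>"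
   using z[OF xyz(1), of "act V (y ** be ** S z) v"] xyz v by (simp add: c)
 qed (simp add: module_zero_closed[OF mW])
 also have "... = \<zero>\<^bsub>W\<^esub>"
  by (rule sum3_comp[where P = W and g = "%_. \<zero>\<^bsub>W\<^esub>" and b = "%_ _ _. \<zero>\<^bsub>W\<^esub>", symmetric, OF mW mW module_lin_zero_fun[OF mW] psi_closed])
   (simp add: module_zero_closed[OF mW])
 finally show "N v = \<zero>\<^bsub>ghom Q V W\<^esub> v" using v by (simp add: ghom_zero)
qed

end

section \<open>Tensor products of H-modules and internal composition\<close>

context qhopf
begin

definition hlin :: "('k, 'h, 'v) gmod => ('k, 'h, 'w) gmod => ('v => 'w) => bool" where
 "hlin V W f \<longleftrightarrow> module_lin K V W f \<and> (\<forall>h\<in>carrier H. \<forall>v\<in>carrier V. f (act V h v) = act W h (f v))"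

lemma hlinD:
 assumes "hlin V W f"
 shows "module_lin K V W f" "!!h v. h <: H ==> v <: V ==> f (act V h v) = act W h (f v)"
  "!!v. v <: V ==> f v <: W"
proof -
 show l: "module_lin K V W f" using assms by (simp add: hlin_def)
 show "v <: V ==> f v <: W" for v by (rule module_lin_closed[OF l])
qed (use assms in "simp add: hlin_def")

lemma hmod_tp: "hmod V ==> hmod W ==> tensor_pair K V W"
 by (intro tensor_pair.intro hmodD)

lemmas gsame = same_module_gtensor[of Q]
lemmas gsameD = same_moduleD[OF same_module_gtensor[of Q]]

lemma module_gtensor: "tensor_pair K V W ==> module K (gtensor Q V W)"
 by (rule same_module_module[OF gsame tensor_pair.module_tensor])

lemma gelem_bilin: "tensor_pair K V W ==> bilin K V W (gtensor Q V W) (gtensor_elem Q V W)"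
 using tensor_pair.elem_bilin by (auto simp: same_module_bilin[OF gsame] gtensor_elem_def[abs_def])

lemma glift_lin: "tensor_pair K V W ==> module K P ==> bilin K V W P b ==>
  module_lin K (gtensor Q V W) P (tensor_lift K V W P b)"
 unfolding same_module_lin1[OF gsame] by (rule tensor_pair.lift_bilin_lin)

lemma glift_elem: "tensor_pair K V W ==> module K P ==> bilin K V W P b ==> v <: V ==> w <: W ==>
  tensor_lift K V W P b (gtensor_elem Q V W v w) = b v w"
 unfolding gtensor_elem_def by (rule tensor_pair.lift_elem)

lemma gtensor_ext:
 assumes "tensor_pair K V W" "module K P" "module_lin K (gtensor Q V W) P f" "module_lin K (gtensor Q V W) P g"
  "!!v w. v <: V ==> w <: W ==> f (gtensor_elem Q V W v w) = g (gtensor_elem Q V W v w)"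
  "t <: (gtensor Q V W)"
 shows "f t = g t"
 by (rule tensor_pair.ext[OF assms(1,2), of f g])
  (use assms(3-6) in "simp_all add: same_module_lin1[OF gsame] gsameD gtensor_elem_def")

lemma sum2_same:
 assumes "same_module T T'" "module K T" "t <: HH2"
  "!!x y. x <: H ==> y <: H ==> b x y <: T"
 shows "sum2 Q T t b = sum2 Q T' t b"
 using sum2_comp[where g = "%x. x" and b = b, OF assms(2) same_module_module[OF assms(1,2)] _ assms(3,4)]
 by (simp add: same_module_lin2[OF assms(1)] module_lin_id)

lemma gtensor_act_def: "act (gtensor Q V W) h = tensor_lift K V W (tensor_module K V W) (%v w.
  sum2 Q (tensor_module K V W) (D h) (%x y. gtensor_elem Q V W (act V x v) (act W y w)))"
 by (simp add: gtensor_def Let_def)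

lemma hmod_gtensor_aux:
 assumes V: "hmod V" and W: "hmod W" and t: "t <: HH2"
 shows "bilin K V W (tensor_module K V W) (%v w.
  sum2 Q (tensor_module K V W) t (%x y. gtensor_elem Q V W (act V x v) (act W y w)))"
proof -
 note tp = hmod_tp[OF V W]
 have e: "bilin K V W (tensor_module K V W) (gtensor_elem Q V W)"
  using gelem_bilin[OF tp] by (simp add: same_module_bilin[OF gsame])
 show ?thesis
  by (rule lins bilin_comp2[OF e] bilin_comp1[OF e] act_lins[OF V] act_lins[OF W]
   | simp add: t hmodD(5)[OF V] hmodD(5)[OF W] tensor_pair.module_tensor[OF tp])+
qed

lemma gtensor_act_elem:
 assumes V: "hmod V" and W: "hmod W" and h: "h <: H" and v: "v <: V" and w: "w <: W"
 shows "act (gtensor Q V W) h (gtensor_elem Q V W v w) =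
  sum2 Q (gtensor Q V W) (D h) (%x y. gtensor_elem Q V W (act V x v) (act W y w))"
proof -
 note tp = hmod_tp[OF V W]
 note m = tensor_pair.module_tensor[OF tp]
 have "act (gtensor Q V W) h (gtensor_elem Q V W v w) =
  sum2 Q (tensor_module K V W) (D h) (%x y. gtensor_elem Q V W (act V x v) (act W y w))"
  unfolding gtensor_act_def
  by (rule glift_elem[OF tp m hmod_gtensor_aux[OF V W] v w]) (use h in simp)
 also have "... = sum2 Q (gtensor Q V W) (D h) (%x y. gtensor_elem Q V W (act V x v) (act W y w))"
  by (rule sum2_same[OF gsame m])
   (use h v w bilin_closed[OF gelem_bilin[OF tp]] in "simp_all add: gsameD hmodD(5)[OF V] hmodD(5)[OF W]")
 finally show ?thesis .
qed

lemma hmod_gtensor: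
 assumes V: "hmod V" and W: "hmod W"
 shows "hmod (gtensor Q V W)"
proof -
 note tp = hmod_tp[OF V W]
 note m = tensor_pair.module_tensor[OF tp]
 note mT = module_gtensor[OF tp]
 note e = gelem_bilin[OF tp]
 note ec = bilin_closed[OF e]
 note c = hmodD(5)[OF V] hmodD(5)[OF W] ec
 let ?T = "gtensor Q V W"
 have e': "bilin K V W (tensor_module K V W) (gtensor_elem Q V W)"
  using e by (simp add: same_module_bilin[OF gsame])
 have lt: "module_lin K ?T ?T (act ?T h)" if "h <: H" for h
  unfolding gtensor_act_def same_module_lin2[OF gsame]
  by (rule glift_lin[OF tp m hmod_gtensor_aux[OF V W]]) (use that in simp)
 have lh: "module_lin K H ?T (%h. act ?T h t)" if t: "t <: ?T" for t
  unfolding gtensor_act_def same_module_lin2[OF gsame]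
 proof (rule tensor_pair.lift_fun_lin[OF tp m])
  fix v w assume vw: "v <: V" "w <: W"
  show "module_lin K H (tensor_module K V W) (%h. sum2 Q (tensor_module K V W) (D h)
    (%x y. gtensor_elem Q V W (act V x v) (act W y w)))"
   by (rule lins bilin_comp2[OF e'] bilin_comp1[OF e'] act_lins[OF V] act_lins[OF W]
    | simp add: vw m hmodD(5)[OF V] hmodD(5)[OF W])+
 qed (use t in "simp add: gsameD")
 have b: "bilin K H ?T ?T (act ?T)" by (intro bilinI lt lh)
 have be: "bilin K H H ?T (%x y. gtensor_elem Q V W (act V x v) (act W y w))"
  if "v <: V" "w <: W" for v w
  by (rule lins bilin_comp2[OF e] bilin_comp1[OF e] act_lins[OF V] act_lins[OF W] | simp add: c that)+
 have mu: "act ?T (h ** h') t = act ?T h (act ?T h' t)"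
  if h: "h <: H" and h': "h' <: H" and t: "t <: ?T" for h h' t
 proof (rule gtensor_ext[OF tp mT lt module_lin_comp[OF lt lt] _ t])
  fix v w assume v: "v <: V" and w: "w <: W"
  have "act ?T (h ** h') (gtensor_elem Q V W v w) =
   sum2 Q ?T (D h *\<^sub>2 D h') (%x y. gtensor_elem Q V W (act V x v) (act W y w))"
   using h h' by (simp add: gtensor_act_elem[OF V W _ v w] alghomD(3)[OF D_alghom])
  also have "... = sum2 Q ?T (D h) (%x y. sum2 Q ?T (D h') (%x' y'.
    gtensor_elem Q V W (act V (x ** x') v) (act W (y ** y') w)))"
   by (rule sum2_mult[OF mT be[OF v w]]) (use h h' in simp_all)
  also have "... = sum2 Q ?T (D h') (%x' y'. sum2 Q ?T (D h) (%x y.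
    gtensor_elem Q V W (act V (x ** x') v) (act W (y ** y') w)))"
   by (rule sum2_swap[OF mT]) (use h h' v w in "simp_all add: c")
  also have "... = sum2 Q ?T (D h') (%x' y'. act ?T h (gtensor_elem Q V W (act V x' v) (act W y' w)))"
  proof (rule sum2_cong[OF mT])
   fix x' y' assume xy: "x' <: H" "y' <: H"
   show "sum2 Q ?T (D h) (%x y. gtensor_elem Q V W (act V (x ** x') v) (act W (y ** y') w)) =
    act ?T h (gtensor_elem Q V W (act V x' v) (act W y' w))"
    by (subst gtensor_act_elem[OF V W h], use xy v w in "simp_all add: c", rule sum2_cong[OF mT])
     (use xy h v w in "simp_all add: c hmodD(3)[OF V] hmodD(3)[OF W]")
  qed (use h h' v w in "simp_all add: c module_lin_closed[OF lt]")
  also have "... = act ?T h (act ?T h' (gtensor_elem Q V W v w))"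
   unfolding gtensor_act_elem[OF V W h' v w]
   by (rule sum2_comp[symmetric, OF mT mT lt[OF h]]) (use h' v w in "simp_all add: c")
  finally show "act ?T (h ** h') (gtensor_elem Q V W v w) = act ?T h (act ?T h' (gtensor_elem Q V W v w))" .
 qed (use h h' in simp_all)
 have on: "act ?T \<one>\<^bsub>H\<^esub> t = t" if t: "t <: ?T" for t
 proof (rule gtensor_ext[OF tp mT lt module_lin_id _ t])
  fix v w assume v: "v <: V" and w: "w <: W"
  show "act ?T \<one>\<^bsub>H\<^esub> (gtensor_elem Q V W v w) = gtensor_elem Q V W v w"
   using v w by (simp add: gtensor_act_elem[OF V W _ v w] alghomD(2)[OF D_alghom] one_H2 sum2_e2[OF mT be]
     hmodD(4)[OF V] hmodD(4)[OF W])
 qed simp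
 show ?thesis unfolding hmod_def using mT b mu on by auto
qed

lemma hbilin_hlin:
 assumes V: "hmod V" and W: "hmod W" and X: "hmod X" and F: "hlin (gtensor Q V W) X F"
 shows "hbilin V W X (%v w. F (gtensor_elem Q V W v w))"
 unfolding hbilin_def
proof (intro conjI ballI)
 note tp = hmod_tp[OF V W]
 note e = gelem_bilin[OF tp]
 show "bilin K V W X (%v w. F (gtensor_elem Q V W v w))"
  by (intro bilinI module_lin_comp[OF hlinD(1)[OF F]] bilin_lin1[OF e] bilin_lin2[OF e])
 fix h v w assume h: "h <: H" and v: "v <: V" and w: "w <: W"
 have "sum2 Q X (D h) (%x y. F (gtensor_elem Q V W (act V x v) (act W y w))) =
  F (sum2 Q (gtensor Q V W) (D h) (%x y. gtensor_elem Q V W (act V x v) (act W y w)))"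
  by (rule sum2_comp[symmetric, OF module_gtensor[OF tp] hmodD(1)[OF X] hlinD(1)[OF F]])
   (use h v w in "simp_all add: bilin_closed[OF e] hmodD(5)[OF V] hmodD(5)[OF W]")
 then show "sum2 Q X (D h) (%x y. F (gtensor_elem Q V W (act V x v) (act W y w))) = act X h (F (gtensor_elem Q V W v w))"
  using gtensor_act_elem[OF V W h v w] hlinD(2)[OF F h bilin_closed[OF e v w]] by simp
qed

lemma hlin_lift:
 assumes V: "hmod V" and W: "hmod W" and X: "hmod X" and b: "hbilin V W X b"
 shows "hlin (gtensor Q V W) X (tensor_lift K V W X b)"
 unfolding hlin_def
proof (intro conjI ballI)
 note tp = hmod_tp[OF V W]
 note e = gelem_bilin[OF tp]
 note mX = hmodD(1)[OF X]
 note T = hmod_gtensor[OF V W]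
 note bb = hbilinD(1)[OF b]
 show l: "module_lin K (gtensor Q V W) X (tensor_lift K V W X b)" by (rule glift_lin[OF tp mX bb])
 fix h t assume h: "h <: H" and t: "t <: (gtensor Q V W)"
 show "tensor_lift K V W X b (act (gtensor Q V W) h t) = act X h (tensor_lift K V W X b t)"
 proof (rule gtensor_ext[OF tp mX module_lin_comp[OF l bilin_lin2[OF hmodD(2)[OF T] h]]
    module_lin_comp[OF bilin_lin2[OF hmodD(2)[OF X] h] l] _ t])
  fix v w assume v: "v <: V" and w: "w <: W"
  have "tensor_lift K V W X b (act (gtensor Q V W) h (gtensor_elem Q V W v w)) =
    sum2 Q X (D h) (%x y. tensor_lift K V W X b (gtensor_elem Q V W (act V x v) (act W y w)))"
   unfolding gtensor_act_elem[OF V W h v w]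
   by (rule sum2_comp[OF module_gtensor[OF tp] mX l])
    (use h v w in "simp_all add: bilin_closed[OF e] hmodD(5)[OF V] hmodD(5)[OF W]")
  also have "... = sum2 Q X (D h) (%x y. b (act V x v) (act W y w))"
   by (rule sum2_cong[OF mX]) (use h v w in "simp_all add: glift_elem[OF tp mX bb] hmodD(5)[OF V] hmodD(5)[OF W] hbilinD(3)[OF b]")
  finally show "tensor_lift K V W X b (act (gtensor Q V W) h (gtensor_elem Q V W v w)) =
   act X h (tensor_lift K V W X b (gtensor_elem Q V W v w))"
   using hbilinD(2)[OF b h v w] glift_elem[OF tp mX bb v w] by simp
 qed
qed

text \<open>The definition applies F to a sum of pure tensors; linearity brings F inside the sum.
  From here on, currying is handled through bilinear forms.\<close>

lemma gcurry_cur: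
 assumes V: "hmod V" and W: "hmod W" and X: "hmod X" and F: "module_lin K (gtensor Q V W) X F"
 shows "gcurry Q V W F = cur V W X (%v w. F (gtensor_elem Q V W v w))"
proof -
 note tp = hmod_tp[OF V W]
 have "F (sum3 Q (gtensor Q V W) psi (%x y z. gtensor_elem Q V W (act V x v) (act W (y ** be ** S z) w))) =
  sum3 Q X psi (%x y z. F (gtensor_elem Q V W (act V x v) (act W (y ** be ** S z) w)))"
  if "v <: V" "w <: W" for v w
  by (rule sum3_comp[OF module_gtensor[OF tp] hmodD(1)[OF X] F psi_closed])
   (use that in "simp add: bilin_closed[OF gelem_bilin[OF tp]] hmodD(5)[OF V] hmodD(5)[OF W]")
 then show ?thesis unfolding gcurry_def cur_def Let_def by (auto intro!: restrict_ext)
qed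

lemma gev_app: "gev Q V W = tensor_lift K (ghom Q V W) V W (app V W)"
 unfolding gev_def guncurry_def app_def Let_def ..

lemma gev_hlin: "hmod V ==> hmod W ==> hlin (gtensor Q (ghom Q V W) V) W (gev Q V W)"
 unfolding gev_app by (intro hlin_lift hmod_ghom app_hbilin)

lemma gev_elem: "hmod V ==> hmod W ==> L <: (ghom Q V W) ==> v <: V ==>
  gev Q V W (gtensor_elem Q (ghom Q V W) V L v) = app V W L v"
 unfolding gev_app
 by (rule glift_elem) (simp_all add: hmod_tp hmod_ghom hmodD(1) hbilinD(1)[OF app_hbilin])

lemma gtensor_map_lin:
 assumes V: "hmod V" and W: "hmod W" and V': "hmod V'" and W': "hmod W'"
  and f: "module_lin K V V' f" and g: "module_lin K W W' g"
 shows "module_lin K (gtensor Q V W) (gtensor Q V' W') (gtensor_map Q V W V' W' f g)"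
  and "v <: V ==> w <: W ==>
   gtensor_map Q V W V' W' f g (gtensor_elem Q V W v w) = gtensor_elem Q V' W' (f v) (g w)"
proof -
 note e = gelem_bilin[OF hmod_tp[OF V' W']]
 have b: "bilin K V W (gtensor Q V' W') (%v w. gtensor_elem Q V' W' (f v) (g w))"
  by (intro bilinI bilin_comp1[OF e] bilin_comp2[OF e] f g module_lin_closed[OF f] module_lin_closed[OF g])
 note t = hmod_tp[OF V W] module_gtensor[OF hmod_tp[OF V' W']] b
 show "module_lin K (gtensor Q V W) (gtensor Q V' W') (gtensor_map Q V W V' W' f g)"
  unfolding gtensor_map_def by (rule glift_lin[OF t])
 show "v <: V ==> w <: W ==>
   gtensor_map Q V W V' W' f g (gtensor_elem Q V W v w) = gtensor_elem Q V' W' (f v) (g w)"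
  unfolding gtensor_map_def by (rule glift_elem[OF t])
qed

lemma gassoc_lin:
 assumes V: "hmod V" and W: "hmod W" and X: "hmod X"
 defines "T \<equiv> gtensor Q V (gtensor Q W X)"
 shows "module_lin K (gtensor Q (gtensor Q V W) X) T (gassoc Q V W X)"
  and "v <: V ==> w <: W ==> u <: X ==>
   gassoc Q V W X (gtensor_elem Q (gtensor Q V W) X (gtensor_elem Q V W v w) u) =
   sum3 Q T phi (%x y z. gtensor_elem Q V (gtensor Q W X) (act V x v) (gtensor_elem Q W X (act W y w) (act X z u)))"
proof -
 note tVW = hmod_tp[OF V W] and tWX = hmod_tp[OF W X]
 note VW = hmod_gtensor[OF V W] and WX = hmod_gtensor[OF W X]
 note e1 = gelem_bilin[OF tWX] and e2 = gelem_bilin[OF hmod_tp[OF V WX]]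
 note c = hmodD(5)[OF V] hmodD(5)[OF W] hmodD(5)[OF X] bilin_closed[OF e1] bilin_closed[OF e2]
 have mT: "module K T" unfolding T_def by (rule module_gtensor[OF hmod_tp[OF V WX]])
 have e2': "bilin K V (gtensor Q W X) T (gtensor_elem Q V (gtensor Q W X))" unfolding T_def by (rule e2)
 let ?c = "%v w u. sum3 Q T phi (%x y z.
   gtensor_elem Q V (gtensor Q W X) (act V x v) (gtensor_elem Q W X (act W y w) (act X z u)))"
 have b1: "bilin K V W T (%v w. ?c v w u)" if "u <: X" for u
  by (rule lins bilin_comp2[OF e2'] bilin_comp1[OF e2'] bilin_comp2[OF e1] bilin_comp1[OF e1]
    act_lins[OF V] act_lins[OF W] act_lins[OF X] | simp add: c mT that)+
 have b2: "bilin K (gtensor Q V W) X T (%s u. tensor_lift K V W T (%v w. ?c v w u) s)"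
 proof (rule bilinI)
  fix u assume u: "u <: X"
  show "module_lin K (gtensor Q V W) T (%s. tensor_lift K V W T (%v w. ?c v w u) s)"
   by (rule glift_lin[OF tVW mT b1[OF u]])
 next
  fix s assume s: "s <: (gtensor Q V W)"
  show "module_lin K X T (%u. tensor_lift K V W T (%v w. ?c v w u) s)"
  proof (rule tensor_pair.lift_fun_lin[OF tVW mT])
   fix v w assume vw: "v <: V" "w <: W"
   show "module_lin K X T (%u. ?c v w u)"
    by (rule lins bilin_comp2[OF e2'] bilin_comp1[OF e2'] bilin_comp2[OF e1] bilin_comp1[OF e1]
      act_lins[OF X] | simp add: c mT vw)+
  qed (use s in "simp add: gsameD")
 qed
 have eq: "gassoc Q V W X = tensor_lift K (gtensor Q V W) X T (%s u. tensor_lift K V W T (%v w. ?c v w u) s)"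
  unfolding gassoc_def Let_def T_def ..
 show "module_lin K (gtensor Q (gtensor Q V W) X) T (gassoc Q V W X)"
  unfolding eq by (rule glift_lin[OF hmod_tp[OF VW X] mT b2])
 show "gassoc Q V W X (gtensor_elem Q (gtensor Q V W) X (gtensor_elem Q V W v w) u) = ?c v w u"
  if "v <: V" "w <: W" "u <: X"
  unfolding eq using that
  by (subst glift_elem[OF hmod_tp[OF VW X] mT b2])
   (simp_all add: glift_elem[OF tVW mT b1] bilin_closed[OF gelem_bilin[OF tVW]])
qed

text \<open>The evaluation of the internal composite at v, by \<open>app_gcomp\<close>; the
  associator distributes over the two operators and the vector.\<close>

definition cmp3 :: "('k, 'h, 'v) gmod => ('k, 'h, 'w) gmod => ('k, 'h, 'x) gmod
  => ('w => 'x) => ('v => 'w) => 'v => 'x" where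
 "cmp3 V W X L L' v = sum3 Q X phi (%x y z.
  app W X (act (ghom Q W X) x L) (app V W (act (ghom Q V W) y L') (act V z v)))"

definition precomp :: "('k, 'h, 'v) gmod => ('k, 'h, 'w) gmod
  => ('k, 'h, 'x) gmod => ('k, ('k, 'w => 'x, 'v => 'w) tensor, 'v) tensor => 'x" where
 "precomp V W X = gev Q W X
    \<circ> gtensor_map Q (ghom Q W X) (gtensor Q (ghom Q V W) V) (ghom Q W X) W (%L. L) (gev Q V W)
    \<circ> gassoc Q (ghom Q W X) (ghom Q V W) V"

lemma precomp_lin:
 assumes V: "hmod V" and W: "hmod W" and X: "hmod X"
 shows "module_lin K (gtensor Q (gtensor Q (ghom Q W X) (ghom Q V W)) V) X (precomp V W X)"
  and "L <: (ghom Q W X) ==> L' <: (ghom Q V W) ==> v <: V ==>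
   precomp V W X (gtensor_elem Q (gtensor Q (ghom Q W X) (ghom Q V W)) V
    (gtensor_elem Q (ghom Q W X) (ghom Q V W) L L') v) = cmp3 V W X L L' v"
proof -
 note E1 = hmod_ghom[OF W X] and E2 = hmod_ghom[OF V W]
 note E2V = hmod_gtensor[OF E2 V]
 note mX = hmodD(1)[OF X]
 note ev1 = hlinD(1)[OF gev_hlin[OF W X]] and ev2 = hlinD(1)[OF gev_hlin[OF V W]]
 note mp = gtensor_map_lin[OF E1 E2V E1 W module_lin_id ev2]
 note as = gassoc_lin[OF E1 E2 V]
 show "module_lin K (gtensor Q (gtensor Q (ghom Q W X) (ghom Q V W)) V) X (precomp V W X)"
  unfolding precomp_def comp_def
  by (rule module_lin_comp[OF module_lin_comp[OF ev1 mp(1)] as(1)])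
 assume L: "L <: (ghom Q W X)" and L': "L' <: (ghom Q V W)" and v: "v <: V"
 note c = hmodD(5)[OF E1] hmodD(5)[OF E2] hmodD(5)[OF V] bilin_closed[OF gelem_bilin[OF hmod_tp[OF E2 V]]]
  bilin_closed[OF gelem_bilin[OF hmod_tp[OF E1 E2V]]] hbilinD(3)[OF app_hbilin[OF V W]] hbilinD(3)[OF app_hbilin[OF W X]]
 show "precomp V W X (gtensor_elem Q (gtensor Q (ghom Q W X) (ghom Q V W)) V
    (gtensor_elem Q (ghom Q W X) (ghom Q V W) L L') v) = cmp3 V W X L L' v"
  unfolding precomp_def comp_def as(2)[OF L L' v] cmp3_def
  by (subst sum3_comp[where P' = X, OF module_gtensor[OF hmod_tp[OF E1 E2V]] mX module_lin_comp[OF ev1 mp(1)] phi_closed],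
    simp add: c L L' v, rule sum3_cong[OF mX phi_closed])
   (simp_all add: c L L' v mp(2) gev_elem[OF V W] gev_elem[OF W X])
qed

lemma cmp3_trilin:
 assumes V: "hmod V" and W: "hmod W" and X: "hmod X"
  and L: "L <: (ghom Q W X)" and L': "L' <: (ghom Q V W)" and v: "v <: V"
 shows "trilin X (%x y z. app W X (act (ghom Q W X) x L) (app V W (act (ghom Q V W) y L') (act V z v)))"
proof -
 note E1 = hmod_ghom[OF W X] and E2 = hmod_ghom[OF V W]
 note a1 = hbilinD(1)[OF app_hbilin[OF W X]] and a2 = hbilinD(1)[OF app_hbilin[OF V W]]
 note c = hmodD(5)[OF E1] hmodD(5)[OF E2] hmodD(5)[OF V] bilin_closed[OF a1] bilin_closed[OF a2]
 show ?thesis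
  by (rule lins bilin_comp2[OF a1] bilin_comp1[OF a1] bilin_comp2[OF a2] bilin_comp1[OF a2]
    act_lins[OF E1] act_lins[OF E2] act_lins[OF V] | simp add: c L L' v)+
qed

text \<open>After quasi-coassociativity the inner pair of coproduct legs acts within the inner
  evaluation and the outer leg on the outer operator, so equivariance of \<open>app\<close> is used
  twice.\<close>

lemma precomp_hbilin:
 assumes V: "hmod V" and W: "hmod W" and X: "hmod X"
 shows "hbilin (gtensor Q (ghom Q W X) (ghom Q V W)) V X
  (%s v. precomp V W X (gtensor_elem Q (gtensor Q (ghom Q W X) (ghom Q V W)) V s v))"
 unfolding hbilin_def
proof (intro conjI ballI)
 note E1 = hmod_ghom[OF W X] and E2 = hmod_ghom[OF V W]
 note tp = hmod_tp[OF E1 E2]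
 let ?S = "gtensor Q (ghom Q W X) (ghom Q V W)"
 let ?f = "%s v. precomp V W X (gtensor_elem Q ?S V s v)"
 note S = hmod_gtensor[OF E1 E2]
 note mX = hmodD(1)[OF X]
 note e = gelem_bilin[OF hmod_tp[OF S V]] and e0 = gelem_bilin[OF tp]
 note p = precomp_lin[OF V W X]
 show b: "bilin K ?S V X ?f"
  by (intro bilinI module_lin_comp[OF p(1)] bilin_lin1[OF e] bilin_lin2[OF e])
 note a1 = hbilinD(1)[OF app_hbilin[OF W X]] and a2 = hbilinD(1)[OF app_hbilin[OF V W]]
 note c = hmodD(5)[OF E1] hmodD(5)[OF E2] hmodD(5)[OF V] hmodD(5)[OF S] hmodD(5)[OF X]
  bilin_closed[OF a1] bilin_closed[OF a2] bilin_closed[OF e0] bilin_closed[OF b]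
 fix h s v assume h: "h <: H" and s: "s <: ?S" and v: "v <: V"
 show "sum2 Q X (D h) (%x y. ?f (act ?S x s) (act V y v)) = act X h (?f s v)"
 proof (rule gtensor_ext[OF tp mX, where f = "%s. sum2 Q X (D h) (%x y. ?f (act ?S x s) (act V y v))"
    and g = "%s. act X h (?f s v)", OF _ _ _ s])
  show "module_lin K ?S X (%s. sum2 Q X (D h) (%x y. ?f (act ?S x s) (act V y v)))"
   by (rule lins bilin_comp1[OF b] act_lins[OF S] | simp add: c mX h v)+
  show "module_lin K ?S X (%s. act X h (?f s v))"
   by (rule lins bilin_comp1[OF b] act_lins[OF X] | simp add: c mX h v)+
  fix L L' assume L: "L <: (ghom Q W X)" and L': "L' <: (ghom Q V W)"
  let ?b = "%x y z. app W X (act (ghom Q W X) x L) (app V W (act (ghom Q V W) y L') (act V z v))"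
  note tri = cmp3_trilin[OF V W X L L' v]
  have "sum2 Q X (D h) (%x y. ?f (act ?S x (gtensor_elem Q (ghom Q W X) (ghom Q V W) L L')) (act V y v)) =
   sum2 Q X (D h) (%x y. sum3 Q X phi (%u s t. sum2 Q X (D x) (%p q. ?b (u ** p) (s ** q) (t ** y))))"
  proof (rule sum2_cong[OF mX])
   fix x y assume xy: "x <: H" "y <: H"
   have "?f (act ?S x (gtensor_elem Q (ghom Q W X) (ghom Q V W) L L')) (act V y v) =
    sum2 Q X (D x) (%p q. ?f (gtensor_elem Q (ghom Q W X) (ghom Q V W) (act (ghom Q W X) p L) (act (ghom Q V W) q L')) (act V y v))"
    unfolding gtensor_act_elem[OF E1 E2 xy(1) L L']
    by (rule sum2_comp[where g = "%s. ?f s (act V y v)", OF hmodD(1)[OF S] mX bilin_lin1[OF b]])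
     (use xy L L' v in "simp_all add: c")
   also have "... = sum2 Q X (D x) (%p q. sum3 Q X phi (%u s t. ?b (u ** p) (s ** q) (t ** y)))"
    by (rule sum2_cong[OF mX], use xy in simp, use xy L L' v in "simp add: p(2) c", unfold cmp3_def, rule sum3_cong[OF mX phi_closed])
     (use xy L L' v in "simp_all add: c sum3_closed mX hmodD(3)[OF E1] hmodD(3)[OF E2] hmodD(3)[OF V]")
   also have "... = sum3 Q X phi (%u s t. sum2 Q X (D x) (%p q. ?b (u ** p) (s ** q) (t ** y)))"
    by (rule sum23_swap[OF mX]) (use xy L L' v in "simp_all add: c")
   finally show "?f (act ?S x (gtensor_elem Q (ghom Q W X) (ghom Q V W) L L')) (act V y v) = ..." .
  qed (use h L L' v in "simp_all add: sum3_closed sum2_closed mX c")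
  also have "... = sum3 Q X phi (%u s t. sum2 Q X (D h) (%x y. sum2 Q X (D x) (%p q. ?b (u ** p) (s ** q) (t ** y))))"
   by (rule sum23_swap[OF mX]) (use h L L' v in "simp_all add: sum2_closed mX c")
  also have "... = sum2 Q X (D h) (%x y. sum2 Q X (D y) (%p q. sum3 Q X phi (%u s t. ?b (x ** u) (p ** s) (q ** t))))"
   by (rule coassoc_phi[OF mX tri h, symmetric])
  also have "... = sum2 Q X (D h) (%x y. sum3 Q X phi (%u s t. sum2 Q X (D y) (%p q. ?b (x ** u) (p ** s) (q ** t))))"
   by (rule sum2_cong[OF mX], use h in simp, rule sum23_swap[OF mX])
    (use h L L' v in "simp_all add: sum3_closed sum2_closed mX c")
  also have "... = sum3 Q X phi (%u s t. sum2 Q X (D h) (%x y. sum2 Q X (D y) (%p q. ?b (x ** u) (p ** s) (q ** t))))"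
   by (rule sum23_swap[OF mX]) (use h L L' v in "simp_all add: sum2_closed mX c")
  also have "... = sum3 Q X phi (%u s t. act X h (?b u s t))"
  proof (rule sum3_cong[OF mX phi_closed])
   fix u s t assume ust: "u <: H" "s <: H" "t <: H"
   have 1: "sum2 Q X (D y) (%p q. ?b (x ** u) (p ** s) (q ** t)) =
     app W X (act (ghom Q W X) x (act (ghom Q W X) u L)) (act W y (app V W (act (ghom Q V W) s L') (act V t v)))"
    if xy: "x <: H" "y <: H" for x y
   proof -
    have "app W X (act (ghom Q W X) x (act (ghom Q W X) u L)) (act W y (app V W (act (ghom Q V W) s L') (act V t v))) =
     app W X (act (ghom Q W X) x (act (ghom Q W X) u L))
      (sum2 Q W (D y) (%p q. app V W (act (ghom Q V W) p (act (ghom Q V W) s L')) (act V q (act V t v))))"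
     using xy ust L L' v by (simp add: hbilinD(2)[OF app_hbilin[OF V W]] c)
    also have "... = sum2 Q X (D y) (%p q. app W X (act (ghom Q W X) x (act (ghom Q W X) u L))
      (app V W (act (ghom Q V W) p (act (ghom Q V W) s L')) (act V q (act V t v))))"
     by (rule sum2_comp[OF hmodD(1)[OF W] mX bilin_lin2[OF a1]]) (use xy ust L L' v in "simp_all add: c")
    also have "... = sum2 Q X (D y) (%p q. ?b (x ** u) (p ** s) (q ** t))"
     by (rule sum2_cong[OF mX]) (use xy ust L L' v in "simp_all add: c hmodD(3)[OF E1] hmodD(3)[OF E2] hmodD(3)[OF V]")
    finally show ?thesis by simp
   qed
   have "sum2 Q X (D h) (%x y. sum2 Q X (D y) (%p q. ?b (x ** u) (p ** s) (q ** t))) =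
    sum2 Q X (D h) (%x y. app W X (act (ghom Q W X) x (act (ghom Q W X) u L)) (act W y (app V W (act (ghom Q V W) s L') (act V t v))))"
    by (rule sum2_cong[OF mX]) (use h ust L L' v in "simp_all add: 1 c hmodD(5)[OF W]")
   then show "sum2 Q X (D h) (%x y. sum2 Q X (D y) (%p q. ?b (x ** u) (p ** s) (q ** t))) = act X h (?b u s t)"
    using h ust L L' v by (simp add: hbilinD(2)[OF app_hbilin[OF W X]] c)
  qed (use h L L' v in "simp add: c")
  also have "... = act X h (cmp3 V W X L L' v)"
   unfolding cmp3_def
   by (rule sum3_comp[symmetric, OF mX mX bilin_lin2[OF hmodD(2)[OF X] h] phi_closed]) (use L L' v in "simp add: c")
  finally show "sum2 Q X (D h) (%x y. ?f (act ?S x (gtensor_elem Q (ghom Q W X) (ghom Q V W) L L')) (act V y v)) =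
   act X h (?f (gtensor_elem Q (ghom Q W X) (ghom Q V W) L L') v)"
   unfolding p(2)[OF L L' v] .
 qed
qed

lemma gcomp_cur:
 assumes V: "hmod V" and W: "hmod W" and X: "hmod X"
 shows "gcomp Q V W X = cur (gtensor Q (ghom Q W X) (ghom Q V W)) V X
  (%s v. precomp V W X (gtensor_elem Q (gtensor Q (ghom Q W X) (ghom Q V W)) V s v))"
 unfolding gcomp_def precomp_def[symmetric]
 by (rule gcurry_cur[OF hmod_gtensor[OF hmod_ghom[OF W X] hmod_ghom[OF V W]] V X precomp_lin(1)[OF V W X]])

lemma gcomp_hlin:
 assumes V: "hmod V" and W: "hmod W" and X: "hmod X"
 shows "hlin (gtensor Q (ghom Q W X) (ghom Q V W)) (ghom Q V X) (gcomp Q V W X)"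
proof -
 note S = hmod_gtensor[OF hmod_ghom[OF W X] hmod_ghom[OF V W]]
 note p = precomp_hbilin[OF V W X]
 show ?thesis
  unfolding hlin_def gcomp_cur[OF V W X]
  using cur_closed(2)[OF S V X hbilinD(1)[OF p]] cur_equivariant[OF S V X p] by auto
qed

lemma app_gcomp:
 assumes V: "hmod V" and W: "hmod W" and X: "hmod X"
  and L: "L <: (ghom Q W X)" and L': "L' <: (ghom Q V W)" and v: "v <: V"
 shows "app V X (gcomp Q V W X (gtensor_elem Q (ghom Q W X) (ghom Q V W) L L')) v = cmp3 V W X L L' v"
proof -
 note E1 = hmod_ghom[OF W X] and E2 = hmod_ghom[OF V W]
 show ?thesis
  unfolding gcomp_cur[OF V W X] precomp_lin(2)[OF V W X L L' v, symmetric]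
  by (rule app_cur[OF hmod_gtensor[OF E1 E2] V X precomp_hbilin[OF V W X] bilin_closed[OF gelem_bilin[OF hmod_tp[OF E1 E2]] L L'] v])
qed

end

section \<open>Homogeneous components\<close>

lemma submodule_carrier_update:
 assumes "module K P" "submodule U K P"
 shows "module K (P\<lparr>carrier := U\<rparr>)" "module_lin K (P\<lparr>carrier := U\<rparr>) P (%x. x)"
 using submodule.submodule_is_module[OF assms(2,1)] module.submoduleE(1)[OF assms]
 by (simp_all add: module_lin_def subset_eq)

lemma (in abelian_monoid) finsum_single:
 assumes "finite I" "i \<in> I" "!!j. j \<in> I ==> j \<noteq> i ==> f j = \<zero>" "f i <: G"
 shows "(\<Oplus>j\<in>I. f j) = f i"
proof -
 have c: "f j <: G" if "j \<in> I" for j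
  using assms(3)[OF that] assms(4) by (cases "j = i") auto
 have "(\<Oplus>j\<in>I. f j) = (\<Oplus>j\<in>{i}. f j)"
  by (rule add.finprod_mono_neutral_cong_right) (use assms(1-3) c in auto)
 then show ?thesis using assms(4) by simp
qed

lemma module_lin_finsum_fun:
 assumes "module K N" "!!i. i \<in> I ==> module_lin K M N (f i)"
 shows "module_lin K M N (%u. \<Oplus>\<^bsub>N\<^esub>i\<in>I. f i u)"
proof -
 interpret N: module K N by fact
 show ?thesis
 proof (rule module_linI)
  fix x assume x: "x <: M"
  show "(\<Oplus>\<^bsub>N\<^esub>i\<in>I. f i x) <: N"
   by (rule N.finsum_closed) (auto intro: module_lin_closed[OF assms(2) x])
  fix y assume y: "y <: M"
  have c: "f i x <: N" "f i y <: N" "f i (x \<oplus>\<^bsub>M\<^esub> y) = f i x \<oplus>\<^bsub>N\<^esub> f i y" if "i \<in> I" for i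
   using module_lin_closed[OF assms(2)[OF that] x] module_lin_closed[OF assms(2)[OF that] y]
    module_lin_add[OF assms(2)[OF that] x y] by auto
  have "(\<Oplus>\<^bsub>N\<^esub>i\<in>I. f i (x \<oplus>\<^bsub>M\<^esub> y)) = (\<Oplus>\<^bsub>N\<^esub>i\<in>I. f i x \<oplus>\<^bsub>N\<^esub> f i y)"
   by (rule N.finsum_cong') (use c in auto)
  also have "... = (\<Oplus>\<^bsub>N\<^esub>i\<in>I. f i x) \<oplus>\<^bsub>N\<^esub> (\<Oplus>\<^bsub>N\<^esub>i\<in>I. f i y)"
   by (rule N.finsum_addf) (use c in auto)
  finally show "(\<Oplus>\<^bsub>N\<^esub>i\<in>I. f i (x \<oplus>\<^bsub>M\<^esub> y)) = (\<Oplus>\<^bsub>N\<^esub>i\<in>I. f i x) \<oplus>\<^bsub>N\<^esub> (\<Oplus>\<^bsub>N\<^esub>i\<in>I. f i y)" .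
 next
  fix r x assume r: "r <: K" and x: "x <: M"
  have c: "f i x <: N" "f i (r \<odot>\<^bsub>M\<^esub> x) = r \<odot>\<^bsub>N\<^esub> f i x" if "i \<in> I" for i
   using module_lin_closed[OF assms(2)[OF that] x] module_lin_smult[OF assms(2)[OF that] r x] by auto
  have "(\<Oplus>\<^bsub>N\<^esub>i\<in>I. f i (r \<odot>\<^bsub>M\<^esub> x)) = (\<Oplus>\<^bsub>N\<^esub>i\<in>I. r \<odot>\<^bsub>N\<^esub> f i x)"
   by (rule N.finsum_cong') (use c r in auto)
  also have "... = r \<odot>\<^bsub>N\<^esub> (\<Oplus>\<^bsub>N\<^esub>i\<in>I. f i x)"
   by (rule module_finsum_smult[symmetric, OF assms(1) r]) (use c in auto)
  finally show "(\<Oplus>\<^bsub>N\<^esub>i\<in>I. f i (r \<odot>\<^bsub>M\<^esub> x)) = r \<odot>\<^bsub>N\<^esub> (\<Oplus>\<^bsub>N\<^esub>i\<in>I. f i x)" .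
 qed
qed

context qhopf
begin

text \<open>The sum can be formed in U as a module of its own; the inclusion of U is linear and
  takes it to the sum formed in P.\<close>

lemma sum2_submodule:
 assumes P: "module K P" and U: "submodule U K P" and t: "t <: HH2"
  and b: "!!x y. x <: H ==> y <: H ==> b x y \<in> U"
 shows "sum2 Q P t b \<in> U"
proof -
 note s = submodule_carrier_update[OF P U]
 have "sum2 Q P t b = sum2 Q (P\<lparr>carrier := U\<rparr>) t b"
  using sum2_comp[OF s(1) P s(2) t, of b] b by simp
 then show ?thesis using sum2_closed[OF s(1), of b t] b t by simp
qed

lemma sum3_submodule:
 assumes P: "module K P" and U: "submodule U K P" and t: "t <: HH3"
  and b: "!!x y z. x <: H ==> y <: H ==> z <: H ==> b x y z \<in> U"
 shows "sum3 Q P t b \<in> U"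
proof -
 note s = submodule_carrier_update[OF P U]
 have "sum3 Q P t b = sum3 Q (P\<lparr>carrier := U\<rparr>) t b"
  using sum3_comp[OF s(1) P s(2) t, of b] b by simp
 then show ?thesis using sum3_closed[OF s(1), of b t] b t by simp
qed

lemma hm_objD:
 assumes V: "hm_obj Q V"
 shows "module K V" "submodule (grd V n) K V" "finite {n. grd V n \<noteq> {\<zero>\<^bsub>V\<^esub>}}"
  "h <: H ==> v \<in> grd V n ==> act V h v \<in> grd V n"
  "v <: V ==> \<exists>!c. homog_decomp V v c"
  "v \<in> grd V n ==> v <: V" "\<zero>\<^bsub>V\<^esub> \<in> grd V n" "hmod V"
proof -
 show M: "module K V" and s: "submodule (grd V n) K V"
  using V by (simp_all add: hm_obj_def Let_def)
 show "v \<in> grd V n ==> v <: V" using module.submoduleE(1)[OF M s] by auto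
 show "\<zero>\<^bsub>V\<^esub> \<in> grd V n" by (rule submodule_zero[OF s])
 show "hmod V" by (rule hmod_obj[OF V])
qed (use V in "simp_all add: hm_obj_def Let_def")

lemma homog_decompI:
 assumes V: "module K V" and "!!n. submodule (grd V n) K V" and I: "finite I"
  "!!n. c n \<in> grd V n" "!!n. n \<notin> I ==> c n = \<zero>\<^bsub>V\<^esub>" "v = (\<Oplus>\<^bsub>V\<^esub>n\<in>I. c n)"
 shows "homog_decomp V v c"
proof -
 interpret V: module K V by (rule V)
 have s: "{n. c n \<noteq> \<zero>\<^bsub>V\<^esub>} \<subseteq> I" using I(3) by auto
 have "c n <: V" for n using subsetD[OF V.submoduleE(1)[OF assms(2)] I(2)] .
 then have "(\<Oplus>\<^bsub>V\<^esub>n\<in>{n. c n \<noteq> \<zero>\<^bsub>V\<^esub>}. c n) = (\<Oplus>\<^bsub>V\<^esub>n\<in>I. c n)"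
  by (intro V.add.finprod_mono_neutral_cong_left I(1) s) auto
 then show ?thesis unfolding homog_decomp_def using I finite_subset[OF s I(1)] by simp
qed

lemma homog_part_decomp:
 assumes "hm_obj Q V" "v <: V"
 shows "homog_decomp V v (homog_part V v)"
 unfolding homog_part_def by (rule theI'[OF hm_objD(5)[OF assms]])

lemma homog_part_eq:
 assumes "hm_obj Q V" "v <: V" "homog_decomp V v c"
 shows "homog_part V v = c"
 using hm_objD(5)[OF assms(1,2)] homog_part_decomp[OF assms(1,2)] assms(3) by blast

lemma homog_part_eqI:
 assumes "hm_obj Q V" "finite I"
  "!!n. c n \<in> grd V n" "!!n. n \<notin> I ==> c n = \<zero>\<^bsub>V\<^esub>" "v = (\<Oplus>\<^bsub>V\<^esub>n\<in>I. c n)"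
 shows "homog_part V v = c"
proof (rule homog_part_eq[OF assms(1)])
 interpret V: module K V by (rule hm_objD(1)[OF assms(1)])
 show "v <: V" unfolding assms(5)
  by (rule V.finsum_closed) (auto intro: hm_objD(6)[OF assms(1) assms(3)])
 show "homog_decomp V v c"
  by (rule homog_decompI[OF hm_objD(1)[OF assms(1)] hm_objD(2)[OF assms(1)] assms(2-5)])
qed

text \<open>A finite set of degrees independent of the vector. Sums over \<open>degs V\<close> are
  linear in the vector, whereas the support of a vector varies with it.\<close>

definition degs :: "('k, 'h, 'v) gmod => int set" where
 "degs V = {n. grd V n \<noteq> {\<zero>\<^bsub>V\<^esub>}}"

lemma degs_finite: "hm_obj Q V ==> finite (degs V)"
 unfolding degs_def by (rule hm_objD(3))

lemma degs_outside: "n \<notin> degs V ==> v \<in> grd V n ==> v = \<zero>\<^bsub>V\<^esub>"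
 by (auto simp: degs_def)

lemma homog_part_grd: "hm_obj Q V ==> v <: V ==> homog_part V v n \<in> grd V n"
 using homog_part_decomp[of V v] by (simp add: homog_decomp_def)

lemma homog_part_closed: "hm_obj Q V ==> v <: V ==> homog_part V v n <: V"
 by (rule hm_objD(6)[OF _ homog_part_grd])

lemma homog_part_sum:
 assumes V: "hm_obj Q V" and v: "v <: V" and I: "finite I" "degs V \<subseteq> I"
 shows "(\<Oplus>\<^bsub>V\<^esub>n\<in>I. homog_part V v n) = v"
proof -
 interpret V: module K V by (rule hm_objD(1)[OF V])
 have s: "{n. homog_part V v n \<noteq> \<zero>\<^bsub>V\<^esub>} \<subseteq> I"
  using degs_outside[OF _ homog_part_grd[OF V v]] I(2) by auto
 have "(\<Oplus>\<^bsub>V\<^esub>n\<in>{n. homog_part V v n \<noteq> \<zero>\<^bsub>V\<^esub>}. homog_part V v n) = (\<Oplus>\<^bsub>V\<^esub>n\<in>I. homog_part V v n)"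
  using homog_part_closed[OF V v] by (intro V.add.finprod_mono_neutral_cong_left I(1) s) auto
 then show ?thesis using homog_part_decomp[OF V v] by (simp add: homog_decomp_def)
qed

lemma homog_part_homog:
 assumes V: "hm_obj Q V" and v: "v \<in> grd V m"
 shows "homog_part V v = (%n. if n = m then v else \<zero>\<^bsub>V\<^esub>)"
proof (rule homog_part_eqI[OF V, where I = "{m}"])
 interpret V: module K V by (rule hm_objD(1)[OF V])
 show "v = (\<Oplus>\<^bsub>V\<^esub>n\<in>{m}. if n = m then v else \<zero>\<^bsub>V\<^esub>)"
  using hm_objD(6)[OF V v] by simp
qed (use v hm_objD(7)[OF V] in auto)

lemma homog_part_lin:
 assumes V: "hm_obj Q V"
 shows "module_lin K V V (%v. homog_part V v n)"
proof (rule module_linI)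
 interpret V: module K V by (rule hm_objD(1)[OF V])
 note S = V.submoduleE[OF hm_objD(2)[OF V]]
 fix v assume v: "v <: V"
 show "homog_part V v n <: V" by (rule homog_part_closed[OF V v])
 fix w assume w: "w <: V"
 have "homog_part V (v \<oplus>\<^bsub>V\<^esub> w) = (%n. homog_part V v n \<oplus>\<^bsub>V\<^esub> homog_part V w n)"
 proof (rule homog_part_eqI[OF V degs_finite[OF V]])
  show "homog_part V v n \<oplus>\<^bsub>V\<^esub> homog_part V w n \<in> grd V n" for n
   by (rule S(5)[OF homog_part_grd[OF V v] homog_part_grd[OF V w]])
  show "homog_part V v n \<oplus>\<^bsub>V\<^esub> homog_part V w n = \<zero>\<^bsub>V\<^esub>" if "n \<notin> degs V" for n
   using degs_outside[OF that homog_part_grd[OF V v]] degs_outside[OF that homog_part_grd[OF V w]] by simp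
  show "v \<oplus>\<^bsub>V\<^esub> w = (\<Oplus>\<^bsub>V\<^esub>n\<in>degs V. homog_part V v n \<oplus>\<^bsub>V\<^esub> homog_part V w n)"
   using homog_part_closed[OF V v] homog_part_closed[OF V w]
   by (subst V.finsum_addf) (auto simp: homog_part_sum[OF V _ degs_finite[OF V]] v w)
 qed
 then show "homog_part V (v \<oplus>\<^bsub>V\<^esub> w) n = homog_part V v n \<oplus>\<^bsub>V\<^esub> homog_part V w n" by simp
next
 interpret V: module K V by (rule hm_objD(1)[OF V])
 note S = V.submoduleE[OF hm_objD(2)[OF V]]
 fix r v assume r: "r <: K" and v: "v <: V"
 have "homog_part V (r \<odot>\<^bsub>V\<^esub> v) = (%n. r \<odot>\<^bsub>V\<^esub> homog_part V v n)"
 proof (rule homog_part_eqI[OF V degs_finite[OF V]])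
  show "r \<odot>\<^bsub>V\<^esub> homog_part V v n \<in> grd V n" for n
   by (rule S(4)[OF r homog_part_grd[OF V v]])
  show "r \<odot>\<^bsub>V\<^esub> homog_part V v n = \<zero>\<^bsub>V\<^esub>" if "n \<notin> degs V" for n
   using degs_outside[OF that homog_part_grd[OF V v]] r by simp
  show "r \<odot>\<^bsub>V\<^esub> v = (\<Oplus>\<^bsub>V\<^esub>n\<in>degs V. r \<odot>\<^bsub>V\<^esub> homog_part V v n)"
   using homog_part_closed[OF V v] r
   by (subst module_finsum_smult[symmetric, OF hm_objD(1)[OF V]]) (auto simp: homog_part_sum[OF V _ degs_finite[OF V]] v)
 qed
 then show "homog_part V (r \<odot>\<^bsub>V\<^esub> v) n = r \<odot>\<^bsub>V\<^esub> homog_part V v n" by simp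
qed

lemma homog_part_act:
 assumes V: "hm_obj Q V" and v: "v <: V" and h: "h <: H"
 shows "homog_part V (act V h v) = (%n. act V h (homog_part V v n))"
proof (rule homog_part_eqI[OF V degs_finite[OF V]])
 note M = hm_objD(8)[OF V]
 note l = bilin_lin2[OF hmodD(2)[OF M] h]
 show "act V h (homog_part V v n) \<in> grd V n" for n
  by (rule hm_objD(4)[OF V h homog_part_grd[OF V v]])
 show "act V h (homog_part V v n) = \<zero>\<^bsub>V\<^esub>" if "n \<notin> degs V" for n
  using degs_outside[OF that homog_part_grd[OF V v]] module_lin_zero[OF hmodD(1)[OF M] hmodD(1)[OF M] l] by simp
 show "act V h v = (\<Oplus>\<^bsub>V\<^esub>n\<in>degs V. act V h (homog_part V v n))"
  using module_lin_finsum[OF hmodD(1)[OF M] hmodD(1)[OF M] l, of "homog_part V v" "degs V"] homog_part_closed[OF V v]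
  by (simp add: homog_part_sum[OF V v degs_finite[OF V]])
qed

lemma graded_ext:
 assumes V: "hm_obj Q V" and P: "module K P" and f: "module_lin K V P f" and g: "module_lin K V P g"
  and eq: "!!n v. v \<in> grd V n ==> f v = g v" and v: "v <: V"
 shows "f v = g v"
proof -
 interpret P: module K P by (rule P)
 have c: "homog_part V v \<in> degs V \<rightarrow> carrier V" using homog_part_closed[OF V v] by auto
 have "f v = f (\<Oplus>\<^bsub>V\<^esub>n\<in>degs V. homog_part V v n)" by (simp add: homog_part_sum[OF V v degs_finite[OF V]])
 also have "... = (\<Oplus>\<^bsub>P\<^esub>n\<in>degs V. f (homog_part V v n))" by (rule module_lin_finsum[OF hm_objD(1)[OF V] P f c])
 also have "... = (\<Oplus>\<^bsub>P\<^esub>n\<in>degs V. g (homog_part V v n))"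
  by (rule P.finsum_cong') (auto intro: eq[OF homog_part_grd[OF V v]] module_lin_closed[OF g homog_part_closed[OF V v]])
 also have "... = g (\<Oplus>\<^bsub>V\<^esub>n\<in>degs V. homog_part V v n)" by (rule module_lin_finsum[OF hm_objD(1)[OF V] P g c, symmetric])
 finally show ?thesis by (simp add: homog_part_sum[OF V v degs_finite[OF V]])
qed

lemma ghom_grd: "grd (ghom Q V W) n = {L \<in> carrier (ghom Q V W). \<forall>m. \<forall>v\<in>grd V m. L v \<in> grd W (m + n)}"
 by (simp add: ghom_def Let_def)

text \<open>The component of L in degree n is determined on vectors of degree m as the part of L v
  in degree m + n. Boundedness of V and W leaves finitely many n.\<close>

lemma ghom_obj:
 assumes V: "hm_obj Q V" and W: "hm_obj Q W"
 shows "hm_obj Q (ghom Q V W)"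
proof -
 let ?E = "ghom Q V W"
 note hV = hm_objD(8)[OF V] and hW = hm_objD(8)[OF W]
 note E = hmod_ghom[OF hV hW]
 note mE = hmodD(1)[OF E] and mV = hm_objD(1)[OF V] and mW = hm_objD(1)[OF W]
 interpret E: module K ?E by (rule mE)
 interpret W: module K W by (rule mW)
 interpret V: module K V by (rule mV)
 note SW = W.submoduleE[OF hm_objD(2)[OF W]]
 \<comment> \<open>A nonzero homogeneous map can only shift an occurring degree of V to an occurring
   degree of W.\<close>
 define N where "N = (%(m, k). k - m) ` (degs V \<times> degs W)"
 have finN: "finite N" unfolding N_def using degs_finite[OF V] degs_finite[OF W] by auto
 have sub: "submodule (grd ?E n) K ?E" for n
 proof (rule E.submoduleI)
  show "grd ?E n \<subseteq> carrier ?E" by (auto simp: ghom_grd)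
  show "\<zero>\<^bsub>?E\<^esub> \<in> grd ?E n"
   using hm_objD(6)[OF V] hm_objD(7)[OF W] E.zero_closed by (auto simp: ghom_grd ghom_zero)
  show "L \<oplus>\<^bsub>?E\<^esub> L' \<in> grd ?E n" if "L \<in> grd ?E n" "L' \<in> grd ?E n" for L L'
   using that E.a_closed hm_objD(6)[OF V] SW(5) by (auto simp: ghom_grd ghom_add)
  show sm: "r \<odot>\<^bsub>?E\<^esub> L \<in> grd ?E n" if "r <: K" "L \<in> grd ?E n" for r L
   using that E.smult_closed hm_objD(6)[OF V] SW(4) by (auto simp: ghom_grd ghom_smult)
  fix L assume L: "L \<in> grd ?E n"
  then have "\<ominus>\<^bsub>?E\<^esub> L = (\<ominus>\<^bsub>K\<^esub> \<one>\<^bsub>K\<^esub>) \<odot>\<^bsub>?E\<^esub> L" using E.smult_l_minus[of "\<one>\<^bsub>K\<^esub>" L] by (simp add: ghom_grd)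
  then show "\<ominus>\<^bsub>?E\<^esub> L \<in> grd ?E n" using sm[OF _ L, of "\<ominus>\<^bsub>K\<^esub> \<one>\<^bsub>K\<^esub>"] by simp
 qed
 have outside: "L = \<zero>\<^bsub>?E\<^esub>" if L: "L \<in> grd ?E n" and n: "n \<notin> N" for L n
 proof (rule ghom_eqI[where V = V and W = W])
  show Lc: "L <: ?E" using L by (simp add: ghom_grd)
  show "\<zero>\<^bsub>?E\<^esub> <: ?E" by simp
  fix v assume v: "v <: V"
  show "L v = \<zero>\<^bsub>?E\<^esub> v"
  proof (rule graded_ext[OF V mW ghom_linD[OF Lc] ghom_linD[OF E.zero_closed] _ v])
   fix m v assume vm: "v \<in> grd V m"
   have "L v = \<zero>\<^bsub>W\<^esub>"
   proof (cases "v = \<zero>\<^bsub>V\<^esub>")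
    case True
    then show ?thesis using module_lin_zero[OF mV mW ghom_linD[OF Lc]] by simp
   next
    case False
    then have m: "m \<in> degs V" using degs_outside[OF _ vm] by auto
    have "m + n \<notin> degs W"
    proof
     assume "m + n \<in> degs W"
     then have "n \<in> N" unfolding N_def using m by (intro image_eqI[of _ _ "(m, m + n)"]) auto
     then show False using n by simp
    qed
    moreover have "L v \<in> grd W (m + n)" using L vm by (simp add: ghom_grd)
    ultimately show ?thesis by (rule degs_outside)
   qed
   then show "L v = \<zero>\<^bsub>?E\<^esub> v" using hm_objD(6)[OF V vm] by (simp add: ghom_zero)
  qed
 qed
 \<comment> \<open>Any decomposition of L has these values on homogeneous vectors, which forces
   uniqueness.\<close>
 have comp: "c n v = homog_part W (L v) (m + n)"
  if c: "homog_decomp ?E L c" and v: "v \<in> grd V m" for L c n m v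
 proof -
  have cg: "c n \<in> grd ?E n" and fin: "finite {n. c n \<noteq> \<zero>\<^bsub>?E\<^esub>}" and Leq: "L = (\<Oplus>\<^bsub>?E\<^esub>n\<in>{n. c n \<noteq> \<zero>\<^bsub>?E\<^esub>}. c n)" for n
   using c by (auto simp: homog_decomp_def)
  have vc: "v <: V" by (rule hm_objD(6)[OF V v])
  have cc: "c n <: ?E" for n using cg by (simp add: ghom_grd)
  have cv: "c n v <: W" for n by (rule ghom_app_closed[OF cc vc])
  let ?I = "{n. c n \<noteq> \<zero>\<^bsub>?E\<^esub>}"
  have "L v = (\<Oplus>\<^bsub>W\<^esub>n\<in>?I. c n v)"
   unfolding Leq by (rule module_lin_finsum[OF mE mW ghom_app_lin[OF vc]]) (use cc in auto)
  also have "... = (\<Oplus>\<^bsub>W\<^esub>k\<in>(%n. m + n) ` ?I. c (k - m) v)"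
   by (subst W.finsum_reindex) (use cv in "auto simp: inj_on_def")
  finally have Lv: "L v = (\<Oplus>\<^bsub>W\<^esub>k\<in>(%n. m + n) ` ?I. c (k - m) v)" .
  have "homog_part W (L v) = (%k. c (k - m) v)"
  proof (rule homog_part_eqI[OF W _ _ _ Lv])
   show "finite ((%n. m + n) ` ?I)" using fin by simp
   show "c (k - m) v \<in> grd W k" for k
   proof -
    have "c (k - m) v \<in> grd W (m + (k - m))" using cg[of "k - m"] v unfolding ghom_grd by blast
    then show ?thesis by simp
   qed
   show "c (k - m) v = \<zero>\<^bsub>W\<^esub>" if "k \<notin> (%n. m + n) ` ?I" for k
   proof -
    have "c (k - m) = \<zero>\<^bsub>?E\<^esub>"
    proof (rule ccontr)
     assume "c (k - m) \<noteq> \<zero>\<^bsub>?E\<^esub>"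
     then have "k \<in> (%n. m + n) ` ?I" by (intro image_eqI[of _ _ "k - m"]) auto
     then show False using that by simp
    qed
    then show ?thesis using vc by (simp add: ghom_zero)
   qed
  qed
  then show ?thesis by simp
 qed
 have ex: "\<exists>!c. homog_decomp ?E L c" if L: "L <: ?E" for L
 proof -
  note lL = ghom_linD[OF L]
  \<comment> \<open>Existence: the formula is summed over all degrees of V so that it defines a
    linear map on every vector, homogeneous or not.\<close>
  define g where "g n v = (\<Oplus>\<^bsub>W\<^esub>m\<in>degs V. homog_part W (L (homog_part V v m)) (m + n))" for n v
  have gl: "module_lin K V W (g n)" for n
   unfolding g_def[abs_def]
   by (intro module_lin_finsum_fun mW module_lin_comp[OF homog_part_lin[OF W]] module_lin_comp[OF lL] homog_part_lin[OF V])
  have gv: "g n v = homog_part W (L v) (m + n)" if v: "v \<in> grd V m" for n m v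
  proof (cases "m \<in> degs V")
   case True
   have z: "homog_part W (L \<zero>\<^bsub>V\<^esub>) k = \<zero>\<^bsub>W\<^esub>" for k
    using module_lin_zero[OF mV mW module_lin_comp[OF homog_part_lin[OF W] lL]] .
   show ?thesis
    unfolding g_def homog_part_homog[OF V v]
    by (subst W.finsum_single[OF degs_finite[OF V] True])
     (use z homog_part_closed[OF W] module_lin_closed[OF lL hm_objD(6)[OF V v]] in auto)
  next
   case False
   then have "v = \<zero>\<^bsub>V\<^esub>" by (rule degs_outside[OF _ v])
   then show ?thesis
    using module_lin_zero[OF mV mW gl] module_lin_zero[OF mV mW module_lin_comp[OF homog_part_lin[OF W] lL]] by simp
  qed
  define c where "c n = restrict (g n) (carrier V)" for n
  have cE: "c n <: ?E" for n unfolding c_def by (rule ghomI[OF mV gl])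
  have cg: "c n \<in> grd ?E n" for n
   unfolding ghom_grd using cE hm_objD(6)[OF V] homog_part_grd[OF W ghom_app_closed[OF L]]
   by (auto simp: c_def gv)
  have "homog_decomp ?E L c"
  proof (rule homog_decompI[OF mE sub finN cg])
   show "c n = \<zero>\<^bsub>?E\<^esub>" if "n \<notin> N" for n by (rule outside[OF cg that])
   show "L = (\<Oplus>\<^bsub>?E\<^esub>n\<in>N. c n)"
   proof (rule ghom_eqI[OF L])
    show sc: "(\<Oplus>\<^bsub>?E\<^esub>n\<in>N. c n) <: ?E" by (rule E.finsum_closed) (use cE in auto)
    fix v assume v: "v <: V"
    show "L v = (\<Oplus>\<^bsub>?E\<^esub>n\<in>N. c n) v"
    proof (rule graded_ext[OF V mW lL ghom_linD[OF sc] _ v])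
     fix m v assume v: "v \<in> grd V m"
     note vc = hm_objD(6)[OF V v]
     note Lvc = ghom_app_closed[OF L vc]
     show "L v = (\<Oplus>\<^bsub>?E\<^esub>n\<in>N. c n) v"
     proof (cases "m \<in> degs V")
      case True
      have "(\<Oplus>\<^bsub>?E\<^esub>n\<in>N. c n) v = (\<Oplus>\<^bsub>W\<^esub>n\<in>N. c n v)"
       by (rule module_lin_finsum[OF mE mW ghom_app_lin[OF vc]]) (use cE in auto)
      also have "... = (\<Oplus>\<^bsub>W\<^esub>n\<in>N. homog_part W (L v) (m + n))"
       by (rule W.finsum_cong') (use vc homog_part_closed[OF W Lvc] in "auto simp: c_def gv[OF v]")
      also have "... = (\<Oplus>\<^bsub>W\<^esub>k\<in>(%n. m + n) ` N. homog_part W (L v) k)"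
       by (subst W.finsum_reindex) (use homog_part_closed[OF W Lvc] in "auto simp: inj_on_def")
      also have "... = L v"
      proof (rule homog_part_sum[OF W Lvc])
       show "finite ((%n. m + n) ` N)" using finN by simp
       show "degs W \<subseteq> (%n. m + n) ` N"
       proof
        fix k assume "k \<in> degs W"
        then have "k - m \<in> N" unfolding N_def using True by (intro image_eqI[of _ _ "(m, k)"]) auto
        then show "k \<in> (%n. m + n) ` N" by (intro image_eqI[of _ _ "k - m"]) auto
       qed
      qed
      finally show ?thesis by simp
     next
      case False
      then have "v = \<zero>\<^bsub>V\<^esub>" by (rule degs_outside[OF _ v])
      then show ?thesis using module_lin_zero[OF mV mW lL] module_lin_zero[OF mV mW ghom_linD[OF sc]] by simp
     qed
    qed
   qed
  qed
  moreover have "c1 = c2" if c1: "homog_decomp ?E L c1" and c2: "homog_decomp ?E L c2" for c1 c2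
  proof
   fix n
   have g1: "c1 n <: ?E" and g2: "c2 n <: ?E"
    using c1 c2 by (auto simp: homog_decomp_def ghom_grd)
   show "c1 n = c2 n"
   proof (rule ghom_eqI[OF g1 g2])
    fix v assume v: "v <: V"
    show "c1 n v = c2 n v"
     by (rule graded_ext[OF V mW ghom_linD[OF g1] ghom_linD[OF g2] _ v]) (simp add: comp[OF c1] comp[OF c2])
   qed
  qed
  ultimately show ?thesis by blast
 qed
 have "{n. grd ?E n \<noteq> {\<zero>\<^bsub>?E\<^esub>}} \<subseteq> N"
  using outside submodule_zero[OF sub] by auto
 then have bd: "finite {n. grd ?E n \<noteq> {\<zero>\<^bsub>?E\<^esub>}}" using finN by (rule finite_subset)
 have ga: "act ?E h L \<in> grd ?E n" if h: "h <: H" and L: "L \<in> grd ?E n" for h L n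
 proof -
  have Lc: "L <: ?E" using L by (simp add: ghom_grd)
  have "act ?E h L v \<in> grd W (m + n)" if v: "v \<in> grd V m" for m v
  proof -
   have "sum2 Q W (D h) (%x y. act W x (L (act V (S y) v))) \<in> grd W (m + n)"
    using L v h hm_objD(4)[OF V _ v] hm_objD(4)[OF W] by (intro sum2_submodule[OF mW hm_objD(2)[OF W]]) (auto simp: ghom_grd)
   then show ?thesis unfolding ghom_act using hm_objD(6)[OF V v] by simp
  qed
  then show ?thesis using hmodD(5)[OF E h Lc] by (simp add: ghom_grd)
 qed
 have l: "module_lin K ?E ?E (act ?E h)" if "h <: H" for h
  by (rule bilin_lin2[OF hmodD(2)[OF E] that])
 show ?thesis
  unfolding hm_obj_def Let_def
  using mE sub ex bd l ga hmodD(3,4)[OF E] module_lin_add[OF bilin_lin1[OF hmodD(2)[OF E]]]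
   module_lin_smult[OF bilin_lin1[OF hmodD(2)[OF E]]]
  by simp
qed

end

section \<open>The braiding and the commutator\<close>

context qhopf
begin

text \<open>The Koszul sign as a scalar: signs then multiply in \<open>K\<close> and pass through
  linear maps like any coefficient.\<close>

definition sg :: "int => 'k" where
 "sg n = (if even n then \<one>\<^bsub>K\<^esub> else \<ominus>\<^bsub>K\<^esub> \<one>\<^bsub>K\<^esub>)"

lemma sg_closed [simp]: "sg n <: K"
 and sg_mult: "sg m \<otimes>\<^bsub>K\<^esub> sg n = sg (m + n)"
proof -
 interpret cring K by (rule cringK)
 show "sg n <: K" "sg m \<otimes>\<^bsub>K\<^esub> sg n = sg (m + n)" by (auto simp: sg_def l_minus r_minus)
qed

lemma sg_smult:
 assumes "module K P" "t <: P"
 shows "sg n \<odot>\<^bsub>P\<^esub> t = (if even n then t else \<ominus>\<^bsub>P\<^esub> t)"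
proof -
 interpret P: module K P by (rule assms(1))
 show ?thesis using assms(2) by (simp add: sg_def P.smult_l_minus)
qed

lemma sg_cong: "even (m + n) ==> sg m = sg n"
 by (auto simp: sg_def)

lemma bilin_cong:
 assumes "module K M" "module K N" "!!m n. m <: M ==> n <: N ==> b m n = b' m n"
 shows "bilin K M N P b = bilin K M N P b'"
proof -
 have "module_lin K M P (%m. b m n) = module_lin K M P (%m. b' m n)" if "n <: N" for n
  by (rule module_lin_cong[OF assms(1)]) (rule assms(3)[OF _ that])
 moreover have "module_lin K N P (%n. b m n) = module_lin K N P (%n. b' m n)" if "m <: M" for m
  by (rule module_lin_cong[OF assms(2)]) (rule assms(3)[OF that])
 ultimately show ?thesis unfolding bilin_def by simp
qed

lemma flip2_sum:
 assumes P: "module K P" and b: "bilin K H H P b" and t: "t <: HH2"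
 shows "sum2 Q P (flip2 Q t) b = sum2 Q P t (%x y. b y x)"
proof -
 have "sum2 Q P (flip2 Q t) b = sum2 Q P t (%x y. sum2 Q P (e2 Q y x) b)"
  unfolding flip2_def by (rule sum2_comp[OF modH2 P sum2_lin[OF P b] t]) simp
 also have "... = sum2 Q P t (%x y. b y x)"
  by (rule sum2_cong[OF P t]) (simp_all add: sum2_e2[OF P b] bilin_closed[OF b])
 finally show ?thesis .
qed

text \<open>The braiding without its sign. This part is defined and bilinear on all vectors, while
  the sign refers to homogeneous components.\<close>

definition tau :: "('k, 'h, 'v) gmod => ('k, 'h, 'w) gmod => 'v => 'w => ('k, 'w, 'v) tensor" where
 "tau V W v w = sum2 Q (gtensor Q W V) R (%x y. gtensor_elem Q W V (act W y w) (act V x v))"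

lemma tau_bilin:
 assumes V: "hmod V" and W: "hmod W"
 shows "bilin K V W (gtensor Q W V) (tau V W)"
proof -
 note tp = hmod_tp[OF W V]
 note e = gelem_bilin[OF tp]
 show ?thesis unfolding tau_def
  by (rule lins bilin_comp2[OF e] bilin_comp1[OF e] act_lins[OF V] act_lins[OF W]
    | simp add: module_gtensor[OF tp] hmodD(5)[OF V] hmodD(5)[OF W])+
qed

text \<open>Acting by h before the exchange multiplies R by the coproduct from the right; acting
  afterwards multiplies it by the opposite coproduct from the left. Quasi-cocommutativity equates
  the two.\<close>

lemma tau_equivariant:
 assumes V: "hmod V" and W: "hmod W" and h: "h <: H" and v: "v <: V" and w: "w <: W"
 shows "sum2 Q (gtensor Q W V) (D h) (%x y. tau V W (act V x v) (act W y w)) = act (gtensor Q W V) h (tau V W v w)"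
proof -
 let ?T = "gtensor Q W V"
 note tp = hmod_tp[OF W V]
 note e = gelem_bilin[OF tp]
 note mT = module_gtensor[OF tp]
 note T = hmod_gtensor[OF W V]
 note c = bilin_closed[OF e] hmodD(5)[OF V] hmodD(5)[OF W] hmodD(5)[OF T]
 define b where "b x y = gtensor_elem Q W V (act W y w) (act V x v)" for x y
 have b: "bilin K H H ?T b" unfolding b_def
  by (rule lins bilin_comp2[OF e] bilin_comp1[OF e] act_lins[OF V] act_lins[OF W] | simp add: c v w)+
 note bc = bilin_closed[OF b]
 have b1: "bilin K H H ?T (%x y. sum2 Q ?T R (%p q. b (x ** p) (y ** q)))"
  by (rule lins bilin_lins[OF b] | simp add: mT)+
 have "sum2 Q ?T (D h) (%x y. tau V W (act V x v) (act W y w)) =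
  sum2 Q ?T (D h) (%x y. sum2 Q ?T R (%p q. b (p ** x) (q ** y)))"
  unfolding tau_def b_def
  by (intro sum2_cong[OF mT]) (use h v w in "simp_all add: c hmodD(3)[OF V] hmodD(3)[OF W] sum2_closed mT")
 also have "... = sum2 Q ?T R (%p q. sum2 Q ?T (D h) (%x y. b (p ** x) (q ** y)))"
  by (rule sum2_swap[OF mT]) (use h in "simp_all add: bc")
 also have "... = sum2 Q ?T (R *\<^sub>2 D h) b"
  by (rule sum2_mult[OF mT b, symmetric]) (use h in simp_all)
 also have "... = sum2 Q ?T (flip2 Q (D h)) (%x y. sum2 Q ?T R (%p q. b (x ** p) (y ** q)))"
  unfolding flip2_D[OF h, symmetric]
  by (rule sum2_mult[OF mT b]) (use h flip2_closed in simp_all)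
 also have "... = sum2 Q ?T (D h) (%x y. sum2 Q ?T R (%p q. b (y ** p) (x ** q)))"
  by (rule flip2_sum[OF mT b1]) (use h in simp)
 also have "... = sum2 Q ?T R (%p q. sum2 Q ?T (D h) (%x y. b (y ** p) (x ** q)))"
  by (rule sum2_swap[OF mT]) (use h in "simp_all add: bc")
 also have "... = sum2 Q ?T R (%p q. act ?T h (gtensor_elem Q W V (act W q w) (act V p v)))"
 proof (rule sum2_cong[OF mT R_closed])
  fix p q assume pq: "p <: H" "q <: H"
  show "sum2 Q ?T (D h) (%x y. b (y ** p) (x ** q)) = act ?T h (gtensor_elem Q W V (act W q w) (act V p v))"
   unfolding b_def
   by (subst gtensor_act_elem[OF W V h], use pq v w in "simp_all add: c", rule sum2_cong[OF mT])
    (use pq h v w in "simp_all add: c hmodD(3)[OF V] hmodD(3)[OF W]")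
 qed (use h v w in "simp add: c")
 also have "... = act ?T h (tau V W v w)"
  unfolding tau_def
  by (rule sum2_comp[symmetric, OF mT mT bilin_lin2[OF hmodD(2)[OF T] h] R_closed]) (use v w in "simp add: c")
 finally show ?thesis .
qed

lemma gbraid_lin:
 assumes V: "hm_obj Q V" and W: "hm_obj Q W"
 shows "module_lin K (gtensor Q V W) (gtensor Q W V) (gbraid Q V W)"
  and "v \<in> grd V m ==> w \<in> grd W n ==>
   gbraid Q V W (gtensor_elem Q V W v w) = sg (m * n) \<odot>\<^bsub>gtensor Q W V\<^esub> tau V W v w"
proof -
 let ?T = "gtensor Q W V"
 note hV = hm_objD(8)[OF V] and hW = hm_objD(8)[OF W]
 note tp = hmod_tp[OF hW hV]
 note mT = module_gtensor[OF tp]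
 interpret T: module K ?T by (rule mT)
 note tb = tau_bilin[OF hV hW]
 define b where "b v w = (\<Oplus>\<^bsub>?T\<^esub>i\<in>{m. homog_part V v m \<noteq> \<zero>\<^bsub>V\<^esub>} \<times> {n. homog_part W w n \<noteq> \<zero>\<^bsub>W\<^esub>}.
   (let t = tau V W (homog_part V v (fst i)) (homog_part W w (snd i))
    in if even (fst i * snd i) then t else \<ominus>\<^bsub>?T\<^esub> t))" for v w
 \<comment> \<open>The definition of the braiding sums over the supports of the two vectors.
   Extending the sum to all occurring degrees adds zero terms only and makes bilinearity
   visible.\<close>
 define b' where "b' v w = (\<Oplus>\<^bsub>?T\<^esub>i\<in>degs V \<times> degs W.
   sg (fst i * snd i) \<odot>\<^bsub>?T\<^esub> tau V W (homog_part V v (fst i)) (homog_part W w (snd i)))" for v w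
 have eq: "gbraid Q V W = tensor_lift K V W ?T b"
  unfolding gbraid_def b_def tau_def Let_def ..
 have t0: "tau V W \<zero>\<^bsub>V\<^esub> w = \<zero>\<^bsub>?T\<^esub>" if "w <: W" for w
  by (rule module_lin_zero[OF hm_objD(1)[OF V] mT bilin_lin1[OF tb that]])
 have t0': "tau V W v \<zero>\<^bsub>W\<^esub> = \<zero>\<^bsub>?T\<^esub>" if "v <: V" for v
  by (rule module_lin_zero[OF hm_objD(1)[OF W] mT bilin_lin2[OF tb that]])
 have bb: "b v w = b' v w" if v: "v <: V" and w: "w <: W" for v w
 proof -
  note hc = homog_part_closed[OF V v] homog_part_closed[OF W w]
  have tc: "tau V W (homog_part V v i) (homog_part W w j) <: ?T" for i j
   by (rule bilin_closed[OF tb hc])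
  show ?thesis unfolding b_def b'_def
  proof (rule T.add.finprod_mono_neutral_cong_left)
   show "finite (degs V \<times> degs W)" using degs_finite[OF V] degs_finite[OF W] by simp
   have "m \<in> degs V" if "homog_part V v m \<noteq> \<zero>\<^bsub>V\<^esub>" for m
    using degs_outside[OF _ homog_part_grd[OF V v]] that by auto
   moreover have "n \<in> degs W" if "homog_part W w n \<noteq> \<zero>\<^bsub>W\<^esub>" for n
    using degs_outside[OF _ homog_part_grd[OF W w]] that by auto
   ultimately show "{m. homog_part V v m \<noteq> \<zero>\<^bsub>V\<^esub>} \<times> {n. homog_part W w n \<noteq> \<zero>\<^bsub>W\<^esub>} \<subseteq> degs V \<times> degs W"
    by auto
  next
   fix i assume "i \<in> degs V \<times> degs W - {m. homog_part V v m \<noteq> \<zero>\<^bsub>V\<^esub>} \<times> {n. homog_part W w n \<noteq> \<zero>\<^bsub>W\<^esub>}"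
   then have "homog_part V v (fst i) = \<zero>\<^bsub>V\<^esub> \<or> homog_part W w (snd i) = \<zero>\<^bsub>W\<^esub>"
    by (cases i) auto
   then have "tau V W (homog_part V v (fst i)) (homog_part W w (snd i)) = \<zero>\<^bsub>?T\<^esub>"
    using t0[OF hc(2)] t0'[OF hc(1)] by auto
   then show "sg (fst i * snd i) \<odot>\<^bsub>?T\<^esub> tau V W (homog_part V v (fst i)) (homog_part W w (snd i)) = \<zero>\<^bsub>?T\<^esub>"
    by simp
  next
   fix i
   show "(let t = tau V W (homog_part V v (fst i)) (homog_part W w (snd i))
     in if even (fst i * snd i) then t else \<ominus>\<^bsub>?T\<^esub> t) =
     sg (fst i * snd i) \<odot>\<^bsub>?T\<^esub> tau V W (homog_part V v (fst i)) (homog_part W w (snd i))"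
    unfolding Let_def sg_smult[OF mT tc] ..
  qed (use tc in auto)
 qed
 have b': "bilin K V W ?T b'" unfolding b'_def
  by (intro bilinI module_lin_finsum_fun mT module_lin_smult_fun sg_closed
    bilin_comp1[OF tb homog_part_lin[OF V]] bilin_comp2[OF tb _ homog_part_lin[OF W]]
    homog_part_closed[OF V] homog_part_closed[OF W])
 have "bilin K V W ?T b = bilin K V W ?T b'"
  by (rule bilin_cong[OF hm_objD(1)[OF V] hm_objD(1)[OF W]]) (rule bb)
 then have b: "bilin K V W ?T b" using b' by simp
 show "module_lin K (gtensor Q V W) ?T (gbraid Q V W)"
  unfolding eq by (rule glift_lin[OF hmod_tp[OF hV hW] mT b])
 assume v: "v \<in> grd V m" and w: "w \<in> grd W n"
 note vc = hm_objD(6)[OF V v] and wc = hm_objD(6)[OF W w]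
 have "gbraid Q V W (gtensor_elem Q V W v w) = b' v w"
  unfolding eq using glift_elem[OF hmod_tp[OF hV hW] mT b vc wc] bb[OF vc wc] by simp
 also have "... = sg (m * n) \<odot>\<^bsub>?T\<^esub> tau V W v w"
 proof (cases "m \<in> degs V \<and> n \<in> degs W")
  case True
  have z: "tau V W (homog_part V v (fst i)) (homog_part W w (snd i)) = \<zero>\<^bsub>?T\<^esub>" if "i \<noteq> (m, n)" for i
   using that t0[OF wc] t0'[OF vc] t0'[OF hm_objD(6)[OF V hm_objD(7)[OF V]]]
   by (cases i) (auto simp: homog_part_homog[OF V v] homog_part_homog[OF W w])
  show ?thesis unfolding b'_def
   by (subst T.finsum_single[where i = "(m, n)"])
    (use True z degs_finite[OF V] degs_finite[OF W] bilin_closed[OF tb vc wc]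
     in "auto simp: homog_part_homog[OF V v] homog_part_homog[OF W w]")
 next
  case False
  then have vw: "v = \<zero>\<^bsub>V\<^esub> \<or> w = \<zero>\<^bsub>W\<^esub>" using degs_outside[OF _ v] degs_outside[OF _ w] by auto
  then have "b' v w = \<zero>\<^bsub>?T\<^esub>"
   using module_lin_zero[OF hm_objD(1)[OF V] mT bilin_lin1[OF b' wc]]
    module_lin_zero[OF hm_objD(1)[OF W] mT bilin_lin2[OF b' vc]] by auto
  moreover have "tau V W v w = \<zero>\<^bsub>?T\<^esub>" using vw t0[OF wc] t0'[OF vc] by auto
  ultimately show ?thesis by simp
 qed
 finally show "gbraid Q V W (gtensor_elem Q V W v w) = sg (m * n) \<odot>\<^bsub>?T\<^esub> tau V W v w" .
qed

text \<open>H preserves degrees, so the sign is constant along an orbit and equivariance is that of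
  \<open>tau\<close>. Homogeneous vectors decide, one argument at a time.\<close>

lemma gbraid_hlin:
 assumes V: "hm_obj Q V" and W: "hm_obj Q W"
 shows "hlin (gtensor Q V W) (gtensor Q W V) (gbraid Q V W)"
 unfolding hlin_def
proof (intro conjI ballI gbraid_lin V W)
 let ?T = "gtensor Q W V" and ?S = "gtensor Q V W"
 note hV = hm_objD(8)[OF V] and hW = hm_objD(8)[OF W]
 note T = hmod_gtensor[OF hW hV] and S = hmod_gtensor[OF hV hW]
 note mT = hmodD(1)[OF T] and mS = hmodD(1)[OF S]
 note e = gelem_bilin[OF hmod_tp[OF hV hW]]
 note B = gbraid_lin(1)[OF V W]
 note tb = tau_bilin[OF hV hW]
 fix h t assume h: "h <: H" and t: "t <: ?S"
 let ?f = "%t. gbraid Q V W (act ?S h t)" and ?g = "%t. act ?T h (gbraid Q V W t)"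
 have f: "module_lin K ?S ?T ?f" by (rule module_lin_comp[OF B bilin_lin2[OF hmodD(2)[OF S] h]])
 have g: "module_lin K ?S ?T ?g" by (rule module_lin_comp[OF bilin_lin2[OF hmodD(2)[OF T] h] B])
 have hom: "?f (gtensor_elem Q V W v w) = ?g (gtensor_elem Q V W v w)" if v: "v \<in> grd V m" and w: "w \<in> grd W n" for v w m n
 proof -
  note vc = hm_objD(6)[OF V v] and wc = hm_objD(6)[OF W w]
  have "?f (gtensor_elem Q V W v w) = sum2 Q ?T (D h) (%x y. gbraid Q V W (gtensor_elem Q V W (act V x v) (act W y w)))"
   unfolding gtensor_act_elem[OF hV hW h vc wc]
   by (rule sum2_comp[OF mS mT B]) (use h vc wc in "simp_all add: bilin_closed[OF e] hmodD(5)[OF hV] hmodD(5)[OF hW]")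
  also have "... = sum2 Q ?T (D h) (%x y. sg (m * n) \<odot>\<^bsub>?T\<^esub> tau V W (act V x v) (act W y w))"
   by (rule sum2_cong[OF mT])
    (use h vc wc in \<open>simp_all add: gbraid_lin(2)[OF V W hm_objD(4)[OF V _ v] hm_objD(4)[OF W _ w]]
     module_smult_closed[OF mT] bilin_closed[OF tb] hmodD(5)[OF hV] hmodD(5)[OF hW]\<close>)
  also have "... = sg (m * n) \<odot>\<^bsub>?T\<^esub> sum2 Q ?T (D h) (%x y. tau V W (act V x v) (act W y w))"
   by (rule sum2_comp[symmetric, OF mT mT module_lin_smult_fun[OF mT module_lin_id sg_closed]])
    (use h vc wc in "simp_all add: bilin_closed[OF tb] hmodD(5)[OF hV] hmodD(5)[OF hW]")
  also have "... = ?g (gtensor_elem Q V W v w)"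
   unfolding tau_equivariant[OF hV hW h vc wc] gbraid_lin(2)[OF V W v w]
   by (rule module_lin_smult[OF bilin_lin2[OF hmodD(2)[OF T] h], symmetric]) (simp_all add: bilin_closed[OF tb vc wc])
  finally show ?thesis .
 qed
 show "?f t = ?g t"
 proof (rule gtensor_ext[OF hmod_tp[OF hV hW] mT f g _ t])
  fix v w assume v: "v <: V" and w: "w <: W"
  have 1: "?f (gtensor_elem Q V W v w) = ?g (gtensor_elem Q V W v w)" if v: "v \<in> grd V m" and w: "w <: W" for v m w
   by (rule graded_ext[OF W mT module_lin_comp[OF f bilin_lin2[OF e hm_objD(6)[OF V v]]]
      module_lin_comp[OF g bilin_lin2[OF e hm_objD(6)[OF V v]]] hom[OF v] w])
  show "?f (gtensor_elem Q V W v w) = ?g (gtensor_elem Q V W v w)"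
   by (rule graded_ext[OF V mT module_lin_comp[OF f bilin_lin1[OF e w]] module_lin_comp[OF g bilin_lin1[OF e w]] 1[OF _ w] v])
 qed
qed

lemma app_graded:
 assumes V: "hm_obj Q V" and W: "hm_obj Q W" and L: "L \<in> grd (ghom Q V W) n" and v: "v \<in> grd V m"
 shows "app V W L v \<in> grd W (m + n)"
 unfolding app_def
proof (rule sum3_submodule[OF hm_objD(1)[OF W] hm_objD(2)[OF W] phi_closed])
 fix x y z assume xyz: "x <: H" "y <: H" "z <: H"
 then have "act V (S y ** al ** z) v \<in> grd V m" by (intro hm_objD(4)[OF V _ v]) simp
 then have "L (act V (S y ** al ** z) v) \<in> grd W (m + n)"
  using L unfolding ghom_grd by simp
 then show "act W x (L (act V (S y ** al ** z) v)) \<in> grd W (m + n)"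
  by (rule hm_objD(4)[OF W xyz(1)])
qed

lemma cmp3_graded:
 assumes V: "hm_obj Q V" and W: "hm_obj Q W" and X: "hm_obj Q X"
  and L: "L \<in> grd (ghom Q W X) n" and L': "L' \<in> grd (ghom Q V W) m" and v: "v \<in> grd V k"
 shows "cmp3 V W X L L' v \<in> grd X (k + m + n)"
 unfolding cmp3_def
 by (rule sum3_submodule[OF hm_objD(1)[OF X] hm_objD(2)[OF X] phi_closed])
  (intro app_graded V W X hm_objD(4)[OF ghom_obj] L L' hm_objD(4)[OF V _ v])

lemma cmp3_closed:
 "hmod V ==> hmod W ==> hmod X ==> L <: (ghom Q W X) ==> L' <: (ghom Q V W) ==> v <: V ==>
  cmp3 V W X L L' v <: X"
 unfolding cmp3_def
 by (rule sum3_closed[OF hmodD(1)]) (auto intro: trilin_lins(4)[OF cmp3_trilin])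

text \<open>On a homogeneous vector the composite is a Sweedler sum of evaluations of translates;
  translation preserves degrees, so all terms lie in the same component.\<close>

lemma gcomp_graded:
 assumes V: "hm_obj Q V" and W: "hm_obj Q W" and X: "hm_obj Q X"
  and L: "L \<in> grd (ghom Q W X) n" and L': "L' \<in> grd (ghom Q V W) m"
 shows "gcomp Q V W X (gtensor_elem Q (ghom Q W X) (ghom Q V W) L L') \<in> grd (ghom Q V X) (n + m)"
proof -
 note hV = hm_objD(8)[OF V] and hW = hm_objD(8)[OF W] and hX = hm_objD(8)[OF X]
 let ?E1 = "ghom Q W X" and ?E2 = "ghom Q V W"
 let ?S = "gtensor Q ?E1 ?E2"
 note E1 = ghom_obj[OF W X] and E2 = ghom_obj[OF V W]
 note hE1 = hm_objD(8)[OF E1] and hE2 = hm_objD(8)[OF E2]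
 note hS = hmod_gtensor[OF hE1 hE2]
 note Lc = hm_objD(6)[OF E1 L] and Lc' = hm_objD(6)[OF E2 L']
 note e0 = gelem_bilin[OF hmod_tp[OF hE1 hE2]]
 note p = precomp_lin[OF hV hW hX] and pb = hbilinD(1)[OF precomp_hbilin[OF hV hW hX]]
 let ?f = "%s v. precomp V W X (gtensor_elem Q ?S V s v)"
 let ?e = "gtensor_elem Q ?E1 ?E2 L L'"
 have ec: "?e <: ?S" by (rule bilin_closed[OF e0 Lc Lc'])
 have fg: "?f (act ?S x ?e) v \<in> grd X (k + (n + m))" if x: "x <: H" and v: "v \<in> grd V k" for x v k
 proof -
  note vc = hm_objD(6)[OF V v]
  have "?f (act ?S x ?e) v = sum2 Q X (D x) (%a d. ?f (gtensor_elem Q ?E1 ?E2 (act ?E1 a L) (act ?E2 d L')) v)"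
   unfolding gtensor_act_elem[OF hE1 hE2 x Lc Lc']
   by (rule sum2_comp[where g = "%s. ?f s v", OF hmodD(1)[OF hS] hmodD(1)[OF hX] bilin_lin1[OF pb vc]])
    (use x Lc Lc' in "simp_all add: bilin_closed[OF e0] hmodD(5)[OF hE1] hmodD(5)[OF hE2]")
  moreover have "?f (gtensor_elem Q ?E1 ?E2 (act ?E1 a L) (act ?E2 d L')) v \<in> grd X (k + (n + m))"
   if "a <: H" "d <: H" for a d
   using cmp3_graded[OF V W X hm_objD(4)[OF E1 that(1) L] hm_objD(4)[OF E2 that(2) L'] v]
    p(2)[OF hmodD(5)[OF hE1 that(1) Lc] hmodD(5)[OF hE2 that(2) Lc'] vc]
   by (simp add: add.assoc add.commute add.left_commute)
  ultimately show ?thesis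
   using sum2_submodule[OF hm_objD(1)[OF X] hm_objD(2)[OF X]] x by simp
 qed
 have "gcomp Q V W X ?e v \<in> grd X (k + (n + m))" if v: "v \<in> grd V k" for v k
 proof -
  have "gcomp Q V W X ?e v = sum3 Q X psi (%x y z. ?f (act ?S x ?e) (act V (y ** be ** S z) v))"
   unfolding gcomp_cur[OF hV hW hX] cur_def using ec hm_objD(6)[OF V v] by simp
  also have "... \<in> grd X (k + (n + m))"
   by (rule sum3_submodule[OF hm_objD(1)[OF X] hm_objD(2)[OF X] psi_closed]) (intro fg hm_objD(4)[OF V _ v], simp_all)
  finally show ?thesis .
 qed
 then show ?thesis
  using hlinD(3)[OF gcomp_hlin[OF hV hW hX] ec] by (simp add: ghom_grd)
qed

lemma hlin_comp: "hlin W X g ==> hlin V W f ==> hlin V X (%x. g (f x))"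
 unfolding hlin_def[of V X]
 by (auto intro: module_lin_comp[OF hlinD(1) hlinD(1)] simp: hlinD(2) hlinD(3))

lemma hlin_diff:
 assumes W: "hmod W" and f: "hlin V W f" and g: "hlin V W g"
 shows "hlin V W (%x. f x \<ominus>\<^bsub>W\<^esub> g x)"
 unfolding hlin_def
proof (intro conjI ballI)
 show "module_lin K V W (%x. f x \<ominus>\<^bsub>W\<^esub> g x)"
  by (rule module_lin_diff[OF hmodD(1)[OF W] hlinD(1)[OF f] hlinD(1)[OF g]])
 fix h v assume h: "h <: H" and v: "v <: V"
 show "f (act V h v) \<ominus>\<^bsub>W\<^esub> g (act V h v) = act W h (f v \<ominus>\<^bsub>W\<^esub> g v)"
  using module_lin_minus[OF hmodD(1)[OF W] hmodD(1)[OF W] bilin_lin2[OF hmodD(2)[OF W] h] hlinD(3)[OF f v] hlinD(3)[OF g v]]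
   hlinD(2)[OF f h v] hlinD(2)[OF g h v] by simp
qed

lemma gcommutator_hlin:
 assumes V: "hm_obj Q V"
 shows "hlin (gtensor Q (gend Q V) (gend Q V)) (gend Q V) (gcommutator Q V)"
proof -
 note h = hm_objD(8)[OF V]
 note E = ghom_obj[OF V V]
 note c = gcomp_hlin[OF h h h]
 show ?thesis unfolding gcommutator_def[abs_def]
  by (rule hlin_diff[OF hm_objD(8)[OF E] c hlin_comp[OF c gbraid_hlin[OF E E]]])
qed

lemma gcomp_gbraid:
 assumes V: "hm_obj Q V" and L: "L \<in> grd (gend Q V) m" and L': "L' \<in> grd (gend Q V) n"
 shows "gcomp Q V V V (gbraid Q (gend Q V) (gend Q V) (gtensor_elem Q (gend Q V) (gend Q V) L L')) =
  sg (m * n) \<odot>\<^bsub>gend Q V\<^esub> sum2 Q (gend Q V) R (%x y.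
   gcomp Q V V V (gtensor_elem Q (gend Q V) (gend Q V) (act (gend Q V) y L') (act (gend Q V) x L)))"
proof -
 note h = hm_objD(8)[OF V]
 let ?E = "gend Q V"
 let ?T = "gtensor Q ?E ?E"
 note E = ghom_obj[OF V V]
 note hE = hm_objD(8)[OF E]
 note c = hlinD(1)[OF gcomp_hlin[OF h h h]]
 note Lc = hm_objD(6)[OF E L] and Lc' = hm_objD(6)[OF E L']
 note e = gelem_bilin[OF hmod_tp[OF hE hE]]
 note mT = module_gtensor[OF hmod_tp[OF hE hE]]
 have t: "tau ?E ?E L L' <: ?T" by (rule bilin_closed[OF tau_bilin[OF hE hE] Lc Lc'])
 have "gcomp Q V V V (gbraid Q ?E ?E (gtensor_elem Q ?E ?E L L')) = sg (m * n) \<odot>\<^bsub>?E\<^esub> gcomp Q V V V (tau ?E ?E L L')"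
  unfolding gbraid_lin(2)[OF E E L L'] by (rule module_lin_smult[OF c sg_closed t])
 also have "gcomp Q V V V (tau ?E ?E L L') = sum2 Q ?E R (%x y.
   gcomp Q V V V (gtensor_elem Q ?E ?E (act ?E y L') (act ?E x L)))"
  unfolding tau_def
  by (rule sum2_comp[OF mT hmodD(1)[OF hE] c R_closed]) (use Lc Lc' in "simp add: bilin_closed[OF e] hmodD(5)[OF hE]")
 finally show ?thesis .
qed

lemma gcommutator_graded:
 assumes V: "hm_obj Q V" and L: "L \<in> grd (gend Q V) m" and L': "L' \<in> grd (gend Q V) n"
 shows "gcommutator Q V (gtensor_elem Q (gend Q V) (gend Q V) L L') \<in> grd (gend Q V) (m + n)"
proof -
 let ?E = "gend Q V"
 note E = ghom_obj[OF V V]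
 interpret E: module K ?E by (rule hm_objD(1)[OF E])
 note SE = E.submoduleE[OF hm_objD(2)[OF E]]
 have 1: "gcomp Q V V V (gtensor_elem Q ?E ?E L L') \<in> grd ?E (m + n)" by (rule gcomp_graded[OF V V V L L'])
 have "sum2 Q ?E R (%x y. gcomp Q V V V (gtensor_elem Q ?E ?E (act ?E y L') (act ?E x L))) \<in> grd ?E (m + n)"
 proof (rule sum2_submodule[OF hm_objD(1)[OF E] hm_objD(2)[OF E] R_closed])
  fix x y assume "x <: H" "y <: H"
  then have "gcomp Q V V V (gtensor_elem Q ?E ?E (act ?E y L') (act ?E x L)) \<in> grd ?E (n + m)"
   by (intro gcomp_graded V hm_objD(4)[OF E] L L')
  then show "gcomp Q V V V (gtensor_elem Q ?E ?E (act ?E y L') (act ?E x L)) \<in> grd ?E (m + n)" by (simp add: add.commute)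
 qed
 then have 2: "gcomp Q V V V (gbraid Q ?E ?E (gtensor_elem Q ?E ?E L L')) \<in> grd ?E (m + n)"
  unfolding gcomp_gbraid[OF V L L'] by (intro SE(4)) simp_all
 show ?thesis unfolding gcommutator_def a_minus_def by (intro SE(5) SE(3) 1 2)
qed

lemma app_gcommutator:
 assumes V: "hm_obj Q V" and L: "L \<in> grd (gend Q V) m" and L': "L' \<in> grd (gend Q V) n" and v: "v <: V"
 shows "app V V (gcommutator Q V (gtensor_elem Q (gend Q V) (gend Q V) L L')) v =
  cmp3 V V V L L' v \<ominus>\<^bsub>V\<^esub> sg (m * n) \<odot>\<^bsub>V\<^esub> sum2 Q V R (%x y. cmp3 V V V (act (gend Q V) y L') (act (gend Q V) x L) v)"
proof -
 note h = hm_objD(8)[OF V]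
 let ?E = "gend Q V"
 let ?T = "gtensor Q ?E ?E"
 note E = ghom_obj[OF V V]
 note hE = hm_objD(8)[OF E]
 note mE = hm_objD(1)[OF E] and mV = hm_objD(1)[OF V]
 note Lc = hm_objD(6)[OF E L] and Lc' = hm_objD(6)[OF E L']
 note e = gelem_bilin[OF hmod_tp[OF hE hE]]
 note gc = hlinD(3)[OF gcomp_hlin[OF h h h]]
 note a = app_bilin[OF h h]
 have l: "module_lin K ?E V (%N. app V V N v)" by (rule bilin_lin1[OF a v])
 have c2: "gcomp Q V V V (gbraid Q ?E ?E (gtensor_elem Q ?E ?E L L')) <: ?E"
  by (intro gc hlinD(3)[OF gbraid_hlin[OF E E]] bilin_closed[OF e] Lc Lc')
 have s: "sum2 Q ?E R (%x y. gcomp Q V V V (gtensor_elem Q ?E ?E (act ?E y L') (act ?E x L))) <: ?E"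
  by (intro sum2_closed mE gc bilin_closed[OF e] hmodD(5)[OF hE] Lc Lc' R_closed)
 have "app V V (sum2 Q ?E R (%x y. gcomp Q V V V (gtensor_elem Q ?E ?E (act ?E y L') (act ?E x L)))) v =
  sum2 Q V R (%x y. app V V (gcomp Q V V V (gtensor_elem Q ?E ?E (act ?E y L') (act ?E x L))) v)"
  by (rule sum2_comp[where g = "%N. app V V N v", OF mE mV l R_closed])
   (use Lc Lc' in "simp add: gc bilin_closed[OF e] hmodD(5)[OF hE]")
 also have "... = sum2 Q V R (%x y. cmp3 V V V (act ?E y L') (act ?E x L) v)"
  by (rule sum2_cong[OF mV R_closed])
   (use Lc Lc' v in "simp_all add: app_gcomp[OF h h h] hmodD(5)[OF hE] cmp3_closed[OF h h h]")
 finally have 1: "app V V (sum2 Q ?E R (%x y. gcomp Q V V V (gtensor_elem Q ?E ?E (act ?E y L') (act ?E x L)))) v =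
  sum2 Q V R (%x y. cmp3 V V V (act ?E y L') (act ?E x L) v)" .
 have "app V V (gcommutator Q V (gtensor_elem Q ?E ?E L L')) v =
  app V V (gcomp Q V V V (gtensor_elem Q ?E ?E L L')) v \<ominus>\<^bsub>V\<^esub>
  app V V (gcomp Q V V V (gbraid Q ?E ?E (gtensor_elem Q ?E ?E L L'))) v"
  unfolding gcommutator_def by (rule module_lin_minus[OF mE mV l gc[OF bilin_closed[OF e Lc Lc']] c2])
 also have "app V V (gcomp Q V V V (gbraid Q ?E ?E (gtensor_elem Q ?E ?E L L'))) v =
   sg (m * n) \<odot>\<^bsub>V\<^esub> sum2 Q V R (%x y. cmp3 V V V (act ?E y L') (act ?E x L) v)"
  unfolding gcomp_gbraid[OF V L L'] 1[symmetric] by (rule module_lin_smult[OF l sg_closed s])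
 finally show ?thesis unfolding app_gcomp[OF h h h Lc Lc' v] .
qed

lemma hm_mor_hlin: "hm_mor Q V W f ==> hlin V W f"
 by (simp add: hm_mor_def hlin_def)

lemma gelem_grd:
 assumes V: "hm_obj Q V" and W: "hm_obj Q W" and v: "v \<in> grd V m" and w: "w \<in> grd W n"
 shows "gtensor_elem Q V W v w \<in> grd (gtensor Q V W) (m + n)"
proof -
 have "gtensor_elem Q V W v w \<in> {gtensor_elem Q V W v w | v w i j. v \<in> grd V i \<and> w \<in> grd W j \<and> i + j = m + n}"
  using v w by blast
 then show ?thesis unfolding gtensor_def Let_def by (simp add: subsetD[OF module_span_mono])
qed

text \<open>By \<open>app_cur\<close> the evaluation of the curried action is the module action
  again; together with equivariance in a, this is what turns commutators with \<open>lhat\<close>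
  into Leibniz rules.\<close>

lemma lhat_facts:
 assumes A: "hm_obj Q A" and V: "hm_obj Q V" and l: "hm_mor Q (gtensor Q A V) V l"
 shows "hlin A (gend Q V) (lhat Q A V l)"
  and "a <: A ==> v <: V ==> app V V (lhat Q A V l a) v = l (gtensor_elem Q A V a v)"
  and "a \<in> grd A n ==> lhat Q A V l a \<in> grd (gend Q V) n"
  and "hbilin A V V (%a v. l (gtensor_elem Q A V a v))"
  and "a \<in> grd A n ==> v \<in> grd V m ==> l (gtensor_elem Q A V a v) \<in> grd V (n + m)"
proof -
 note hA = hm_objD(8)[OF A] and hV = hm_objD(8)[OF V]
 note hl = hm_mor_hlin[OF l]
 let ?f = "%a v. l (gtensor_elem Q A V a v)"
 show f: "hbilin A V V ?f" by (rule hbilin_hlin[OF hA hV hV hl])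
 have eq: "lhat Q A V l = cur A V V ?f" unfolding lhat_def by (rule gcurry_cur[OF hA hV hV hlinD(1)[OF hl]])
 show h: "hlin A (gend Q V) (lhat Q A V l)"
  unfolding hlin_def eq using cur_closed(2)[OF hA hV hV hbilinD(1)[OF f]] cur_equivariant[OF hA hV hV f] by auto
 show "a <: A ==> v <: V ==> app V V (lhat Q A V l a) v = l (gtensor_elem Q A V a v)"
  unfolding eq by (rule app_cur[OF hA hV hV f])
 show g: "l (gtensor_elem Q A V a v) \<in> grd V (n + m)" if "a \<in> grd A n" "v \<in> grd V m" for a v n m
  using l gelem_grd[OF A V that] by (simp add: hm_mor_def)
 show "lhat Q A V l a \<in> grd (gend Q V) n" if a: "a \<in> grd A n" for a n
 proof -
  note ac = hm_objD(6)[OF A a]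
  have "lhat Q A V l a v \<in> grd V (m + n)" if v: "v \<in> grd V m" for v m
  proof -
   have "lhat Q A V l a v = sum3 Q V psi (%x y z. ?f (act A x a) (act V (y ** be ** S z) v))"
    unfolding eq cur_def using ac hm_objD(6)[OF V v] by simp
   also have "... \<in> grd V (n + m)"
    by (rule sum3_submodule[OF hm_objD(1)[OF V] hm_objD(2)[OF V] psi_closed])
     (intro g hm_objD(4)[OF V _ v] hm_objD(4)[OF A _ a], simp_all)
   finally show ?thesis by (simp add: add.commute)
  qed
  then show ?thesis using hlinD(3)[OF h ac] by (simp add: ghom_grd)
 qed
qed

end

section \<open>Leibniz rules and brackets\<close>

text \<open>An endomorphism of the target merely relabels the legs of a word; this will be applied
  to the exchange of the first two positions.\<close>

lemma (in qhopf_alg) alghom_L3: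
 assumes G: "alghom K B B G" and h: "Hhom f" "Hhom g" "Hhom h" and t: "t <: HH3"
 shows "G (L3 f g h t) = L3 (%x. G (f x)) (%x. G (g x)) (%x. G (h x)) t"
proof -
 interpret B: monoid B by (rule monB)
 have "G (L3 f g h t) = sum3 Q B t (%x y z. G (f x \<cdot> g y \<cdot> h z))"
  by (rule eval_L3[OF modB alghomD(1)[OF G] h t])
 also have "... = L3 (%x. G (f x)) (%x. G (g x)) (%x. G (h x)) t"
  unfolding L3_def
  by (rule sum3_cong[OF modB t]) (use h in "simp_all add: hom_closed alghomD(3,4)[OF G]")
 finally show ?thesis .
qed

lemma (in qhopf_alg) alghom_L2D:
 assumes G: "alghom K B B G" and h: "Hhom f" "Hhom g" and x: "x <: H"
 shows "G (L2D f g x) = L2D (%x. G (f x)) (%x. G (g x)) x"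
proof -
 interpret B: monoid B by (rule monB)
 have "G (L2D f g x) = sum2 Q B (D x) (%x y. G (f x \<cdot> g y))"
  unfolding L2D_def by (rule eval_L2[OF modB alghomD(1)[OF G] h]) (use x in simp)
 also have "... = L2D (%x. G (f x)) (%x. G (g x)) x"
  unfolding L2D_def L2_def
  by (rule sum2_cong[OF modB]) (use h x in "simp_all add: hom_closed alghomD(3,4)[OF G]")
 finally show ?thesis .
qed

text \<open>P abstracts the pairs (L, c): it enters through its equivariant actions on V and on A.
  Degrees of its elements are recorded by \<open>leib\<close>.\<close>

locale leibniz = qhopf Q for Q :: "('k, 'h) qhopf" +
 fixes P :: "('k, 'h, 'p) gmod" and A :: "('k, 'h, 'a) gmod" and V :: "('k, 'h, 'v) gmod"
  and pv :: "'p => 'v => 'v" and pa :: "'p => 'a => 'a" and am :: "'a => 'v => 'v"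
 assumes hP: "hmod P" and oA: "hm_obj Q A" and hV: "hmod V"
  and pv: "hbilin P V V pv" and pa: "hbilin P A A pa" and am: "hbilin A V V am"
begin

interpretation E: qhopf_alg Q HH4 by (rule qalg4)

lemma hA: "hmod A" by (rule hm_objD(8)[OF oA])

lemmas mV = hmodD(1)[OF hV]

lemmas op_closed = hmodD(5)[OF hP] hmodD(5)[OF hA] hmodD(5)[OF hV]
 hbilinD(3)[OF pv] hbilinD(3)[OF pa] hbilinD(3)[OF am]

lemmas op_lins = act_lins[OF hP] act_lins[OF hA] act_lins[OF hV]
 bilin_comp2[OF hbilinD(1)[OF pv]] bilin_comp1[OF hbilinD(1)[OF pv]]
 bilin_comp2[OF hbilinD(1)[OF pa]] bilin_comp1[OF hbilinD(1)[OF pa]]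
 bilin_comp2[OF hbilinD(1)[OF am]] bilin_comp1[OF hbilinD(1)[OF am]]

section \<open>The fourfold tensor power of H acting on the arguments p, q, a, v\<close>

definition multi4 :: "('p => 'p => 'a => 'v => 'v) => bool" where
 "multi4 F \<longleftrightarrow>
  (\<forall>q\<in>carrier P. \<forall>a\<in>carrier A. \<forall>v\<in>carrier V. module_lin K P V (%p. F p q a v)) \<and>
  (\<forall>p\<in>carrier P. \<forall>a\<in>carrier A. \<forall>v\<in>carrier V. module_lin K P V (%q. F p q a v)) \<and>
  (\<forall>p\<in>carrier P. \<forall>q\<in>carrier P. \<forall>v\<in>carrier V. module_lin K A V (%a. F p q a v)) \<and>
  (\<forall>p\<in>carrier P. \<forall>q\<in>carrier P. \<forall>a\<in>carrier A. module_lin K V V (%v. F p q a v))"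

lemma multi4I:
 assumes "!!q a v. q <: P ==> a <: A ==> v <: V ==> module_lin K P V (%p. F p q a v)"
  "!!p a v. p <: P ==> a <: A ==> v <: V ==> module_lin K P V (%q. F p q a v)"
  "!!p q v. p <: P ==> q <: P ==> v <: V ==> module_lin K A V (%a. F p q a v)"
  "!!p q a. p <: P ==> q <: P ==> a <: A ==> module_lin K V V (%v. F p q a v)"
 shows "multi4 F"
 using assms by (simp add: multi4_def)

lemma multi4_lins:
 assumes "multi4 F"
 shows "q <: P ==> a <: A ==> v <: V ==> module_lin K L P f ==> module_lin K L V (%u. F (f u) q a v)"
  "p <: P ==> a <: A ==> v <: V ==> module_lin K L P f ==> module_lin K L V (%u. F p (f u) a v)"
  "p <: P ==> q <: P ==> v <: V ==> module_lin K L A g ==> module_lin K L V (%u. F p q (g u) v)"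
  "p <: P ==> q <: P ==> a <: A ==> module_lin K L V k ==> module_lin K L V (%u. F p q a (k u))"
  "p <: P ==> q <: P ==> a <: A ==> v <: V ==> F p q a v <: V"
proof -
 note M = assms[unfolded multi4_def]
 note M1 = M[THEN conjunct1, rule_format] and M2 = M[THEN conjunct2, THEN conjunct1, rule_format]
  and M3 = M[THEN conjunct2, THEN conjunct2, THEN conjunct1, rule_format]
  and M4 = M[THEN conjunct2, THEN conjunct2, THEN conjunct2, rule_format]
 show "q <: P ==> a <: A ==> v <: V ==> module_lin K L P f ==> module_lin K L V (%u. F (f u) q a v)"
  by (rule module_lin_comp[OF M1])
 show "p <: P ==> a <: A ==> v <: V ==> module_lin K L P f ==> module_lin K L V (%u. F p (f u) a v)"
  by (rule module_lin_comp[OF M2])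
 show "p <: P ==> q <: P ==> v <: V ==> module_lin K L A g ==> module_lin K L V (%u. F p q (g u) v)"
  by (rule module_lin_comp[OF M3])
 show "p <: P ==> q <: P ==> a <: A ==> module_lin K L V k ==> module_lin K L V (%u. F p q a (k u))"
  by (rule module_lin_comp[OF M4])
 show "p <: P ==> q <: P ==> a <: A ==> v <: V ==> F p q a v <: V"
  by (rule module_lin_closed[OF M4])
qed

definition act4 :: "('p => 'p => 'a => 'v => 'v) => ('k, ('k, ('k, 'h, 'h) tensor, 'h) tensor, 'h) tensor
  => 'p => 'p => 'a => 'v => 'v" where
 "act4 F T p q a v = sum4 Q V T (%x y z w. F (act P x p) (act P y q) (act A z a) (act V w v))"

lemma act4_quadlin:
 assumes F: "multi4 F" and "p <: P" "q <: P" "a <: A" "v <: V"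
 shows "quadlin V (%x y z w. F (act P x p) (act P y q) (act A z a) (act V w v))"
 by (rule lins multi4_lins(1-4)[OF F] op_lins | simp add: assms op_closed)+

lemma act4_lin:
 assumes F: "multi4 F" and "p <: P" "q <: P" "a <: A" "v <: V"
 shows "module_lin K HH4 V (%T. act4 F T p q a v)"
 unfolding act4_def by (rule sum4_lin[OF mV act4_quadlin[OF assms]])

lemma act4_e4:
 assumes F: "multi4 F" and "p <: P" "q <: P" "a <: A" "v <: V"
  and "x <: H" "y <: H" "z <: H" "w <: H"
 shows "act4 F (e4 Q x y z w) p q a v = F (act P x p) (act P y q) (act A z a) (act V w v)"
 unfolding act4_def by (rule sum4_e4[OF mV act4_quadlin[OF assms(1-5)] assms(6-9)])

lemma act4_multi4:
 assumes F: "multi4 F" and T: "T <: HH4"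
 shows "multi4 (act4 F T)"
 unfolding act4_def
 by (rule multi4I; (rule sum4_fun_lin[OF mV T] multi4_lins(1-4)[OF F] op_lins module_lin_id | simp add: op_closed)+)

text \<open>The right factor reaches the arguments first. Rewriting the expression F inside
  therefore multiplies the accumulated word from the left, in agreement with routes read from right
  to left.\<close>

lemma act4_mult:
 assumes F: "multi4 F" and pqav: "p <: P" "q <: P" "a <: A" "v <: V"
  and T1: "T1 <: HH4" and T2: "T2 <: HH4"
 shows "act4 F (T1 *\<^sub>4 T2) p q a v = act4 (act4 F T1) T2 p q a v"
proof -
 note FT = act4_multi4[OF F T1]
 note l = act4_lin[OF F pqav]
 note act_m = hmodD(3)[OF hP] hmodD(3)[OF hA] hmodD(3)[OF hV]
 show ?thesis
 proof (rule H4_ext[where f = "%T2. act4 F (T1 *\<^sub>4 T2) p q a v" and g = "%T2. act4 (act4 F T1) T2 p q a v",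
    OF mV module_lin_comp[OF l bilin_comp2[OF kalgD(2)[OF kalgH4] T1 module_lin_id]] act4_lin[OF FT pqav] _ T2])
  fix x y z w assume xyzw: "x <: H" "y <: H" "z <: H" "w <: H"
  have pqav': "act P x p <: P" "act P y q <: P" "act A z a <: A" "act V w v <: V"
   using xyzw pqav op_closed by auto
  have "act4 F (T1 *\<^sub>4 e4 Q x y z w) p q a v = act4 F T1 (act P x p) (act P y q) (act A z a) (act V w v)"
   by (rule H4_ext[where f = "%T1. act4 F (T1 *\<^sub>4 e4 Q x y z w) p q a v" and
      g = "%T1. act4 F T1 (act P x p) (act P y q) (act A z a) (act V w v)",
      OF mV module_lin_comp[OF l bilin_comp1[OF kalgD(2)[OF kalgH4] module_lin_id]] act4_lin[OF F pqav'] _ T1])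
    (use xyzw pqav pqav' in "simp_all add: e4_mult act4_e4[OF F] act_m")
  then show "act4 F (T1 *\<^sub>4 e4 Q x y z w) p q a v = act4 (act4 F T1) (e4 Q x y z w) p q a v"
   using act4_e4[OF FT pqav xyzw] by simp
 qed
qed

lemma act4_add:
 assumes F: "multi4 F" and G: "multi4 G" and pqav: "p <: P" "q <: P" "a <: A" "v <: V"
  and T: "T <: HH4"
 shows "act4 (%p q a v. F p q a v \<oplus>\<^bsub>V\<^esub> G p q a v) T p q a v = act4 F T p q a v \<oplus>\<^bsub>V\<^esub> act4 G T p q a v"
proof -
 have FG: "multi4 (%p q a v. F p q a v \<oplus>\<^bsub>V\<^esub> G p q a v)"
  by (rule multi4I; (rule module_lin_plus[OF mV] multi4_lins(1-4)[OF F] multi4_lins(1-4)[OF G] module_lin_id | assumption)+)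
 note l = act4_lin[OF F pqav] act4_lin[OF G pqav]
 show ?thesis
  by (rule H4_ext[where f = "%T. act4 (%p q a v. F p q a v \<oplus>\<^bsub>V\<^esub> G p q a v) T p q a v" and
     g = "%T. act4 F T p q a v \<oplus>\<^bsub>V\<^esub> act4 G T p q a v", OF mV act4_lin[OF FG pqav] module_lin_plus[OF mV l] _ T])
   (simp add: act4_e4[OF FG pqav] act4_e4[OF F pqav] act4_e4[OF G pqav])
qed

lemma act4_smult:
 assumes F: "multi4 F" and r: "r <: K" and pqav: "p <: P" "q <: P" "a <: A" "v <: V"
  and T: "T <: HH4"
 shows "act4 (%p q a v. r \<odot>\<^bsub>V\<^esub> F p q a v) T p q a v = r \<odot>\<^bsub>V\<^esub> act4 F T p q a v"
proof -
 have G: "multi4 (%p q a v. r \<odot>\<^bsub>V\<^esub> F p q a v)"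
  by (rule multi4I; (rule module_lin_smult_fun[OF mV] multi4_lins(1-4)[OF F] module_lin_id r | assumption)+)
 note l = act4_lin[OF F pqav]
 show ?thesis
  by (rule H4_ext[where f = "%T. act4 (%p q a v. r \<odot>\<^bsub>V\<^esub> F p q a v) T p q a v" and
     g = "%T. r \<odot>\<^bsub>V\<^esub> act4 F T p q a v", OF mV act4_lin[OF G pqav] module_lin_smult_fun[OF mV l r] _ T])
   (simp add: act4_e4[OF G pqav] act4_e4[OF F pqav])
qed

text \<open>A Leibniz rule is available only for elements of fixed degree in an H-stable set. Every
  argument that T produces stays in these sets, so the rule may be substituted under the action of
  T.\<close>

lemma act4_cong:
 assumes T: "T <: HH4" and S1: "!!h p. h <: H ==> p \<in> S1 ==> act P h p \<in> S1"
  and S2: "!!h p. h <: H ==> p \<in> S2 ==> act P h p \<in> S2"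
  and eq: "!!p q a v. p \<in> S1 ==> q \<in> S2 ==> a \<in> grd A i ==> v <: V ==> F p q a v = G p q a v"
  and G: "multi4 G" and sub: "S1 \<subseteq> carrier P" "S2 \<subseteq> carrier P"
  and pqav: "p \<in> S1" "q \<in> S2" "a \<in> grd A i" "v <: V"
 shows "act4 F T p q a v = act4 G T p q a v"
 unfolding act4_def
proof (rule sum4_cong[OF mV T])
 fix x y z w assume xyzw: "x <: H" "y <: H" "z <: H" "w <: H"
 note c = S1[OF xyzw(1) pqav(1)] S2[OF xyzw(2) pqav(2)] hm_objD(4)[OF oA xyzw(3) pqav(3)] op_closed(3)[OF xyzw(4) pqav(4)]
 show "F (act P x p) (act P y q) (act A z a) (act V w v) = G (act P x p) (act P y q) (act A z a) (act V w v)"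
  by (rule eq[OF c])
 show "G (act P x p) (act P y q) (act A z a) (act V w v) <: V"
  by (rule multi4_lins(5)[OF G subsetD[OF sub(1) c(1)] subsetD[OF sub(2) c(2)] hm_objD(6)[OF oA c(3)] c(4)])
qed

abbreviation "swap12 \<equiv> E.L4 i2 i1 i3 i4"

lemma indep_swap: "E.indep4 i2 i1 i3 i4"
 by (rule E.indep4_perm(1)[OF indep_i])

lemma swap12_hom: "alghom K HH4 HH4 swap12"
 by (rule E.L4_alghom(1)[OF E.indep4D(1-10)[OF indep_swap]])

lemma swap12_e4: "x <: H ==> y <: H ==> z <: H ==> w <: H ==>
  swap12 (e4 Q x y z w) = e4 Q y x z w"
 by (simp add: E.L4_alghom(2)[OF E.indep4D(1-10)[OF indep_swap]] e4_mult)

text \<open>Interchanging the arguments p and q amounts to exchanging the first two legs of T, so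
  one computation covers both orders of the operators.\<close>

lemma act4_swap:
 assumes F: "multi4 F" and pqav: "p <: P" "q <: P" "a <: A" "v <: V"
  and T: "T <: HH4"
 shows "act4 F T q p a v = act4 (%p q. F q p) (swap12 T) p q a v"
proof -
 have G: "multi4 (%p q. F q p)"
  by (rule multi4I; (rule multi4_lins(1-4)[OF F] module_lin_id | assumption)+)
 show ?thesis
  by (rule H4_ext[where f = "%T. act4 F T q p a v" and g = "%T. act4 (%p q. F q p) (swap12 T) p q a v",
     OF mV act4_lin[OF F pqav(2,1,3,4)] module_lin_comp[OF act4_lin[OF G pqav] alghomD(1)[OF swap12_hom]] _ T])
   (simp add: swap12_e4 act4_e4[OF F pqav(2,1,3,4)] act4_e4[OF G pqav])
qed

abbreviation "K1 \<equiv> (%p q a v. am (pa q a) (pv p v))"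
abbreviation "K2 \<equiv> (%p q a v. am (pa p a) (pv q v))"
abbreviation "K3 \<equiv> (%p q a v. am a (pv p (pv q v)))"

lemma multi4_K: "multi4 K1" "multi4 K2" "multi4 K3" "multi4 (%p q a v. am a (pv q (pv p v)))"
 "multi4 (%p q a v. pv p (pv q (am a v)))" "multi4 (%p q a v. pv p (am (pa q a) v))"
 "multi4 (%p q a v. pv p (am a (pv q v)))"
 by (rule multi4I; (rule op_lins module_lin_id | simp add: op_closed)+)+

text \<open>The abstract counterpart of \<open>cmp3\<close>: the evaluation at v of the internal
  composite of p and q.\<close>

definition cmp :: "'p => 'p => 'v => 'v" where
 "cmp p q v = sum3 Q V phi (%x y z. pv (act P x p) (pv (act P y q) (act V z v)))"

lemma cmp_closed: "p <: P ==> q <: P ==> v <: V ==> cmp p q v <: V"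
 unfolding cmp_def by (intro sum3_closed mV phi_closed op_closed)

lemma cmp_lins:
 "q <: P ==> v <: V ==> module_lin K L P f ==> module_lin K L V (%u. cmp (f u) q v)"
 "p <: P ==> v <: V ==> module_lin K L P f ==> module_lin K L V (%u. cmp p (f u) v)"
 "p <: P ==> q <: P ==> module_lin K L V k ==> module_lin K L V (%u. cmp p q (k u))"
 unfolding cmp_def
 by ((rule sum3_fun_lin[OF mV phi_closed] op_lins | simp add: op_closed)+)

text \<open>The evaluated commutator. The parameter k is the product of the two degrees, whose
  parity determines the sign.\<close>

definition brk :: "int => 'p => 'p => 'v => 'v" where
 "brk k p q v = cmp p q v \<ominus>\<^bsub>V\<^esub> sg k \<odot>\<^bsub>V\<^esub> sum2 Q V R (%x y. cmp (act P y q) (act P x p) v)"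

text \<open>The Leibniz rule for elements of degree \<open>k\<close>, with all arguments in right-nested brackets.\<close>

definition leib :: "int => 'p set => bool" where
 "leib k U \<longleftrightarrow> U \<subseteq> carrier P \<and> (\<forall>h\<in>carrier H. \<forall>p\<in>U. act P h p \<in> U) \<and>
  (\<forall>j. \<forall>p\<in>U. \<forall>a\<in>grd A j. pa p a \<in> grd A (j + k)) \<and>
  (\<forall>j. \<forall>p\<in>U. \<forall>a\<in>grd A j. \<forall>v\<in>carrier V.
   pv p (am a v) = sum3 Q V psi (%x y z. am (pa (act P x p) (act A y a)) (act V z v)) \<oplus>\<^bsub>V\<^esub>
    sg (k * j) \<odot>\<^bsub>V\<^esub> sum3 Q V (braidX Q) (%x y z. am (act A y a) (pv (act P x p) (act V z v))))"

lemma leibD: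
 assumes "leib k U"
 shows "U \<subseteq> carrier P" "h <: H ==> p \<in> U ==> act P h p \<in> U" "p \<in> U ==> p <: P"
  "p \<in> U ==> a \<in> grd A j ==> pa p a \<in> grd A (j + k)"
  "p \<in> U ==> a \<in> grd A j ==> v <: V ==>
   pv p (am a v) = sum3 Q V psi (%x y z. am (pa (act P x p) (act A y a)) (act V z v)) \<oplus>\<^bsub>V\<^esub>
    sg (k * j) \<odot>\<^bsub>V\<^esub> sum3 Q V (braidX Q) (%x y z. am (act A y a) (pv (act P x p) (act V z v)))"
 using assms by (auto simp: leib_def)

lemmas i3 = E.indep4_3[OF indep_i]
lemmas bX = E.braidX_closed

lemma indep_1324: "E.indep4 i1 i3 i2 i4" by (rule E.indep4_perm(2)[OF indep_i])

lemma L3_closures: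
 "E.L3 i1 i2 (E.L2D i3 i4) phi <: HH4" "t <: HH3 ==> E.L3 i2 i3 i4 t <: HH4"
 "t <: HH3 ==> E.L3 i1 (E.L2D i2 i3) i4 t <: HH4"
 "t <: HH3 ==> E.L3 i1 i3 (E.L2D i2 i4) t <: HH4"
 "t <: HH3 ==> E.L3 (E.L2D i1 i2) i3 i4 t <: HH4"
 "t <: HH3 ==> E.L3 i1 i2 i4 t <: HH4"
 "t <: HH3 ==> E.L3 i2 i1 i4 t <: HH4"
 using E.L3_cl[OF i3(7) phi_closed] E.L3_cl[OF i3(4)] E.L3_cl[OF i3(6)] E.L3_cl[OF E.indep4_3(7)[OF indep_1324]]
  E.L3_cl[OF i3(5)] E.L3_cl[OF i3(2)] E.L3_cl[OF E.indep3_perm(1)[OF i3(2)]] by simp_all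

lemma act4_one:
 assumes "p <: P" "q <: P" "a <: A" "v <: V"
 shows "act P \<one>\<^bsub>H\<^esub> p = p" "act P \<one>\<^bsub>H\<^esub> q = q" "act A \<one>\<^bsub>H\<^esub> a = a" "act V \<one>\<^bsub>H\<^esub> v = v"
 using assms hmodD(4)[OF hP] hmodD(4)[OF hA] hmodD(4)[OF hV] by auto

text \<open>The dictionary between words and the Sweedler sums in the Leibniz computation. Positions
  that a word does not mention receive the unit of H, which acts trivially.\<close>

lemma act4_evals:
 assumes F: "multi4 F" and pqav: "p <: P" "q <: P" "a <: A" "v <: V"
  and t: "t <: HH3"
 shows "act4 F (E.L3 i2 i3 i4 t) p q a v = sum3 Q V t (%x y z. F p (act P x q) (act A y a) (act V z v))"
  "act4 F (E.L3 i1 i2 i4 t) p q a v = sum3 Q V t (%x y z. F (act P x p) (act P y q) a (act V z v))"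
  "act4 F (E.L3 i2 i1 i4 t) p q a v = sum3 Q V t (%x y z. F (act P y p) (act P x q) a (act V z v))"
  "act4 F (E.L3 i1 (E.L2D i2 i3) i4 t) p q a v =
   sum3 Q V t (%x y z. sum2 Q V (D y) (%s u. F (act P x p) (act P s q) (act A u a) (act V z v)))"
  "act4 F (E.L3 i1 i3 (E.L2D i2 i4) t) p q a v =
   sum3 Q V t (%x y z. sum2 Q V (D z) (%s u. F (act P x p) (act P s q) (act A y a) (act V u v)))"
  "act4 F (E.L3 i1 i2 (E.L2D i3 i4) t) p q a v =
   sum3 Q V t (%x y z. sum2 Q V (D z) (%s u. F (act P x p) (act P y q) (act A s a) (act V u v)))"
  "act4 F (E.L3 (E.L2D i1 i2) i3 i4 t) p q a v =
   sum3 Q V t (%x y z. sum2 Q V (D x) (%s u. F (act P s p) (act P u q) (act A y a) (act V z v)))"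
  "act4 F (E.L2 i1 i2 R) p q a v = sum2 Q V R (%x y. F (act P x p) (act P y q) a v)"
proof -
 note l = act4_lin[OF F pqav]
 note ev = act4_e4[OF F pqav]
 note c = multi4_lins(5)[OF F] op_closed pqav
 note d = i_indep
 note s = sum3_cong[OF mV t]
 note ss = e4_mult ev act4_one[OF pqav] c sum2_closed mV
 show "act4 F (E.L3 i2 i3 i4 t) p q a v = sum3 Q V t (%x y z. F p (act P x q) (act A y a) (act V z v))"
  by (subst E.eval_L3[where \<Theta> = "%T. act4 F T p q a v", OF mV l d(2,3,4) t], rule s) (simp_all add: ss)
 show "act4 F (E.L3 i1 i2 i4 t) p q a v = sum3 Q V t (%x y z. F (act P x p) (act P y q) a (act V z v))"
  by (subst E.eval_L3[where \<Theta> = "%T. act4 F T p q a v", OF mV l d(1,2,4) t], rule s) (simp_all add: ss)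
 show "act4 F (E.L3 i2 i1 i4 t) p q a v = sum3 Q V t (%x y z. F (act P y p) (act P x q) a (act V z v))"
  by (subst E.eval_L3[where \<Theta> = "%T. act4 F T p q a v", OF mV l d(2,1,4) t], rule s) (simp_all add: ss)
 show "act4 F (E.L3 i1 (E.L2D i2 i3) i4 t) p q a v =
   sum3 Q V t (%x y z. sum2 Q V (D y) (%s u. F (act P x p) (act P s q) (act A u a) (act V z v)))"
  by (subst E.eval_L3D2[where \<Theta> = "%T. act4 F T p q a v", OF mV l indep_i t], rule s, rule sum2_cong[OF mV]) (simp_all add: ss)
 show "act4 F (E.L3 i1 i3 (E.L2D i2 i4) t) p q a v =
   sum3 Q V t (%x y z. sum2 Q V (D z) (%s u. F (act P x p) (act P s q) (act A y a) (act V u v)))"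
  by (subst E.eval_L3D3[where \<Theta> = "%T. act4 F T p q a v", OF mV l indep_1324 t], rule s, rule sum2_cong[OF mV]) (simp_all add: ss)
 show "act4 F (E.L3 i1 i2 (E.L2D i3 i4) t) p q a v =
   sum3 Q V t (%x y z. sum2 Q V (D z) (%s u. F (act P x p) (act P y q) (act A s a) (act V u v)))"
  by (subst E.eval_L3D3[where \<Theta> = "%T. act4 F T p q a v", OF mV l indep_i t], rule s, rule sum2_cong[OF mV]) (simp_all add: ss)
 show "act4 F (E.L3 (E.L2D i1 i2) i3 i4 t) p q a v =
   sum3 Q V t (%x y z. sum2 Q V (D x) (%s u. F (act P s p) (act P u q) (act A y a) (act V z v)))"
  by (subst E.eval_L3D1[where \<Theta> = "%T. act4 F T p q a v", OF mV l indep_i t], rule s, rule sum2_cong[OF mV]) (simp_all add: ss)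
 show "act4 F (E.L2 i1 i2 R) p q a v = sum2 Q V R (%x y. F (act P x p) (act P y q) a v)"
  by (subst E.eval_L2[where \<Theta> = "%T. act4 F T p q a v", OF mV l d(1,2) R_closed], rule sum2_cong[OF mV R_closed]) (simp_all add: ss)
qed

text \<open>The rule for q is used under p, then the rule for p on both results. X1, X2, X3 are the
  routes from (p q)(a v) to (q a)(p v), to (p a)(q v) and to a (p (q v)). In the first of them p
  passes q a, of degree n + i, whence the exponent m (n + i).\<close>

lemma cmp_leibniz:
 assumes S1: "leib m S1" and S2: "leib n S2"
  and zero: "!!p q a. p \<in> S1 ==> q \<in> S2 ==> a <: A ==> pa p (pa q a) = \<zero>\<^bsub>A\<^esub>"
  and p: "p \<in> S1" and q: "q \<in> S2" and a: "a \<in> grd A i" and v: "v <: V"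
 defines "X1 \<equiv> E.L3 i1 (E.L2D i2 i3) i4 (braidX Q) *\<^sub>4 E.L3 i2 i3 i4 psi *\<^sub>4 E.L3 i1 i2 (E.L2D i3 i4) phi"
  and "X2 \<equiv> E.L3 i1 i3 (E.L2D i2 i4) psi *\<^sub>4 E.L3 i2 i3 i4 (braidX Q) *\<^sub>4 E.L3 i1 i2 (E.L2D i3 i4) phi"
  and "X3 \<equiv> E.L3 i1 i3 (E.L2D i2 i4) (braidX Q) *\<^sub>4 E.L3 i2 i3 i4 (braidX Q) *\<^sub>4 E.L3 i1 i2 (E.L2D i3 i4) phi"
 shows "cmp p q (am a v) = sg (m * (n + i)) \<odot>\<^bsub>V\<^esub> act4 K1 X1 p q a v \<oplus>\<^bsub>V\<^esub>
  (sg (n * i) \<odot>\<^bsub>V\<^esub> act4 K2 X2 p q a v \<oplus>\<^bsub>V\<^esub> sg ((m + n) * i) \<odot>\<^bsub>V\<^esub> act4 K3 X3 p q a v)"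
proof -
 interpret V: module K V by (rule mV)
 note pc = leibD(3)[OF S1] and qc = leibD(3)[OF S2] and ac = hm_objD(6)[OF oA]
 note c = op_closed L3_closures bX
 let ?G0 = "%p q a v. pv p (pv q (am a v))" and ?G1 = "%p q a v. pv p (am (pa q a) v)"
  and ?G2 = "%p q a v. pv p (am a (pv q v))"
 let ?Y1 = "E.L3 i1 (E.L2D i2 i3) i4 (braidX Q)" and ?Y2 = "E.L3 i2 i3 i4 psi" and ?Y3 = "E.L3 i1 i2 (E.L2D i3 i4) phi"
  and ?Y4 = "E.L3 i1 i3 (E.L2D i2 i4) psi" and ?Y5 = "E.L3 i2 i3 i4 (braidX Q)" and ?Y6 = "E.L3 i1 i3 (E.L2D i2 i4) (braidX Q)"
 have Y: "?Y1 <: HH4" "?Y2 <: HH4" "?Y3 <: HH4" "?Y4 <: HH4" "?Y5 <: HH4" "?Y6 <: HH4"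
  by (simp_all add: L3_closures bX)
 have g0: "?G0 p q a v = act4 ?G1 ?Y2 p q a v \<oplus>\<^bsub>V\<^esub> sg (n * i) \<odot>\<^bsub>V\<^esub> act4 ?G2 ?Y5 p q a v"
  if pqa: "p \<in> S1" "q \<in> S2" "a \<in> grd A i" "v <: V" for p q a v
 proof -
  note cc = pc[OF pqa(1)] qc[OF pqa(2)] ac[OF pqa(3)] pqa(4)
  have l: "module_lin K V V (pv p)" by (rule bilin_lin2[OF hbilinD(1)[OF pv] cc(1)])
  have s1: "sum3 Q V psi (%x y z. am (pa (act P x q) (act A y a)) (act V z v)) <: V"
   by (intro sum3_closed mV psi_closed c cc)
  have s2: "sum3 Q V (braidX Q) (%x y z. am (act A y a) (pv (act P x q) (act V z v))) <: V"
   by (intro sum3_closed mV bX c cc)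
  have "?G0 p q a v = pv p (sum3 Q V psi (%x y z. am (pa (act P x q) (act A y a)) (act V z v))) \<oplus>\<^bsub>V\<^esub>
   sg (n * i) \<odot>\<^bsub>V\<^esub> pv p (sum3 Q V (braidX Q) (%x y z. am (act A y a) (pv (act P x q) (act V z v))))"
   unfolding leibD(5)[OF S2 pqa(2-4)] using s1 s2 by (simp add: module_lin_add[OF l] module_lin_smult[OF l])
  also have "pv p (sum3 Q V psi (%x y z. am (pa (act P x q) (act A y a)) (act V z v))) = act4 ?G1 ?Y2 p q a v"
   unfolding act4_evals(1)[OF multi4_K(6) cc psi_closed]
   by (rule sum3_comp[OF mV mV l psi_closed]) (use cc in "simp add: c")
  also have "pv p (sum3 Q V (braidX Q) (%x y z. am (act A y a) (pv (act P x q) (act V z v)))) = act4 ?G2 ?Y5 p q a v"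
   unfolding act4_evals(1)[OF multi4_K(7) cc bX]
   by (rule sum3_comp[OF mV mV l bX]) (use cc in "simp add: c")
  finally show ?thesis .
 qed
 have g1: "?G1 p q a v = sg (m * (n + i)) \<odot>\<^bsub>V\<^esub> act4 K1 ?Y1 p q a v"
  if pqa: "p \<in> S1" "q \<in> S2" "a \<in> grd A i" "v <: V" for p q a v
 proof -
  note cc = pc[OF pqa(1)] qc[OF pqa(2)] ac[OF pqa(3)] pqa(4)
  note qa = leibD(4)[OF S2 pqa(2,3)]
  \<comment> \<open>The element y acts on q a through its coproduct, so the result is a sum of terms
    p' (q' a') with p' and q' in the same stable sets, and each of these vanishes.\<close>
  have z: "pa (act P x p) (act A y (pa q a)) = \<zero>\<^bsub>A\<^esub>" if xy: "x <: H" "y <: H" for x y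
  proof -
   note xp = leibD(2)[OF S1 xy(1) pqa(1)]
   have "pa (act P x p) (act A y (pa q a)) = pa (act P x p) (sum2 Q A (D y) (%s u. pa (act P s q) (act A u a)))"
    using hbilinD(2)[OF pa xy(2) cc(2,3)] by simp
   also have "... = sum2 Q A (D y) (%s u. pa (act P x p) (pa (act P s q) (act A u a)))"
    by (rule sum2_comp[OF hmodD(1)[OF hA] hmodD(1)[OF hA] bilin_lin2[OF hbilinD(1)[OF pa] pc[OF xp]]])
     (use xy cc in "simp_all add: c")
   also have "... = sum2 Q A (D y) (%s u. \<zero>\<^bsub>A\<^esub>)"
    by (rule sum2_cong[OF hmodD(1)[OF hA]])
     (use xy cc in "simp_all add: c zero[OF xp leibD(2)[OF S2 _ pqa(2)]] module_zero_closed[OF hmodD(1)[OF hA]]")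
   also have "... = \<zero>\<^bsub>A\<^esub>"
    by (rule sum2_comp[where P = A and g = "%_. \<zero>\<^bsub>A\<^esub>" and b = "%_ _. \<zero>\<^bsub>A\<^esub>", symmetric, OF hmodD(1)[OF hA] hmodD(1)[OF hA]
       module_lin_zero_fun[OF hmodD(1)[OF hA]]])
     (use xy in "simp_all add: module_zero_closed[OF hmodD(1)[OF hA]]")
   finally show ?thesis .
  qed
  have am0: "am \<zero>\<^bsub>A\<^esub> w = \<zero>\<^bsub>V\<^esub>" if "w <: V" for w
   by (rule module_lin_zero[OF hmodD(1)[OF hA] mV bilin_lin1[OF hbilinD(1)[OF am] that]])
  have "sum3 Q V psi (%x y z. am (pa (act P x p) (act A y (pa q a))) (act V z v)) = sum3 Q V psi (%x y z. \<zero>\<^bsub>V\<^esub>)"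
   by (rule sum3_cong[OF mV psi_closed]) (use cc in "simp_all add: z am0 c")
  also have "... = \<zero>\<^bsub>V\<^esub>"
   by (rule sum3_comp[where P = V and g = "%_. \<zero>\<^bsub>V\<^esub>" and b = "%_ _ _. \<zero>\<^bsub>V\<^esub>", symmetric, OF mV mV module_lin_zero_fun[OF mV] psi_closed])
    simp
  finally have z1: "sum3 Q V psi (%x y z. am (pa (act P x p) (act A y (pa q a))) (act V z v)) = \<zero>\<^bsub>V\<^esub>" .
  have "sum3 Q V (braidX Q) (%x y z. am (act A y (pa q a)) (pv (act P x p) (act V z v))) = act4 K1 ?Y1 p q a v"
   unfolding act4_evals(4)[OF multi4_K(1) cc bX]
  proof (rule sum3_cong[OF mV bX])
   fix x y z assume xyz: "x <: H" "y <: H" "z <: H"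
   show "am (act A y (pa q a)) (pv (act P x p) (act V z v)) =
    sum2 Q V (D y) (%s u. am (pa (act P s q) (act A u a)) (pv (act P x p) (act V z v)))"
    unfolding hbilinD(2)[OF pa xyz(2) cc(2,3), symmetric]
    by (rule sum2_comp[where g = "%t. am t (pv (act P x p) (act V z v))", OF hmodD(1)[OF hA] mV bilin_lin1[OF hbilinD(1)[OF am]]])
     (use xyz cc in "simp_all add: c")
  qed (use cc in "simp add: c sum2_closed mV")
  moreover have "act4 K1 ?Y1 p q a v <: V" by (rule module_lin_closed[OF act4_lin[OF multi4_K(1) cc] Y(1)])
  ultimately show ?thesis
   unfolding leibD(5)[OF S1 pqa(1) qa pqa(4)] z1 by (simp add: add.commute)
 qed
 have g2: "?G2 p q a v = act4 K2 ?Y4 p q a v \<oplus>\<^bsub>V\<^esub> sg (m * i) \<odot>\<^bsub>V\<^esub> act4 K3 ?Y6 p q a v"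
  if pqa: "p \<in> S1" "q \<in> S2" "a \<in> grd A i" "v <: V" for p q a v
 proof -
  note cc = pc[OF pqa(1)] qc[OF pqa(2)] ac[OF pqa(3)] pqa(4)
  have w: "pv q v <: V" using cc c by simp
  have "sum3 Q V psi (%x y z. am (pa (act P x p) (act A y a)) (act V z (pv q v))) = act4 K2 ?Y4 p q a v"
   unfolding act4_evals(5)[OF multi4_K(2) cc psi_closed]
  proof (rule sum3_cong[OF mV psi_closed])
   fix x y z assume xyz: "x <: H" "y <: H" "z <: H"
   show "am (pa (act P x p) (act A y a)) (act V z (pv q v)) =
    sum2 Q V (D z) (%s u. am (pa (act P x p) (act A y a)) (pv (act P s q) (act V u v)))"
    unfolding hbilinD(2)[OF pv xyz(3) cc(2,4), symmetric]
    by (rule sum2_comp[OF mV mV bilin_lin2[OF hbilinD(1)[OF am]]]) (use xyz cc in "simp_all add: c")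
  qed (use cc in "simp add: c sum2_closed mV")
  moreover have "sum3 Q V (braidX Q) (%x y z. am (act A y a) (pv (act P x p) (act V z (pv q v)))) = act4 K3 ?Y6 p q a v"
   unfolding act4_evals(5)[OF multi4_K(3) cc bX]
  proof (rule sum3_cong[OF mV bX])
   fix x y z assume xyz: "x <: H" "y <: H" "z <: H"
   show "am (act A y a) (pv (act P x p) (act V z (pv q v))) =
    sum2 Q V (D z) (%s u. am (act A y a) (pv (act P x p) (pv (act P s q) (act V u v))))"
    unfolding hbilinD(2)[OF pv xyz(3) cc(2,4), symmetric]
    by (rule sum2_comp[where g = "%t. am (act A y a) (pv (act P x p) t)", OF mV mV])
     (use xyz cc in "auto intro!: op_lins module_lin_id simp: c")
  qed (use cc in "simp add: c sum2_closed mV")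
  ultimately show ?thesis unfolding leibD(5)[OF S1 pqa(1,3) w] by simp
 qed
 note cc = pc[OF p] qc[OF q] ac[OF a] v
 have cong: "act4 F T p q a v = act4 G T p q a v"
  if "T <: HH4" "!!p q a v. p \<in> S1 ==> q \<in> S2 ==> a \<in> grd A i ==> v <: V ==> F p q a v = G p q a v"
   "multi4 G" for F G T
  by (rule act4_cong[where i = i and ?S1.0 = S1 and ?S2.0 = S2])
   (simp_all add: that leibD(1,2)[OF S1] leibD(1,2)[OF S2] p q a v)
 note m4 = act4_multi4[OF multi4_K(1)] act4_multi4[OF multi4_K(2)] act4_multi4[OF multi4_K(3)]
  act4_multi4[OF multi4_K(6)] act4_multi4[OF multi4_K(7)]
 have msm: "multi4 (%p q a v. r \<odot>\<^bsub>V\<^esub> F p q a v)" if "multi4 F" "r <: K" for F r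
  by (rule multi4I; (rule module_lin_smult_fun[OF mV] multi4_lins(1-4)[OF that(1)] module_lin_id that(2) | assumption)+)
 have mpl: "multi4 (%p q a v. F p q a v \<oplus>\<^bsub>V\<^esub> G p q a v)" if "multi4 F" "multi4 G" for F G
  by (rule multi4I; (rule module_lin_plus[OF mV] multi4_lins(1-4)[OF that(1)] multi4_lins(1-4)[OF that(2)] module_lin_id | assumption)+)
 \<comment> \<open>The third leg of the associator acts on a v. Equivariance of the action splits it
   by the coproduct, and this is the first step of all three routes, from (p q)(a v) to p (q (a
   v)).\<close>
 have "cmp p q (am a v) = act4 ?G0 ?Y3 p q a v"
  unfolding cmp_def act4_evals(6)[OF multi4_K(5) cc phi_closed]
 proof (rule sum3_cong[OF mV phi_closed])
  fix x y z assume xyz: "x <: H" "y <: H" "z <: H"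
  show "pv (act P x p) (pv (act P y q) (act V z (am a v))) =
   sum2 Q V (D z) (%s u. pv (act P x p) (pv (act P y q) (am (act A s a) (act V u v))))"
   unfolding hbilinD(2)[OF am xyz(3) cc(3,4), symmetric]
   by (rule sum2_comp[where g = "%t. pv (act P x p) (pv (act P y q) t)", OF mV mV])
    (use xyz cc in "auto intro!: op_lins module_lin_id simp: c")
 qed (use cc in "simp add: c sum2_closed mV")
 also have "... = act4 (%p q a v. act4 ?G1 ?Y2 p q a v \<oplus>\<^bsub>V\<^esub> sg (n * i) \<odot>\<^bsub>V\<^esub> act4 ?G2 ?Y5 p q a v) ?Y3 p q a v"
  by (rule cong[OF Y(3) g0 mpl]) (simp_all add: msm m4 Y)
 also have "... = act4 (act4 ?G1 ?Y2) ?Y3 p q a v \<oplus>\<^bsub>V\<^esub> sg (n * i) \<odot>\<^bsub>V\<^esub> act4 (act4 ?G2 ?Y5) ?Y3 p q a v"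
  by (simp add: act4_add[OF _ _ cc Y(3)] act4_smult[OF _ _ cc Y(3)] msm m4 Y)
 also have "act4 (act4 ?G1 ?Y2) ?Y3 p q a v = act4 ?G1 (?Y2 *\<^sub>4 ?Y3) p q a v"
  by (rule act4_mult[symmetric, OF multi4_K(6) cc Y(2,3)])
 also have "... = act4 (%p q a v. sg (m * (n + i)) \<odot>\<^bsub>V\<^esub> act4 K1 ?Y1 p q a v) (?Y2 *\<^sub>4 ?Y3) p q a v"
  by (rule cong[OF _ g1 msm]) (simp_all add: m4 Y)
 also have "... = sg (m * (n + i)) \<odot>\<^bsub>V\<^esub> act4 K1 X1 p q a v"
  unfolding X1_def
  using Y kalgD(3)[OF kalgH4]
  by (simp add: act4_smult[OF _ _ cc] m4 act4_mult[OF multi4_K(1) cc, symmetric] monoid.m_assoc)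
 also have "act4 (act4 ?G2 ?Y5) ?Y3 p q a v = act4 ?G2 (?Y5 *\<^sub>4 ?Y3) p q a v"
  by (rule act4_mult[symmetric, OF multi4_K(7) cc Y(5,3)])
 also have "... = act4 (%p q a v. act4 K2 ?Y4 p q a v \<oplus>\<^bsub>V\<^esub> sg (m * i) \<odot>\<^bsub>V\<^esub> act4 K3 ?Y6 p q a v) (?Y5 *\<^sub>4 ?Y3) p q a v"
  by (rule cong[OF _ g2 mpl]) (simp_all add: msm m4 Y)
 also have "... = act4 K2 X2 p q a v \<oplus>\<^bsub>V\<^esub> sg (m * i) \<odot>\<^bsub>V\<^esub> act4 K3 X3 p q a v"
  unfolding X2_def X3_def
  using Y kalgD(3)[OF kalgH4]
  by (simp add: act4_add[OF _ _ cc] act4_smult[OF _ _ cc] msm m4 act4_mult[OF multi4_K(2) cc, symmetric]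
    act4_mult[OF multi4_K(3) cc, symmetric] monoid.m_assoc)
 finally have "cmp p q (am a v) = sg (m * (n + i)) \<odot>\<^bsub>V\<^esub> act4 K1 X1 p q a v \<oplus>\<^bsub>V\<^esub>
  sg (n * i) \<odot>\<^bsub>V\<^esub> (act4 K2 X2 p q a v \<oplus>\<^bsub>V\<^esub> sg (m * i) \<odot>\<^bsub>V\<^esub> act4 K3 X3 p q a v)" .
 moreover have "X2 <: HH4" "X3 <: HH4" unfolding X2_def X3_def using Y by simp_all
 then have "act4 K2 X2 p q a v <: V" "act4 K3 X3 p q a v <: V"
  using module_lin_closed[OF act4_lin[OF multi4_K(2) cc]] module_lin_closed[OF act4_lin[OF multi4_K(3) cc]] by auto
 ultimately show ?thesis
  by (simp add: V.smult_r_distr V.smult_assoc1[symmetric] sg_mult distrib_right add.commute)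
qed

end

section \<open>Exchanging the two operators\<close>

context leibniz begin

interpretation E: qhopf_alg Q HH4 by (rule qalg4)

lemma swap12_L2D:
 assumes h: "E.Hhom f" "E.Hhom g" "E.Hhom f'" "E.Hhom g'" and x: "x <: H"
  and eq: "!!x. x <: H ==> swap12 (f x) = f' x" "!!x. x <: H ==> swap12 (g x) = g' x"
 shows "swap12 (E.L2D f g x) = E.L2D f' g' x"
proof -
 have "E.L2D (%x. swap12 (f x)) (%x. swap12 (g x)) x = E.L2D f' g' x"
  unfolding E.L2D_def E.L2_def
  by (rule sum2_cong[OF E.modB]) (use h x eq monoid.m_closed[OF E.monB] in "simp_all add: E.hom_closed")
 then show ?thesis using E.alghom_L2D[OF swap12_hom h(1,2) x] by simp
qed

lemma swap12_L3:
 assumes h: "E.Hhom f" "E.Hhom g" "E.Hhom h" "E.Hhom f'" "E.Hhom g'" "E.Hhom h'" and t: "t <: HH3"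
  and eq: "!!x. x <: H ==> swap12 (f x) = f' x" "!!x. x <: H ==> swap12 (g x) = g' x"
   "!!x. x <: H ==> swap12 (h x) = h' x"
 shows "swap12 (E.L3 f g h t) = E.L3 f' g' h' t"
 using E.alghom_L3[OF swap12_hom h(1-3) t] E.L3_cong[OF eq h(4-6) t] by simp

lemma swap12_i:
 assumes "x <: H"
 shows "swap12 (i1 x) = i2 x" "swap12 (i2 x) = i1 x" "swap12 (i3 x) = i3 x" "swap12 (i4 x) = i4 x"
  "swap12 (E.L2D i1 i2 x) = E.L2D i2 i1 x" "swap12 (E.L2D i2 i3 x) = E.L2D i1 i3 x"
  "swap12 (E.L2D i2 i4 x) = E.L2D i1 i4 x" "swap12 (E.L2D i3 i4 x) = E.L2D i3 i4 x"
proof -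
 have i: "swap12 (i1 x) = i2 x" "swap12 (i2 x) = i1 x" "swap12 (i3 x) = i3 x" "swap12 (i4 x) = i4 x"
  if "x <: H" for x using that by (simp_all add: swap12_e4)
 show "swap12 (i1 x) = i2 x" "swap12 (i2 x) = i1 x" "swap12 (i3 x) = i3 x" "swap12 (i4 x) = i4 x"
  by (rule i[OF assms])+
 show "swap12 (E.L2D i1 i2 x) = E.L2D i2 i1 x" "swap12 (E.L2D i2 i3 x) = E.L2D i1 i3 x"
  "swap12 (E.L2D i2 i4 x) = E.L2D i1 i4 x" "swap12 (E.L2D i3 i4 x) = E.L2D i3 i4 x"
  using assms i_indep(1-4) i by (simp_all add: swap12_L2D)
qed

text \<open>The first two relations between words are \<open>one_past_two\<close> for the orders p,
  q and q, p, the second one solved for X1 by the inverse property of R. The last two come from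
  \<open>two_past_one\<close>; in the swapped version naturality carries R through W.\<close>

lemma swap_relations:
 defines "X1 \<equiv> E.L3 i1 (E.L2D i2 i3) i4 (braidX Q) *\<^sub>4 E.L3 i2 i3 i4 psi *\<^sub>4 E.L3 i1 i2 (E.L2D i3 i4) phi"
  and "X2 \<equiv> E.L3 i1 i3 (E.L2D i2 i4) psi *\<^sub>4 E.L3 i2 i3 i4 (braidX Q) *\<^sub>4 E.L3 i1 i2 (E.L2D i3 i4) phi"
  and "X3 \<equiv> E.L3 i1 i3 (E.L2D i2 i4) (braidX Q) *\<^sub>4 E.L3 i2 i3 i4 (braidX Q) *\<^sub>4 E.L3 i1 i2 (E.L2D i3 i4) phi"
  and "W \<equiv> E.L3 (E.L2D i1 i2) i3 i4 (braidX Q)"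
 shows "X1 <: HH4" "X2 <: HH4" "X3 <: HH4" "W <: HH4" "E.L2 i1 i2 R <: HH4"
  "swap12 X1 <: HH4" "swap12 X2 <: HH4" "swap12 X3 <: HH4"
  "swap12 X1 *\<^sub>4 E.L2 i1 i2 R = X2" "swap12 X2 *\<^sub>4 E.L2 i1 i2 R = X1"
  "X3 = E.L3 i1 i2 i4 phi *\<^sub>4 W"
  "swap12 X3 *\<^sub>4 E.L2 i1 i2 R = E.L3 i2 i1 i4 phi *\<^sub>4 (E.L2 i1 i2 R *\<^sub>4 W)"
proof -
 interpret B: monoid HH4 by (rule E.monB)
 note d = i_indep
 note Lh = E.L2D_hom[OF d(1,2,5)] E.L2D_hom[OF d(2,1,11)] E.L2D_hom[OF d(2,3,7)] E.L2D_hom[OF d(1,3,6)]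
  E.L2D_hom[OF d(2,4,9)] E.L2D_hom[OF d(1,4,8)] E.L2D_hom[OF d(3,4,10)]
 note sm = alghomD(3)[OF swap12_hom]
 note Lc = E.L3_closed E.L2_closed
 note cl = d(1-4) Lh bX phi_closed psi_closed R_closed Lc
 have s3: "swap12 (E.L3 i1 (E.L2D i2 i3) i4 (braidX Q)) = E.L3 i2 (E.L2D i1 i3) i4 (braidX Q)"
  "swap12 (E.L3 i2 i3 i4 (braidX Q)) = E.L3 i1 i3 i4 (braidX Q)" "swap12 (E.L3 i2 i3 i4 psi) = E.L3 i1 i3 i4 psi"
  "swap12 (E.L3 i1 i2 (E.L2D i3 i4) phi) = E.L3 i2 i1 (E.L2D i3 i4) phi"
  "swap12 (E.L3 i1 i3 (E.L2D i2 i4) psi) = E.L3 i2 i3 (E.L2D i1 i4) psi"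
  "swap12 (E.L3 i1 i2 i4 phi) = E.L3 i2 i1 i4 phi"
  "swap12 (E.L3 (E.L2D i1 i2) i3 i4 (braidX Q)) = E.L3 (E.L2D i2 i1) i3 i4 (braidX Q)"
  by (rule swap12_L3, simp_all only: swap12_i cl)+
 show c: "X1 <: HH4" "X2 <: HH4" "X3 <: HH4" "W <: HH4" and r: "E.L2 i1 i2 R <: HH4"
  unfolding X1_def X2_def X3_def W_def by (simp_all add: cl)
 show "swap12 X1 <: HH4" "swap12 X2 <: HH4" "swap12 X3 <: HH4"
  by (rule module_lin_closed[OF alghomD(1)[OF swap12_hom]], rule c)+
 have r': "E.L2 i2 i1 R <: HH4" by (simp add: cl)
 have sw1: "swap12 X1 = E.L3 i2 (E.L2D i1 i3) i4 (braidX Q) *\<^sub>4 E.L3 i1 i3 i4 psi *\<^sub>4 E.L3 i2 i1 (E.L2D i3 i4) phi"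
  unfolding X1_def by (simp add: sm s3 cl)
 have sw2: "swap12 X2 = E.L3 i2 i3 (E.L2D i1 i4) psi *\<^sub>4 E.L3 i1 i3 i4 (braidX Q) *\<^sub>4 E.L3 i2 i1 (E.L2D i3 i4) phi"
  unfolding X2_def by (simp add: sm s3 cl)
 show "swap12 X1 *\<^sub>4 E.L2 i1 i2 R = X2"
  unfolding sw1 X2_def E.one_past_two[OF indep_i] ..
 have "swap12 X2 = X1 *\<^sub>4 E.L2 i2 i1 R"
  unfolding sw2 X1_def E.one_past_two[OF indep_swap] ..
 then show "swap12 X2 *\<^sub>4 E.L2 i1 i2 R = X1"
  using E.R_inverse[OF d(2,1,11)] c r r' by (simp add: B.m_assoc)
 show X3: "X3 = E.L3 i1 i2 i4 phi *\<^sub>4 W"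
  unfolding X3_def W_def by (rule E.two_past_one[OF indep_i])
 have "swap12 X3 = E.L3 i2 i1 i4 phi *\<^sub>4 E.L3 (E.L2D i2 i1) i3 i4 (braidX Q)"
  unfolding X3 W_def by (simp add: sm s3 cl)
 then show "swap12 X3 *\<^sub>4 E.L2 i1 i2 R = E.L3 i2 i1 i4 phi *\<^sub>4 (E.L2 i1 i2 R *\<^sub>4 W)"
  unfolding W_def using E.R_natural1[OF indep_i bX] by (simp add: B.m_assoc cl)
qed

lemma multi4_smult:
 assumes F: "multi4 F" and r: "r <: K"
 shows "multi4 (%p q a v. r \<odot>\<^bsub>V\<^esub> F p q a v)"
 by (rule multi4I; (rule module_lin_smult_fun[OF mV] multi4_lins(1-4)[OF F] module_lin_id r | assumption)+)

lemma multi4_plus: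
 assumes F: "multi4 F" and G: "multi4 G"
 shows "multi4 (%p q a v. F p q a v \<oplus>\<^bsub>V\<^esub> G p q a v)"
 by (rule multi4I; (rule module_lin_plus[OF mV] multi4_lins(1-4)[OF F] multi4_lins(1-4)[OF G] module_lin_id | assumption)+)

lemma brk_leibniz:
 assumes S1: "leib m S1" and S2: "leib n S2"
  and zero: "!!p q a. p <: P ==> q <: P ==> a <: A ==> pa p (pa q a) = \<zero>\<^bsub>A\<^esub>"
  and p: "p \<in> S1" and q: "q \<in> S2" and a: "a \<in> grd A i" and v: "v <: V"
 shows "brk (m * n) p q (am a v) = sg ((m + n) * i) \<odot>\<^bsub>V\<^esub>
  sum3 Q V (braidX Q) (%x y z. sum2 Q V (D x) (%s u. am (act A y a) (brk (m * n) (act P s p) (act P u q) (act V z v))))"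
proof -
 interpret V: module K V by (rule mV)
 note pc = leibD(3)[OF S1] and qc = leibD(3)[OF S2] and ac = hm_objD(6)[OF oA]
 note cc = pc[OF p] qc[OF q] ac[OF a] v
 note sr = swap_relations
 let ?X1 = "E.L3 i1 (E.L2D i2 i3) i4 (braidX Q) *\<^sub>4 E.L3 i2 i3 i4 psi *\<^sub>4 E.L3 i1 i2 (E.L2D i3 i4) phi"
  and ?X2 = "E.L3 i1 i3 (E.L2D i2 i4) psi *\<^sub>4 E.L3 i2 i3 i4 (braidX Q) *\<^sub>4 E.L3 i1 i2 (E.L2D i3 i4) phi"
  and ?X3 = "E.L3 i1 i3 (E.L2D i2 i4) (braidX Q) *\<^sub>4 E.L3 i2 i3 i4 (braidX Q) *\<^sub>4 E.L3 i1 i2 (E.L2D i3 i4) phi"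
  and ?W = "E.L3 (E.L2D i1 i2) i3 i4 (braidX Q)" and ?R = "E.L2 i1 i2 R"
 let ?K4 = "%p q a v. am a (pv q (pv p v))"
 let ?rc = "%p q v. sum2 Q V R (%x y. cmp (act P y q) (act P x p) v)"
 let ?B = "%p q a v. am a (cmp p q v)" and ?C = "%p q a v. am a (?rc p q v)"
 note K = multi4_K(1-4)
 note c4 = multi4_lins(5)[OF act4_multi4]
 note cl = op_closed cmp_closed
 have rc_closed: "?rc p q v <: V" if "p <: P" "q <: P" "v <: V" for p q v
  by (intro sum2_closed mV R_closed cl that)
 have mC0: "multi4 (%p q a v. cmp q p (am a v))"
  by (rule multi4I; (rule cmp_lins op_lins module_lin_id | simp add: cl)+)
 have mB: "multi4 ?B"
  by (rule multi4I; (rule cmp_lins op_lins module_lin_id | simp add: cl)+)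
 have mC: "multi4 ?C"
  by (rule multi4I; (rule sum2_fun_lin[OF mV R_closed] cmp_lins op_lins module_lin_id | simp add: cl rc_closed)+)
 have one: "cmp p q (am a v) = sg (m * (n + i)) \<odot>\<^bsub>V\<^esub> act4 K1 ?X1 p q a v \<oplus>\<^bsub>V\<^esub>
  (sg (n * i) \<odot>\<^bsub>V\<^esub> act4 K2 ?X2 p q a v \<oplus>\<^bsub>V\<^esub> sg ((m + n) * i) \<odot>\<^bsub>V\<^esub> act4 K3 ?X3 p q a v)"
  by (rule cmp_leibniz[OF S1 S2 _ p q a v]) (simp add: zero pc qc)
 \<comment> \<open>The same formula with the roles of p and q exchanged. \<open>act4_swap\<close>
   brings the arguments back to the order p, q at the price of exchanging legs in the words.\<close>
 have two: "cmp q p (am a v) = sg (n * (m + i)) \<odot>\<^bsub>V\<^esub> act4 K2 (swap12 ?X1) p q a v \<oplus>\<^bsub>V\<^esub>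
  (sg (m * i) \<odot>\<^bsub>V\<^esub> act4 K1 (swap12 ?X2) p q a v \<oplus>\<^bsub>V\<^esub> sg ((n + m) * i) \<odot>\<^bsub>V\<^esub> act4 ?K4 (swap12 ?X3) p q a v)"
  if pq: "p \<in> S1" "q \<in> S2" "a \<in> grd A i" "v <: V" for p q a v
 proof -
  note cc = pc[OF pq(1)] qc[OF pq(2)] ac[OF pq(3)] pq(4)
  have "cmp q p (am a v) = sg (n * (m + i)) \<odot>\<^bsub>V\<^esub> act4 K1 ?X1 q p a v \<oplus>\<^bsub>V\<^esub>
   (sg (m * i) \<odot>\<^bsub>V\<^esub> act4 K2 ?X2 q p a v \<oplus>\<^bsub>V\<^esub> sg ((n + m) * i) \<odot>\<^bsub>V\<^esub> act4 K3 ?X3 q p a v)"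
   by (rule cmp_leibniz[OF S2 S1 _ pq(2,1,3,4)]) (simp add: zero pc qc)
  then show ?thesis
   by (simp only: act4_swap[OF K(1) cc sr(1)] act4_swap[OF K(2) cc sr(2)] act4_swap[OF K(3) cc sr(3)])
 qed
 note sA = multi4_smult[OF act4_multi4 sg_closed]
 note mA = sA[OF K(2) sr(6)] multi4_plus[OF sA[OF K(1) sr(7)] sA[OF K(4) sr(8)]]
 \<comment> \<open>In the braided half of the bracket R acts on p and q before everything else, so
   it multiplies the swapped words from the right, and \<open>swap_relations\<close> returns X2 and
   X1.\<close>
 have "?rc p q (am a v) = act4 (%p q a v. cmp q p (am a v)) ?R p q a v"
  by (rule act4_evals(8)[symmetric, OF mC0 cc phi_closed])
 also have "... = act4 (%p q a v. sg (n * (m + i)) \<odot>\<^bsub>V\<^esub> act4 K2 (swap12 ?X1) p q a v \<oplus>\<^bsub>V\<^esub>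
  (sg (m * i) \<odot>\<^bsub>V\<^esub> act4 K1 (swap12 ?X2) p q a v \<oplus>\<^bsub>V\<^esub> sg ((n + m) * i) \<odot>\<^bsub>V\<^esub> act4 ?K4 (swap12 ?X3) p q a v)) ?R p q a v"
  by (rule act4_cong[where i = i and ?S1.0 = S1 and ?S2.0 = S2, OF sr(5) _ _ two multi4_plus[OF mA]])
   (simp_all add: leibD(1,2)[OF S1] leibD(1,2)[OF S2] p q a v)
 also have "... = sg (n * (m + i)) \<odot>\<^bsub>V\<^esub> act4 K2 ?X2 p q a v \<oplus>\<^bsub>V\<^esub>
  (sg (m * i) \<odot>\<^bsub>V\<^esub> act4 K1 ?X1 p q a v \<oplus>\<^bsub>V\<^esub> sg ((n + m) * i) \<odot>\<^bsub>V\<^esub> act4 ?K4 (swap12 ?X3 *\<^sub>4 ?R) p q a v)"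
  unfolding act4_add[OF mA cc sr(5)] act4_add[OF sA[OF K(1) sr(7)] sA[OF K(4) sr(8)] cc sr(5)]
   act4_smult[OF act4_multi4[OF K(2) sr(6)] sg_closed cc sr(5)] act4_smult[OF act4_multi4[OF K(1) sr(7)] sg_closed cc sr(5)]
   act4_smult[OF act4_multi4[OF K(4) sr(8)] sg_closed cc sr(5)]
   act4_mult[symmetric, OF K(2) cc sr(6,5)] act4_mult[symmetric, OF K(1) cc sr(7,5)] act4_mult[symmetric, OF K(4) cc sr(8,5)]
   sr(9,10) ..
 \<comment> \<open>This word splits into an associator for q, p, v, then R, then W. The first two
   turn the plain nested action into the braided composite, so W is all that remains, as it is for
   the unbraided half.\<close>
 also have "act4 ?K4 (swap12 ?X3 *\<^sub>4 ?R) p q a v = act4 ?C ?W p q a v"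
 proof -
  let ?U = "E.L3 i2 i1 i4 phi"
  have U: "?U <: HH4" by (rule L3_closures(7)[OF phi_closed])
  have e1: "act4 (act4 ?K4 ?U) ?R p q a v = ?C p q a v" if pq: "p <: P" "q <: P" "a <: A" "v <: V" for p q a v
   unfolding act4_evals(8)[OF act4_multi4[OF K(4) U] pq phi_closed]
   apply (subst sum2_comp[where g = "am a", OF mV mV bilin_lin2[OF hbilinD(1)[OF am]] R_closed])
    apply (use pq in "simp_all add: cl")
   apply (rule sum2_cong[OF mV R_closed])
    apply (use pq in "simp_all add: cl")
   apply (subst act4_evals(3)[OF K(4) _ _ _ _ phi_closed])
     apply (simp_all add: cl)
   unfolding cmp_def
   apply (subst sum3_comp[where g = "am a", OF mV mV bilin_lin2[OF hbilinD(1)[OF am]] phi_closed])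
    apply (simp_all add: cl)
   done
  have "act4 ?K4 (swap12 ?X3 *\<^sub>4 ?R) p q a v = act4 (act4 (act4 ?K4 ?U) ?R) ?W p q a v"
   unfolding sr(12) using act4_mult[OF K(4) cc U monoid.m_closed[OF E.monB sr(5,4)]]
    act4_mult[OF act4_multi4[OF K(4) U] cc sr(5,4)] by simp
  also have "... = act4 ?C ?W p q a v"
   by (rule act4_cong[where i = i and ?S1.0 = S1 and ?S2.0 = S2, OF sr(4) _ _ e1 mC])
    (simp_all add: leibD(1,2)[OF S1] leibD(1,2)[OF S2] p q a v pc qc ac)
  finally show ?thesis .
 qed
 finally have two': "?rc p q (am a v) = sg (n * (m + i)) \<odot>\<^bsub>V\<^esub> act4 K2 ?X2 p q a v \<oplus>\<^bsub>V\<^esub>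
  (sg (m * i) \<odot>\<^bsub>V\<^esub> act4 K1 ?X1 p q a v \<oplus>\<^bsub>V\<^esub> sg ((n + m) * i) \<odot>\<^bsub>V\<^esub> act4 ?C ?W p q a v)" .
 have K3W: "act4 K3 ?X3 p q a v = act4 ?B ?W p q a v"
 proof -
  let ?U = "E.L3 i1 i2 i4 phi"
  have U: "?U <: HH4" by (rule L3_closures(6)[OF phi_closed])
  have e1: "act4 K3 ?U p q a v = ?B p q a v" if pq: "p <: P" "q <: P" "a <: A" "v <: V" for p q a v
   unfolding act4_evals(2)[OF K(3) pq phi_closed] cmp_def
   apply (subst sum3_comp[where g = "am a", OF mV mV bilin_lin2[OF hbilinD(1)[OF am]] phi_closed])
    apply (use pq in "simp_all add: cl")
   done
  have "act4 K3 ?X3 p q a v = act4 (act4 K3 ?U) ?W p q a v"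
   unfolding sr(11) by (rule act4_mult[OF K(3) cc U sr(4)])
  also have "... = act4 ?B ?W p q a v"
   by (rule act4_cong[where i = i and ?S1.0 = S1 and ?S2.0 = S2, OF sr(4) _ _ e1 mB])
    (simp_all add: leibD(1,2)[OF S1] leibD(1,2)[OF S2] p q a v pc qc ac)
  finally show ?thesis .
 qed
 have in1: "act4 K1 ?X1 p q a v <: V" "act4 K2 ?X2 p q a v <: V" "act4 ?B ?W p q a v <: V" "act4 ?C ?W p q a v <: V"
  using c4[OF K(1) sr(1) cc] c4[OF K(2) sr(2) cc] c4[OF mB sr(4) cc] c4[OF mC sr(4) cc] by auto
 let ?s = "sg (m * n)"
 have sg2: "sg j \<odot>\<^bsub>V\<^esub> (sg k \<odot>\<^bsub>V\<^esub> t) = sg (j + k) \<odot>\<^bsub>V\<^esub> t" if "t <: V" for j k t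
  using that by (simp add: V.smult_assoc1[symmetric] sg_mult)
 \<comment> \<open>The sign of the bracket contributes m n, and m n occurs twice in the first
   exponent. The mixed terms of both halves thus carry equal signs and cancel in the
   difference.\<close>
 have sgs: "sg (m * n + n * (m + i)) = sg (n * i)" "sg (m * n + m * i) = sg (m * (n + i))" "sg ((n + m) * i) = sg ((m + n) * i)"
  by (rule sg_cong, simp add: algebra_simps)+
 have "brk (m * n) p q (am a v) = sg ((m + n) * i) \<odot>\<^bsub>V\<^esub> act4 ?B ?W p q a v \<ominus>\<^bsub>V\<^esub> ?s \<odot>\<^bsub>V\<^esub> (sg ((m + n) * i) \<odot>\<^bsub>V\<^esub> act4 ?C ?W p q a v)"
 proof -
  have "?s \<odot>\<^bsub>V\<^esub> ?rc p q (am a v) = sg (n * i) \<odot>\<^bsub>V\<^esub> act4 K2 ?X2 p q a v \<oplus>\<^bsub>V\<^esub>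
   (sg (m * (n + i)) \<odot>\<^bsub>V\<^esub> act4 K1 ?X1 p q a v \<oplus>\<^bsub>V\<^esub> ?s \<odot>\<^bsub>V\<^esub> (sg ((m + n) * i) \<odot>\<^bsub>V\<^esub> act4 ?C ?W p q a v))"
   unfolding two' using in1 by (simp add: V.smult_r_distr sg2 sgs)
  then have e: "brk (m * n) p q (am a v) = (sg (m * (n + i)) \<odot>\<^bsub>V\<^esub> act4 K1 ?X1 p q a v \<oplus>\<^bsub>V\<^esub>
    (sg (n * i) \<odot>\<^bsub>V\<^esub> act4 K2 ?X2 p q a v \<oplus>\<^bsub>V\<^esub> sg ((m + n) * i) \<odot>\<^bsub>V\<^esub> act4 ?B ?W p q a v)) \<ominus>\<^bsub>V\<^esub>
   (sg (n * i) \<odot>\<^bsub>V\<^esub> act4 K2 ?X2 p q a v \<oplus>\<^bsub>V\<^esub>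
    (sg (m * (n + i)) \<odot>\<^bsub>V\<^esub> act4 K1 ?X1 p q a v \<oplus>\<^bsub>V\<^esub> ?s \<odot>\<^bsub>V\<^esub> (sg ((m + n) * i) \<odot>\<^bsub>V\<^esub> act4 ?C ?W p q a v)))"
   unfolding brk_def one K3W by simp
  have cancel: "(t1 \<oplus>\<^bsub>V\<^esub> (t2 \<oplus>\<^bsub>V\<^esub> t3)) \<ominus>\<^bsub>V\<^esub> (t2 \<oplus>\<^bsub>V\<^esub> (t1 \<oplus>\<^bsub>V\<^esub> t4)) = t3 \<ominus>\<^bsub>V\<^esub> t4"
   if "t1 <: V" "t2 <: V" "t3 <: V" "t4 <: V" for t1 t2 t3 t4
  proof -
   have "(t1 \<oplus>\<^bsub>V\<^esub> (t2 \<oplus>\<^bsub>V\<^esub> t3)) \<ominus>\<^bsub>V\<^esub> (t2 \<oplus>\<^bsub>V\<^esub> (t1 \<oplus>\<^bsub>V\<^esub> t4)) =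
     (t1 \<oplus>\<^bsub>V\<^esub> \<ominus>\<^bsub>V\<^esub> t1) \<oplus>\<^bsub>V\<^esub> ((t2 \<oplus>\<^bsub>V\<^esub> \<ominus>\<^bsub>V\<^esub> t2) \<oplus>\<^bsub>V\<^esub> (t3 \<ominus>\<^bsub>V\<^esub> t4))"
    using that by (simp add: V.minus_eq V.minus_add V.a_ac)
   then show ?thesis using that by (simp add: V.r_neg)
  qed
  show ?thesis unfolding e by (rule cancel) (use in1 in simp_all)
 qed
 also have "... = sg ((m + n) * i) \<odot>\<^bsub>V\<^esub> (act4 ?B ?W p q a v \<oplus>\<^bsub>V\<^esub> (\<ominus>\<^bsub>K\<^esub> ?s) \<odot>\<^bsub>V\<^esub> act4 ?C ?W p q a v)"
  using in1 by (simp add: V.smult_r_distr V.smult_l_minus V.smult_r_minus sg2 add.commute a_minus_def)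
 also have "act4 ?B ?W p q a v \<oplus>\<^bsub>V\<^esub> (\<ominus>\<^bsub>K\<^esub> ?s) \<odot>\<^bsub>V\<^esub> act4 ?C ?W p q a v =
   act4 (%p q a v. ?B p q a v \<oplus>\<^bsub>V\<^esub> (\<ominus>\<^bsub>K\<^esub> ?s) \<odot>\<^bsub>V\<^esub> ?C p q a v) ?W p q a v"
  by (simp add: act4_add[OF mB multi4_smult[OF mC] cc sr(4)] act4_smult[OF mC _ cc sr(4)])
 also have "... = sum3 Q V (braidX Q) (%x y z. sum2 Q V (D x) (%s u. am (act A y a) (brk (m * n) (act P s p) (act P u q) (act V z v))))"
  (is "_ = ?S")
 proof -
  have e: "?B p q a v \<oplus>\<^bsub>V\<^esub> (\<ominus>\<^bsub>K\<^esub> ?s) \<odot>\<^bsub>V\<^esub> ?C p q a v = am a (brk (m * n) p q v)"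
   if pq: "p <: P" "q <: P" "a <: A" "v <: V" for p q a v
  proof -
   have l: "module_lin K V V (am a)" by (rule bilin_lin2[OF hbilinD(1)[OF am] pq(3)])
   note c = rc_closed[OF pq(1,2,4)] cmp_closed[OF pq(1,2,4)]
   have "am a (brk (m * n) p q v) = ?B p q a v \<ominus>\<^bsub>V\<^esub> ?s \<odot>\<^bsub>V\<^esub> ?C p q a v"
    unfolding brk_def using c by (simp add: module_lin_minus[OF mV mV l] module_lin_smult[OF l])
   then show ?thesis using c pq by (simp add: V.smult_l_minus V.minus_eq cl)
  qed
  have mE: "multi4 (%p q a v. ?B p q a v \<oplus>\<^bsub>V\<^esub> (\<ominus>\<^bsub>K\<^esub> ?s) \<odot>\<^bsub>V\<^esub> ?C p q a v)"
   by (simp add: multi4_plus[OF mB multi4_smult[OF mC]])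
  have bc: "brk (m * n) p q v <: V" if "p <: P" "q <: P" "v <: V" for p q v
   unfolding brk_def using rc_closed[OF that] cmp_closed[OF that] by simp
  show ?thesis
   unfolding act4_evals(7)[OF mE cc bX]
  proof (rule sum3_cong[OF mV bX])
   fix x y z assume xyz: "x <: H" "y <: H" "z <: H"
   show "sum2 Q V (D x) (%s u. am (act A y a) (brk (m * n) (act P s p) (act P u q) (act V z v))) <: V"
    by (intro sum2_closed mV D_closed bc cl cc xyz)
   show "sum2 Q V (D x) (%s u. ?B (act P s p) (act P u q) (act A y a) (act V z v) \<oplus>\<^bsub>V\<^esub>
     (\<ominus>\<^bsub>K\<^esub> ?s) \<odot>\<^bsub>V\<^esub> ?C (act P s p) (act P u q) (act A y a) (act V z v)) =
    sum2 Q V (D x) (%s u. am (act A y a) (brk (m * n) (act P s p) (act P u q) (act V z v)))"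
    by (rule sum2_cong[OF mV D_closed[OF xyz(1)]]) (use xyz cc in "simp_all add: e bc cl")
  qed
 qed
 finally show ?thesis .
qed

end

section \<open>The Leibniz rule and the evaluated commutator\<close>

context leibniz begin

interpretation E: qhopf_alg Q HH4 by (rule qalg4)

definition multi3 :: "('p => 'a => 'v => 'v) => bool" where
 "multi3 F \<longleftrightarrow>
  (\<forall>a\<in>carrier A. \<forall>v\<in>carrier V. module_lin K P V (%p. F p a v)) \<and>
  (\<forall>p\<in>carrier P. \<forall>v\<in>carrier V. module_lin K A V (%a. F p a v)) \<and>
  (\<forall>p\<in>carrier P. \<forall>a\<in>carrier A. module_lin K V V (F p a))"

lemma multi3I:
 assumes "!!a v. a <: A ==> v <: V ==> module_lin K P V (%p. F p a v)"
  "!!p v. p <: P ==> v <: V ==> module_lin K A V (%a. F p a v)"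
  "!!p a. p <: P ==> a <: A ==> module_lin K V V (%v. F p a v)"
 shows "multi3 F"
 using assms by (simp add: multi3_def)

lemma multi3_lins:
 assumes "multi3 F"
 shows "a <: A ==> v <: V ==> module_lin K L P f ==> module_lin K L V (%u. F (f u) a v)"
  "p <: P ==> v <: V ==> module_lin K L A g ==> module_lin K L V (%u. F p (g u) v)"
  "p <: P ==> a <: A ==> module_lin K L V k ==> module_lin K L V (%u. F p a (k u))"
  "p <: P ==> a <: A ==> v <: V ==> F p a v <: V"
proof -
 note M = assms[unfolded multi3_def]
 note M1 = M[THEN conjunct1, rule_format] and M2 = M[THEN conjunct2, THEN conjunct1, rule_format]
  and M3 = M[THEN conjunct2, THEN conjunct2, rule_format]
 show "a <: A ==> v <: V ==> module_lin K L P f ==> module_lin K L V (%u. F (f u) a v)"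
  by (rule module_lin_comp[OF M1])
 show "p <: P ==> v <: V ==> module_lin K L A g ==> module_lin K L V (%u. F p (g u) v)"
  by (rule module_lin_comp[OF M2])
 show "p <: P ==> a <: A ==> module_lin K L V k ==> module_lin K L V (%u. F p a (k u))"
  by (rule module_lin_comp[OF M3])
 show "p <: P ==> a <: A ==> v <: V ==> F p a v <: V"
  by (rule module_lin_closed[OF M3])
qed

definition act3 :: "('p => 'a => 'v => 'v) => ('k, ('k, 'h, 'h) tensor, 'h) tensor => 'p => 'a => 'v => 'v" where
 "act3 F t p a v = sum3 Q V t (%x y z. F (act P x p) (act A y a) (act V z v))"

lemma act3_trilin:
 assumes F: "multi3 F" and "p <: P" "a <: A" "v <: V"
 shows "trilin V (%x y z. F (act P x p) (act A y a) (act V z v))"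
 by (rule lins multi3_lins(1-3)[OF F] op_lins | simp add: assms op_closed)+

lemmas act3_lin = sum3_lin[OF mV act3_trilin, folded act3_def]
lemmas act3_e3 = sum3_e3[OF mV act3_trilin, folded act3_def]

lemma act3_multi3:
 assumes F: "multi3 F" and t: "t <: HH3"
 shows "multi3 (act3 F t)"
 unfolding act3_def
 by (rule multi3I; (rule sum3_fun_lin[OF mV t] multi3_lins(1-3)[OF F] op_lins module_lin_id | simp add: op_closed)+)

lemma act3_mult:
 assumes F: "multi3 F" and c: "p <: P" "a <: A" "v <: V"
  and s: "s <: HH3" and t: "t <: HH3"
 shows "act3 F (s *\<^sub>3 t) p a v = act3 (act3 F s) t p a v"
proof -
 note m = hmodD(3)[OF hP] hmodD(3)[OF hA] hmodD(3)[OF hV] multi3_lins(4)[OF F]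
 have "act3 F (s *\<^sub>3 t) p a v = sum3 Q V s (%x y z. sum3 Q V t (%x' y' z'.
   F (act P (x ** x') p) (act A (y ** y') a) (act V (z ** z') v)))"
  unfolding act3_def by (rule sum3_mult[OF mV act3_trilin[OF F c] s t])
 also have "... = sum3 Q V t (%x' y' z'. sum3 Q V s (%x y z.
   F (act P (x ** x') p) (act A (y ** y') a) (act V (z ** z') v)))"
  by (rule sum3_swap[OF mV s t]) (simp add: m c op_closed)
 also have "... = act3 (act3 F s) t p a v"
  unfolding act3_def by (intro sum3_cong[OF mV] s t) (simp_all add: m c op_closed sum3_closed mV s)
 finally show ?thesis .
qed

lemma act3_expand:
 assumes F: "multi3 F" and G: "multi3 G" and r: "r <: K" and t: "t <: HH3"
  and c: "p <: P" "a <: A" "v <: V"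
 shows "multi3 (%p a v. F p a v \<oplus>\<^bsub>V\<^esub> r \<odot>\<^bsub>V\<^esub> G p a v)"
  and "act3 (%p a v. F p a v \<oplus>\<^bsub>V\<^esub> r \<odot>\<^bsub>V\<^esub> G p a v) t p a v = act3 F t p a v \<oplus>\<^bsub>V\<^esub> r \<odot>\<^bsub>V\<^esub> act3 G t p a v"
proof -
 show FG: "multi3 (%p a v. F p a v \<oplus>\<^bsub>V\<^esub> r \<odot>\<^bsub>V\<^esub> G p a v)"
  by (rule multi3I; (rule module_lin_plus[OF mV] module_lin_smult_fun[OF mV] multi3_lins(1-3)[OF F]
     multi3_lins(1-3)[OF G] module_lin_id r | assumption)+)
 show "act3 (%p a v. F p a v \<oplus>\<^bsub>V\<^esub> r \<odot>\<^bsub>V\<^esub> G p a v) t p a v = act3 F t p a v \<oplus>\<^bsub>V\<^esub> r \<odot>\<^bsub>V\<^esub> act3 G t p a v"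
  by (rule H3_ext[where f = "%t. act3 (%p a v. F p a v \<oplus>\<^bsub>V\<^esub> r \<odot>\<^bsub>V\<^esub> G p a v) t p a v" and
     g = "%t. act3 F t p a v \<oplus>\<^bsub>V\<^esub> r \<odot>\<^bsub>V\<^esub> act3 G t p a v", OF mV act3_lin[OF FG c]
     module_lin_plus[OF mV act3_lin[OF F c] module_lin_smult_fun[OF mV act3_lin[OF G c] r]] _ t])
   (simp add: act3_e3[OF FG c] act3_e3[OF F c] act3_e3[OF G c])
qed

text \<open>
 The right-hand condition is the Leibniz rule for the commutator with \<open>a\<close>; multiplying by
 \<open>\<phi>\<inverse>\<close> (respectively \<open>\<phi>\<close>) exchanges it with the rule in right-nested brackets.
\<close>

lemma leib_iff_commutator:
 assumes U: "U \<subseteq> carrier P" and stable: "!!h p. h <: H ==> p \<in> U ==> act P h p \<in> U"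
  and deg: "!!p a j. p \<in> U ==> a \<in> grd A j ==> pa p a \<in> grd A (j + k)"
 shows "leib k U \<longleftrightarrow> (\<forall>j. \<forall>p\<in>U. \<forall>a\<in>grd A j. \<forall>v\<in>carrier V.
  sum3 Q V phi (%x y z. pv (act P x p) (am (act A y a) (act V z v))) = am (pa p a) v \<oplus>\<^bsub>V\<^esub>
   sg (k * j) \<odot>\<^bsub>V\<^esub> sum2 Q V R (%s u. sum3 Q V phi (%x y z.
    am (act A x (act A u a)) (pv (act P y (act P s p)) (act V z v)))))"
proof -
 interpret V: module K V by (rule mV)
 interpret B: monoid HH3 by (rule kalgD(3)[OF kalgH3])
 let ?F = "sum3 Q HH3 phi (%x y z. e3 Q y x z)" and ?R = "sum2 Q HH3 R (%x y. e3 Q x y \<one>\<^bsub>H\<^esub>)"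
 let ?G = "%p a v. pv p (am a v)" and ?C = "%p a v. am (pa p a) v" and ?N = "%p a v. am a (pv p v)"
 let ?W = "?F *\<^sub>3 ?R"
 have mm: "multi3 ?G" "multi3 ?C" "multi3 ?N"
  by (rule multi3I; (rule op_lins module_lin_id | simp add: op_closed)+)+
 have Tc: "?F <: HH3" "?R <: HH3" by (simp_all add: E.H3_closures)
 have Wc: "?W <: HH3" using Tc by simp
 have X: "braidX Q = ?W *\<^sub>3 psi" by (simp add: braidX_def)
 have XW: "braidX Q *\<^sub>3 phi = ?W" unfolding X using Wc by (simp add: B.m_assoc psi_phi)
 have unit: "act3 F \<one>\<^bsub>HH3\<^esub> p a v = F p a v"
  if F: "multi3 F" and c: "p <: P" "a <: A" "v <: V" for F p a v
  unfolding one_H3 using act3_e3[OF F c] act4_one[OF c(1,1,2,3)] monoid.one_closed[OF H_ring] by simp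
 \<comment> \<open>Without its last factor \<open>psi\<close> the word of \<open>braidX\<close> is
   exactly the one produced by the braided half of a commutator.\<close>
 have evW: "act3 ?N ?W p a v = sum2 Q V R (%s u. sum3 Q V phi (%x y z.
    am (act A x (act A u a)) (pv (act P y (act P s p)) (act V z v))))"
  if c: "p <: P" "a <: A" "v <: V" for p a v
 proof -
  note m' = act3_multi3[OF mm(3) Tc(1)]
  have 1: "act3 ?N ?F p a v = sum3 Q V phi (%x y z. am (act A x a) (pv (act P y p) (act V z v)))"
   if cc: "p <: P" "a <: A" "v <: V" for p a v
   by (subst sum3_comp[where g = "%t. act3 ?N t p a v", OF modH3 mV act3_lin[OF mm(3) cc] phi_closed], simp,
     rule sum3_cong[OF mV phi_closed])
    (simp_all add: act3_e3[OF mm(3) cc] cc op_closed)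
  have "act3 ?N ?W p a v = act3 (act3 ?N ?F) ?R p a v"
   by (rule act3_mult[OF mm(3) c Tc])
  also have "... = sum2 Q V R (%s u. act3 ?N ?F (act P s p) (act A u a) v)"
   by (subst sum2_comp[where g = "%t. act3 (act3 ?N ?F) t p a v", OF modH3 mV act3_lin[OF m' c] R_closed], simp,
     rule sum2_cong[OF mV R_closed])
    (simp_all add: act3_e3[OF m' c] act4_one[OF c(1,1,2,3)] c op_closed multi3_lins(4)[OF m'])
  also have "... = sum2 Q V R (%s u. sum3 Q V phi (%x y z.
    am (act A x (act A u a)) (pv (act P y (act P s p)) (act V z v))))"
   by (rule sum2_cong[OF mV R_closed]) (simp_all add: 1 c op_closed sum3_closed mV)
  finally show ?thesis .
 qed
 have ac: "a <: A" if "a \<in> grd A j" for a j by (rule hm_objD(6)[OF oA that])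
 have cong: "act3 F t p a v = act3 G t p a v"
  if t: "t <: HH3" and p: "p \<in> U" and a: "a \<in> grd A j" and v: "v <: V" and G: "multi3 G"
   and eq: "!!p a v. p \<in> U ==> a \<in> grd A j ==> v <: V ==> F p a v = G p a v" for F G t p a v j
  unfolding act3_def
  by (rule sum3_cong[OF mV t])
   (simp_all add: eq stable p hm_objD(4)[OF oA _ a] v op_closed multi3_lins(4)[OF G] subsetD[OF U] ac[OF a])
 note tr = act3_multi3[OF mm(1)] act3_multi3[OF mm(2)] act3_multi3[OF mm(3)]
 have pointwise: "(\<forall>p\<in>U. \<forall>a\<in>grd A j. \<forall>v\<in>carrier V.
   ?G p a v = act3 ?C psi p a v \<oplus>\<^bsub>V\<^esub> sg (k * j) \<odot>\<^bsub>V\<^esub> act3 ?N (braidX Q) p a v) \<longleftrightarrow>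
  (\<forall>p\<in>U. \<forall>a\<in>grd A j. \<forall>v\<in>carrier V.
   act3 ?G phi p a v = ?C p a v \<oplus>\<^bsub>V\<^esub> sg (k * j) \<odot>\<^bsub>V\<^esub> act3 ?N ?W p a v)" (is "?L \<longleftrightarrow> ?R'") for j
 proof (intro iffI ballI)
  fix p a v assume L: ?L and p: "p \<in> U" and a: "a \<in> grd A j" and v: "v <: V"
  note c = subsetD[OF U p] ac[OF a] v
  note ex = act3_expand[OF tr(2)[OF psi_closed] tr(3)[OF bX] sg_closed phi_closed c]
  have "act3 ?G phi p a v = act3 (%p a v. act3 ?C psi p a v \<oplus>\<^bsub>V\<^esub> sg (k * j) \<odot>\<^bsub>V\<^esub> act3 ?N (braidX Q) p a v) phi p a v"
   by (rule cong[OF phi_closed p a v ex(1) L[rule_format]])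
  also have "... = ?C p a v \<oplus>\<^bsub>V\<^esub> sg (k * j) \<odot>\<^bsub>V\<^esub> act3 ?N ?W p a v"
   unfolding ex(2) act3_mult[OF mm(2) c psi_closed phi_closed, symmetric] act3_mult[OF mm(3) c bX phi_closed, symmetric]
    psi_phi XW unit[OF mm(2) c] ..
  finally show "act3 ?G phi p a v = ?C p a v \<oplus>\<^bsub>V\<^esub> sg (k * j) \<odot>\<^bsub>V\<^esub> act3 ?N ?W p a v" .
 next
  fix p a v assume L: ?R' and p: "p \<in> U" and a: "a \<in> grd A j" and v: "v <: V"
  note c = subsetD[OF U p] ac[OF a] v
  note ex = act3_expand[OF mm(2) tr(3)[OF Wc] sg_closed psi_closed c]
  have "?G p a v = act3 (act3 ?G phi) psi p a v"
   unfolding act3_mult[OF mm(1) c phi_closed psi_closed, symmetric] phi_psi unit[OF mm(1) c] ..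
  also have "... = act3 (%p a v. ?C p a v \<oplus>\<^bsub>V\<^esub> sg (k * j) \<odot>\<^bsub>V\<^esub> act3 ?N ?W p a v) psi p a v"
   by (rule cong[OF psi_closed p a v ex(1) L[rule_format]])
  also have "... = act3 ?C psi p a v \<oplus>\<^bsub>V\<^esub> sg (k * j) \<odot>\<^bsub>V\<^esub> act3 ?N (braidX Q) p a v"
   unfolding ex(2) act3_mult[OF mm(3) c Wc psi_closed, symmetric] X ..
  finally show "?G p a v = act3 ?C psi p a v \<oplus>\<^bsub>V\<^esub> sg (k * j) \<odot>\<^bsub>V\<^esub> act3 ?N (braidX Q) p a v" .
 qed
 have "leib k U \<longleftrightarrow> (\<forall>j. \<forall>p\<in>U. \<forall>a\<in>grd A j. \<forall>v\<in>carrier V.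
   ?G p a v = act3 ?C psi p a v \<oplus>\<^bsub>V\<^esub> sg (k * j) \<odot>\<^bsub>V\<^esub> act3 ?N (braidX Q) p a v)"
  unfolding leib_def act3_def using U stable deg by simp
 also have "... \<longleftrightarrow> (\<forall>j. \<forall>p\<in>U. \<forall>a\<in>grd A j. \<forall>v\<in>carrier V.
   act3 ?G phi p a v = ?C p a v \<oplus>\<^bsub>V\<^esub> sg (k * j) \<odot>\<^bsub>V\<^esub> act3 ?N ?W p a v)"
  by (intro all_cong1 pointwise)
 finally show ?thesis
  by (simp add: act3_def[of ?G] evW subsetD[OF U] ac cong: ball_cong)
qed

end

section \<open>Products, kernels and connections\<close>

lemma submodule_finsum:
 assumes "module K M" "submodule U K M" "!!i. i \<in> I ==> f i \<in> U"
 shows "(\<Oplus>\<^bsub>M\<^esub>i\<in>I. f i) \<in> U"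
proof -
 interpret M: module K M by fact
 note U = submodule.axioms(1)[OF assms(2)]
 have sub: "U \<subseteq> carrier M" and zero: "\<zero>\<^bsub>M\<^esub> \<in> U"
  using subgroup.subset[OF U] subgroup.one_closed[OF U] by simp_all
 have add: "x \<oplus>\<^bsub>M\<^esub> y \<in> U" if "x \<in> U" "y \<in> U" for x y
  using subgroup.m_closed[OF U that] by simp
 show ?thesis
 proof (cases "finite I")
  case True
  then show ?thesis
   using assms(3)
  proof (induction I)
   case (insert i I)
   then have "(\<Oplus>\<^bsub>M\<^esub>j\<in>insert i I. f j) = f i \<oplus>\<^bsub>M\<^esub> (\<Oplus>\<^bsub>M\<^esub>j\<in>I. f j)"
    using sub by (intro M.finsum_insert) auto
   then show ?case using insert add by simp
  qed (simp add: zero)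
 qed (simp add: zero M.finsum_infinite)
qed

lemma gprod_simps:
 "carrier (gprod V W) = carrier V \<times> carrier W" "\<zero>\<^bsub>gprod V W\<^esub> = (\<zero>\<^bsub>V\<^esub>, \<zero>\<^bsub>W\<^esub>)"
 "p \<oplus>\<^bsub>gprod V W\<^esub> q = (fst p \<oplus>\<^bsub>V\<^esub> fst q, snd p \<oplus>\<^bsub>W\<^esub> snd q)"
 "r \<odot>\<^bsub>gprod V W\<^esub> p = (r \<odot>\<^bsub>V\<^esub> fst p, r \<odot>\<^bsub>W\<^esub> snd p)"
 "act (gprod V W) h p = (act V h (fst p), act W h (snd p))" "grd (gprod V W) n = grd V n \<times> grd W n"
 by (simp_all add: gprod_def)

lemma module_gprod:
 assumes "module K V" "module K W"
 shows "module K (gprod V W)"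
proof -
 interpret V: module K V by fact
 interpret W: module K W by fact
 have "\<exists>q\<in>carrier (gprod V W). q \<oplus>\<^bsub>gprod V W\<^esub> p = \<zero>\<^bsub>gprod V W\<^esub>" if "p <: (gprod V W)" for p
  using that by (intro bexI[of _ "(\<ominus>\<^bsub>V\<^esub> fst p, \<ominus>\<^bsub>W\<^esub> snd p)"]) (auto simp: gprod_simps V.l_neg W.l_neg)
 then show ?thesis
  by (intro moduleI abelian_groupI)
   (auto simp: gprod_simps V.R.is_cring V.smult_l_distr V.smult_r_distr V.smult_assoc1 V.a_ac
    W.smult_l_distr W.smult_r_distr W.smult_assoc1 W.a_ac)
qed

lemma gprod_lins:
 "module_lin K (gprod V W) V fst" "module_lin K (gprod V W) W snd"
 "module_lin K L V f ==> module_lin K L W g ==> module_lin K L (gprod V W) (%u. (f u, g u))"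
 by (auto simp: module_lin_def gprod_simps)

context qhopf
begin

lemma hmod_gprod:
 assumes V: "hmod V" and W: "hmod W"
 shows "hmod (gprod V W)"
proof -
 have "bilin K H (gprod V W) (gprod V W) (act (gprod V W))"
  unfolding gprod_simps
  by (intro bilinI gprod_lins(3) act_lins[OF V] act_lins[OF W] gprod_lins(1,2) module_lin_id)
   (auto simp: gprod_simps)
 then show ?thesis
  unfolding hmod_def using module_gprod[OF hmodD(1)[OF V] hmodD(1)[OF W]]
  by (auto simp: gprod_simps hmodD(3,4)[OF V] hmodD(3,4)[OF W])
qed

lemma gprod_hlin: "hlin (gprod V W) V fst" "hlin (gprod V W) W snd"
 unfolding hlin_def using gprod_lins(1,2) by (auto simp: gprod_simps)

lemma gunit_simps:
 "carrier (gunit Q n) = carrier K" "\<zero>\<^bsub>gunit Q n\<^esub> = \<zero>\<^bsub>K\<^esub>" "c \<oplus>\<^bsub>gunit Q n\<^esub> c' = c \<oplus>\<^bsub>K\<^esub> c'"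
 "c \<odot>\<^bsub>gunit Q n\<^esub> c' = c \<otimes>\<^bsub>K\<^esub> c'" "act (gunit Q n) h c = ep h \<otimes>\<^bsub>K\<^esub> c"
 "grd (gunit Q n) m = (if m = n then carrier K else {\<zero>\<^bsub>K\<^esub>})"
 by (simp_all add: gunit_def Let_def)

lemma hmod_gunit: "hmod (gunit Q n)"
proof -
 interpret K: cring K by (rule cringK)
 have "\<exists>y\<in>carrier K. y \<oplus>\<^bsub>K\<^esub> x = \<zero>\<^bsub>K\<^esub>" if "x <: K" for x
  using that by (intro bexI[of _ "\<ominus>\<^bsub>K\<^esub> x"]) (auto simp: K.l_neg)
 then have "module K (gunit Q n)"
  by (intro moduleI abelian_groupI cringK)
   (auto simp: gunit_simps K.l_distr K.r_distr K.m_assoc K.a_ac)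
 moreover have "bilin K H (gunit Q n) (gunit Q n) (act (gunit Q n))"
  by (intro bilinI module_linI)
   (auto simp: gunit_simps K.l_distr K.r_distr K.m_ac)
 ultimately show ?thesis
  unfolding hmod_def by (auto simp: gunit_simps K.m_assoc)
qed

lemma hbilin_comp:
 assumes V: "hmod V" and W: "hmod W" and X: "hmod X"
  and b: "hbilin V W X b" and f: "hlin V' V f" and g: "hlin W' W g"
 shows "hbilin V' W' X (%v w. b (f v) (g w))"
 unfolding hbilin_def
proof (intro conjI ballI)
 show "bilin K V' W' X (%v w. b (f v) (g w))"
  by (intro bilinI bilin_comp1[OF hbilinD(1)[OF b]] bilin_comp2[OF hbilinD(1)[OF b]] hlinD(1,3)[OF f] hlinD(1,3)[OF g])
 fix h v w assume h: "h <: H" and v: "v <: V'" and w: "w <: W'"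
 show "sum2 Q X (D h) (%x y. b (f (act V' x v)) (g (act W' y w))) = act X h (b (f v) (g w))"
  unfolding hbilinD(2)[OF b h hlinD(3)[OF f v] hlinD(3)[OF g w], symmetric]
  by (rule sum2_cong[OF hmodD(1)[OF X] D_closed[OF h]])
   (simp_all add: v w hlinD(2,3)[OF f] hlinD(2,3)[OF g] hmodD(5)[OF V] hmodD(5)[OF W] hbilinD(3)[OF b])
qed

lemma hbilin_cong:
 assumes V: "hmod V" and W: "hmod W" and X: "hmod X" and f: "hbilin V W X f"
  and eq: "!!v w. v <: V ==> w <: W ==> g v w = f v w"
 shows "hbilin V W X g"
 unfolding hbilin_def
proof (intro conjI ballI)
 show "bilin K V W X g"
  using bilin_cong[OF hmodD(1)[OF V] hmodD(1)[OF W], of g f X] eq hbilinD(1)[OF f] by simp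
 fix h v w assume h: "h <: H" and v: "v <: V" and w: "w <: W"
 show "sum2 Q X (D h) (%x y. g (act V x v) (act W y w)) = act X h (g v w)"
  unfolding eq[OF v w] hbilinD(2)[OF f h v w, symmetric]
  by (rule sum2_cong[OF hmodD(1)[OF X] D_closed[OF h]])
   (simp_all add: v w eq hmodD(5)[OF V] hmodD(5)[OF W] hbilinD(3)[OF f])
qed

lemma hbilin_diff:
 assumes V: "hmod V" and W: "hmod W" and X: "hmod X" and f: "hbilin V W X f" and g: "hbilin V W X g"
 shows "hbilin V W X (%v w. f v w \<ominus>\<^bsub>X\<^esub> g v w)"
proof -
 note h = hbilin_hlin[OF V W X hlin_diff[OF X hlin_lift[OF V W X f] hlin_lift[OF V W X g]]]
 show ?thesis
  by (rule hbilin_cong[OF V W X h])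
   (simp add: glift_elem[OF hmod_tp[OF V W] hmodD(1)[OF X] hbilinD(1)[OF f]]
    glift_elem[OF hmod_tp[OF V W] hmodD(1)[OF X] hbilinD(1)[OF g]])
qed

text \<open>A translate of the curried map at v is the curried map at h v, and its evaluation at w
  is f(h v, w). This settles one direction; the other is \<open>ghom_eq_zeroI\<close>.\<close>

lemma cur_eq_zero_iff:
 assumes V: "hmod V" and W: "hmod W" and X: "hmod X" and f: "hbilin V W X f" and v: "v <: V"
 shows "cur V W X f v = \<zero>\<^bsub>ghom Q W X\<^esub> \<longleftrightarrow> (\<forall>h\<in>carrier H. \<forall>w\<in>carrier W. f (act V h v) w = \<zero>\<^bsub>X\<^esub>)"
proof
 note G = hmod_ghom[OF W X]
 note av = hmodD(5)[OF V _ v]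
 assume z: "cur V W X f v = \<zero>\<^bsub>ghom Q W X\<^esub>"
 show "\<forall>h\<in>carrier H. \<forall>w\<in>carrier W. f (act V h v) w = \<zero>\<^bsub>X\<^esub>"
 proof (intro ballI)
  fix h w assume h: "h <: H" and w: "w <: W"
  have "f (act V h v) w = app W X (act (ghom Q W X) h \<zero>\<^bsub>ghom Q W X\<^esub>) w"
   using app_cur[OF V W X f av[OF h] w] cur_equivariant[OF V W X f v h] z by simp
  also have "act (ghom Q W X) h \<zero>\<^bsub>ghom Q W X\<^esub> = \<zero>\<^bsub>ghom Q W X\<^esub>"
   by (rule module_lin_zero[OF hmodD(1)[OF G] hmodD(1)[OF G] bilin_lin2[OF hmodD(2)[OF G] h]])
  also have "app W X \<zero>\<^bsub>ghom Q W X\<^esub> w = \<zero>\<^bsub>X\<^esub>"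
   by (rule module_lin_zero[OF hmodD(1)[OF G] hmodD(1)[OF X] bilin_lin1[OF app_bilin[OF W X] w]])
  finally show "f (act V h v) w = \<zero>\<^bsub>X\<^esub>" .
 qed
next
 assume z: "\<forall>h\<in>carrier H. \<forall>w\<in>carrier W. f (act V h v) w = \<zero>\<^bsub>X\<^esub>"
 show "cur V W X f v = \<zero>\<^bsub>ghom Q W X\<^esub>"
 proof (rule ghom_eq_zeroI[OF W X cur_closed(1)[OF V W X hbilinD(1)[OF f] v]])
  fix h w assume h: "h <: H" and w: "w <: W"
  show "app W X (act (ghom Q W X) h (cur V W X f v)) w = \<zero>\<^bsub>X\<^esub>"
   unfolding cur_equivariant[OF V W X f v h, symmetric] app_cur[OF V W X f hmodD(5)[OF V h v] w]
   using z h w by simp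
 qed
qed

lemma sum2_zero: "module K P ==> t <: HH2 ==> sum2 Q P t (%x y. \<zero>\<^bsub>P\<^esub>) = \<zero>\<^bsub>P\<^esub>"
 using sum2_comp[where P = P and g = "%_. \<zero>\<^bsub>P\<^esub>" and b = "%_ _. \<zero>\<^bsub>P\<^esub>" and P' = P]
  module_lin_zero_fun[of K P P] module_zero_closed[of K P] by simp

text \<open>For values in an endomorphism object a second evaluation is added. Translates of f(v, w)
  are Sweedler sums of values of f at translated arguments, so the quantifier over h already present
  covers them.\<close>

lemma cur_end_eq_zero_iff:
 assumes V: "hmod V" and W: "hmod W" and X: "hmod X" and f: "hbilin V W (gend Q X) f" and v: "v <: V"
 shows "cur V W (gend Q X) f v = \<zero>\<^bsub>ghom Q W (gend Q X)\<^esub> \<longleftrightarrow>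
  (\<forall>h\<in>carrier H. \<forall>w\<in>carrier W. \<forall>x\<in>carrier X. app X X (f (act V h v) w) x = \<zero>\<^bsub>X\<^esub>)"
proof -
 note E = hmod_ghom[OF X X]
 have "f (act V h v) w = \<zero>\<^bsub>gend Q X\<^esub>"
  if z: "!!h w x. h <: H ==> w <: W ==> x <: X ==> app X X (f (act V h v) w) x = \<zero>\<^bsub>X\<^esub>"
   and h: "h <: H" and w: "w <: W" for h w
 proof (rule ghom_eq_zeroI[OF X X hbilinD(3)[OF f hmodD(5)[OF V h v] w]])
  fix g x assume g: "g <: H" and x: "x <: X"
  have "app X X (act (gend Q X) g (f (act V h v) w)) x =
   sum2 Q X (D g) (%s u. app X X (f (act V s (act V h v)) (act W u w)) x)"
   unfolding hbilinD(2)[OF f g hmodD(5)[OF V h v] w, symmetric]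
   by (rule sum2_comp[where g = "%N. app X X N x", OF hmodD(1)[OF E] hmodD(1)[OF X] bilin_lin1[OF app_bilin[OF X X] x] D_closed[OF g]])
    (simp add: hbilinD(3)[OF f] hmodD(5)[OF V] hmodD(5)[OF W] h v w)
  also have "... = sum2 Q X (D g) (%s u. \<zero>\<^bsub>X\<^esub>)"
   by (rule sum2_cong[OF hmodD(1)[OF X] D_closed[OF g]])
    (simp_all add: hmodD(3)[OF V, symmetric] z h v w x hmodD(5)[OF W] monoid.m_closed[OF H_ring] module_zero_closed[OF hmodD(1)[OF X]])
  finally show "app X X (act (gend Q X) g (f (act V h v) w)) x = \<zero>\<^bsub>X\<^esub>"
   using sum2_zero[OF hmodD(1)[OF X] D_closed[OF g]] by simp
 qed
 moreover have "app X X \<zero>\<^bsub>gend Q X\<^esub> x = \<zero>\<^bsub>X\<^esub>" if "x <: X" for x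
  by (rule module_lin_zero[OF hmodD(1)[OF E] hmodD(1)[OF X] bilin_lin1[OF app_bilin[OF X X] that]])
 ultimately show ?thesis
  unfolding cur_eq_zero_iff[OF V W E f v] by (metis (no_types, lifting))
qed

lemma gker_simps:
 "carrier (gker V X g) = {v \<in> carrier V. g v = \<zero>\<^bsub>X\<^esub>}" "grd (gker V X g) n = {v \<in> grd V n. g v = \<zero>\<^bsub>X\<^esub>}"
 "\<zero>\<^bsub>gker V X g\<^esub> = \<zero>\<^bsub>V\<^esub>" "add (gker V X g) = add V" "smult (gker V X g) = smult V" "act (gker V X g) = act V"
 by (simp_all add: gker_def)

lemma hmod_gker:
 assumes V: "hmod V" and X: "module K X" and g: "module_lin K V X g"
  and stable: "!!h v. h <: H ==> v <: V ==> g v = \<zero>\<^bsub>X\<^esub> ==> g (act V h v) = \<zero>\<^bsub>X\<^esub>"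
 shows "hmod (gker V X g)" "hlin (gker V X g) V (%v. v)"
proof -
 have m: "module K (gker V X g)"
  by (rule same_module_module[OF _ submodule_carrier_update(1)[OF hmodD(1)[OF V] submodule_kernel[OF hmodD(1)[OF V] X g]]])
   (simp add: same_module_def gker_simps)
 have "bilin K H (gker V X g) (gker V X g) (act V)"
  using hmodD(2)[OF V] stable hmodD(5)[OF V] by (auto simp: bilin_def module_lin_def gker_simps)
 with m show "hmod (gker V X g)"
  unfolding hmod_def gker_simps using hmodD(3,4)[OF V] by auto
 show "hlin (gker V X g) V (%v. v)"
  by (auto simp: hlin_def module_lin_def gker_simps)
qed

end

context qhopf
begin

lemma hlin_id: "hlin V V (%x. x)"
 by (simp add: hlin_def module_lin_id)

lemma hbilin_post:
 assumes V: "hmod V" and W: "hmod W" and X: "hmod X" and Y: "hmod Y" and b: "hbilin V W X b" and F: "hlin X Y F"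
 shows "hbilin V W Y (%v w. F (b v w))"
 by (rule hbilin_cong[OF V W Y hbilin_hlin[OF V W Y hlin_comp[OF F hlin_lift[OF V W X b]]]])
  (simp add: glift_elem[OF hmod_tp[OF V W] hmodD(1)[OF X] hbilinD(1)[OF b]])

end

section \<open>The pairs (L, c) and their connection defect\<close>

locale connections = qhopf Q for Q :: "('k, 'h) qhopf" +
 fixes A :: "('k, 'h, 'a) gmod" and \<mu> :: "('k, 'a, 'a) tensor => 'a" and \<eta> :: "'k => 'a" and d :: "'k => 'a => 'a"
  and V :: "('k, 'h, 'v) gmod" and l :: "('k, 'a, 'v) tensor => 'v"
 assumes calculus: "differential_calculus Q A \<mu> \<eta> d" and oV: "hm_obj Q V" and action: "hm_mor Q (gtensor Q A V) V l"
begin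

abbreviation "EV \<equiv> gend Q V"
abbreviation "EA \<equiv> gend Q A"
abbreviation "PV \<equiv> end_shift Q V"
abbreviation "lh \<equiv> lhat Q A V l"
abbreviation "pv p v \<equiv> app V V (fst p) v"
abbreviation "pa p a \<equiv> app A A (d (snd p)) a"
abbreviation "am a v \<equiv> l (gtensor_elem Q A V a v)"
abbreviation "ac L a \<equiv> gcommutator Q V (gtensor_elem Q EV EV L (lh a))"
abbreviation "df p a \<equiv> ac (fst p) a \<ominus>\<^bsub>EV\<^esub> lh (pa p a)"
abbreviation "lb p q \<equiv> gcommutator Q V (gtensor_elem Q EV EV (fst p) (fst q))"

lemma oA: "hm_obj Q A" and d_mor: "hm_mor Q (gunit Q 1) (der Q A \<mu>) d"
 and d_sq: "c <: K ==> c' <: K ==> gcomp Q A A A (gtensor_elem Q EA EA (d c) (d c')) = \<zero>\<^bsub>EA\<^esub>"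
 using calculus by (simp_all add: differential_calculus_def braided_comm_algebra_def hm_algebra_def Let_def)

lemmas oE = ghom_obj[OF oV oV]
lemmas hA = hm_objD(8)[OF oA] and hV = hm_objD(8)[OF oV]
lemmas hE = hmod_ghom[OF hV hV] and hEA = hmod_ghom[OF hA hA]
lemmas hP = hmod_gprod[OF hE hmod_gunit]
lemmas mV = hmodD(1)[OF hV] and mE = hmodD(1)[OF hE]
lemmas lhat = lhat_facts[OF oA oV action]

lemma d_hlin: "hlin (gunit Q 1) EA d"
 and d_grd: "c \<in> grd (gunit Q 1) n ==> d c \<in> grd EA n"
 using d_mor by (auto simp: hm_mor_def der_def gker_simps hlin_def module_lin_def)

lemmas app_hV = app_hbilin[OF hV hV]

lemma pv_hbilin: "hbilin PV V V pv"
 by (rule hbilin_comp[OF hE hV hV app_hV gprod_hlin(1) hlin_id])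

lemma pa_hbilin: "hbilin PV A A pa"
 by (rule hbilin_comp[OF hEA hA hA app_hbilin[OF hA hA] hlin_comp[OF d_hlin gprod_hlin(2)] hlin_id])

lemma lie_hbilin: "hbilin EV EV EV (%L L'. gcommutator Q V (gtensor_elem Q EV EV L L'))"
 by (rule hbilin_hlin[OF hE hE hE gcommutator_hlin[OF oV]])

lemma ac_hbilin: "hbilin EV A EV ac"
 by (rule hbilin_comp[OF hE hE hE lie_hbilin hlin_id lhat(1)])

lemma lb_hbilin: "hbilin PV PV EV lb"
 by (rule hbilin_comp[OF hE hE hE lie_hbilin gprod_hlin(1) gprod_hlin(1)])

lemma df_hbilin: "hbilin PV A EV df"
 by (rule hbilin_diff[OF hP hA hE hbilin_comp[OF hE hA hE ac_hbilin gprod_hlin(1) hlin_id]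
    hbilin_post[OF hP hA hA hE pa_hbilin lhat(1)]])

sublocale L: leibniz Q PV A V pv pa am
 by unfold_locales (rule hP oA hV pv_hbilin pa_hbilin lhat(4))+

lemma acommutator_elem: "L <: EV ==> a <: A ==> acommutator Q A V l (gtensor_elem Q EV A L a) = ac L a"
 by (simp add: acommutator_def gtensor_map_lin(2)[OF hE hA hE hE module_lin_id hlinD(1)[OF lhat(1)]])

lemma snd_PV: "p <: PV ==> fst p <: EV" "p <: PV ==> snd p <: K"
 by (auto simp: gprod_simps gunit_simps)

text \<open>The lifted form agrees with \<open>df\<close> on the carriers, and this suffices to
  transfer bilinearity and with it the universal property of the lift.\<close>

lemma defect_facts:
 shows "module_lin K (gtensor Q PV A) EV (connection_defect Q A d V l)"
  and "p <: PV ==> a <: A ==> connection_defect Q A d V l (gtensor_elem Q PV A p a) = df p a"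
proof -
 let ?raw = "%p a. acommutator Q A V l (gtensor_elem Q EV A (fst p) a) \<ominus>\<^bsub>EV\<^esub>
  lh (gev Q A A (gtensor_elem Q EA A (d (snd p)) a))"
 have eq: "?raw p a = df p a" if "p <: PV" "a <: A" for p a
  using snd_PV[OF that(1)] that hlinD(3)[OF d_hlin]
  by (simp add: acommutator_elem gev_elem[OF hA hA] gunit_simps)
 note b = hbilin_cong[OF hP hA hE df_hbilin eq]
 show "module_lin K (gtensor Q PV A) EV (connection_defect Q A d V l)"
  unfolding connection_defect_def by (rule glift_lin[OF hmod_tp[OF hP hA] mE hbilinD(1)[OF b]])
 show "connection_defect Q A d V l (gtensor_elem Q PV A p a) = df p a" if "p <: PV" "a <: A"
  unfolding connection_defect_def
  using glift_elem[OF hmod_tp[OF hP hA] mE hbilinD(1)[OF b] that] eq[OF that] by (rule trans)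
qed

lemma grd_PV: "p \<in> grd PV n ==> p <: PV"
proof -
 interpret K: cring K by (rule cringK)
 show "p \<in> grd PV n ==> p <: PV"
  using hm_objD(6)[OF oE] by (auto simp: gprod_simps gunit_simps split: if_splits)
qed

text \<open>The kernel condition is made explicit by \<open>cur_end_eq_zero_iff\<close>: all
  translates of p have vanishing defect after evaluation on A and V.\<close>

lemma con_iff:
 "carrier (con Q A d V l) = {p \<in> carrier PV. \<forall>h\<in>carrier H. \<forall>a\<in>carrier A. \<forall>v\<in>carrier V.
  app V V (df (act PV h p) a) v = \<zero>\<^bsub>V\<^esub>}"
 "grd (con Q A d V l) n = carrier (con Q A d V l) \<inter> grd PV n"
proof -
 let ?b = "%p a. connection_defect Q A d V l (gtensor_elem Q PV A p a)"
 have b: "hbilin PV A EV ?b" by (rule hbilin_cong[OF hP hA hE df_hbilin defect_facts(2)])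
 note g = gcurry_cur[OF hP hA hE defect_facts(1)]
 have "cur PV A EV ?b p = \<zero>\<^bsub>ghom Q A EV\<^esub> \<longleftrightarrow> (\<forall>h\<in>carrier H. \<forall>a\<in>carrier A. \<forall>v\<in>carrier V.
  app V V (df (act PV h p) a) v = \<zero>\<^bsub>V\<^esub>)" if "p <: PV" for p
  unfolding cur_end_eq_zero_iff[OF hP hA hV b that] using hmodD(5)[OF hP _ that] defect_facts(2) by simp
 then show "carrier (con Q A d V l) = {p \<in> carrier PV. \<forall>h\<in>carrier H. \<forall>a\<in>carrier A. \<forall>v\<in>carrier V.
  app V V (df (act PV h p) a) v = \<zero>\<^bsub>V\<^esub>}"
  unfolding con_def gker_simps g by auto
 show "grd (con Q A d V l) n = carrier (con Q A d V l) \<inter> grd PV n"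
  unfolding con_def gker_simps using grd_PV by auto
qed

lemma end_A_iff:
 "carrier (end_A Q A V l) = {M \<in> carrier EV. \<forall>h\<in>carrier H. \<forall>a\<in>carrier A. \<forall>v\<in>carrier V.
  app V V (ac (act EV h M) a) v = \<zero>\<^bsub>V\<^esub>}"
 "grd (end_A Q A V l) n = carrier (end_A Q A V l) \<inter> grd EV n"
 "submodule (carrier (end_A Q A V l)) K EV"
proof -
 let ?F = "acommutator Q A V l"
 let ?b = "%L a. ?F (gtensor_elem Q EV A L a)"
 have F: "module_lin K (gtensor Q EV A) EV ?F"
  unfolding acommutator_def o_def
  by (rule module_lin_comp[OF hlinD(1)[OF gcommutator_hlin[OF oV]]
    gtensor_map_lin(1)[OF hE hA hE hE module_lin_id hlinD(1)[OF lhat(1)]]])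
 have b: "hbilin EV A EV ?b" by (rule hbilin_cong[OF hE hA hE ac_hbilin acommutator_elem])
 note g = gcurry_cur[OF hE hA hE F]
 have "cur EV A EV ?b M = \<zero>\<^bsub>ghom Q A EV\<^esub> \<longleftrightarrow> (\<forall>h\<in>carrier H. \<forall>a\<in>carrier A. \<forall>v\<in>carrier V.
  app V V (ac (act EV h M) a) v = \<zero>\<^bsub>V\<^esub>)" if "M <: EV" for M
  unfolding cur_end_eq_zero_iff[OF hE hA hV b that] using hmodD(5)[OF hE _ that] acommutator_elem by simp
 then show "carrier (end_A Q A V l) = {M \<in> carrier EV. \<forall>h\<in>carrier H. \<forall>a\<in>carrier A. \<forall>v\<in>carrier V.
  app V V (ac (act EV h M) a) v = \<zero>\<^bsub>V\<^esub>}"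
  unfolding end_A_def gker_simps g by auto
 show "grd (end_A Q A V l) n = carrier (end_A Q A V l) \<inter> grd EV n"
  unfolding end_A_def gker_simps using hm_objD(6)[OF oE] by auto
 show "submodule (carrier (end_A Q A V l)) K EV"
  unfolding end_A_def gker_simps g
  by (rule submodule_kernel[OF mE hmodD(1)[OF hmod_ghom[OF hA hE]] cur_closed(2)[OF hE hA hE hbilinD(1)[OF b]]])
qed

lemma con_module: "hmod (con Q A d V l)" "hlin (con Q A d V l) PV (%p. p)"
proof -
 let ?b = "%p a. connection_defect Q A d V l (gtensor_elem Q PV A p a)"
 have b: "hbilin PV A EV ?b" by (rule hbilin_cong[OF hP hA hE df_hbilin defect_facts(2)])
 note g = gcurry_cur[OF hP hA hE defect_facts(1)]
 note G = hmod_ghom[OF hA hE]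
 have s: "cur PV A EV ?b (act PV h p) = \<zero>\<^bsub>ghom Q A EV\<^esub>"
  if "h <: H" "p <: PV" "cur PV A EV ?b p = \<zero>\<^bsub>ghom Q A EV\<^esub>" for h p
  unfolding cur_equivariant[OF hP hA hE b that(2,1)] that(3)
  by (rule module_lin_zero[OF hmodD(1)[OF G] hmodD(1)[OF G] bilin_lin2[OF hmodD(2)[OF G] that(1)]])
 show "hmod (con Q A d V l)" "hlin (con Q A d V l) PV (%p. p)"
  unfolding con_def g
  by (rule hmod_gker[OF hP hmodD(1)[OF G] cur_closed(2)[OF hP hA hE hbilinD(1)[OF b]]], rule s, assumption+)+
qed

text \<open>The composite of d c and d c' vanishes, and its evaluation is a nested evaluation with
  an associator inserted. As H acts on I[1] through the counit, two legs of that associator become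
  counits and \<open>sum3_eps2\<close> removes it.\<close>

lemma pa_square:
 assumes p: "p <: PV" and q: "q <: PV" and a: "a <: A"
 shows "pa p (pa q a) = \<zero>\<^bsub>A\<^esub>"
proof -
 interpret A: module K A by (rule hmodD(1)[OF hA])
 note c = snd_PV(2)[OF p] snd_PV(2)[OF q]
 have dc: "d (snd p) <: EA" "d (snd q) <: EA" using hlinD(3)[OF d_hlin] c by (simp_all add: gunit_simps)
 note ap = app_bilin[OF hA hA] and ac = bilin_closed[OF app_bilin[OF hA hA]]
 \<comment> \<open>Equivariance of d moves the action to I[1], where it is multiplication by the
   counit.\<close>
 have act_d: "act EA x (d c) = ep x \<odot>\<^bsub>EA\<^esub> d c" if "x <: H" "c <: K" for x c
 proof -
  have "act EA x (d c) = d (ep x \<odot>\<^bsub>gunit Q 1\<^esub> c)"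
   using hlinD(2)[OF d_hlin that(1), of c] that(2) by (simp add: gunit_simps)
  also have "... = ep x \<odot>\<^bsub>EA\<^esub> d c"
   by (rule module_lin_smult[OF hlinD(1)[OF d_hlin]]) (use that in "simp_all add: gunit_simps")
  finally show ?thesis .
 qed
 have "\<zero>\<^bsub>A\<^esub> = app A A \<zero>\<^bsub>EA\<^esub> a"
  by (rule module_lin_zero[symmetric, OF hmodD(1)[OF hEA] hmodD(1)[OF hA] bilin_lin1[OF ap a]])
 also have "... = cmp3 A A A (d (snd p)) (d (snd q)) a"
  unfolding d_sq[OF c, symmetric] by (rule app_gcomp[OF hA hA hA dc a])
 also have "... = sum3 Q A phi (%x y z. ep y \<odot>\<^bsub>A\<^esub> (ep x \<odot>\<^bsub>A\<^esub> pa p (pa q (act A z a))))"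
  unfolding cmp3_def
 proof (rule sum3_cong[OF hmodD(1)[OF hA] phi_closed])
  fix x y z assume xyz: "x <: H" "y <: H" "z <: H"
  note za = hmodD(5)[OF hA xyz(3) a]
  note i = ac[OF dc(2) za] ac[OF dc(1) ac[OF dc(2) za]]
  have "app A A (act EA x (d (snd p))) (app A A (act EA y (d (snd q))) (act A z a)) =
    ep x \<odot>\<^bsub>A\<^esub> (ep y \<odot>\<^bsub>A\<^esub> pa p (pa q (act A z a)))"
   unfolding act_d[OF xyz(1) c(1)] act_d[OF xyz(2) c(2)]
   using i xyz za dc
   by (simp add: module_lin_smult[OF bilin_lin1[OF ap za]] module_lin_smult[OF bilin_lin1[OF ap]]
     module_lin_smult[OF bilin_lin2[OF ap dc(1)]])
  also have "... = ep y \<odot>\<^bsub>A\<^esub> (ep x \<odot>\<^bsub>A\<^esub> pa p (pa q (act A z a)))"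
   using i xyz by (simp add: A.smult_assoc1[symmetric] A.R.m_comm)
  finally show "app A A (act EA x (d (snd p))) (app A A (act EA y (d (snd q))) (act A z a)) =
    ep y \<odot>\<^bsub>A\<^esub> (ep x \<odot>\<^bsub>A\<^esub> pa p (pa q (act A z a)))" .
  show "ep y \<odot>\<^bsub>A\<^esub> (ep x \<odot>\<^bsub>A\<^esub> pa p (pa q (act A z a))) <: A" using i xyz by simp
 qed
 also have "... = ep \<one>\<^bsub>H\<^esub> \<odot>\<^bsub>A\<^esub> pa p (pa q (act A \<one>\<^bsub>H\<^esub> a))"
 proof (rule sum3_eps2[OF hmodD(1)[OF hA]])
  have z: "module_lin K H A (%z. pa p (pa q (act A z a)))"
   by (intro bilin_comp2[OF ap dc(1)] bilin_comp2[OF ap dc(2)] bilin_lin1[OF hmodD(2)[OF hA] a])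
  show "bilin K H H A (%x z. ep x \<odot>\<^bsub>A\<^esub> pa p (pa q (act A z a)))"
  proof (rule bilinI)
   fix z assume "z <: H"
   then have "pa p (pa q (act A z a)) <: A" by (rule module_lin_closed[OF z])
   then show "module_lin K H A (%x. ep x \<odot>\<^bsub>A\<^esub> pa p (pa q (act A z a)))"
    by (intro module_linI) (simp_all add: A.smult_l_distr A.smult_assoc1)
  qed (intro module_lin_smult_fun[OF hmodD(1)[OF hA] z], simp)
 qed simp
 also have "... = pa p (pa q a)"
  using hmodD(4)[OF hA a] ac[OF dc(1) ac[OF dc(2) a]] by simp
 finally show ?thesis by simp
qed

end

section \<open>Leibniz rules for connections and for their brackets\<close>

context connections
begin

lemma pa_degree: "p \<in> grd PV k ==> a \<in> grd A j ==> pa p a \<in> grd A (j + k)"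
 by (rule app_graded[OF oA oA d_grd]) (auto simp: gprod_simps)

text \<open>Translates of \<open>lh a\<close> are again of the form \<open>lh b\<close> by
  equivariance, so each evaluation in the commutator returns the module action, and the formula for
  commutators becomes explicit.\<close>

lemma app_df:
 assumes p: "p \<in> grd PV k" and a: "a \<in> grd A j" and v: "v <: V"
 shows "app V V (df p a) v = sum3 Q V phi (%x y z. pv (act PV x p) (am (act A y a) (act V z v))) \<ominus>\<^bsub>V\<^esub>
  (am (pa p a) v \<oplus>\<^bsub>V\<^esub> sg (k * j) \<odot>\<^bsub>V\<^esub> sum2 Q V R (%s u. sum3 Q V phi (%x y z.
    am (act A x (act A u a)) (pv (act PV y (act PV s p)) (act V z v)))))"
proof -
 interpret V: module K V by (rule mV)
 have f: "fst p \<in> grd EV k" using p by (auto simp: gprod_simps)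
 note pc = grd_PV[OF p] and ac = hm_objD(6)[OF oA a] and fc = hm_objD(6)[OF oE f]
 note ap = hbilinD(1)[OF app_hV]
 have lhx: "act EV x (lh b) = lh (act A x b)" if "x <: H" "b <: A" for x b
  by (rule hlinD(2)[symmetric, OF lhat(1) that])
 note c = hmodD(5)[OF hP] hmodD(5)[OF hA] hmodD(5)[OF hV] hbilinD(3)[OF pv_hbilin] hbilinD(3)[OF lhat(4)] pc ac v
 have t1: "cmp3 V V V (fst p) (lh a) v = sum3 Q V phi (%x y z. pv (act PV x p) (am (act A y a) (act V z v)))"
  unfolding cmp3_def
  by (rule sum3_cong[OF mV phi_closed]) (simp add: lhx lhat(2) c gprod_simps(5), simp add: c del: gprod_simps)
 have t2: "cmp3 V V V (act EV u (lh a)) (act EV s (fst p)) v = sum3 Q V phi (%x y z.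
    am (act A x (act A u a)) (pv (act PV y (act PV s p)) (act V z v)))"
  if "s <: H" "u <: H" for s u
 proof -
  have "sum3 Q V phi (%x y z. app V V (act EV x (act EV u (lh a))) (app V V (act EV y (act EV s (fst p))) (act V z v))) =
   sum3 Q V phi (%x y z. am (act A x (act A u a)) (pv (act PV y (act PV s p)) (act V z v)))"
  proof (rule sum3_cong[OF mV phi_closed])
   fix x y z assume xyz: "x <: H" "y <: H" "z <: H"
   have w: "pv (act PV y (act PV s p)) (act V z v) <: V" by (intro c xyz that)
   show "am (act A x (act A u a)) (pv (act PV y (act PV s p)) (act V z v)) <: V" by (intro c xyz that)
   show "app V V (act EV x (act EV u (lh a))) (app V V (act EV y (act EV s (fst p))) (act V z v)) =
    am (act A x (act A u a)) (pv (act PV y (act PV s p)) (act V z v))"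
    using lhat(2)[OF _ w, of "act A x (act A u a)"] xyz that ac hmodD(5)[OF hA] by (simp add: lhx gprod_simps(5))
  qed
  then show ?thesis unfolding cmp3_def .
 qed
 have s2: "sum2 Q V R (%x y. cmp3 V V V (act EV y (lh a)) (act EV x (fst p)) v) = sum2 Q V R (%s u. sum3 Q V phi (%x y z.
    am (act A x (act A u a)) (pv (act PV y (act PV s p)) (act V z v))))"
  by (rule sum2_cong[OF mV R_closed t2]) (assumption | intro sum3_closed mV phi_closed c)+
 have i: "sum3 Q V phi (%x y z. pv (act PV x p) (am (act A y a) (act V z v))) <: V"
   "sum2 Q V R (%s u. sum3 Q V phi (%x y z. am (act A x (act A u a)) (pv (act PV y (act PV s p)) (act V z v)))) <: V"
  by (intro sum2_closed sum3_closed mV R_closed phi_closed c; assumption)+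
 have lp: "pa p a <: A" "am (pa p a) v <: V"
  using hbilinD(3)[OF pa_hbilin pc ac] hbilinD(3)[OF lhat(4) _ v] by auto
 have "app V V (df p a) v = app V V (ac (fst p) a) v \<ominus>\<^bsub>V\<^esub> app V V (lh (pa p a)) v"
  by (rule module_lin_minus[OF mE mV bilin_lin1[OF ap v] hbilinD(3)[OF ac_hbilin fc ac] hlinD(3)[OF lhat(1) lp(1)]])
 also have "... = (sum3 Q V phi (%x y z. pv (act PV x p) (am (act A y a) (act V z v))) \<ominus>\<^bsub>V\<^esub>
  sg (k * j) \<odot>\<^bsub>V\<^esub> sum2 Q V R (%s u. sum3 Q V phi (%x y z.
    am (act A x (act A u a)) (pv (act PV y (act PV s p)) (act V z v))))) \<ominus>\<^bsub>V\<^esub> am (pa p a) v"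
  unfolding app_gcommutator[OF oV f lhat(3)[OF a] v] t1 s2 lhat(2)[OF lp(1) v] ..
 also have "... = sum3 Q V phi (%x y z. pv (act PV x p) (am (act A y a) (act V z v))) \<ominus>\<^bsub>V\<^esub>
  (am (pa p a) v \<oplus>\<^bsub>V\<^esub> sg (k * j) \<odot>\<^bsub>V\<^esub> sum2 Q V R (%s u. sum3 Q V phi (%x y z.
    am (act A x (act A u a)) (pv (act PV y (act PV s p)) (act V z v)))))"
  using i lp(2) by (simp add: V.minus_eq V.minus_add V.a_ac)
 finally show ?thesis .
qed

text \<open>Once the defect is evaluated, its vanishing is literally the condition in
  \<open>leib_iff_commutator\<close>.\<close>

lemma leib_iff_df:
 assumes U: "U \<subseteq> grd PV k" and stable: "!!h p. h <: H ==> p \<in> U ==> act PV h p \<in> U"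
 shows "L.leib k U \<longleftrightarrow> (\<forall>j. \<forall>p\<in>U. \<forall>a\<in>grd A j. \<forall>v\<in>carrier V. app V V (df p a) v = \<zero>\<^bsub>V\<^esub>)"
proof -
 interpret V: module K V by (rule mV)
 have Uc: "U \<subseteq> carrier PV" using U grd_PV by blast
 note c = hmodD(5)[OF hP] hmodD(5)[OF hA] hmodD(5)[OF hV] hbilinD(3)[OF pv_hbilin] hbilinD(3)[OF lhat(4)]
  hbilinD(3)[OF pa_hbilin]
 have eq: "app V V (df p a) v = \<zero>\<^bsub>V\<^esub> \<longleftrightarrow>
   sum3 Q V phi (%x y z. pv (act PV x p) (am (act A y a) (act V z v))) = am (pa p a) v \<oplus>\<^bsub>V\<^esub>
   sg (k * j) \<odot>\<^bsub>V\<^esub> sum2 Q V R (%s u. sum3 Q V phi (%x y z.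
    am (act A x (act A u a)) (pv (act PV y (act PV s p)) (act V z v))))"
  if p: "p \<in> U" and a: "a \<in> grd A j" and v: "v <: V" for p a v j
  unfolding app_df[OF subsetD[OF U p] a v]
  by (rule module_minus_eq_zero_iff[OF mV]) (intro V.a_closed V.smult_closed sg_closed sum2_closed sum3_closed mV R_closed phi_closed c
   subsetD[OF Uc p] hm_objD(6)[OF oA a] v | assumption)+
 show ?thesis
 proof (rule L.leib_iff_commutator[OF Uc, THEN trans])
  show "act PV h p \<in> U" if "h <: H" "p \<in> U" for h p by (rule stable[OF that])
  show "pa p a \<in> grd A (j + k)" if "p \<in> U" "a \<in> grd A j" for p a j by (rule pa_degree[OF subsetD[OF U that(1)] that(2)])
 qed (intro all_cong1 ball_cong refl eq[symmetric])
qed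

lemma app_lb:
 assumes p: "p \<in> grd PV m" and q: "q \<in> grd PV n" and v: "v <: V"
 shows "app V V (lb p q) v = L.brk (m * n) p q v"
proof -
 have "fst p \<in> grd EV m" "fst q \<in> grd EV n" using p q by (auto simp: gprod_simps)
 from app_gcommutator[OF oV this v] show ?thesis
  by (simp add: L.brk_def L.cmp_def cmp3_def gprod_simps(5))
qed

lemma con_stable: "h <: H ==> p \<in> grd (con Q A d V l) n ==> act PV h p \<in> grd (con Q A d V l) n"
proof -
 assume h: "h <: H" and p: "p \<in> grd (con Q A d V l) n"
 have pc: "p <: (con Q A d V l)" "p \<in> grd PV n" using p con_iff(2) by auto
 have "act PV h p <: (con Q A d V l)"
  using hmodD(5)[OF con_module(1) h pc(1)] by (simp add: con_def gker_simps)
 moreover have "act PV h p \<in> grd PV n"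
 proof -
  interpret K: cring K by (rule cringK)
  show ?thesis
   using pc(2) hm_objD(4)[OF oE h] h by (auto simp: gprod_simps gunit_simps split: if_splits)
 qed
 ultimately show ?thesis using con_iff(2) by auto
qed

lemma con_df:
 assumes p: "p <: (con Q A d V l)" and a: "a <: A" and v: "v <: V"
 shows "app V V (df p a) v = \<zero>\<^bsub>V\<^esub>"
proof -
 have pc: "p <: PV" using p con_iff(1) by auto
 have "app V V (df (act PV \<one>\<^bsub>H\<^esub> p) a) v = \<zero>\<^bsub>V\<^esub>"
  using p a v monoid.one_closed[OF H_ring] unfolding con_iff(1) by blast
 then show ?thesis unfolding hmodD(4)[OF hP pc] .
qed

lemma con_leib: "L.leib n (grd (con Q A d V l) n)"
proof (rule leib_iff_df[THEN iffD2])
 show "grd (con Q A d V l) n \<subseteq> grd PV n" unfolding con_iff(2) by (rule Int_lower2)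
 show "\<forall>j. \<forall>p\<in>grd (con Q A d V l) n. \<forall>a\<in>grd A j. \<forall>v\<in>carrier V. app V V (df p a) v = \<zero>\<^bsub>V\<^esub>"
  unfolding con_iff(2) by (intro allI ballI con_df hm_objD(6)[OF oA]) (assumption | erule IntD1)+
qed (rule con_stable)

lemma sum3_zero: "module K P ==> t <: HH3 ==> sum3 Q P t (%x y z. \<zero>\<^bsub>P\<^esub>) = \<zero>\<^bsub>P\<^esub>"
 using sum3_comp[where P = P and g = "%_. \<zero>\<^bsub>P\<^esub>" and b = "%_ _ _. \<zero>\<^bsub>P\<^esub>" and P' = P]
  module_lin_zero_fun[of K P P] module_zero_closed[of K P] by simp

lemma d_zero: "d \<zero>\<^bsub>K\<^esub> = \<zero>\<^bsub>EA\<^esub>"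
 using module_lin_zero[OF hmodD(1)[OF hmod_gunit] hmodD(1)[OF hEA] hlinD(1)[OF d_hlin]] by (simp add: gunit_simps)

lemma pa_zero: "a <: A ==> pa (N, \<zero>\<^bsub>K\<^esub>) a = \<zero>\<^bsub>A\<^esub>"
 unfolding snd_conv d_zero
 by (rule module_lin_zero[OF hmodD(1)[OF hEA] hmodD(1)[OF hA] bilin_lin1[OF app_bilin[OF hA hA]]])

text \<open>For c = 0 the defect is the bare commutator; this embeds \<open>end_A\<close> into the
  framework of connections.\<close>

lemma df_zero:
 assumes N: "N <: EV" and a: "a <: A"
 shows "df (N, \<zero>\<^bsub>K\<^esub>) a = ac N a"
proof -
 interpret E: module K EV by (rule mE)
 have "lh \<zero>\<^bsub>A\<^esub> = \<zero>\<^bsub>EV\<^esub>" by (rule module_lin_zero[OF hmodD(1)[OF hA] mE hlinD(1)[OF lhat(1)]])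
 then show ?thesis unfolding pa_zero[OF a] fst_conv using hbilinD(3)[OF ac_hbilin N a] by (simp add: E.minus_eq)
qed

text \<open>
 \<open>act h (lb p q)\<close> is a sum of brackets of homogeneous elements of \<open>con(V)\<close>, so it suffices to
 test the vanishing of its Leibniz defect on such brackets.
\<close>

lemma lb_end_A_homogeneous:
 assumes p: "p \<in> grd (con Q A d V l) m" and q: "q \<in> grd (con Q A d V l) n"
 shows "lb p q <: (end_A Q A V l)"
proof -
 interpret V: module K V by (rule mV)
 interpret K: cring K by (rule cringK)
 let ?Cm = "grd (con Q A d V l) m" and ?Cn = "grd (con Q A d V l) n"
 have gr: "p \<in> grd PV k" "p <: PV" if "p \<in> grd (con Q A d V l) k" for p k
  by (rule that[unfolded con_iff(2), THEN IntD2] grd_PV[OF that[unfolded con_iff(2), THEN IntD2]])+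
 have lc: "lb p q <: EV" if "p <: PV" "q <: PV" for p q by (rule hbilinD(3)[OF lb_hbilin that])
 have M: "lb p q \<in> grd EV (m + n)"
  by (rule gcommutator_graded[OF oV gr(1)[OF p, unfolded gprod_simps mem_Times_iff, THEN conjunct1]
    gr(1)[OF q, unfolded gprod_simps mem_Times_iff, THEN conjunct1]])
 \<comment> \<open>The orbit of the bracket, paired with the scalar 0: \<open>leib\<close> speaks of
   H-stable sets, and \<open>end_A\<close> tests every translate.\<close>
 let ?U = "(%h. (act EV h (lb p q), \<zero>\<^bsub>K\<^esub>)) ` carrier H"
 note MC = lc[OF gr(2)[OF p] gr(2)[OF q]]
 have U: "?U \<subseteq> grd PV (m + n)" using hm_objD(4)[OF oE _ M] by (auto simp: gprod_simps gunit_simps)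
 have stable: "act PV h u \<in> ?U" if h: "h <: H" and u: "u \<in> ?U" for h u
 proof -
  obtain g where g: "g <: H" "u = (act EV g (lb p q), \<zero>\<^bsub>K\<^esub>)" using u by blast
  have "act PV h u = (act EV (h ** g) (lb p q), \<zero>\<^bsub>K\<^esub>)"
   using g h hmodD(3)[OF hE h g(1) MC] by (simp add: gprod_simps gunit_simps)
  then show ?thesis using monoid.m_closed[OF H_ring h g(1)] by blast
 qed
 note c = hmodD(5)[OF hE] hmodD(5)[OF hP] hmodD(5)[OF hA] hmodD(5)[OF hV] hbilinD(3)[OF app_hV] hbilinD(3)[OF lhat(4)]
 have key: "app V V (act EV h (lb p q)) (am a v) = sg ((m + n) * j) \<odot>\<^bsub>V\<^esub>
   sum3 Q V (braidX Q) (%x y z. am (act A y a) (app V V (act EV x (act EV h (lb p q))) (act V z v)))"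
  if h: "h <: H" and a: "a \<in> grd A j" and v: "v <: V" for h a v j
 proof -
  note ac = hm_objD(6)[OF oA a]
  let ?G1 = "%N. app V V N (am a v)" and
   ?G2 = "%N. sg ((m + n) * j) \<odot>\<^bsub>V\<^esub> sum3 Q V (braidX Q) (%x y z. am (act A y a) (app V V (act EV x N) (act V z v)))"
  have l1: "module_lin K EV V ?G1" by (rule bilin_lin1[OF hbilinD(1)[OF app_hV] hbilinD(3)[OF lhat(4) ac v]])
  have l2: "module_lin K EV V ?G2"
   by (intro module_lin_smult_fun[OF mV] sum3_fun_lin[OF mV L.bX] bilin_comp2[OF hbilinD(1)[OF lhat(4)]]
    bilin_comp1[OF hbilinD(1)[OF app_hV]] bilin_lin2[OF hmodD(2)[OF hE]] sg_closed c ac v)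
  have eq: "?G1 (lb p q) = ?G2 (lb p q)" if p: "p \<in> ?Cm" and q: "q \<in> ?Cn" for p q
  proof -
   note pc = gr[OF p] and qc = gr[OF q]
   note lpq = lc[OF pc(2) qc(2)]
   have "?G1 (lb p q) = L.brk (m * n) p q (am a v)" by (rule app_lb[OF pc(1) qc(1) hbilinD(3)[OF lhat(4) ac v]])
   also have "... = sg ((m + n) * j) \<odot>\<^bsub>V\<^esub> sum3 Q V (braidX Q) (%x y z. sum2 Q V (D x) (%s u.
     am (act A y a) (L.brk (m * n) (act PV s p) (act PV u q) (act V z v))))"
    by (rule L.brk_leibniz[OF con_leib con_leib pa_square p q a v])
   \<comment> \<open>Each \<open>brk\<close> is first read as the evaluated bracket of translates.
     Acting on p and q through the coproduct is acting on the bracket, so the inner double sum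
     collapses to one translate of \<open>lb p q\<close>.\<close>
   also have "sum3 Q V (braidX Q) (%x y z. sum2 Q V (D x) (%s u.
     am (act A y a) (L.brk (m * n) (act PV s p) (act PV u q) (act V z v)))) =
    sum3 Q V (braidX Q) (%x y z. am (act A y a) (app V V (act EV x (lb p q)) (act V z v)))"
   proof (rule sum3_cong[OF mV L.bX])
    fix x y z assume xyz: "x <: H" "y <: H" "z <: H"
    note ya = c(3)[OF xyz(2) ac] and zv = c(4)[OF xyz(3) v]
    have "sum2 Q V (D x) (%s u. am (act A y a) (L.brk (m * n) (act PV s p) (act PV u q) (act V z v))) =
     sum2 Q V (D x) (%s u. am (act A y a) (app V V (lb (act PV s p) (act PV u q)) (act V z v)))"
    proof (rule sum2_cong[OF mV D_closed[OF xyz(1)]])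
     fix s u assume su: "s <: H" "u <: H"
     note sp = gr[OF con_stable[OF su(1) p]] and uq = gr[OF con_stable[OF su(2) q]]
     show "am (act A y a) (L.brk (m * n) (act PV s p) (act PV u q) (act V z v)) =
      am (act A y a) (app V V (lb (act PV s p) (act PV u q)) (act V z v))"
      unfolding app_lb[OF sp(1) uq(1) zv] ..
     show "am (act A y a) (app V V (lb (act PV s p) (act PV u q)) (act V z v)) <: V"
      by (intro c(6) c(5) ya zv lc sp(2) uq(2))
    qed
    also have "... = am (act A y a) (app V V (sum2 Q EV (D x) (%s u. lb (act PV s p) (act PV u q))) (act V z v))"
     by (rule sum2_comp[symmetric, where g = "%N. am (act A y a) (app V V N (act V z v))", OF mE mV
        bilin_comp2[OF hbilinD(1)[OF lhat(4)] ya bilin_lin1[OF hbilinD(1)[OF app_hV] zv]] D_closed[OF xyz(1)]])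
      (intro lc c(2) pc(2) qc(2))
    also have "sum2 Q EV (D x) (%s u. lb (act PV s p) (act PV u q)) = act EV x (lb p q)"
     by (rule hbilinD(2)[OF lb_hbilin xyz(1) pc(2) qc(2)])
    finally show "sum2 Q V (D x) (%s u. am (act A y a) (L.brk (m * n) (act PV s p) (act PV u q) (act V z v))) =
     am (act A y a) (app V V (act EV x (lb p q)) (act V z v))" .
    show "am (act A y a) (app V V (act EV x (lb p q)) (act V z v)) <: V"
     by (intro c(6) c(5) ya zv c(1) xyz lpq)
   qed
   finally show ?thesis .
  qed
  have e: "act EV h (lb p q) = sum2 Q EV (D h) (%s u. lb (act PV s p) (act PV u q))"
   by (rule hbilinD(2)[symmetric, OF lb_hbilin h gr(2)[OF p] gr(2)[OF q]])
  have sc: "sum2 Q EV (D h) (%s u. lb (act PV s p) (act PV u q)) \<in> {N \<in> carrier EV. ?G1 N \<ominus>\<^bsub>V\<^esub> ?G2 N = \<zero>\<^bsub>V\<^esub>}"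
  proof (rule sum2_submodule[OF mE submodule_kernel[OF mE mV module_lin_diff[OF mV l1 l2]] D_closed[OF h]])
   fix s u assume su: "s <: H" "u <: H"
   note sp = con_stable[OF su(1) p] and uq = con_stable[OF su(2) q]
   note lsu = lc[OF gr(2)[OF sp] gr(2)[OF uq]]
   have "?G1 (lb (act PV s p) (act PV u q)) \<ominus>\<^bsub>V\<^esub> ?G2 (lb (act PV s p) (act PV u q)) = \<zero>\<^bsub>V\<^esub>"
    using module_minus_eq_zero_iff[OF mV module_lin_closed[OF l1 lsu] module_lin_closed[OF l2 lsu]] eq[OF sp uq] by blast
   then show "lb (act PV s p) (act PV u q) \<in> {N \<in> carrier EV. ?G1 N \<ominus>\<^bsub>V\<^esub> ?G2 N = \<zero>\<^bsub>V\<^esub>}"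
    using lsu by blast
  qed
  note hM = c(1)[OF h MC]
  have "?G1 (act EV h (lb p q)) \<ominus>\<^bsub>V\<^esub> ?G2 (act EV h (lb p q)) = \<zero>\<^bsub>V\<^esub>" using sc unfolding e by blast
  then show ?thesis
   using module_minus_eq_zero_iff[OF mV module_lin_closed[OF l1 hM] module_lin_closed[OF l2 hM]] by blast
 qed
 have "L.leib (m + n) ?U"
  unfolding L.leib_def
 proof (intro conjI allI ballI)
  show "?U \<subseteq> carrier PV" using U grd_PV by blast
  show "act PV h u \<in> ?U" if "h <: H" "u \<in> ?U" for h u by (rule stable[OF that])
  show "pa u a \<in> grd A (j + (m + n))" if "u \<in> ?U" "a \<in> grd A j" for u a j
   by (rule pa_degree[OF subsetD[OF U that(1)] that(2)])
  fix j u a v assume u: "u \<in> ?U" and a: "a \<in> grd A j" and v: "v <: V"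
  obtain h where h: "h <: H" and ue: "u = (act EV h (lb p q), \<zero>\<^bsub>K\<^esub>)" using u by blast
  note hM = c(1)[OF h MC] and ac = hm_objD(6)[OF oA a]
  have au: "act PV x u = (act EV x (act EV h (lb p q)), \<zero>\<^bsub>K\<^esub>)" if "x <: H" for x
   using that by (simp add: ue gprod_simps gunit_simps)
  have am0: "am \<zero>\<^bsub>A\<^esub> w = \<zero>\<^bsub>V\<^esub>" if "w <: V" for w
   by (rule module_lin_zero[OF hmodD(1)[OF hA] mV bilin_lin1[OF hbilinD(1)[OF lhat(4)] that]])
  have "sum3 Q V psi (%x y z. am (pa (act PV x u) (act A y a)) (act V z v)) = sum3 Q V psi (%x y z. \<zero>\<^bsub>V\<^esub>)"
  proof (rule sum3_cong[OF mV psi_closed])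
   fix x y z assume xyz: "x <: H" "y <: H" "z <: H"
   show "am (pa (act PV x u) (act A y a)) (act V z v) = \<zero>\<^bsub>V\<^esub>"
    unfolding au[OF xyz(1)] pa_zero[OF c(3)[OF xyz(2) ac]] by (rule am0[OF c(4)[OF xyz(3) v]])
  qed simp
  then have z: "sum3 Q V psi (%x y z. am (pa (act PV x u) (act A y a)) (act V z v)) = \<zero>\<^bsub>V\<^esub>"
   using sum3_zero[OF mV psi_closed] by simp
  have b: "sum3 Q V (braidX Q) (%x y z. am (act A y a) (app V V (act EV x (act EV h (lb p q))) (act V z v))) =
   sum3 Q V (braidX Q) (%x y z. am (act A y a) (pv (act PV x u) (act V z v)))"
  proof (rule sum3_cong[OF mV L.bX])
   fix x y z assume xyz: "x <: H" "y <: H" "z <: H"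
   show "am (act A y a) (app V V (act EV x (act EV h (lb p q))) (act V z v)) = am (act A y a) (pv (act PV x u) (act V z v))"
    unfolding au[OF xyz(1)] fst_conv ..
   show "am (act A y a) (pv (act PV x u) (act V z v)) <: V"
    unfolding au[OF xyz(1)] fst_conv by (intro c(6) c(5) c(4) c(3) c(1) xyz hM ac v)
  qed
  have cl: "sum3 Q V (braidX Q) (%x y z. am (act A y a) (app V V (act EV x (act EV h (lb p q))) (act V z v))) <: V"
   by (intro sum3_closed mV L.bX c(6) c(5) c(4) c(3) c(1) hM ac v)
  have "pv u (am a v) = sg ((m + n) * j) \<odot>\<^bsub>V\<^esub> sum3 Q V (braidX Q) (%x y z. am (act A y a) (pv (act PV x u) (act V z v)))"
   unfolding ue fst_conv using key[OF h a v] b[unfolded ue] by simp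
  then show "pv u (am a v) = sum3 Q V psi (%x y z. am (pa (act PV x u) (act A y a)) (act V z v)) \<oplus>\<^bsub>V\<^esub>
   sg ((m + n) * j) \<odot>\<^bsub>V\<^esub> sum3 Q V (braidX Q) (%x y z. am (act A y a) (pv (act PV x u) (act V z v)))"
   unfolding z using cl[unfolded b] by simp
 qed
 then have df0: "app V V (df u a) v = \<zero>\<^bsub>V\<^esub>" if "u \<in> ?U" "a \<in> grd A j" "v <: V" for u a v j
  using leib_iff_df[OF U stable] that by blast
 have "app V V (ac (act EV h (lb p q)) a) v = \<zero>\<^bsub>V\<^esub>"
  if h: "h <: H" and a: "a <: A" and v: "v <: V" for h a v
 proof (rule graded_ext[where f = "%a. app V V (ac (act EV h (lb p q)) a) v" and g = "%a. \<zero>\<^bsub>V\<^esub>", OF oA mV _ module_lin_zero_fun[OF mV] _ a])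
  note hM = c(1)[OF h MC]
  show "module_lin K A V (%a. app V V (ac (act EV h (lb p q)) a) v)"
   by (rule module_lin_comp[OF bilin_lin1[OF hbilinD(1)[OF app_hV] v] bilin_lin2[OF hbilinD(1)[OF ac_hbilin] hM]])
  fix j a assume a: "a \<in> grd A j"
  have "(act EV h (lb p q), \<zero>\<^bsub>K\<^esub>) \<in> ?U" using h by blast
  from df0[OF this a v] show "app V V (ac (act EV h (lb p q)) a) v = \<zero>\<^bsub>V\<^esub>"
   unfolding df_zero[OF hM hm_objD(6)[OF oA a]] .
 qed
 then show ?thesis unfolding end_A_iff(1) using MC by blast
qed

end

section \<open>Passage to arbitrary elements of \<open>con\<close>\<close>

context connections
begin

text \<open>The homogeneous components of a pair; the scalar belongs to degree 1 because I[1] is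
  concentrated there.\<close>

definition part :: "int => ('v => 'v) \<times> 'k => ('v => 'v) \<times> 'k" where
 "part n p = (homog_part EV (fst p) n, if n = 1 then snd p else \<zero>\<^bsub>K\<^esub>)"

lemma part_grd: "p <: PV ==> part n p \<in> grd PV n"
 using homog_part_grd[OF oE snd_PV(1)] snd_PV(2) by (simp add: part_def gprod_simps gunit_simps)

lemma part_act: "p <: PV ==> h <: H ==> act PV h (part n p) = part n (act PV h p)"
proof -
 interpret K: cring K by (rule cringK)
 show "p <: PV ==> h <: H ==> act PV h (part n p) = part n (act PV h p)"
  using homog_part_act[OF oE snd_PV(1)] by (simp add: part_def gprod_simps gunit_simps)
qed

text \<open>The index set must contain 1 to catch the scalar component, since 1 may lie outside the
  degrees of the endomorphism object.\<close>

lemma part_sum: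
 assumes p: "p <: PV" and I: "finite I" "degs EV \<subseteq> I" "1 \<in> I"
 shows "(\<Oplus>\<^bsub>PV\<^esub>n\<in>I. part n p) = p"
proof -
 interpret G: module K "gunit Q 1" by (rule hmodD(1)[OF hmod_gunit])
 note mP = hmodD(1)[OF hP]
 have c: "part n p <: PV" for n by (rule grd_PV[OF part_grd[OF p]])
 have "fst (\<Oplus>\<^bsub>PV\<^esub>n\<in>I. part n p) = (\<Oplus>\<^bsub>EV\<^esub>n\<in>I. fst (part n p))"
  by (rule module_lin_finsum[OF mP mE gprod_lins(1)]) (intro Pi_I c)
 also have "... = fst p" unfolding part_def fst_conv by (rule homog_part_sum[OF oE snd_PV(1)[OF p] I(1,2)])
 finally have 1: "fst (\<Oplus>\<^bsub>PV\<^esub>n\<in>I. part n p) = fst p" .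
 have s: "snd p <: (gunit Q 1)" using snd_PV(2)[OF p] by (simp add: gunit_simps)
 have "snd (\<Oplus>\<^bsub>PV\<^esub>n\<in>I. part n p) = (\<Oplus>\<^bsub>gunit Q 1\<^esub>n\<in>I. snd (part n p))"
  by (rule module_lin_finsum[OF mP hmodD(1)[OF hmod_gunit] gprod_lins(2)]) (intro Pi_I c)
 also have "... = snd (part 1 p)"
  by (rule G.finsum_single[OF I(1,3)]) (use s in "simp_all add: part_def gunit_simps")
 finally have 2: "snd (\<Oplus>\<^bsub>PV\<^esub>n\<in>I. part n p) = snd p" by (simp add: part_def)
 show ?thesis using 1 2 by (rule prod_eqI)
qed

lemma part_submodule:
 assumes p: "p <: PV" and g: "module_lin K PV EV g" and Z: "submodule Z K EV" and z: "!!n. g (part n p) \<in> Z"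
 shows "g p \<in> Z"
proof -
 let ?I = "insert 1 (degs EV)"
 have c: "part n p <: PV" for n by (rule grd_PV[OF part_grd[OF p]])
 have ps: "(\<Oplus>\<^bsub>PV\<^esub>n\<in>?I. part n p) = p" by (rule part_sum[OF p]) (use degs_finite[OF oE] in auto)
 have "g (\<Oplus>\<^bsub>PV\<^esub>n\<in>?I. part n p) = (\<Oplus>\<^bsub>EV\<^esub>n\<in>?I. g (part n p))"
  by (rule module_lin_finsum[OF hmodD(1)[OF hP] mE g]) (intro Pi_I c)
 then have "g p = (\<Oplus>\<^bsub>EV\<^esub>n\<in>?I. g (part n p))"
  unfolding ps .
 then show ?thesis using submodule_finsum[OF mE Z, of ?I "%n. g (part n p)"] z by simp
qed

lemma df_graded:
 assumes p: "p \<in> grd PV n" and a: "a \<in> grd A j" and v: "v \<in> grd V i"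
 shows "app V V (df p a) v \<in> grd V (i + (n + j))"
proof (rule app_graded[OF oV oV _ v])
 note SE = module.submoduleE[OF mE hm_objD(2)[OF oE]]
 have f: "fst p \<in> grd EV n" using p by (auto simp: gprod_simps)
 have "ac (fst p) a \<in> grd EV (n + j)" by (rule gcommutator_graded[OF oV f lhat(3)[OF a]])
 moreover have "lh (pa p a) \<in> grd EV (n + j)" using lhat(3)[OF pa_degree[OF p a]] by (simp add: add.commute)
 ultimately show "df p a \<in> grd EV (n + j)"
  unfolding a_minus_def by (intro SE(5) SE(3))
qed

text \<open>At homogeneous a and v of degrees j and i, the defect of the component in degree n lies
  in degree i + n + j. Different n give different degrees, so the terms of a vanishing sum vanish
  separately.\<close>

lemma part_con:
 assumes p: "p <: (con Q A d V l)"
 shows "part n p \<in> grd (con Q A d V l) n"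
proof -
 interpret V: module K V by (rule mV)
 have pc: "p <: PV" using p con_iff(1) by blast
 have hom: "app V V (df (act PV h (part n p)) a) v = \<zero>\<^bsub>V\<^esub>"
  if h: "h <: H" and a: "a \<in> grd A j" and v: "v \<in> grd V i" for h a v i j
 proof -
  \<comment> \<open>The degree n is inserted so that the wanted component occurs in the sum even if
    it is not among the degrees of \<open>EV\<close>.\<close>
  let ?I = "insert n (insert 1 (degs EV))" and ?q = "act PV h p" and ?m = "i + (n + j)"
  let ?F = "%q. app V V (df q a) v"
  note ac = hm_objD(6)[OF oA a] and vc = hm_objD(6)[OF oV v]
  have fin: "finite ?I" using degs_finite[OF oE] by simp
  have q: "?q <: PV" by (rule hmodD(5)[OF hP h pc])
  have pq: "part k ?q <: PV" for k by (rule grd_PV[OF part_grd[OF q]])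
  have F: "module_lin K PV V ?F"
   by (rule module_lin_comp[OF bilin_lin1[OF hbilinD(1)[OF app_hV] vc] bilin_lin1[OF hbilinD(1)[OF df_hbilin] ac]])
  have Fg: "?F (part k ?q) \<in> grd V (i + (k + j))" for k by (rule df_graded[OF part_grd[OF q] a v])
  have Fc: "?F (part k ?q) <: V" for k by (rule hm_objD(6)[OF oV Fg])
  have hp: "homog_part V (?F (part k ?q)) ?m = (if k = n then ?F (part k ?q) else \<zero>\<^bsub>V\<^esub>)" for k
   by (simp add: homog_part_homog[OF oV Fg])
  have ps: "(\<Oplus>\<^bsub>PV\<^esub>k\<in>?I. part k ?q) = ?q" by (rule part_sum[OF q fin]) auto
  have "?F (\<Oplus>\<^bsub>PV\<^esub>k\<in>?I. part k ?q) = (\<Oplus>\<^bsub>V\<^esub>k\<in>?I. ?F (part k ?q))"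
   by (rule module_lin_finsum[OF hmodD(1)[OF hP] mV F]) (intro Pi_I pq)
  then have "(\<Oplus>\<^bsub>V\<^esub>k\<in>?I. ?F (part k ?q)) = ?F ?q"
   unfolding ps by (rule sym)
  also have "... = \<zero>\<^bsub>V\<^esub>" using p h ac vc unfolding con_iff(1) by blast
  finally have z: "(\<Oplus>\<^bsub>V\<^esub>k\<in>?I. ?F (part k ?q)) = \<zero>\<^bsub>V\<^esub>" .
  have "\<zero>\<^bsub>V\<^esub> = homog_part V \<zero>\<^bsub>V\<^esub> ?m"
   by (rule module_lin_zero[symmetric, OF mV mV homog_part_lin[OF oV]])
  also have "... = (\<Oplus>\<^bsub>V\<^esub>k\<in>?I. homog_part V (?F (part k ?q)) ?m)"
   unfolding z[symmetric] by (rule module_lin_finsum[OF mV mV homog_part_lin[OF oV]]) (intro Pi_I Fc)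
  also have "... = homog_part V (?F (part n ?q)) ?m"
   by (rule V.finsum_single[OF fin]) (simp_all only: hp insert_iff simp_thms if_True if_False V.zero_closed Fc)
  also have "... = ?F (part n ?q)" unfolding hp by simp
  finally show ?thesis unfolding part_act[OF pc h] ..
 qed
 have "app V V (df (act PV h (part n p)) a) v = \<zero>\<^bsub>V\<^esub>"
  if h: "h <: H" and a: "a <: A" and v: "v <: V" for h a v
 proof -
  have q: "act PV h (part n p) <: PV" by (rule hmodD(5)[OF hP h grd_PV[OF part_grd[OF pc]]])
  have l: "module_lin K A V (%a. app V V (df (act PV h (part n p)) a) v)" if "v <: V" for v
   by (rule module_lin_comp[OF bilin_lin1[OF hbilinD(1)[OF app_hV] that] bilin_lin2[OF hbilinD(1)[OF df_hbilin] q]])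
  have "app V V (df (act PV h (part n p)) a) v = \<zero>\<^bsub>V\<^esub>" if v: "v \<in> grd V i" for v i
   by (rule graded_ext[where f = "%a. app V V (df (act PV h (part n p)) a) v" and g = "%a. \<zero>\<^bsub>V\<^esub>",
      OF oA mV l[OF hm_objD(6)[OF oV v]] module_lin_zero_fun[OF mV] hom[OF h _ v] a])
  then show ?thesis
   by (intro graded_ext[where f = "%v. app V V (df (act PV h (part n p)) a) v" and g = "%v. \<zero>\<^bsub>V\<^esub>",
      OF oV mV bilin_lin2[OF hbilinD(1)[OF app_hV] hbilinD(3)[OF df_hbilin q a]] module_lin_zero_fun[OF mV] _ v])
 qed
 then have "part n p <: (con Q A d V l)"
  unfolding con_iff(1) using grd_PV[OF part_grd[OF pc]] by blast
 then show ?thesis unfolding con_iff(2) using part_grd[OF pc] by blast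
qed

text \<open>\<open>end_A\<close> is a submodule and the bracket is bilinear, so both arguments may
  be expanded into components, one after the other; \<open>part_con\<close> keeps these components
  in \<open>con\<close>.\<close>

lemma lb_end_A:
 assumes p: "p <: (con Q A d V l)" and q: "q <: (con Q A d V l)"
 shows "lb p q <: (end_A Q A V l)"
proof -
 note Z = end_A_iff(3)
 have pc: "p <: PV" and qc: "q <: PV" using p q con_iff(1) by blast+
 note l = hbilinD(1)[OF lb_hbilin]
 have "lb (part n p) q <: (end_A Q A V l)" for n
  by (rule part_submodule[OF qc bilin_lin2[OF l grd_PV[OF part_grd[OF pc]]] Z lb_end_A_homogeneous[OF part_con[OF p] part_con[OF q]]])
 then show ?thesis by (rule part_submodule[OF pc bilin_lin1[OF l qc] Z])
qed

lemma lb_graded: "p \<in> grd PV m ==> q \<in> grd PV n ==> lb p q \<in> grd EV (m + n)"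
 by (rule gcommutator_graded[OF oV]) (simp_all only: gprod_simps mem_Times_iff)

text \<open>A graded piece of the tensor product is spanned by homogeneous pure tensors, and the
  preimage of a graded piece is a submodule. W is kept general so that both the full bracket and its
  restriction to \<open>con\<close> are covered.\<close>

lemma lift_lb_graded:
 assumes W: "hmod W" and i: "hlin W PV (%p. p)" and W_grd: "!!n p. p \<in> grd W n ==> p <: W \<and> p \<in> grd PV n"
  and F: "module_lin K (gtensor Q W W) EV F" and e: "!!p q. p <: W ==> q <: W ==> F (gtensor_elem Q W W p q) = lb p q"
  and t: "t \<in> grd (gtensor Q W W) n"
 shows "t <: (gtensor Q W W) \<and> F t \<in> grd EV n"
proof -
 let ?X = "{gtensor_elem Q W W v w | v w i j. v \<in> grd W i \<and> w \<in> grd W j \<and> i + j = n}"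
 let ?N = "{t \<in> carrier (tensor_module K W W). F t \<in> grd EV n}"
 have ts: "module K (tensor_module K W W)" "module_lin K (tensor_module K W W) EV F"
  by (rule tensor_pair.module_tensor[OF hmod_tp[OF W W]], rule F[unfolded same_module_lin1[OF gsame]])
 have "submodule ?N K (tensor_module K W W)"
  by (rule submodule_vimage[OF ts(1) mE ts(2) hm_objD(2)[OF oE]])
 moreover have "?X \<subseteq> ?N"
 proof
  fix s assume "s \<in> ?X"
  then obtain v w i j where s: "s = gtensor_elem Q W W v w" "v \<in> grd W i" "w \<in> grd W j" "i + j = n" by blast
  note v = W_grd[OF s(2)] and w = W_grd[OF s(3)]
  have "s <: (tensor_module K W W)"
   using bilin_closed[OF gelem_bilin[OF hmod_tp[OF W W]]] v w s(1) by (simp add: gsameD)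
  moreover have "F s \<in> grd EV n"
   unfolding s(1) e[OF v[THEN conjunct1] w[THEN conjunct1]] s(4)[symmetric]
   by (rule lb_graded[OF v[THEN conjunct2] w[THEN conjunct2]])
  ultimately show "s \<in> ?N" by blast
 qed
 ultimately have "module_span K (tensor_module K W W) ?X \<subseteq> ?N" by (rule module_span_least)
 moreover have "t \<in> module_span K (tensor_module K W W) ?X" using t by (simp add: gtensor_def Let_def)
 ultimately show ?thesis by (auto simp: gsameD)
qed

lemma bracket_mor: "hm_mor Q (gtensor Q PV PV) EV (con_bracket Q V)"
proof -
 have h: "hlin (gtensor Q PV PV) EV (con_bracket Q V)"
  unfolding con_bracket_def by (rule hlin_lift[OF hP hP hE lb_hbilin])
 have e: "con_bracket Q V (gtensor_elem Q PV PV p q) = lb p q" if "p <: PV" "q <: PV" for p q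
  unfolding con_bracket_def by (rule glift_elem[OF hmod_tp[OF hP hP] mE hbilinD(1)[OF lb_hbilin] that])
 have "con_bracket Q V t \<in> grd EV n" if "t \<in> grd (gtensor Q PV PV) n" for t n
  by (rule lift_lb_graded[OF hP hlin_id _ hlinD(1)[OF h] e that, THEN conjunct2]) (simp_all add: grd_PV)
 then show ?thesis unfolding hm_mor_def using hlinD(1,2)[OF h] by blast
qed

text \<open>Over a ring the tensor product of two inclusions need not be injective, so restricting
  means composing with \<open>gtensor_map\<close>. The composite is compared with the lift of
  \<open>lb\<close> from \<open>con\<close> itself, and values on pure tensors come from
  \<open>lb_end_A\<close>.\<close>

lemma con_bracket_mor:
 defines "C \<equiv> con Q A d V l"
 shows "hm_mor Q (gtensor Q C C) (end_A Q A V l) (con_bracket Q V \<circ> gtensor_map Q C C PV PV (%p. p) (%p. p))"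
proof -
 let ?F = "con_bracket Q V \<circ> gtensor_map Q C C PV PV (%p. p) (%p. p)"
 have C: "hmod C" and i: "hlin C PV (%p. p)" unfolding C_def by (rule con_module)+
 have h: "hlin (gtensor Q PV PV) EV (con_bracket Q V)"
  unfolding con_bracket_def by (rule hlin_lift[OF hP hP hE lb_hbilin])
 have e: "con_bracket Q V (gtensor_elem Q PV PV p q) = lb p q" if "p <: PV" "q <: PV" for p q
  unfolding con_bracket_def by (rule glift_elem[OF hmod_tp[OF hP hP] mE hbilinD(1)[OF lb_hbilin] that])
 note gm = gtensor_map_lin[OF C C hP hP hlinD(1)[OF i] hlinD(1)[OF i]]
 have F: "module_lin K (gtensor Q C C) EV ?F" unfolding o_def by (rule module_lin_comp[OF hlinD(1)[OF h] gm(1)])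
 have Fe: "?F (gtensor_elem Q C C p q) = lb p q" if "p <: C" "q <: C" for p q
  using gm(2)[OF that] e[OF hlinD(3)[OF i that(1)] hlinD(3)[OF i that(2)]] by simp
 have b: "hbilin C C EV lb" by (rule hbilin_comp[OF hP hP hE lb_hbilin i i])
 note hl = hlin_lift[OF C C hE b] and tp = hmod_tp[OF C C]
 \<comment> \<open>The lift is equivariant by \<open>hlin_lift\<close>; agreement on pure tensors
   passes this on to the composite.\<close>
 have Fl: "?F t = tensor_lift K C C EV lb t" if "t <: (gtensor Q C C)" for t
  by (rule gtensor_ext[OF tp mE F hlinD(1)[OF hl] _ that]) (simp only: Fe glift_elem[OF tp mE hbilinD(1)[OF b]])
 have FZ: "?F t <: (end_A Q A V l)" if t: "t <: (gtensor Q C C)" for t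
 proof -
  have "t <: (tensor_module K C C)" using t by (simp add: gsameD)
  then show ?thesis
  proof (induction t rule: tensor_pair.induct[OF tp, consumes 1, case_names elem add])
   case (elem p q)
   have "?F (gtensor_elem Q C C p q) <: (end_A Q A V l)"
    unfolding Fe[OF elem] by (rule lb_end_A[OF elem[unfolded C_def]])
   then show ?case unfolding gtensor_elem_def .
  next
   case (add s t)
   have st: "s <: (gtensor Q C C)" "t <: (gtensor Q C C)" using add(1,2) by (simp_all add: gsameD)
   have "?F (s \<oplus>\<^bsub>tensor_module K C C\<^esub> t) = ?F s \<oplus>\<^bsub>EV\<^esub> ?F t"
    using module_lin_add[OF F st] by (simp add: gsameD)
   then show ?case using module.submoduleE(5)[OF mE end_A_iff(3) add(3,4)] by simp
  qed
 qed
 have Fg: "?F t \<in> grd (end_A Q A V l) n" if t: "t \<in> grd (gtensor Q C C) n" for t n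
 proof -
  have "t <: (gtensor Q C C) \<and> ?F t \<in> grd EV n"
   by (rule lift_lb_graded[OF C i _ F Fe t]) (simp_all add: C_def con_iff(2))
  then show ?thesis unfolding end_A_iff(2) using FZ by blast
 qed
 have "module_lin K (gtensor Q C C) (end_A Q A V l) ?F"
  using module_lin_add[OF F] module_lin_smult[OF F] FZ
  by (intro module_linI) (simp_all add: end_A_def gker_simps)
 moreover have "?F (act (gtensor Q C C) h t) = act (end_A Q A V l) h (?F t)"
  if "h <: H" "t <: (gtensor Q C C)" for h t
  unfolding Fl[OF that(2)] Fl[OF hmodD(5)[OF hmod_gtensor[OF C C] that]] hlinD(2)[OF hl that]
  by (simp add: end_A_def gker_simps)
 ultimately show ?thesis unfolding hm_mor_def using Fg by blast
qed

end

theorem lemma5p1: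
  fixes Q :: "('k, 'h) qhopf"
    and A :: "('k, 'h, 'a) gmod"
    and \<mu> :: "('k, 'a, 'a) tensor \<Rightarrow> 'a"
    and \<eta> :: "'k \<Rightarrow> 'a"
    and d :: "'k \<Rightarrow> 'a \<Rightarrow> 'a"
    and V :: "('k, 'h, 'v) gmod"
    and l :: "('k, 'a, 'v) tensor \<Rightarrow> 'v"
    and r :: "('k, 'v, 'a) tensor \<Rightarrow> 'v"
  assumes "triangular_quasi_hopf Q"
    and "differential_calculus Q A \<mu> \<eta> d"
    and "symmetric_bimodule Q A \<mu> \<eta> V l r"
  shows "hm_mor Q (gtensor Q (end_shift Q V) (end_shift Q V)) (gend Q V) (con_bracket Q V) \<and>
    hm_mor Q (gtensor Q (con Q A d V l) (con Q A d V l)) (end_A Q A V l)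
      (con_bracket Q V \<circ>
        gtensor_map Q (con Q A d V l) (con Q A d V l) (end_shift Q V) (end_shift Q V)
          (\<lambda>p. p) (\<lambda>p. p))"
proof -
 interpret connections Q A \<mu> \<eta> d V l
  using assms by unfold_locales (simp_all add: symmetric_bimodule_def hm_bimodule_def Let_def)
 show ?thesis using bracket_mor con_bracket_mor by (rule conjI)
qed

end
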